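(* Let $X$ be a zero-mean supCAR field on $\mathbb R^d$ with characteristic quadruple $(0,b,W,\pi)_1$ and let $X^*(T)=\int_{\Delta(T)}X(\boldsymbol y)\,d\boldsymbol y$ (see context). Assume that $b=0$, that $\pi$ has density $p(\lambda)=l(1/\lambda)\lambda^{\alpha-1}$, $\lambda>0$, with $\alpha\in(d+1,2d+2)$, where $l$ is slowly varying at infinity, strictly positive and bounded on each compact subset, and that, for some positive $c^+$ and $c^-$, the Lévy measure $W$ has Blumenthal–Getoor index $\beta_{BG}$ with $\frac{\alpha}{d+1}<\beta_{BG}<\min(2,\alpha-d)$ and $$W([x,\infty))\sim c^+x^{-\beta_{BG}}\quad\text{and}\quad W((-\infty,-x])\sim c^-x^{-\beta_{BG}},\quad x\to0+.$$ Then, for $t\in[0,1]$, as $T\to\infty$, $$\frac{1}{T^{\,d+1-\frac{\alpha-d}{\beta_{BG}}}\;l(T)^{1/\beta_{BG}}}\,X^*\left(t^{1/d}T\right)\to\int_0^\infty\int_{\mathbb R^d}\left(-\int_{\Delta(t^{1/d})}\frac1{2\lambda}e^{-\lambda\|\boldsymbol y-\boldsymbol u\|}\,d\boldsymbol y\right)K(d\boldsymbol u,d\lambda)$$ in the sense of convergence of finite-dimensional distributions, where $K$ is an independently scattered scalar random measure on $\mathcal S'$ such that $$C(s\ddagger K(d\boldsymbol u\times d\lambda))=-|s|^{\beta_{BG}}\,\omega(s;\beta_{BG},c^+,c^-)\,\lambda^{\alpha-1}\,d\boldsymbol u\,d\lambda.$$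
   Context: Let $d\ge1$; $\|\cdot\|$ is the Euclidean norm, $|\cdot|$ and $\mathrm{Leb}$ denote Lebesgue measure on $\mathbb R^d$, $\mathbb R^+=(0,\infty)$, $B(r)$ is the closed ball of radius $r$ centred at the origin, and $C(s\ddagger\xi):=\log Ee^{is\xi}$. Let $b\ge0$, let $W$ be a Lévy measure on $\mathbb R$ (a Radon measure with $W(\{0\})=0$, $\int\min(1,x^2)W(dx)<\infty$) with $\int_{\mathbb R}x^2W(dx)<\infty$, and put $$\mathcal K(s)=-\frac b2s^2+\int_{\mathbb R}\left(e^{isx}-1-isx\right)W(dx),\quad s\in\mathbb R.$$ The Blumenthal–Getoor index of $W$ is $\beta_{BG}=\inf\{\gamma\ge0:\int_{|x|\le1}|x|^\gamma W(dx)<\infty\}$. $\pi$ is a probability measure on $\mathbb R^+$. Let $\mathcal S'$ be a ring of Borel subsets of $\mathbb R^+\times\mathbb R^d$ closed under countable intersections and containing an increasing sequence of sets whose union is the whole space. $\Lambda$ is an independently scattered infinitely divisible random measure on $\mathcal S'$ (independent values on disjoint sets, a.s. countably additive) with $C(s\ddagger\Lambda(A))=[\pi\times\mathrm{Leb}](A)\,\mathcal K(s)$ for $A\in\mathcal S'$ with $[\pi\times\mathrm{Leb}](A)<\infty$. The supCAR field with characteristic quadruple $(0,b,W,\pi)_1$ is $$X(\boldsymbol t)=-\int_0^\infty\int_{\mathbb R^d}\frac1{2\lambda}e^{-\lambda\|\boldsymbol t-\boldsymbol u\|}\Lambda(d\boldsymbol u,d\lambda),\quad\boldsymbol t\in\mathbb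 R^d.$$ Integrals with respect to $\Lambda$ and $K$ are Rajput–Rosinski integrals (limits in probability of integrals $\sum_ia_i\Lambda(A_i)$ of simple functions converging almost everywhere to the integrand, for which the integrals over every set of $\sigma(\mathcal S')$ converge in probability); $X$ is assumed well-defined, and it has zero mean. The infinitesimal formula for $K$ means that $C(s\ddagger K(A))=-|s|^{\beta_{BG}}\omega(s;\beta_{BG},c^+,c^-)\int_A\lambda^{\alpha-1}d\boldsymbol u\,d\lambda$ whenever the last integral is finite. For $\gamma\in(1,2)$ and $\tilde c_1,\tilde c_2\ge0$, $$\omega(s;\gamma,\tilde c_1,\tilde c_2)=\frac{\Gamma(2-\gamma)}{1-\gamma}\left((\tilde c_1+\tilde c_2)\cos\frac{\pi\gamma}2-i(\tilde c_1-\tilde c_2)\,\mathrm{sign}(s)\sin\frac{\pi\gamma}2\right)$$ (here $\pi$ is the number), so that $-|s|^\gamma\omega(s;\gamma,\tilde c_1,\tilde c_2)$ is the cumulant function of a zero-mean $\gamma$-stable random variable. $\Delta\subset\mathbb R^d$ is a Jordan-measurable convex bounded set containing the origin in its interior, with $|\Delta|>0$, normalised so that $\Delta\subseteq B(1)$. $\Delta(T)=\{T\boldsymbol x:\boldsymbol x\in\Delta\}$ is its homothetic image with parameter $T$. *)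

theory Defs
  imports "HOL-Probability.Probability" "HOL-Library.Landau_Symbols"
begin

section \<open>Probabilistic notions\<close>

text \<open>
  \<open>C\<close> is the cumulant function of \<open>\<xi>\<close>. The logarithm of the characteristic function is the
  distinguished one, that is the continuous branch vanishing at the origin; by connectedness of the
  line there is at most one such \<open>C\<close>.
\<close>

definition has_cumulant :: "'w measure \<Rightarrow> ('w \<Rightarrow> real) \<Rightarrow> (real \<Rightarrow> complex) \<Rightarrow> bool" where
  "has_cumulant M \<xi> C \<longleftrightarrow>
     continuous_on UNIV C \<and> C 0 = 0 \<and> (\<forall>s. exp (C s) = char (distr M borel \<xi>) s)"

definition infinitely_divisible :: "real measure \<Rightarrow> bool" where
  "infinitely_divisible \<mu> \<longleftrightarrow>
     (\<forall>n\<ge>1. \<exists>\<nu>. real_distribution \<nu> \<and>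
        \<mu> = distr (PiM {..<n::nat} (\<lambda>_. \<nu>)) borel (\<lambda>x. \<Sum>i<n. x i))"

definition tendsto_in_prob :: "'w measure \<Rightarrow> (nat \<Rightarrow> 'w \<Rightarrow> real) \<Rightarrow> ('w \<Rightarrow> real) \<Rightarrow> bool" where
  "tendsto_in_prob M Y Z \<longleftrightarrow>
     (\<forall>n. Y n \<in> borel_measurable M) \<and> Z \<in> borel_measurable M \<and>
     (\<forall>\<epsilon>>0. (\<lambda>n. measure M {\<omega> \<in> space M. \<bar>Y n \<omega> - Z \<omega>\<bar> > \<epsilon>}) \<longlonglongrightarrow> 0)"

text \<open>Convergence in distribution; the limit may live on another probability space.\<close>

definition conv_in_distr ::
  "'w measure \<Rightarrow> ('i \<Rightarrow> 'w \<Rightarrow> 'b::topological_space) \<Rightarrow> 'v measure \<Rightarrow> ('v \<Rightarrow> 'b) \<Rightarrow> 'i filter \<Rightarrow> bool"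
where
  "conv_in_distr M Y M' Z F \<longleftrightarrow>
     (\<forall>\<^sub>F T in F. Y T \<in> borel_measurable M) \<and> Z \<in> borel_measurable M' \<and>
     (\<forall>f::'b \<Rightarrow> real. continuous_on UNIV f \<and> bounded (range f) \<longrightarrow>
        ((\<lambda>T. \<integral>\<omega>. f (Y T \<omega>) \<partial>M) \<longlongrightarrow> (\<integral>\<omega>. f (Z \<omega>) \<partial>M')) F)"


section \<open>Levy measures, stability and cumulant functions\<close>

text \<open>
  The integrability condition makes \<open>W\<close> finite on sets bounded away from the origin, hence a Radon
  measure on the punctured line. \<open>W\<close> need not be finite near the origin.
\<close>

definition Levy_measure :: "real measure \<Rightarrow> bool" where
  "Levy_measure W \<longleftrightarrow>
     sets W = sets borel \<and> emeasure W {0} = 0 \<and> (\<integral>\<^sup>+x. ennreal (min 1 (x\<^sup>2)) \<partial>W) < \<infinity>"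

definition BG_index :: "real measure \<Rightarrow> real" where
  "BG_index W = Inf {\<gamma>. \<gamma> \<ge> 0 \<and> (\<integral>\<^sup>+x\<in>{-1..1}. ennreal (\<bar>x\<bar> powr \<gamma>) \<partial>W) < \<infinity>}"

definition levy_cumulant :: "real \<Rightarrow> real measure \<Rightarrow> real \<Rightarrow> complex" where
  "levy_cumulant b W s =
     - of_real (b / 2 * s\<^sup>2) + (\<integral>x. (exp (\<i> * of_real (s * x)) - 1 - \<i> * of_real (s * x)) \<partial>W)"

definition stable_omega :: "real \<Rightarrow> real \<Rightarrow> real \<Rightarrow> real \<Rightarrow> complex" where
  "stable_omega s \<gamma> c1 c2 =
     of_real (Gamma (2 - \<gamma>) / (1 - \<gamma>)) *
       (of_real ((c1 + c2) * cos (pi * \<gamma> / 2))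
        - \<i> * of_real ((c1 - c2) * sgn s * sin (pi * \<gamma> / 2)))"

definition stable_cumulant :: "real \<Rightarrow> real \<Rightarrow> real \<Rightarrow> real \<Rightarrow> complex" where
  "stable_cumulant \<gamma> c1 c2 s = - of_real (\<bar>s\<bar> powr \<gamma>) * stable_omega s \<gamma> c1 c2"


section \<open>Random measures and Rajput--Rosinski integrals\<close>

definition exhausting_delta_ring :: "'e set \<Rightarrow> 'e set set \<Rightarrow> bool" where
  "exhausting_delta_ring \<Omega> S \<longleftrightarrow>
     ring_of_sets \<Omega> S \<and>
     (\<forall>A::nat \<Rightarrow> 'e set. range A \<subseteq> S \<longrightarrow> (\<Inter>n. A n) \<in> S) \<and>
     (\<exists>A::nat \<Rightarrow> 'e set. range A \<subseteq> S \<and> incseq A \<and> (\<Union>n. A n) = \<Omega>)"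

definition independently_scattered ::
  "'w measure \<Rightarrow> 'e set set \<Rightarrow> ('e set \<Rightarrow> 'w \<Rightarrow> real) \<Rightarrow> bool" where
  "independently_scattered M S \<Lambda> \<longleftrightarrow>
     (\<forall>A\<in>S. \<Lambda> A \<in> borel_measurable M) \<and>
     (\<forall>A::nat \<Rightarrow> 'e set. range A \<subseteq> S \<and> disjoint_family A \<longrightarrow>
        prob_space.indep_vars M (\<lambda>_. borel) (\<lambda>n. \<Lambda> (A n)) UNIV \<and>
        ((\<Union>n. A n) \<in> S \<longrightarrow> (AE \<omega> in M. (\<lambda>n. \<Lambda> (A n) \<omega>) sums \<Lambda> (\<Union>n. A n) \<omega>)))"

text \<open>Infinitesimally, the cumulant function of \<open>\<Lambda>(dx)\<close> is \<open>\<psi>(s) m(dx)\<close>.\<close>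

definition has_cumulant_measure ::
  "'w measure \<Rightarrow> 'e set set \<Rightarrow> ('e set \<Rightarrow> 'w \<Rightarrow> real) \<Rightarrow> 'e measure \<Rightarrow> (real \<Rightarrow> complex) \<Rightarrow> bool" where
  "has_cumulant_measure M S \<Lambda> m \<psi> \<longleftrightarrow>
     (\<forall>A\<in>S. emeasure m A < \<infinity> \<longrightarrow>
        has_cumulant M (\<Lambda> A) (\<lambda>s. of_real (measure m A) * \<psi> s))"

text \<open>A simple function is given by the list of its coefficients \<open>a\<close> and sets \<open>B\<close>.\<close>

definition simple_val :: "(real \<times> 'e set) list \<Rightarrow> 'e \<Rightarrow> real" where
  "simple_val xs x = (\<Sum>(a, B)\<leftarrow>xs. a * indicator B x)"

definition simple_integral_on ::
  "('e set \<Rightarrow> 'w \<Rightarrow> real) \<Rightarrow> 'e set \<Rightarrow> (real \<times> 'e set) list \<Rightarrow> 'w \<Rightarrow> real" where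
  "simple_integral_on \<Lambda> A xs \<omega> = (\<Sum>(a, B)\<leftarrow>xs. a * \<Lambda> (A \<inter> B) \<omega>)"

text \<open>
  \<open>m\<close> only supplies the null sets for the almost-everywhere convergence; it is the measure
  occurring in \<open>has_cumulant_measure\<close>.
\<close>

definition has_RR_integral ::
  "'w measure \<Rightarrow> 'e set \<Rightarrow> 'e set set \<Rightarrow> 'e measure \<Rightarrow> ('e set \<Rightarrow> 'w \<Rightarrow> real) \<Rightarrow>
   ('e \<Rightarrow> real) \<Rightarrow> ('w \<Rightarrow> real) \<Rightarrow> bool" where
  "has_RR_integral M \<Omega> S m \<Lambda> f Y \<longleftrightarrow>
     (\<exists>\<phi>::nat \<Rightarrow> (real \<times> 'e set) list.
        (\<forall>n. snd ` set (\<phi> n) \<subseteq> S) \<and>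
        (AE x in m. (\<lambda>n. simple_val (\<phi> n) x) \<longlonglongrightarrow> f x) \<and>
        (\<forall>A\<in>sigma_sets \<Omega> S. \<exists>J. tendsto_in_prob M (\<lambda>n. simple_integral_on \<Lambda> A (\<phi> n)) J) \<and>
        tendsto_in_prob M (\<lambda>n. simple_integral_on \<Lambda> \<Omega> (\<phi> n)) Y)"

definition RR_integrable ::
  "'w measure \<Rightarrow> 'e set \<Rightarrow> 'e set set \<Rightarrow> 'e measure \<Rightarrow> ('e set \<Rightarrow> 'w \<Rightarrow> real) \<Rightarrow>
   ('e \<Rightarrow> real) \<Rightarrow> bool" where
  "RR_integrable M \<Omega> S m \<Lambda> f \<longleftrightarrow> (\<exists>Y. has_RR_integral M \<Omega> S m \<Lambda> f Y)"

text \<open>The integral is determined up to almost sure equality only; some version is chosen.\<close>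

definition RR_integral ::
  "'w measure \<Rightarrow> 'e set \<Rightarrow> 'e set set \<Rightarrow> 'e measure \<Rightarrow> ('e set \<Rightarrow> 'w \<Rightarrow> real) \<Rightarrow>
   ('e \<Rightarrow> real) \<Rightarrow> 'w \<Rightarrow> real" where
  "RR_integral M \<Omega> S m \<Lambda> f = (SOME Y. has_RR_integral M \<Omega> S m \<Lambda> f Y)"


section \<open>supCAR fields\<close>

text \<open>Points of the parameter space are pairs \<open>(r, u)\<close>; \<open>r\<close> is the rate parameter.\<close>

definition param_space :: "(real \<times> (real^'d)) set" where
  "param_space = {0<..} \<times> UNIV"

text \<open>
  \<open>X\<close> is a supCAR field with characteristic quadruple \<open>(0, b, W, \<pi>)\<^sub>1\<close>. The measure \<open>\<pi>\<close> is a Borel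
  measure on the line concentrated on the positive half-line. Each \<open>X t\<close> is specified up to
  almost sure equality only, so a jointly measurable version is required in order that integrals
  of \<open>X\<close> over subsets of the Euclidean space make sense.
\<close>

definition supCAR_field ::
  "'w measure \<Rightarrow> (real \<times> (real^'d)) set set \<Rightarrow> ((real \<times> (real^'d)) set \<Rightarrow> 'w \<Rightarrow> real) \<Rightarrow>
   real \<Rightarrow> real measure \<Rightarrow> real measure \<Rightarrow> (real^'d \<Rightarrow> 'w \<Rightarrow> real) \<Rightarrow> bool" where
  "supCAR_field M S \<Lambda> b W \<pi> X \<longleftrightarrow>
     prob_space M \<and>
     b \<ge> 0 \<and> Levy_measure W \<and> (\<integral>\<^sup>+x. ennreal (x\<^sup>2) \<partial>W) < \<infinity> \<and>
     prob_space \<pi> \<and> sets \<pi> = sets borel \<and> (AE r in \<pi>. r > 0) \<and>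
     exhausting_delta_ring param_space S \<and> S \<subseteq> sets borel \<and>
     independently_scattered M S \<Lambda> \<and>
     (\<forall>A\<in>S. infinitely_divisible (distr M borel (\<Lambda> A))) \<and>
     has_cumulant_measure M S \<Lambda> (\<pi> \<Otimes>\<^sub>M lborel) (levy_cumulant b W) \<and>
     (\<lambda>(y, \<omega>). X y \<omega>) \<in> borel_measurable (lborel \<Otimes>\<^sub>M M) \<and>
     (\<forall>t. RR_integrable M param_space S (\<pi> \<Otimes>\<^sub>M lborel) \<Lambda>
            (\<lambda>(r, u). 1 / (2 * r) * exp (- r * norm (t - u))) \<and>
          (AE \<omega> in M. X t \<omega> =
             - RR_integral M param_space S (\<pi> \<Otimes>\<^sub>M lborel) \<Lambda>
                 (\<lambda>(r, u). 1 / (2 * r) * exp (- r * norm (t - u))) \<omega>))"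

definition zero_mean_field :: "'w measure \<Rightarrow> ('t \<Rightarrow> 'w \<Rightarrow> real) \<Rightarrow> bool" where
  "zero_mean_field M X \<longleftrightarrow> (\<forall>t. integrable M (X t) \<and> (\<integral>\<omega>. X t \<omega> \<partial>M) = 0)"

definition homothetic :: "(real^'d) set \<Rightarrow> real \<Rightarrow> (real^'d) set" where
  "homothetic \<Delta> T = (\<lambda>x. T *\<^sub>R x) ` \<Delta>"

text \<open>
  A Jordan-measurable set need not be a Borel set, whence Lebesgue rather than Borel measure in the
  integrals below.
\<close>

definition jordan_measurable :: "(real^'d) set \<Rightarrow> bool" where
  "jordan_measurable \<Delta> \<longleftrightarrow> bounded \<Delta> \<and> negligible (frontier \<Delta>)"

definition aggregated :: "(real^'d) set \<Rightarrow> (real^'d \<Rightarrow> 'w \<Rightarrow> real) \<Rightarrow> real \<Rightarrow> 'w \<Rightarrow> real" where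
  "aggregated \<Delta> X T \<omega> = (LINT y:homothetic \<Delta> T|lebesgue. X y \<omega>)"

definition limit_kernel :: "(real^'d) set \<Rightarrow> real \<Rightarrow> real \<times> (real^'d) \<Rightarrow> real" where
  "limit_kernel \<Delta> t = (\<lambda>(r, u).
     - (LINT y:homothetic \<Delta> (t powr (1 / real CARD('d)))|lebesgue.
          1 / (2 * r) * exp (- r * norm (y - u))))"

text \<open>The measure \<open>r powr (\<alpha> - 1) du dr\<close> on the parameter space.\<close>

definition limit_control :: "real \<Rightarrow> (real \<times> (real^'d)) measure" where
  "limit_control \<alpha> =
     density lborel (\<lambda>r. ennreal (indicator {0<..} r * r powr (\<alpha> - 1))) \<Otimes>\<^sub>M lborel"

text \<open>Functions in the theory of slow variation live on the positive half-line only.\<close>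

definition slowly_varying_at_top :: "(real \<Rightarrow> real) \<Rightarrow> bool" where
  "slowly_varying_at_top l \<longleftrightarrow>
     l \<in> borel_measurable (restrict_space borel {0<..}) \<and>
     (\<forall>c>0. ((\<lambda>x. l (c * x) / l x) \<longlongrightarrow> 1) at_top)"

end

theory Submission
  imports Defs "HOL-Real_Asymp.Real_Asymp"
begin

text \<open>
  Write \<open>\<kappa>\<close> for the cumulant function of the Levy measure \<open>W\<close>, \<open>\<kappa>\<^sub>s\<close> for the stable one and
  \<open>m = \<pi> \<times> Leb\<close>. A linear combination \<open>\<Sum>\<^sub>i a\<^sub>i X*(\<tau>\<^sub>i T)\<close> is the average \<open>\<integral> \<theta>(y/T) X(y) dy\<close> of the field
  against a bounded step function \<open>\<theta>\<close> of compact support, and averaging commutes with stochastic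
  integration: its characteristic function is \<open>exp \<integral> \<kappa>(H\<^sub>T) dm\<close>, where \<open>H\<^sub>T(r, u)\<close> is minus the
  average of the kernel \<open>exp(-r |y - u|) / 2r\<close> against \<open>\<theta>(y/T)\<close> (\<open>stochastic_Fubini\<close>). On the other
  side the limit has characteristic function \<open>exp \<integral> \<kappa>\<^sub>s(H\<^sub>1) r\<^sup>\<alpha>\<^sup>-\<^sup>1 du dr\<close>. Hence everything reduces to
  the convergence of one deterministic integral, and the multivariate continuity theorem
  (\<open>levy_continuity_vec\<close>) does the rest.

  The kernel is homogeneous, \<open>H\<^sub>T(r/T, T u) = T\<^sup>d\<^sup>+\<^sup>1 H\<^sub>1(r, u)\<close>. With the normalisation \<open>N\<^sub>T\<close> of the theorem
  the substitution \<open>(r, u) \<leftarrow> (r/T, T u)\<close> turns \<open>\<integral> \<kappa>(H\<^sub>T / N\<^sub>T) dm\<close> into the integral of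
  \<open>(l(T/r) / l(T)) r\<^sup>\<alpha>\<^sup>-\<^sup>1 \<kappa>(\<lambda>\<^sub>T H\<^sub>1) / \<lambda>\<^sub>T\<^sup>\<beta>\<close> with a scale \<open>\<lambda>\<^sub>T \<rightarrow> \<infinity>\<close>. Slow variation sends the first factor
  to \<open>1\<close>, and since \<open>\<lambda>\<^sub>T \<rightarrow> \<infinity>\<close> only the small jumps of \<open>W\<close> count: a power law of its tails at the
  origin gives \<open>\<kappa>(\<lambda> x) / \<lambda>\<^sup>\<beta> \<rightarrow> \<kappa>\<^sub>s(x)\<close> (\<open>kappa_scaling_limit\<close>). The passage to the limit is dominated
  convergence (\<open>cumulant_limit\<close>): Potter bounds control \<open>l(T/r) / l(T)\<close> up to \<open>r\<close> of order \<open>T\<close>,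
  \<open>|\<kappa>(s)| \<le> C |s|\<^sup>\<beta>\<close> holds for all \<open>s\<close>, and \<open>\<integral> |H\<^sub>1|\<^sup>\<beta> du\<close> is at most of order \<open>r\<^sup>-\<^sup>\<beta>\<^sup>-\<^sup>d\<close> for small and \<open>r\<^sup>-\<^sup>(\<^sup>d\<^sup>+\<^sup>1\<^sup>)\<^sup>\<beta>\<close> for
  large \<open>r\<close>. These exponents are integrable against \<open>r\<^sup>\<alpha>\<^sup>-\<^sup>1\<close> because
  \<open>\<beta> + d < \<alpha> < (d + 1) \<beta>\<close>; the remaining rates \<open>r\<close> above order \<open>T\<close> contribute
  \<open>O(T\<^sup>\<alpha>\<^sup>-\<^sup>(\<^sup>d\<^sup>+\<^sup>1\<^sup>)\<^sup>\<beta> / l(T))\<close> because \<open>\<pi>\<close> has mass one, and this tends to zero.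

  The other ingredient is a theory of the stochastic integral itself, developed for random measures
  whose cumulant satisfies \<open>|\<kappa>(s)| \<le> C |s|\<^sup>\<beta>\<close> and \<open>|\<kappa>(s)| \<le> - D Re \<kappa>(s)\<close>. The integral is defined by
  convergence in probability over all sets of a sigma-algebra; that it depends on the integrand only is
  a gliding-hump argument (\<open>null_sequence_cf\<close>). For integrands in \<open>L\<^sup>\<beta>(m)\<close> the integral exists, has
  characteristic function \<open>exp \<integral> \<kappa>(f) dm\<close> and satisfies \<open>E|Y| \<le> const \<cdot> |f|\<^sub>\<beta>\<close> (\<open>RR_exists\<close>, \<open>RR_cf\<close>,
  \<open>RR_L1\<close>). The \<open>L\<^sup>1\<close> bound is what makes the stochastic Fubini theorem work.

  Neither control measure is assumed to be finite on the ring, and the ring is not assumed to generate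
  the Borel sets. Finiteness follows from the presence of one integrable integrand without zeros
  (\<open>finite_measure_on_S\<close>), and the limit kernel is measurable with respect to the ring, up to null sets,
  because it is a limit of combinations of the kernels that define \<open>X\<close> (\<open>H_version\<close>).
\<close>

section \<open>Levy continuity theorem in several dimensions\<close>

lemma vec_nth_borel: "(\<lambda>v::real^'n. v $ i) \<in> borel_measurable borel"
  by (intro borel_measurable_continuous_onI continuous_intros)

text \<open>
  Closed under products by the product-to-sum formula, so that substituting sines into a polynomial stays in the class.
  Expectations of such functions are determined by the characteristic function.
\<close>

inductive trig_poly :: "('a::real_inner \<Rightarrow> real) \<Rightarrow> bool" where
  wave: "trig_poly (\<lambda>x. c * cos (inner a x + b))"
| add: "trig_poly f \<Longrightarrow> trig_poly g \<Longrightarrow> trig_poly (\<lambda>x. f x + g x)"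

lemma trig_poly_const: "trig_poly (\<lambda>x. c)"
  using trig_poly.wave[of c 0 0] by simp

lemma trig_poly_wave_mult: "trig_poly g \<Longrightarrow> trig_poly (\<lambda>x. c * cos (inner a x + b) * g x)"
proof (induction rule: trig_poly.induct)
  case (wave c' a' b')
  have *: "c * cos (inner a x + b) * (c' * cos (inner a' x + b')) =
     (c * c' / 2) * cos (inner (a - a') x + (b - b')) + (c * c' / 2) * cos (inner (a + a') x + (b + b'))"
    for x
  proof -
    have "cos (inner a x + b) * cos (inner a' x + b') =
       (cos ((inner a x + b) - (inner a' x + b')) + cos ((inner a x + b) + (inner a' x + b'))) / 2"
      by (rule cos_times_cos)
    also have "(inner a x + b) - (inner a' x + b') = inner (a - a') x + (b - b')"
      by (simp add: inner_diff_left)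
    also have "(inner a x + b) + (inner a' x + b') = inner (a + a') x + (b + b')"
      by (simp add: inner_add_left)
    finally show ?thesis by (simp add: field_simps)
  qed
  show ?case unfolding * by (rule trig_poly.add[OF trig_poly.wave trig_poly.wave])
next
  case (add f g)
  then show ?case by (simp add: distrib_left trig_poly.add)
qed

lemma trig_poly_mult: "trig_poly f \<Longrightarrow> trig_poly g \<Longrightarrow> trig_poly (\<lambda>x. f x * g x)"
proof (induction rule: trig_poly.induct)
  case (wave c a b)
  then show ?case by (rule trig_poly_wave_mult)
next
  case (add f g)
  then show ?case by (simp add: distrib_right trig_poly.add)
qed

lemma trig_poly_sum: "finite I \<Longrightarrow> (\<And>i. i \<in> I \<Longrightarrow> trig_poly (f i)) \<Longrightarrow> trig_poly (\<lambda>x. \<Sum>i\<in>I. f i x)"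
  by (induction rule: finite_induct) (auto intro: trig_poly_const trig_poly.add)

lemma trig_poly_cont: "trig_poly g \<Longrightarrow> continuous_on UNIV g"
  by (induction rule: trig_poly.induct) (auto intro!: continuous_intros)

lemma trig_poly_bounded: "trig_poly g \<Longrightarrow> \<exists>B. \<forall>x. \<bar>g x\<bar> \<le> B"
proof (induction rule: trig_poly.induct)
  case (wave c a b)
  have "\<bar>c * cos (inner a x + b)\<bar> \<le> \<bar>c\<bar>" for x :: 'a
    by (simp add: abs_mult mult_left_le)
  then show ?case by blast
next
  case (add f g)
  then obtain B C where "\<And>x. \<bar>f x\<bar> \<le> B" "\<And>x. \<bar>g x\<bar> \<le> C" by blast
  then have "\<bar>f x + g x\<bar> \<le> B + C" for x
    by (meson abs_triangle_ineq add_mono order_trans)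
  then show ?case by blast
qed

lemma polynomial_of_sines_trig_poly:
  fixes P :: "real^'n \<Rightarrow> real"
  assumes "real_polynomial_function P"
  shows "trig_poly (\<lambda>x::real^'n. P (\<chi> i. sin (\<rho> * x $ i)))"
  using assms
proof (induction rule: real_polynomial_function.induct)
  case (linear f)
  have "f (\<chi> i. sin (\<rho> * x $ i)) = (\<Sum>i\<in>UNIV. f (axis i 1) * cos (inner (axis i \<rho>) x + - (pi / 2)))" for x :: "real^'n"
  proof -
    have "(\<chi> i. sin (\<rho> * x $ i)) = (\<Sum>i\<in>UNIV. sin (\<rho> * x $ i) *\<^sub>R axis i 1)"
      by (simp add: vec_eq_iff axis_def if_distrib cong: if_cong)
    then have "f (\<chi> i. sin (\<rho> * x $ i)) = (\<Sum>i\<in>UNIV. sin (\<rho> * x $ i) *\<^sub>R f (axis i 1))"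
      using linear by (simp add: linear_sum linear_cmul bounded_linear.linear)
    also have "\<dots> = (\<Sum>i\<in>UNIV. f (axis i 1) * cos (inner (axis i \<rho>) x + - (pi / 2)))"
    proof (intro sum.cong refl)
      fix i :: 'n
      have "cos (\<rho> * x $ i - pi / 2) = sin (\<rho> * x $ i)"
        by (simp add: cos_diff)
      then show "sin (\<rho> * x $ i) *\<^sub>R f (axis i 1) = f (axis i 1) * cos (inner (axis i \<rho>) x + - (pi / 2))"
        by (simp add: inner_axis')
    qed
    finally show ?thesis .
  qed
  then show ?case by (simp only:) (intro trig_poly_sum trig_poly.wave finite)
next
  case (const c)
  then show ?case by (rule trig_poly_const)
next
  case (add f g)
  then show ?case by (intro trig_poly.add)
next
  case (mult f g)
  then show ?case by (intro trig_poly_mult)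
qed

text \<open>
  Trigonometric polynomials approximate \<open>f\<close> uniformly on a box and stay bounded everywhere: apply the
  Weierstrass theorem to \<open>f\<close> in the coordinates \<open>s\<^sub>i = sin(\<rho> x\<^sub>i)\<close> on the compact cube \<open>[-1,1]\<^sup>n\<close>.
\<close>

lemma trig_poly_approximation:
  fixes f :: "real^'n \<Rightarrow> real"
  assumes f: "continuous_on UNIV f" "\<And>x. \<bar>f x\<bar> \<le> B" and "R > 0" "e > 0"
  obtains g where "trig_poly g" "\<And>x. (\<And>i. \<bar>x $ i\<bar> \<le> R) \<Longrightarrow> \<bar>f x - g x\<bar> \<le> e" "\<And>x. \<bar>g x\<bar> \<le> B + e"
proof -
  \<comment> \<open>With this frequency \<open>x \<mapsto> sin (\<rho> x)\<close> is injective on \<open>[-R, R]\<close> and maps it onto \<open>[-1, 1]\<close>.\<close>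
  define \<rho> where "\<rho> = pi / (2 * R)"
  have \<rho>: "\<rho> > 0" using \<open>R > 0\<close> by (simp add: \<rho>_def)
  define h where "h = (\<lambda>s::real^'n. f (\<chi> i. arcsin (s $ i) / \<rho>))"
  let ?K = "cbox (- 1) (1::real^'n)"
  have K: "s \<in> ?K \<longleftrightarrow> (\<forall>i. - 1 \<le> s $ i \<and> s $ i \<le> 1)" for s
    by (simp add: mem_box_cart)
  have "continuous_on ?K h"
    unfolding h_def
  proof (rule continuous_on_compose2[OF f(1)])
    show "continuous_on ?K (\<lambda>s::real^'n. \<chi> i. arcsin (s $ i) / \<rho>)"
      using \<rho> by (auto intro!: continuous_intros simp: K)
  qed auto
  from Stone_Weierstrass_real_polynomial_function[OF compact_cbox this \<open>e > 0\<close>]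
  obtain P where P: "real_polynomial_function P" "\<And>s. s \<in> ?K \<Longrightarrow> \<bar>h s - P s\<bar> < e" by blast
  let ?g = "\<lambda>x::real^'n. P (\<chi> i. sin (\<rho> * x $ i))"
  have inK: "(\<chi> i. sin (\<rho> * x $ i)) \<in> ?K" for x :: "real^'n" by (simp add: K)
  show ?thesis
  proof
    show "trig_poly ?g" by (rule polynomial_of_sines_trig_poly[OF P(1)])
    show "\<bar>f x - ?g x\<bar> \<le> e" if x: "\<And>i. \<bar>x $ i\<bar> \<le> R" for x
    proof -
      have "arcsin (sin (\<rho> * x $ i)) = \<rho> * x $ i" for i
      proof (rule arcsin_sin)
        have "\<bar>\<rho> * x $ i\<bar> \<le> \<rho> * R" using x[of i] \<rho> by (simp add: abs_mult)
        also have "\<rho> * R = pi / 2" using \<open>R > 0\<close> by (simp add: \<rho>_def)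
        finally show "- (pi / 2) \<le> \<rho> * x $ i" "\<rho> * x $ i \<le> pi / 2" by auto
      qed
      then have "h (\<chi> i. sin (\<rho> * x $ i)) = f x" using \<rho> by (simp add: h_def)
      then show ?thesis using P(2)[OF inK[of x]] by simp
    qed
    show "\<bar>?g x\<bar> \<le> B + e" for x
      using P(2)[OF inK[of x]] f(2)[of "\<chi> i. arcsin ((\<chi> i. sin (\<rho> * x $ i)) $ i) / \<rho>"]
      unfolding h_def by linarith
  qed
qed

lemma trig_poly_expectation_tendsto:
  fixes Y :: "nat \<Rightarrow> 'w \<Rightarrow> 'a::euclidean_space"
  assumes "prob_space M" "prob_space M'" and Y[measurable]: "\<And>k. Y k \<in> borel_measurable M" "Z \<in> borel_measurable M'"
    and char: "\<And>a. (\<lambda>k. \<integral>\<omega>. iexp (inner a (Y k \<omega>)) \<partial>M) \<longlonglongrightarrow> (\<integral>\<omega>. iexp (inner a (Z \<omega>)) \<partial>M')"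
    and "trig_poly g"
  shows "(\<lambda>k. \<integral>\<omega>. g (Y k \<omega>) \<partial>M) \<longlonglongrightarrow> (\<integral>\<omega>. g (Z \<omega>) \<partial>M')"
  using \<open>trig_poly g\<close>
proof (induction rule: trig_poly.induct)
  case (wave c a b)
  interpret M: prob_space M by fact
  interpret M': prob_space M' by fact
  have *: "(\<integral>\<omega>. c * cos (inner a (V \<omega>) + b) \<partial>N) = c * Re (iexp b * (\<integral>\<omega>. iexp (inner a (V \<omega>)) \<partial>N))"
    if "prob_space N" and [measurable]: "V \<in> borel_measurable N" for N :: "'z measure" and V :: "'z \<Rightarrow> 'a"
  proof -
    interpret N: prob_space N by fact
    have i: "integrable N (\<lambda>\<omega>. iexp (inner a (V \<omega>)))"
      by (rule N.integrable_iexp) measurable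
    have "(\<integral>\<omega>. c * cos (inner a (V \<omega>) + b) \<partial>N) = c * (\<integral>\<omega>. Re (iexp b * iexp (inner a (V \<omega>))) \<partial>N)"
      by (simp add: exp_add[symmetric] Re_exp algebra_simps)
    also have "(\<integral>\<omega>. Re (iexp b * iexp (inner a (V \<omega>))) \<partial>N) = Re (\<integral>\<omega>. iexp b * iexp (inner a (V \<omega>)) \<partial>N)"
      using i by (intro integral_Re) simp
    finally show ?thesis using i by simp
  qed
  show ?case
    unfolding *[OF \<open>prob_space M\<close> Y(1)] *[OF \<open>prob_space M'\<close> Y(2)]
    by (intro tendsto_intros char)
next
  case (add f g)
  interpret M: prob_space M by fact
  interpret M': prob_space M' by fact
  have i: "integrable M (\<lambda>\<omega>. u (Y k \<omega>))" "integrable M' (\<lambda>\<omega>. u (Z \<omega>))" if tu: "trig_poly u" for u k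
  proof -
    have [measurable]: "u \<in> borel_measurable borel"
      using trig_poly_cont[OF tu] by (rule borel_measurable_continuous_onI)
    obtain B where "\<And>x. \<bar>u x\<bar> \<le> B" using trig_poly_bounded[OF tu] by blast
    then show "integrable M (\<lambda>\<omega>. u (Y k \<omega>))" "integrable M' (\<lambda>\<omega>. u (Z \<omega>))"
      by (auto intro!: M.integrable_const_bound[where B=B] M'.integrable_const_bound[where B=B])
  qed
  show ?case
    by (simp add: i add.hyps tendsto_add add.IH)
qed

text \<open>
  The one-dimensional continuity theorem. It is applied to cut-off functions of single coordinates, which
  provide tightness of the vectors.
\<close>

lemma cutoff_marginal_tendsto:
  fixes Y :: "nat \<Rightarrow> 'w \<Rightarrow> real"
  assumes "prob_space M" "prob_space M'" and Y[measurable]: "\<And>k. Y k \<in> borel_measurable M" "Z \<in> borel_measurable M'"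
    and char: "\<And>s. (\<lambda>k. \<integral>\<omega>. iexp (s * Y k \<omega>) \<partial>M) \<longlonglongrightarrow> (\<integral>\<omega>. iexp (s * Z \<omega>) \<partial>M')"
    and h: "continuous_on UNIV h" "\<And>x. \<bar>h x\<bar> \<le> 1"
  shows "(\<lambda>k. \<integral>\<omega>. h (Y k \<omega>) \<partial>M) \<longlonglongrightarrow> (\<integral>\<omega>. h (Z \<omega>) \<partial>M' :: real)"
proof -
  interpret M: prob_space M by fact
  interpret M': prob_space M' by fact
  have [measurable]: "h \<in> borel_measurable borel" using h(1) by (rule borel_measurable_continuous_onI)
  have d: "real_distribution (distr M borel (Y k))" for k by (rule M.real_distribution_distr) (rule Y)
  have d': "real_distribution (distr M' borel Z)" by (rule M'.real_distribution_distr) (rule Y)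
  have w: "weak_conv_m (\<lambda>k. distr M borel (Y k)) (distr M' borel Z)"
    by (rule levy_continuity[OF d d']) (use char in \<open>simp add: char_def integral_distr\<close>)
  have "(\<lambda>k. integral\<^sup>L (distr M borel (Y k)) h) \<longlonglongrightarrow> integral\<^sup>L (distr M' borel Z) h"
  proof (rule weak_conv_imp_integral_bdd_continuous_conv[OF d d' w])
    show "isCont h x" for x using h(1) by (simp add: continuous_on_eq_continuous_at)
    show "norm (h x) \<le> 1" for x using h(2) by simp
  qed
  then show ?thesis by (simp add: integral_distr)
qed

text \<open>
  Replace \<open>f\<close> by a trigonometric polynomial on a large box. The error outside the box is controlled by the
  mass that the coordinates put outside \<open>[-R, R]\<close>, uniformly in large \<open>k\<close> because the marginals converge.
\<close>

lemma levy_continuity_vec_seq: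
  fixes Y :: "nat \<Rightarrow> 'w \<Rightarrow> real^'n" and f :: "real^'n \<Rightarrow> real"
  assumes M: "prob_space M" "prob_space M'" and Y[measurable]: "\<And>k. Y k \<in> borel_measurable M" "Z \<in> borel_measurable M'"
    and char: "\<And>a. (\<lambda>k. \<integral>\<omega>. iexp (inner a (Y k \<omega>)) \<partial>M) \<longlonglongrightarrow> (\<integral>\<omega>. iexp (inner a (Z \<omega>)) \<partial>M')"
    and f: "continuous_on UNIV f" "bounded (range f)"
  shows "(\<lambda>k. \<integral>\<omega>. f (Y k \<omega>) \<partial>M) \<longlonglongrightarrow> (\<integral>\<omega>. f (Z \<omega>) \<partial>M')"
proof -
  interpret M: prob_space M by fact
  interpret M': prob_space M' by fact
  have [measurable]: "f \<in> borel_measurable borel" using f(1) by (rule borel_measurable_continuous_onI)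
  obtain B where B: "B > 0" "\<And>x. \<bar>f x\<bar> \<le> B"
    using f(2) unfolding bounded_pos by auto
  define h where "h = (\<lambda>R t::real. min 1 (max 0 (\<bar>t\<bar> - R + 1)))"
  have hc: "continuous_on UNIV (h R)" for R unfolding h_def by (intro continuous_intros)
  have hb: "\<bar>h R t\<bar> \<le> 1" "h R t \<ge> 0" for R t by (auto simp: h_def)
  have hm[measurable]: "h R \<in> borel_measurable borel" for R using hc by (rule borel_measurable_continuous_onI)
  have marg: "(\<lambda>k. \<integral>\<omega>. iexp (s * Y k \<omega> $ i) \<partial>M) \<longlonglongrightarrow> (\<integral>\<omega>. iexp (s * Z \<omega> $ i) \<partial>M')" for s i
    using char[of "axis i s"] by (simp add: inner_axis')
  have Yi[measurable]: "(\<lambda>\<omega>. Y k \<omega> $ i) \<in> borel_measurable M" for k i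
    by (rule measurable_compose[OF _ vec_nth_borel]) simp
  have Zi[measurable]: "(\<lambda>\<omega>. Z \<omega> $ i) \<in> borel_measurable M'" for i
    by (rule measurable_compose[OF _ vec_nth_borel]) simp
  have hlim: "(\<lambda>k. \<integral>\<omega>. h R (Y k \<omega> $ i) \<partial>M) \<longlonglongrightarrow> (\<integral>\<omega>. h R (Z \<omega> $ i) \<partial>M')" for R i
    by (rule cutoff_marginal_tendsto[OF M Yi Zi marg hc hb(1)])
  have tight: "(\<lambda>R. \<Sum>i\<in>UNIV. \<integral>\<omega>. h (real R) (Z \<omega> $ i) \<partial>M') \<longlonglongrightarrow> (\<Sum>i\<in>(UNIV::'n set). \<integral>\<omega>. 0 \<partial>M')"
  proof (intro tendsto_sum integral_dominated_convergence[where w="\<lambda>_. 1"])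
    fix i :: 'n
    have "(\<lambda>R. h (real R) t) \<longlonglongrightarrow> 0" for t
    proof (rule tendsto_eventually)
      have "eventually (\<lambda>R. real R \<ge> \<bar>t\<bar> + 1) sequentially"
        using filterlim_real_sequentially by (simp add: filterlim_at_top)
      then show "eventually (\<lambda>R. h (real R) t = 0) sequentially"
        by eventually_elim (simp add: h_def)
    qed
    then show "AE \<omega> in M'. (\<lambda>R. h (real R) (Z \<omega> $ i)) \<longlonglongrightarrow> 0" by simp
  qed (use hb in auto)
  show ?thesis
  proof (rule LIMSEQ_I)
    fix \<epsilon> :: real assume "\<epsilon> > 0"
    define e where "e = min 1 (\<epsilon> / 8)"
    have e: "e > 0" "e \<le> 1" "8 * e \<le> \<epsilon>" using \<open>\<epsilon> > 0\<close> by (auto simp: e_def)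
    \<comment> \<open>Bounds \<open>|f - g|\<close> outside the box, where \<open>|f| \<le> B\<close> and \<open>|g| \<le> B + e\<close>.\<close>
    define C where "C = 2 * B + 1"
    have C: "C > 0" using B by (simp add: C_def)
    have "eventually (\<lambda>R. (\<Sum>i\<in>UNIV. \<integral>\<omega>. h (real R) (Z \<omega> $ i) \<partial>M') < e / C) sequentially"
      using tight e C by (intro order_tendstoD(2)) auto
    then have "eventually (\<lambda>R. R > 0 \<and> (\<Sum>i\<in>UNIV. \<integral>\<omega>. h (real R) (Z \<omega> $ i) \<partial>M') < e / C) sequentially"
      by (intro eventually_conj eventually_gt_at_top)
    then obtain R :: nat where R: "R > 0" "(\<Sum>i\<in>UNIV. \<integral>\<omega>. h (real R) (Z \<omega> $ i) \<partial>M') < e / C"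
      by (auto simp: eventually_sequentially)
    obtain g where g: "trig_poly g" "\<And>x. (\<And>i. \<bar>x $ i\<bar> \<le> real R) \<Longrightarrow> \<bar>f x - g x\<bar> \<le> e" "\<And>x. \<bar>g x\<bar> \<le> B + e"
      using trig_poly_approximation[OF f(1) B(2), of "real R" e] R(1) e(1) by (metis of_nat_0_less_iff)
    have [measurable]: "g \<in> borel_measurable borel"
      using trig_poly_cont[OF g(1)] by (rule borel_measurable_continuous_onI)
    have pt: "\<bar>f x - g x\<bar> \<le> e + C * (\<Sum>i\<in>UNIV. h R (x $ i))" for x
    proof (cases "\<forall>i. \<bar>x $ i\<bar> \<le> real R")
      case True
      then have "\<bar>f x - g x\<bar> \<le> e" using g(2) by blast
      moreover have "0 \<le> C * (\<Sum>i\<in>UNIV. h R (x $ i))"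
        using C hb by (intro mult_nonneg_nonneg sum_nonneg) auto
      ultimately show ?thesis by linarith
    next
      case False
      then obtain i where "\<bar>x $ i\<bar> > real R" by (auto simp: not_le)
      then have "h R (x $ i) = 1" by (simp add: h_def)
      then have "1 \<le> (\<Sum>i\<in>UNIV. h R (x $ i))"
        using member_le_sum[of i UNIV "\<lambda>i. h R (x $ i)"] hb(2) by simp
      then have "C \<le> C * (\<Sum>i\<in>UNIV. h R (x $ i))" using C by simp
      then show ?thesis using B(2)[of x] g(3)[of x] e(1,2) unfolding C_def by linarith
    qed
    have int: "\<bar>(\<integral>\<omega>. f (V \<omega>) \<partial>N) - (\<integral>\<omega>. g (V \<omega>) \<partial>N)\<bar> \<le> e + C * (\<Sum>i\<in>UNIV. \<integral>\<omega>. h R (V \<omega> $ i) \<partial>N)"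
      if "prob_space N" and [measurable]: "V \<in> borel_measurable N" for N :: "'z measure" and V :: "'z \<Rightarrow> real^'n"
    proof -
      interpret N: prob_space N by fact
      have [measurable]: "(\<lambda>\<omega>. V \<omega> $ i) \<in> borel_measurable N" for i
        by (rule measurable_compose[OF _ vec_nth_borel]) simp
      have i1: "integrable N (\<lambda>\<omega>. f (V \<omega>))" using B by (intro N.integrable_const_bound[where B=B]) auto
      have i2: "integrable N (\<lambda>\<omega>. g (V \<omega>))" using g(3) by (intro N.integrable_const_bound[where B="B+e"]) auto
      have i3: "integrable N (\<lambda>\<omega>. h R (V \<omega> $ i))" for i
        using hb by (intro N.integrable_const_bound[where B=1]) auto
      have "\<bar>(\<integral>\<omega>. f (V \<omega>) \<partial>N) - (\<integral>\<omega>. g (V \<omega>) \<partial>N)\<bar> = \<bar>\<integral>\<omega>. f (V \<omega>) - g (V \<omega>) \<partial>N\<bar>"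
        using i1 i2 by simp
      also have "\<dots> \<le> (\<integral>\<omega>. \<bar>f (V \<omega>) - g (V \<omega>)\<bar> \<partial>N)" by (rule integral_abs_bound)
      also have "\<dots> \<le> (\<integral>\<omega>. e + C * (\<Sum>i\<in>UNIV. h R (V \<omega> $ i)) \<partial>N)"
        using i1 i2 i3 pt by (intro integral_mono) auto
      also have "\<dots> = e + C * (\<Sum>i\<in>UNIV. \<integral>\<omega>. h R (V \<omega> $ i) \<partial>N)"
        using i3 by (simp add: N.prob_space)
      finally show ?thesis .
    qed
    have "eventually (\<lambda>k. (\<Sum>i\<in>UNIV. \<integral>\<omega>. h R (Y k \<omega> $ i) \<partial>M) < e / C) sequentially"
      by (rule order_tendstoD(2)[OF tendsto_sum[OF hlim] R(2)])
    moreover have "eventually (\<lambda>k. dist (\<integral>\<omega>. g (Y k \<omega>) \<partial>M) (\<integral>\<omega>. g (Z \<omega>) \<partial>M') < e) sequentially"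
      using trig_poly_expectation_tendsto[OF M Y char g(1)] e(1) by (rule tendstoD)
    ultimately have "eventually (\<lambda>k. norm ((\<integral>\<omega>. f (Y k \<omega>) \<partial>M) - (\<integral>\<omega>. f (Z \<omega>) \<partial>M')) < \<epsilon>) sequentially"
    proof eventually_elim
      case (elim k)
      have "C * (\<Sum>i\<in>UNIV. \<integral>\<omega>. h R (Y k \<omega> $ i) \<partial>M) < e" "C * (\<Sum>i\<in>UNIV. \<integral>\<omega>. h R (Z \<omega> $ i) \<partial>M') < e"
        using elim(1) R(2) C by (simp_all add: field_simps)
      with int[OF M(1) Y(1)[of k]] int[OF M(2) Y(2)] elim(2) e
      show ?case unfolding dist_real_def real_norm_def by linarith
    qed
    then show "\<exists>no. \<forall>k\<ge>no. norm ((\<integral>\<omega>. f (Y k \<omega>) \<partial>M) - (\<integral>\<omega>. f (Z \<omega>) \<partial>M')) < \<epsilon>"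
      by (simp add: eventually_sequentially)
  qed
qed

text \<open>
  Convergence along a real parameter follows from convergence along all sequences that tend to infinity.
\<close>

lemma levy_continuity_vec:
  fixes Y :: "real \<Rightarrow> 'w \<Rightarrow> real^'n"
  assumes M: "prob_space M" "prob_space M'"
    and Y: "eventually (\<lambda>T. Y T \<in> borel_measurable M) at_top" and Z: "Z \<in> borel_measurable M'"
    and char: "\<And>a. ((\<lambda>T. \<integral>\<omega>. iexp (inner a (Y T \<omega>)) \<partial>M) \<longlongrightarrow> (\<integral>\<omega>. iexp (inner a (Z \<omega>)) \<partial>M')) at_top"
  shows "conv_in_distr M Y M' Z at_top"
  unfolding conv_in_distr_def
proof (intro conjI allI impI Y Z)
  fix f :: "real^'n \<Rightarrow> real" assume f: "continuous_on UNIV f \<and> bounded (range f)"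
  obtain T0 where T0: "\<And>T. T \<ge> T0 \<Longrightarrow> Y T \<in> borel_measurable M"
    using Y by (auto simp: eventually_at_top_linorder)
  show "((\<lambda>T. \<integral>\<omega>. f (Y T \<omega>) \<partial>M) \<longlongrightarrow> (\<integral>\<omega>. f (Z \<omega>) \<partial>M')) at_top"
  proof (rule tendsto_at_topI_sequentially)
    fix s :: "nat \<Rightarrow> real" assume s: "filterlim s at_top sequentially"
    let ?s = "\<lambda>k. max T0 (s k)"
    have ev: "eventually (\<lambda>k. ?s k = s k) sequentially"
      using s unfolding filterlim_at_top by (auto elim!: eventually_mono dest!: spec[of _ T0])
    have s': "filterlim ?s at_top sequentially"
      using filterlim_cong[OF refl refl ev] s by blast
    have "(\<lambda>k. \<integral>\<omega>. f (Y (?s k) \<omega>) \<partial>M) \<longlonglongrightarrow> (\<integral>\<omega>. f (Z \<omega>) \<partial>M')"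
    proof (rule levy_continuity_vec_seq[OF M])
      show "(\<lambda>k. \<integral>\<omega>. iexp (inner a (Y (?s k) \<omega>)) \<partial>M) \<longlonglongrightarrow> (\<integral>\<omega>. iexp (inner a (Z \<omega>)) \<partial>M')" for a
        by (rule filterlim_compose[OF char s'])
    qed (use f T0 Z in auto)
    moreover have "eventually (\<lambda>k. (\<integral>\<omega>. f (Y (?s k) \<omega>) \<partial>M) = (\<integral>\<omega>. f (Y (s k) \<omega>) \<partial>M)) sequentially"
      using ev by eventually_elim simp
    ultimately show "(\<lambda>k. \<integral>\<omega>. f (Y (s k) \<omega>) \<partial>M) \<longlonglongrightarrow> (\<integral>\<omega>. f (Z \<omega>) \<partial>M')"
      by (rule Lim_transform_eventually)
  qed
qed

section \<open>Potter bounds\<close>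

text \<open>
  The uniform convergence theorem of Karamata, in additive form. If it failed along \<open>x\<^sub>n \<rightarrow> \<infinity>\<close> and
  \<open>u\<^sub>n \<in> [0,1]\<close>, consider the shifts \<open>v \<in> [0,2]\<close> for which \<open>h(y + v)\<close> is close to \<open>h(y)\<close>, for \<open>y = x\<^sub>n\<close> and for
  \<open>y = x\<^sub>n + u\<^sub>n\<close>. Eventually both sets have measure above \<open>3/2\<close>, so the first and the translate of the second
  by \<open>u\<^sub>n\<close> meet within \<open>[0,3]\<close>, and a common point contradicts the choice of \<open>x\<^sub>n, u\<^sub>n\<close>.
\<close>

lemma uniform_convergence_shifts:
  fixes h :: "real \<Rightarrow> real"
  assumes [measurable]: "h \<in> borel_measurable borel"
    and lim: "\<And>u. ((\<lambda>x. h (x + u) - h x) \<longlongrightarrow> 0) at_top" and "\<epsilon> > 0"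
  shows "\<exists>X. \<forall>x\<ge>X. \<forall>u\<in>{0..1}. \<bar>h (x + u) - h x\<bar> < \<epsilon>"
proof (rule ccontr)
  assume "\<not> ?thesis"
  then have "\<exists>x u. x \<ge> X \<and> u \<in> {0..1} \<and> \<bar>h (x + u) - h x\<bar> \<ge> \<epsilon>" for X
    by (meson not_less)
  then have "\<forall>n::nat. \<exists>x u. x \<ge> real n \<and> u \<in> {0..1} \<and> \<bar>h (x + u) - h x\<bar> \<ge> \<epsilon>" by blast
  then obtain x u where xu: "\<And>n::nat. x n \<ge> real n \<and> u n \<in> {0..1} \<and> \<bar>h (x n + u n) - h (x n)\<bar> \<ge> \<epsilon>"
    by metis
  then have x: "\<And>n::nat. x n \<ge> real n" and u: "\<And>n. u n \<in> {0..1}"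
    and big: "\<And>n. \<bar>h (x n + u n) - h (x n)\<bar> \<ge> \<epsilon>" by blast+
  have x_top: "filterlim x at_top sequentially"
    by (rule filterlim_at_top_mono[OF filterlim_real_sequentially]) (simp add: x)
  have xu_top: "filterlim (\<lambda>n. x n + u n) at_top sequentially"
    by (rule filterlim_at_top_mono[OF x_top]) (use u in auto)
  have meas: "(\<lambda>n. measure lborel {v\<in>{0..2}. \<forall>m\<ge>n. \<bar>h (y m + v) - h (y m)\<bar> < \<epsilon> / 2}) \<longlonglongrightarrow> 2"
    if y: "filterlim y at_top sequentially" for y :: "nat \<Rightarrow> real"
  proof -
    let ?V = "\<lambda>n. {v\<in>{0..2}. \<forall>m\<ge>n. \<bar>h (y m + v) - h (y m)\<bar> < \<epsilon> / 2}"
    have m: "?V n \<in> sets lborel" for n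
      by measurable
    have "(\<lambda>n. measure lborel (?V n)) \<longlonglongrightarrow> measure lborel (\<Union>n. ?V n)"
    proof (rule Lim_measure_incseq)
      show "range ?V \<subseteq> sets lborel" using m by blast
      show "incseq ?V" by (auto simp: incseq_def)
      have "emeasure lborel (\<Union>n. ?V n) \<le> emeasure lborel {0..2::real}"
        by (intro emeasure_mono) auto
      then show "emeasure lborel (\<Union>n. ?V n) \<noteq> \<infinity>" by (auto simp: top_unique)
    qed
    also have "(\<Union>n. ?V n) = {0..2}"
    proof -
      have "\<exists>n. \<forall>m\<ge>n. \<bar>h (y m + v) - h (y m)\<bar> < \<epsilon> / 2" for v
      proof -
        have "(\<lambda>n. h (y n + v) - h (y n)) \<longlonglongrightarrow> 0"
          using filterlim_compose[OF lim y] .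
        from LIMSEQ_D[OF this, of "\<epsilon> / 2"] \<open>\<epsilon> > 0\<close> show ?thesis by simp
      qed
      then show ?thesis by auto
    qed
    finally show ?thesis by simp
  qed
  let ?V = "\<lambda>n. {v\<in>{0..2}. \<forall>m\<ge>n. \<bar>h (x m + v) - h (x m)\<bar> < \<epsilon> / 2}"
  let ?W = "\<lambda>n. {v\<in>{0..2}. \<forall>m\<ge>n. \<bar>h (x m + u m + v) - h (x m + u m)\<bar> < \<epsilon> / 2}"
  have "eventually (\<lambda>n. measure lborel (?V n) > 3/2 \<and> measure lborel (?W n) > 3/2) sequentially"
    using meas[OF x_top] meas[OF xu_top] by (intro eventually_conj order_tendstoD) auto
  then obtain n where n: "measure lborel (?V n) > 3/2" "measure lborel (?W n) > 3/2"
    by (auto simp: eventually_sequentially)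
  let ?U = "(+) (u n) ` ?W n"
  have Vm: "?V n \<in> sets lborel" and Wm: "?W n \<in> sets lborel" by measurable
  have Um: "?U \<in> sets borel" and Ue: "measure lborel ?U = measure lborel (?W n)"
  proof -
    have shift: "(+) a ` B = (\<lambda>z. z - a) -` B" for a :: real and B
    proof (intro set_eqI iffI)
      fix z assume "z \<in> (\<lambda>z. z - a) -` B"
      then show "z \<in> (+) a ` B" by (intro image_eqI[of _ _ "z - a"]) auto
    qed auto
    have "?U = (\<lambda>z. z - u n) -` ?W n" by (rule shift)
    also have "\<dots> \<in> sets borel"
      using measurable_sets_borel[of "\<lambda>z. z - u n" borel "?W n"] Wm by simp
    finally show "?U \<in> sets borel" .
    show "measure lborel ?U = measure lborel (?W n)" 
      using measure_translation[of "u n" "?W n"] Wm \<open>?U \<in> sets borel\<close>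
      by (simp add: measure_completion)
  qed
  have "?V n \<inter> ?U \<noteq> {}"
  proof
    assume "?V n \<inter> ?U = {}"
    then have "measure lborel (?V n \<union> ?U) = measure lborel (?V n) + measure lborel ?U"
    proof (intro measure_Union)
      have "emeasure lborel (?V n) \<le> emeasure lborel {0..2::real}" by (intro emeasure_mono) auto
      then show "emeasure lborel (?V n) \<noteq> \<infinity>" by (auto simp: top_unique)
      have "emeasure lborel ?U \<le> emeasure lborel {0..3::real}"
        using u[of n] by (intro emeasure_mono) auto
      then show "emeasure lborel ?U \<noteq> \<infinity>" by (auto simp: top_unique)
    qed (use Vm Um in auto)
    then have "measure lborel (?V n \<union> ?U) > 3" using n Ue by simp
    moreover have "measure lborel (?V n \<union> ?U) \<le> measure lborel {0..3::real}"
      using u[of n] by (intro measure_mono_fmeasurable) (use Vm Um in \<open>auto simp: fmeasurable_def\<close>)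
    ultimately show False by simp
  qed
  then obtain w where w: "w \<in> ?W n" "u n + w \<in> ?V n" by blast
  have "\<bar>h (x n + (u n + w)) - h (x n)\<bar> < \<epsilon> / 2" "\<bar>h (x n + u n + w) - h (x n + u n)\<bar> < \<epsilon> / 2"
    using w by auto
  with big[of n] show False unfolding add.assoc by linarith
qed

lemma shift_growth:
  fixes h :: "real \<Rightarrow> real"
  assumes X: "\<And>x u. x \<ge> X \<Longrightarrow> u \<in> {0..1} \<Longrightarrow> \<bar>h (x + u) - h x\<bar> < \<delta>" and "x \<ge> X" "u \<ge> 0"
  shows "\<bar>h (x + u) - h x\<bar> \<le> \<delta> * (u + 1)"
proof -
  have "\<delta> > 0" using X[of X 0] by simp
  have *: "\<bar>h (x + u) - h x\<bar> \<le> \<delta> * real k" if "u \<le> real k" "u \<ge> 0" for k u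
    using that
  proof (induction k arbitrary: u)
    case 0
    then show ?case by simp
  next
    case (Suc k)
    show ?case
    proof (cases "u \<le> real k")
      case True
      then have "\<bar>h (x + u) - h x\<bar> \<le> \<delta> * real k" using Suc by blast
      then show ?thesis using \<open>\<delta> > 0\<close> by (simp add: algebra_simps)
    next
      case False
      have "\<bar>h (x + real k) - h x\<bar> \<le> \<delta> * real k" using Suc.IH[of "real k"] by simp
      moreover have "\<bar>h (x + real k + (u - real k)) - h (x + real k)\<bar> < \<delta>"
        using False Suc.prems \<open>x \<ge> X\<close> by (intro X) auto
      ultimately show ?thesis by (simp add: algebra_simps)
    qed
  qed
  have "u \<le> real (nat \<lceil>u\<rceil>)" "real (nat \<lceil>u\<rceil>) \<le> u + 1" using \<open>u \<ge> 0\<close> by linarith+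
  then have "\<bar>h (x + u) - h x\<bar> \<le> \<delta> * real (nat \<lceil>u\<rceil>)" using * \<open>u \<ge> 0\<close> by blast
  also have "\<dots> \<le> \<delta> * (u + 1)" using \<open>\<delta> > 0\<close> \<open>real (nat \<lceil>u\<rceil>) \<le> u + 1\<close> by simp
  finally show ?thesis .
qed

text \<open>
  For \<open>h(x) = ln l(e\<^sup>x)\<close> slow variation says that increments over a fixed distance tend to zero; uniformity
  over unit distances makes \<open>h\<close> grow at most linearly with slope \<open>\<delta>\<close>.
\<close>

lemma potter_bound:
  fixes l :: "real \<Rightarrow> real"
  assumes l: "slowly_varying_at_top l" "\<And>x. x > 0 \<Longrightarrow> l x > 0" and "\<delta> > 0"
  obtains X C where "X > 0" "C > 0"
    "\<And>x y. x \<ge> X \<Longrightarrow> y \<ge> X \<Longrightarrow> l y / l x \<le> C * max ((y / x) powr \<delta>) ((y / x) powr (- \<delta>))"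
proof -
  define h where "h = (\<lambda>x. ln (l (exp x)))"
  have "l \<in> borel_measurable (restrict_space borel {0<..})" using l(1) by (simp add: slowly_varying_at_top_def)
  moreover have "exp \<in> measurable borel (restrict_space borel {0::real<..})"
    by (intro measurable_restrict_space2) auto
  ultimately have "(\<lambda>x. l (exp x)) \<in> borel_measurable borel" by (rule measurable_compose[rotated])
  then have hm: "h \<in> borel_measurable borel" unfolding h_def by (rule borel_measurable_ln)
  have "((\<lambda>x. h (x + u) - h x) \<longlongrightarrow> 0) at_top" for u
  proof -
    have "((\<lambda>x. l (exp u * x) / l x) \<longlongrightarrow> 1) at_top" using l(1) by (simp add: slowly_varying_at_top_def)
    from filterlim_compose[OF this exp_at_top]
    have "((\<lambda>x. ln (l (exp u * exp x) / l (exp x))) \<longlongrightarrow> ln 1) at_top" by (rule tendsto_ln) simp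
    moreover have "ln (l (exp u * exp x) / l (exp x)) = h (x + u) - h x" for x
      using l(2)[of "exp x"] l(2)[of "exp (x + u)"] by (simp add: h_def ln_div exp_add mult.commute)
    ultimately show ?thesis by simp
  qed
  from uniform_convergence_shifts[OF hm this \<open>\<delta> > 0\<close>] obtain X0 where
    X0: "\<And>x u. x \<ge> X0 \<Longrightarrow> u \<in> {0..1} \<Longrightarrow> \<bar>h (x + u) - h x\<bar> < \<delta>" by blast
  show ?thesis
  proof
    show "exp X0 > 0" "exp \<delta> > 0" by simp_all
    fix x y assume xy: "x \<ge> exp X0" "y \<ge> exp X0"
    then have pos: "x > 0" "y > 0" using exp_gt_zero[of X0] by linarith+
    have lg: "ln x \<ge> X0" "ln y \<ge> X0" using xy pos by (simp_all add: ln_ge_iff)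
    have "\<bar>h (ln y) - h (ln x)\<bar> \<le> \<delta> * (\<bar>ln y - ln x\<bar> + 1)"
    proof (cases "ln y \<ge> ln x")
      case True
      then show ?thesis using shift_growth[OF X0 lg(1), of "ln y - ln x"] by simp
    next
      case False
      then show ?thesis using shift_growth[OF X0 lg(2), of "ln x - ln y"] by simp
    qed
    then have "ln (l y / l x) \<le> \<delta> + \<delta> * \<bar>ln (y / x)\<bar>"
      using pos l(2)[of x] l(2)[of y] by (simp add: h_def ln_div algebra_simps)
    then have "l y / l x \<le> exp (\<delta> + \<delta> * \<bar>ln (y / x)\<bar>)"
      using pos l(2)[of x] l(2)[of y] exp_ln[of "l y / l x"] by (metis divide_pos_pos exp_le_cancel_iff)
    also have "\<dots> = exp \<delta> * exp (\<delta> * \<bar>ln (y / x)\<bar>)" by (simp add: exp_add)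
    also have "exp (\<delta> * \<bar>ln (y / x)\<bar>) \<le> max ((y / x) powr \<delta>) ((y / x) powr (- \<delta>))"
      using pos by (cases "ln (y / x) \<ge> 0") (auto simp: powr_def)
    finally show "l y / l x \<le> exp \<delta> * max ((y / x) powr \<delta>) ((y / x) powr (- \<delta>))" by simp
  qed
qed

section \<open>Gamma integrals with complex scale\<close>

lemma norm_exp_minus_one_le:
  fixes w :: complex assumes "Re w \<le> 0" shows "norm (exp w - 1) \<le> norm w"
proof -
  have "norm (exp w - exp 0) \<le> 1 * norm (w - 0)"
  proof (rule field_differentiable_bound[of "{z. Re z \<le> 0}" exp exp])
    show "convex {z. Re z \<le> 0}" by (rule convex_halfspace_Re_le)
    show "(exp has_field_derivative exp z) (at z within {z. Re z \<le> 0})" for z :: complex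
      by (rule DERIV_subset[OF DERIV_exp]) simp
    show "norm (exp z) \<le> 1" if "z \<in> {z. Re z \<le> 0}" for z using that by simp
  qed (use assms in auto)
  then show ?thesis by simp
qed

lemma nn_integral_powr_from_0:
  assumes "a > -1" "c \<ge> 0"
  shows "(\<integral>\<^sup>+x. ennreal (indicator {0..c} x * x powr a) \<partial>lborel) = ennreal (c powr (a + 1) / (a + 1))"
  using nn_integral_has_integral_lebesgue[OF _ has_integral_powr_from_0[OF assms]] by simp

lemma nn_integral_powr_to_inf:
  assumes "e < -1" "a > 0"
  shows "(\<integral>\<^sup>+x. ennreal (indicator {a..} x * x powr e) \<partial>lborel) = ennreal (- (a powr (e + 1)) / (e + 1))"
  using nn_integral_has_integral_lebesgue[OF _ has_integral_powr_to_inf[OF assms]] by simp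

lemma integrable_min_powr:
  assumes "a > -2" "a < -1"
  shows "integrable lborel (\<lambda>y::real. indicator {0<..} y * (min 1 y * y powr a))"
proof (rule integrableI_bounded)
  have "(\<integral>\<^sup>+y. ennreal (norm (indicator {0<..} y * (min 1 y * y powr a) :: real)) \<partial>lborel)
     \<le> (\<integral>\<^sup>+y. ennreal (indicator {0..1} y * y powr (a + 1)) + ennreal (indicator {1..} y * y powr a) \<partial>lborel)"
  proof (intro nn_integral_mono)
    fix y :: real
    show "ennreal (norm (indicator {0<..} y * (min 1 y * y powr a) :: real)) \<le> ennreal (indicator {0..1} y * y powr (a + 1)) + ennreal (indicator {1..} y * y powr a)"
      by (cases "y > 0"; cases "y \<le> 1") (auto simp: powr_add indicator_def ennreal_plus[symmetric] mult.commute simp del: ennreal_plus intro!: ennreal_leI)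
  qed
  also have "\<dots> = ennreal (1 powr (a + 1 + 1) / (a + 1 + 1)) + ennreal (- (1 powr (a + 1)) / (a + 1))"
    using assms by (subst nn_integral_add) (simp_all add: nn_integral_powr_from_0 nn_integral_powr_to_inf)
  also have "\<dots> < \<infinity>" by simp
  finally show "(\<integral>\<^sup>+y. ennreal (norm (indicator {0<..} y * (min 1 y * y powr a) :: real)) \<partial>lborel) < \<infinity>" .
qed measurable

lemma scaled_Gamma_integral_real:
  fixes b N :: real
  assumes "b > 0" "N > 0"
  shows "has_bochner_integral lborel (\<lambda>t. indicator {0<..} t * (t powr (b - 1) * exp (- N * t))) (Gamma b * N powr (- b))"
proof -
  have "has_bochner_integral lborel (\<lambda>t. indicator {0..} t * t powr (b - 1) / exp t) (Gamma b)"
  proof (rule has_bochner_integral_nn_integral)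
    show "(\<integral>\<^sup>+ x. ennreal (indicator {0..} x * x powr (b - 1) / exp x) \<partial>lborel) = ennreal (Gamma b)"
      using Gamma_conv_nn_integral_real[OF assms(1)] by simp
    show "0 \<le> Gamma b" using Gamma_real_pos[OF assms(1)] by simp
  qed (auto simp: indicator_def)
  then have "has_bochner_integral lborel (\<lambda>t. indicator {0..} (0 + N * t) * (0 + N * t) powr (b - 1) / exp (0 + N * t)) (Gamma b /\<^sub>R \<bar>N\<bar>)"
    using assms by (subst (asm) lborel_has_bochner_integral_real_affine_iff[of N _ _ 0]) auto
  then have "has_bochner_integral lborel (\<lambda>t. N powr (1 - b) * (indicator {0..} (0 + N * t) * (0 + N * t) powr (b - 1) / exp (0 + N * t)))
     (N powr (1 - b) * (Gamma b /\<^sub>R \<bar>N\<bar>))"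
    by (intro has_bochner_integral_mult_right) auto
  also have "(\<lambda>t. N powr (1 - b) * (indicator {0..} (0 + N * t) * (0 + N * t) powr (b - 1) / exp (0 + N * t)))
      = (\<lambda>t. indicator {0<..} t * (t powr (b - 1) * exp (- N * t)))"
  proof
    fix t
    show "N powr (1 - b) * (indicator {0..} (0 + N * t) * (0 + N * t) powr (b - 1) / exp (0 + N * t))
      = indicator {0<..} t * (t powr (b - 1) * exp (- N * t))"
    proof (cases "t > 0")
      case True
      have "N powr (1 - b) * (N * t) powr (b - 1) = t powr (b - 1)"
        using True assms by (simp add: powr_mult flip: mult.assoc powr_add)
      then show ?thesis using True assms by (simp add: exp_minus field_simps)
    next
      case False
      then have "N * t < 0 \<or> t = 0" using assms by (simp add: mult_less_0_iff not_less le_less)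
      then show ?thesis using False by (auto simp: indicator_def)
    qed
  qed
  also have "N powr (1 - b) * (Gamma b /\<^sub>R \<bar>N\<bar>) = Gamma b * N powr (- b)"
    using assms by (simp add: powr_diff powr_minus field_simps)
  finally show ?thesis .
qed

text \<open>
  Complex scale parameters are reached by a power series. Expand \<open>e\<^sup>-\<^sup>z\<^sup>t = e\<^sup>-\<^sup>N\<^sup>t e\<^sup>-\<^sup>w\<^sup>N\<^sup>t\<close> with \<open>w = z/N - 1\<close> in powers of \<open>w\<close>;
  the real Gamma integrals of the terms add up to the binomial series of \<open>(1 + w)\<^sup>-\<^sup>a\<close>.
\<close>

lemma scaled_Gamma_integral_complex:
  fixes z :: complex
  assumes "a > 0" "Re z > 0"
  shows "has_bochner_integral lborel (\<lambda>t. indicator {0<..} t *\<^sub>R (of_real (t powr (a - 1)) * exp (- z * of_real t)))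
     (of_real (Gamma a) * z powr (- of_real a))"
proof -
  \<comment> \<open>This real \<open>N\<close> gives \<open>|z - N| < N\<close>, so that the binomial series converges.\<close>
  define N where "N = (norm z)\<^sup>2 / Re z"
  have z0: "z \<noteq> 0" using assms by auto
  have N: "N > 0" using assms z0 by (simp add: N_def)
  define w where "w = z / of_real N - 1"
  have w1: "norm w < 1"
  proof -
    have "(norm (z - of_real N))\<^sup>2 = (norm z)\<^sup>2 - 2 * N * Re z + N\<^sup>2"
      unfolding cmod_power2 by (simp add: power2_eq_square algebra_simps)
    also have "2 * N * Re z = 2 * (norm z)\<^sup>2" using assms by (simp add: N_def)
    finally have "(norm (z - of_real N))\<^sup>2 < N\<^sup>2" using z0 by simp
    then have "norm (z - of_real N) < N" using N by (simp add: power2_less_imp_less)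
    moreover have "w = (z - of_real N) / of_real N" using N by (simp add: w_def field_simps)
    ultimately show ?thesis using N by (simp add: norm_divide)
  qed
  let ?f = "\<lambda>n t. indicator {0<..} t *\<^sub>R (of_real (t powr (a - 1) * exp (- N * t)) * ((- w * of_real (N * t)) ^ n / fact n)) :: complex"
  have tpow: "t powr (a + real n - 1) = t powr (a - 1) * t ^ n" if "t > 0" for t :: real and n
    using that by (simp add: powr_add powr_realpow algebra_simps powr_diff)
  have fn: "?f n = (\<lambda>t. ((- w * of_real N) ^ n / fact n) * of_real (indicator {0<..} t * (t powr (a + real n - 1) * exp (- N * t))))" for n
  proof
    fix t show "?f n t = ((- w * of_real N) ^ n / fact n) * of_real (indicator {0<..} t * (t powr (a + real n - 1) * exp (- N * t)))"
    proof (cases "t > 0")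
      case True
      have "(- w * of_real (N * t)) ^ n = (- w * of_real N) ^ n * of_real t ^ n"
        unfolding of_real_mult mult.assoc[symmetric] by (rule power_mult_distrib)
      then show ?thesis using True by (simp add: tpow del: mult_minus_left)
    qed simp
  qed
  have coef: "Gamma (a + real n) * N powr (- (a + real n)) * N ^ n / fact n = Gamma a * N powr (- a) * (pochhammer a n / fact n)" for n
  proof -
    have "Gamma (a + real n) = Gamma a * pochhammer a n"
    proof -
      have "a \<notin> \<int>\<^sub>\<le>\<^sub>0" using assms by (auto elim: nonpos_Ints_cases)
      moreover have "Gamma a > 0" using assms by (intro Gamma_real_pos)
      ultimately show ?thesis using pochhammer_Gamma[of a n] by simp
    qed
    moreover have "N powr (- (a + real n)) * N ^ n = N powr (- a)"
      using N by (simp flip: powr_realpow powr_add)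
    ultimately show ?thesis by (simp add: field_simps)
  qed
  have bi: "has_bochner_integral lborel (?f n) (((- w * of_real N) ^ n / fact n) * of_real (Gamma (a + real n) * N powr (- (a + real n))))" for n
    unfolding fn using scaled_Gamma_integral_real[of "a + real n" N] assms N
    by (intro has_bochner_integral_mult_right has_bochner_integral_of_real) auto
  have val: "integral\<^sup>L lborel (?f n) = of_real (Gamma a * N powr (- a)) * ((- of_real a gchoose n) * w ^ n)" for n
  proof -
    have "integral\<^sup>L lborel (?f n) = (- w) ^ n * of_real (Gamma (a + real n) * N powr (- (a + real n)) * N ^ n / fact n)"
      using has_bochner_integral_integral_eq[OF bi[of n]] unfolding power_mult_distrib[of "- w" "of_real N"] by simp
    also have "\<dots> = of_real (Gamma a * N powr (- a)) * ((- w) ^ n * (pochhammer (of_real a) n / fact n))"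
      unfolding coef by (simp add: pochhammer_of_real)
    also have "(- w) ^ n * (pochhammer (of_real a) n / fact n) = (- of_real a gchoose n) * w ^ n"
      by (subst power_minus) (simp add: gbinomial_pochhammer)
    finally show ?thesis .
  qed
  have nval: "(\<integral>t. norm (?f n t) \<partial>lborel) = Gamma a * N powr (- a) * norm (((- of_real a :: complex) gchoose n) * (- of_real (norm w)) ^ n)" for n
  proof -
    have "(\<integral>t. norm (?f n t) \<partial>lborel) = (norm w ^ n * N ^ n / fact n) * (\<integral>t. (indicator {0<..} t * (t powr (a + real n - 1) * exp (- N * t))) \<partial>lborel)"
    proof -
      have "norm (?f n t) = (norm w ^ n * N ^ n / fact n) * (indicator {0<..} t * (t powr (a + real n - 1) * exp (- N * t)))" for t
        unfolding fun_cong[OF fn[of n], of t] using N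
        by (simp only: norm_mult norm_power norm_divide norm_of_real norm_minus_cancel norm_fact abs_mult power_mult_distrib) simp
      then show ?thesis by simp
    qed
    also have "\<dots> = norm w ^ n * (Gamma (a + real n) * N powr (- (a + real n)) * N ^ n / fact n)"
      using has_bochner_integral_integral_eq[OF scaled_Gamma_integral_real[of "a + real n" N]] assms N by simp
    also have "\<dots> = Gamma a * N powr (- a) * (norm w ^ n * (pochhammer a n / fact n))"
      unfolding coef by simp
    also have "norm w ^ n * (pochhammer a n / fact n) = norm (((- of_real a :: complex) gchoose n) * (- of_real (norm w)) ^ n)"
    proof -
      have "(- of_real a :: complex) gchoose n = of_real ((- 1) ^ n * pochhammer a n / fact n)"
        by (simp add: gbinomial_pochhammer pochhammer_of_real)
      moreover have "pochhammer a n > 0" using assms by (simp add: pochhammer_pos)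
      ultimately show ?thesis by (simp add: norm_mult norm_power norm_divide abs_mult pochhammer_of_real)
    qed
    finally show ?thesis .
  qed
  have sm: "summable (\<lambda>n. norm (((- of_real a :: complex) gchoose n) * (- of_real (norm w)) ^ n))"
  proof -
    define r where "r = (norm w + 1) / 2"
    have r: "norm w < r" "r < 1" "r \<ge> 0" using w1 by (auto simp: r_def field_simps)
    have "(\<lambda>n. ((- of_real a :: complex) gchoose n) * of_real r ^ n) sums (1 + of_real r) powr (- of_real a)"
      using r by (intro gen_binomial_complex) auto
    then have "summable (\<lambda>n. ((- of_real a :: complex) gchoose n) * of_real r ^ n)" by (rule sums_summable)
    then show ?thesis by (rule powser_insidea) (use r in auto)
  qed
  have sumf: "(\<lambda>n. ?f n t) sums (indicator {0<..} t *\<^sub>R (of_real (t powr (a - 1)) * exp (- z * of_real t)))" for t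
  proof -
    have "(\<lambda>n. (- w * of_real (N * t)) ^ n /\<^sub>R fact n) sums exp (- w * of_real (N * t))"
      by (rule exp_converges)
    then have "(\<lambda>n. of_real (t powr (a - 1) * exp (- N * t)) * ((- w * of_real (N * t)) ^ n / fact n)) sums (of_real (t powr (a - 1) * exp (- N * t)) * exp (- w * of_real (N * t)))"
      by (intro sums_mult) (simp add: scaleR_conv_of_real field_simps)
    also have "of_real (t powr (a - 1) * exp (- N * t)) * exp (- w * of_real (N * t)) = of_real (t powr (a - 1)) * exp (- z * of_real t)"
    proof -
      have "of_real (exp (- N * t)) * exp (- w * of_real (N * t)) = exp (- z * of_real t)"
        using N unfolding w_def by (simp flip: exp_of_real exp_add) (simp add: field_simps)
      then show ?thesis by (simp add: mult.assoc)
    qed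
    finally show ?thesis by (intro sums_scaleR_right)
  qed
  have int: "integrable lborel (?f n)" for n using bi by (auto simp: has_bochner_integral_iff)
  have AEs: "AE t in lborel. summable (\<lambda>n. norm (?f n t))"
  proof (rule AE_I2)
    fix t :: real
    have "summable (\<lambda>n. norm (- w * of_real (N * t)) ^ n /\<^sub>R fact n)" by (rule summable_exp_generic)
    then have "summable (\<lambda>n. \<bar>indicator {0<..} t * (t powr (a - 1) * exp (- N * t))\<bar> * (norm (- w * of_real (N * t)) ^ n /\<^sub>R fact n))"
      by (rule summable_mult)
    then show "summable (\<lambda>n. norm (?f n t))"
      by (simp add: norm_mult norm_power norm_divide abs_mult field_simps)
  qed
  have sI: "summable (\<lambda>n. \<integral>t. norm (?f n t) \<partial>lborel)"
    unfolding nval by (rule summable_mult[OF sm])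
  have eq: "(\<lambda>t. \<Sum>n. ?f n t) = (\<lambda>t. indicator {0<..} t *\<^sub>R (of_real (t powr (a - 1)) * exp (- z * of_real t)))"
    using sumf by (simp add: sums_iff fun_eq_iff)
  have "(\<lambda>n. integral\<^sup>L lborel (?f n)) sums (\<integral>t. (\<Sum>n. ?f n t) \<partial>lborel)"
    by (rule sums_integral[OF int AEs sI])
  moreover have "(\<lambda>n. integral\<^sup>L lborel (?f n)) sums (of_real (Gamma a * N powr (- a)) * (1 + w) powr (- of_real a))"
    unfolding val by (intro sums_mult gen_binomial_complex w1)
  ultimately have "(\<integral>t. (\<Sum>n. ?f n t) \<partial>lborel) = of_real (Gamma a * N powr (- a)) * (1 + w) powr (- of_real a)"
    by (rule sums_unique2)
  also have "\<dots> = of_real (Gamma a) * z powr (- of_real a)"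
  proof -
    have "of_real (N powr (- a)) * (1 + w) powr (- of_real a) = (of_real N * (1 + w)) powr (- of_real a)"
      using N powr_of_real[of N "- a"] by (subst powr_times_real_left) auto
    also have "of_real N * (1 + w) = z" using N by (simp add: w_def)
    finally show ?thesis by simp
  qed
  finally show ?thesis
    unfolding has_bochner_integral_iff using integrable_suminf[OF int AEs sI] unfolding eq by simp
qed

text \<open>
  The value of the one-sided cumulant \<open>\<integral>\<^sub>0\<^sup>\<infinity> (e\<^sup>i\<^sup>x - 1 - ix) \<beta> x\<^sup>-\<^sup>\<beta>\<^sup>-\<^sup>1 dx\<close> of a totally asymmetric stable law.
\<close>

definition stable_const :: "real \<Rightarrow> complex" where
  "stable_const \<beta> = - of_real (Gamma (2 - \<beta>) / (1 - \<beta>)) * (of_real (cos (pi * \<beta> / 2)) - \<i> * of_real (sin (pi * \<beta> / 2)))"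

lemma norm_cexp_minus_one_bound:
  fixes z :: complex
  assumes "Re z \<ge> 0" "y \<ge> 0"
  shows "norm (exp (- z * of_real y) - 1) \<le> (2 + norm z) * min 1 y"
proof -
  have "norm (exp (- z * of_real y) - 1) \<le> norm (- z * of_real y)"
    using assms by (intro norm_exp_minus_one_le) simp
  also have "\<dots> = norm z * y" using assms by (simp add: norm_mult)
  finally have 1: "norm (exp (- z * of_real y) - 1) \<le> norm z * y" .
  have "norm (exp (- z * of_real y) - 1) \<le> norm (exp (- z * of_real y)) + norm (1::complex)"
    by (rule norm_triangle_ineq4)
  also have "\<dots> \<le> 2" using assms by simp
  finally have 2: "norm (exp (- z * of_real y) - 1) \<le> 2" .
  show ?thesis
  proof (cases "y \<le> 1")
    case True
    have "norm z * y \<le> (2 + norm z) * y" using assms by (intro mult_right_mono) auto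
    then show ?thesis using 1 True by simp
  next
    case False
    then show ?thesis using 2 by (smt (verit) mult_cancel_left2 norm_ge_zero min_def)
  qed
qed

text \<open>
  Integration by parts against \<open>y\<^sup>1\<^sup>-\<^sup>\<beta> / (1 - \<beta>)\<close> reduces this to a Gamma integral with exponent \<open>2 - \<beta>\<close>.
\<close>

lemma laplace_exp_minus_one:
  fixes z :: complex
  assumes \<beta>: "1 < \<beta>" "\<beta> < 2" and z: "Re z > 0"
  shows "(\<integral>y. indicator {0<..} y *\<^sub>R ((exp (- z * of_real y) - 1) * of_real (y powr (- \<beta>))) \<partial>lborel)
     = of_real (Gamma (2 - \<beta>) / (1 - \<beta>)) * z powr (of_real (\<beta> - 1))"
proof -
  let ?F = "\<lambda>y. of_real (y powr (1 - \<beta>) / (1 - \<beta>)) * (exp (- z * of_real y) - 1)"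
  let ?g = "\<lambda>y::real. (exp (- z * of_real y) - 1) * of_real (y powr (- \<beta>))"
  let ?h = "\<lambda>y::real. of_real (y powr (1 - \<beta>)) * exp (- z * of_real y)"
  let ?f = "\<lambda>y. ?g y - (z / of_real (1 - \<beta>)) * ?h y"
  have z0: "z \<noteq> 0" using z by auto
  have nb: "norm (1 - complex_of_real \<beta>) = \<beta> - 1" using \<beta> norm_of_real[of "1 - \<beta>", where 'a=complex] by simp
  have h: "has_bochner_integral lborel (\<lambda>y. indicator {0<..} y *\<^sub>R ?h y) (of_real (Gamma (2 - \<beta>)) * z powr (- of_real (2 - \<beta>)))"
    using scaled_Gamma_integral_complex[of "2 - \<beta>" z] \<beta> z by simp
  have g: "integrable lborel (\<lambda>y. indicator {0<..} y *\<^sub>R ?g y)"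
  proof (rule Bochner_Integration.integrable_bound)
    show "integrable lborel (\<lambda>y. (2 + norm z) * (indicator {0<..} y * (min 1 y * y powr (- \<beta>))))"
      using \<beta> by (intro integrable_mult_right integrable_min_powr) auto
    show "AE y in lborel. norm (indicator {0<..} y *\<^sub>R ?g y) \<le> norm ((2 + norm z) * (indicator {0<..} y * (min 1 y * y powr (- \<beta>))))"
    proof (rule AE_I2)
      fix y :: real
      show "norm (indicator {0<..} y *\<^sub>R ?g y) \<le> norm ((2 + norm z) * (indicator {0<..} y * (min 1 y * y powr (- \<beta>))))"
      proof (cases "y > 0")
        case True
        then have "norm (exp (- z * of_real y) - 1) * y powr (- \<beta>) \<le> (2 + norm z) * min 1 y * y powr (- \<beta>)"
          using z by (intro mult_right_mono norm_cexp_minus_one_bound) auto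
        then show ?thesis using True by (simp add: norm_mult abs_mult mult.assoc)
      qed simp
    qed
  qed measurable
  have fi: "set_integrable lborel (einterval 0 \<infinity>) ?f"
  proof -
    have "integrable lborel (\<lambda>y. indicator {0<..} y *\<^sub>R ?g y - (z / of_real (1 - \<beta>)) * (indicator {0<..} y *\<^sub>R ?h y))"
      using g h by (intro Bochner_Integration.integrable_diff integrable_mult_right) (auto simp: has_bochner_integral_iff)
    also have "(\<lambda>y. indicator {0<..} y *\<^sub>R ?g y - (z / of_real (1 - \<beta>)) * (indicator {0<..} y *\<^sub>R ?h y)) = (\<lambda>y. indicator {0<..} y *\<^sub>R ?f y)"
      by (auto simp: fun_eq_iff indicator_def)
    also have "{0<..} = einterval 0 \<infinity>" by (auto simp: einterval_def zero_ereal_def)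
    finally show ?thesis unfolding set_integrable_def .
  qed
  have lim0: "(?F \<longlongrightarrow> 0) (at_right 0)"
  proof (rule Lim_null_comparison)
    show "eventually (\<lambda>y. norm (?F y) \<le> norm z / (\<beta> - 1) * y powr (2 - \<beta>)) (at_right 0)"
      unfolding eventually_at_right_field
    proof (intro exI[of _ 1] conjI allI impI)
      fix y :: real assume y: "y > 0" "y < 1"
      have "norm (?F y) = y powr (1 - \<beta>) / (\<beta> - 1) * norm (exp (- z * of_real y) - 1)"
        using \<beta> y by (simp add: norm_mult norm_divide nb)
      also have "\<dots> \<le> y powr (1 - \<beta>) / (\<beta> - 1) * norm (- z * of_real y)"
        using \<beta> y z by (intro mult_left_mono norm_exp_minus_one_le) auto
      also have "\<dots> = norm z / (\<beta> - 1) * (y powr (1 - \<beta>) * y)"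
        using y by (simp add: norm_mult)
      also have "y powr (1 - \<beta>) * y = y powr (2 - \<beta>)"
        using y by (simp add: powr_mult_base mult.commute)
      finally show "norm (?F y) \<le> norm z / (\<beta> - 1) * y powr (2 - \<beta>)" .
    qed simp
    have "((\<lambda>y. norm z / (\<beta> - 1) * y powr (2 - \<beta>)) \<longlongrightarrow> norm z / (\<beta> - 1) * 0 powr (2 - \<beta>)) (at_right 0)"
      using \<beta> by (intro tendsto_intros tendsto_powr') (auto simp: eventually_at_filter intro!: tendsto_ident_at)
    then show "((\<lambda>y. norm z / (\<beta> - 1) * y powr (2 - \<beta>)) \<longlongrightarrow> 0) (at_right 0)" by simp
  qed
  have liminf: "(?F \<longlongrightarrow> 0) at_top"
  proof (rule Lim_null_comparison)
    show "eventually (\<lambda>y. norm (?F y) \<le> 2 / (\<beta> - 1) * y powr (1 - \<beta>)) at_top"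
      using eventually_gt_at_top[of 0]
    proof eventually_elim
      fix y :: real assume y: "y > 0"
      have "norm (exp (- z * of_real y) - 1) \<le> norm (exp (- z * of_real y)) + norm (1::complex)"
        by (rule norm_triangle_ineq4)
      also have "\<dots> \<le> 2" using z y by simp
      finally have "y powr (1 - \<beta>) / (\<beta> - 1) * norm (exp (- z * of_real y) - 1) \<le> y powr (1 - \<beta>) / (\<beta> - 1) * 2"
        using \<beta> by (intro mult_left_mono) auto
      moreover have "norm (?F y) = y powr (1 - \<beta>) / (\<beta> - 1) * norm (exp (- z * of_real y) - 1)"
        using \<beta> y by (simp add: norm_mult norm_divide nb)
      ultimately show "norm (?F y) \<le> 2 / (\<beta> - 1) * y powr (1 - \<beta>)" by (simp add: mult.commute)
    qed
    have "((\<lambda>y. y powr (1 - \<beta>)) \<longlongrightarrow> 0) at_top"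
      using \<beta> by (intro tendsto_neg_powr filterlim_ident) auto
    then show "((\<lambda>y. 2 / (\<beta> - 1) * y powr (1 - \<beta>)) \<longlongrightarrow> 0) at_top" by (rule tendsto_mult_right_zero)
  qed
  have "(LBINT y=0..\<infinity>. ?f y) = 0 - 0"
  proof (rule interval_integral_FTC_integrable[where F = ?F and f = ?f and a = 0 and b = \<infinity> and A = 0 and B = 0])
    fix y :: real assume "0 < ereal y"
    then have y: "y > 0" by simp
    have d: "((\<lambda>y. of_real (y powr (1 - \<beta>) / (1 - \<beta>))) has_vector_derivative (of_real (y powr (- \<beta>)) :: complex)) (at y)"
    proof (rule has_vector_derivative_of_real)
      have "((\<lambda>y. y powr (1 - \<beta>) / (1 - \<beta>)) has_real_derivative (1 - \<beta>) * y powr (1 - \<beta> - 1) / (1 - \<beta>)) (at y)"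
        by (rule DERIV_cdivide[OF has_real_derivative_powr[OF y]])
      then show "((\<lambda>y. y powr (1 - \<beta>) / (1 - \<beta>)) has_real_derivative y powr (- \<beta>)) (at y)"
        using \<beta> by simp
    qed
    have e: "((\<lambda>y. exp (- z * of_real y) - 1) has_vector_derivative (- z * exp (- z * of_real y))) (at y)"
    proof -
      have "((\<lambda>w. exp (- z * w) - 1) has_field_derivative (- z * exp (- z * of_real y))) (at (of_real y))"
        by (auto intro!: derivative_eq_intros)
      from has_vector_derivative_real_field[OF this] show ?thesis by simp
    qed
    have "(?F has_vector_derivative (of_real (y powr (1 - \<beta>) / (1 - \<beta>)) * (- z * exp (- z * of_real y)) + of_real (y powr (- \<beta>)) * (exp (- z * of_real y) - 1))) (at y)"
      by (rule has_vector_derivative_mult[OF d e])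
    moreover have "of_real (y powr (1 - \<beta>) / (1 - \<beta>)) * (- z * exp (- z * of_real y)) + of_real (y powr (- \<beta>)) * (exp (- z * of_real y) - 1) = ?f y"
      by (simp add: field_simps)
    ultimately show "(?F has_vector_derivative ?f y) (at y)" by (simp only:)
    show "isCont ?f y" using y by (intro continuous_intros) auto
  next
    show "((?F \<circ> real_of_ereal) \<longlongrightarrow> 0) (at_right 0)"
      using lim0 by (simp add: zero_ereal_def ereal_tendsto_simps)
    show "((?F \<circ> real_of_ereal) \<longlongrightarrow> 0) (at_left \<infinity>)"
      using liminf by (simp add: ereal_tendsto_simps)
  qed (use fi in auto)
  then have "(\<integral>y. indicator {0<..} y *\<^sub>R ?f y \<partial>lborel) = 0"
    by (simp add: interval_lebesgue_integral_def set_lebesgue_integral_def einterval_def zero_ereal_def greaterThan_def)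
  moreover have "(\<integral>y. indicator {0<..} y *\<^sub>R ?f y \<partial>lborel) = (\<integral>y. indicator {0<..} y *\<^sub>R ?g y - (z / of_real (1 - \<beta>)) * (indicator {0<..} y *\<^sub>R ?h y) \<partial>lborel)"
    by (intro Bochner_Integration.integral_cong) (auto simp: indicator_def)
  moreover have "\<dots> = (\<integral>y. indicator {0<..} y *\<^sub>R ?g y \<partial>lborel) - (z / of_real (1 - \<beta>)) * (of_real (Gamma (2 - \<beta>)) * z powr (- of_real (2 - \<beta>)))"
    by (rule has_bochner_integral_integral_eq[OF has_bochner_integral_diff[OF has_bochner_integral_integrable[OF g] has_bochner_integral_mult_right[OF h]]])
  ultimately have "(\<integral>y. indicator {0<..} y *\<^sub>R ?g y \<partial>lborel) = (z / of_real (1 - \<beta>)) * (of_real (Gamma (2 - \<beta>)) * z powr (- of_real (2 - \<beta>)))"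
    by (metis (no_types, lifting) eq_iff_diff_eq_0)
  also have "\<dots> = of_real (Gamma (2 - \<beta>)) / of_real (1 - \<beta>) * (z * z powr (- of_real (2 - \<beta>)))"
    by simp
  also have "z * z powr (- of_real (2 - \<beta>)) = z powr (of_real (\<beta> - 1))"
    using z0 powr_add[of z 1 "- of_real (2 - \<beta>)"] by simp
  finally show ?thesis by simp
qed

text \<open>
  Let \<open>z\<close> tend to \<open>-i\<close> from the right half-plane in \<open>laplace_exp_minus_one\<close>.
\<close>

lemma oscillatory_integral:
  assumes \<beta>: "1 < \<beta>" "\<beta> < 2"
  shows "(\<integral>y. indicator {0<..} y *\<^sub>R (\<i> * (exp (\<i> * of_real y) - 1) * of_real (y powr (- \<beta>))) \<partial>lborel) = stable_const \<beta>"
proof -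
  let ?z = "\<lambda>n. of_real (inverse (real (Suc n))) - \<i>"
  let ?s = "\<lambda>n y. indicator {0<..} y *\<^sub>R ((exp (- ?z n * of_real y) - 1) * of_real (y powr (- \<beta>)))"
  have z: "Re (?z n) > 0" "norm (?z n) \<le> 2" for n
  proof -
    have "norm (?z n) \<le> norm (of_real (inverse (real (Suc n))) :: complex) + norm \<i>" by (rule norm_triangle_ineq4)
    also have "\<dots> \<le> 2" unfolding norm_of_real by (simp add: inverse_le_1_iff)
    finally show "norm (?z n) \<le> 2" .
  qed simp
  have zlim: "?z \<longlonglongrightarrow> - \<i>"
  proof -
    have "?z \<longlonglongrightarrow> of_real 0 - \<i>"
      by (intro tendsto_diff tendsto_of_real tendsto_const LIMSEQ_inverse_real_of_nat)
    then show ?thesis by simp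
  qed
  have "(\<lambda>n. integral\<^sup>L lborel (?s n)) \<longlonglongrightarrow> (\<integral>y. indicator {0<..} y *\<^sub>R ((exp (- (- \<i>) * of_real y) - 1) * of_real (y powr (- \<beta>))) \<partial>lborel)"
  proof (rule integral_dominated_convergence)
    show "integrable lborel (\<lambda>y. 4 * (indicator {0<..} y * (min 1 y * y powr (- \<beta>))))"
      using \<beta> by (intro integrable_mult_right integrable_min_powr) auto
    show "AE y in lborel. (\<lambda>n. ?s n y) \<longlonglongrightarrow> indicator {0<..} y *\<^sub>R ((exp (- (- \<i>) * of_real y) - 1) * of_real (y powr (- \<beta>)))"
      by (intro AE_I2 tendsto_intros zlim)
    show "AE y in lborel. norm (?s n y) \<le> 4 * (indicator {0<..} y * (min 1 y * y powr (- \<beta>)))" for n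
    proof (rule AE_I2)
      fix y :: real
      show "norm (?s n y) \<le> 4 * (indicator {0<..} y * (min 1 y * y powr (- \<beta>)))"
      proof (cases "y > 0")
        case True
        have "norm (exp (- ?z n * of_real y) - 1) \<le> (2 + norm (?z n)) * min 1 y"
          using True z(1)[of n] by (intro norm_cexp_minus_one_bound) auto
        also have "\<dots> \<le> 4 * min 1 y" using z(2)[of n] True by (intro mult_right_mono) auto
        finally have "norm (exp (- ?z n * of_real y) - 1) * y powr (- \<beta>) \<le> 4 * min 1 y * y powr (- \<beta>)"
          by (rule mult_right_mono) simp
        then show ?thesis using True by (simp add: norm_mult mult.assoc)
      qed simp
    qed
  qed measurable
  moreover have "(\<lambda>n. integral\<^sup>L lborel (?s n)) \<longlonglongrightarrow> of_real (Gamma (2 - \<beta>) / (1 - \<beta>)) * (- \<i>) powr (of_real (\<beta> - 1))"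
  proof -
    have "(\<lambda>n. of_real (Gamma (2 - \<beta>) / (1 - \<beta>)) * ?z n powr (of_real (\<beta> - 1))) \<longlonglongrightarrow> of_real (Gamma (2 - \<beta>) / (1 - \<beta>)) * (- \<i>) powr (of_real (\<beta> - 1))"
      by (intro tendsto_intros tendsto_powr_complex zlim) (auto simp: complex_nonpos_Reals_iff)
    moreover have "integral\<^sup>L lborel (?s n) = of_real (Gamma (2 - \<beta>) / (1 - \<beta>)) * ?z n powr (of_real (\<beta> - 1))" for n
      using laplace_exp_minus_one[OF \<beta> z(1)[of n]] .
    ultimately show ?thesis by (simp only:)
  qed
  ultimately have J: "(\<integral>y. indicator {0<..} y *\<^sub>R ((exp (- (- \<i>) * of_real y) - 1) * of_real (y powr (- \<beta>))) \<partial>lborel)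
      = of_real (Gamma (2 - \<beta>) / (1 - \<beta>)) * (- \<i>) powr (of_real (\<beta> - 1))"
    by (rule LIMSEQ_unique)
  have "(\<integral>y. indicator {0<..} y *\<^sub>R (\<i> * (exp (\<i> * of_real y) - 1) * of_real (y powr (- \<beta>))) \<partial>lborel)
      = (\<integral>y. \<i> * (indicator {0<..} y *\<^sub>R ((exp (- (- \<i>) * of_real y) - 1) * of_real (y powr (- \<beta>)))) \<partial>lborel)"
    by (intro Bochner_Integration.integral_cong) (auto simp: indicator_def)
  also have "\<dots> = of_real (Gamma (2 - \<beta>) / (1 - \<beta>)) * (\<i> * (- \<i>) powr (of_real (\<beta> - 1)))"
    by (simp only: integral_mult_right_zero J) (simp only: mult_ac)
  also have "\<i> * (- \<i>) powr (of_real (\<beta> - 1)) = - (of_real (cos (pi * \<beta> / 2)) - \<i> * of_real (sin (pi * \<beta> / 2)))"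
  proof -
    have "(- \<i>) powr (of_real (\<beta> - 1)) = exp (\<i> * of_real (- (\<beta> - 1) * pi / 2))"
    proof -
      have "of_real (\<beta> - 1) * Ln (- \<i>) = \<i> * of_real (- (\<beta> - 1) * pi / 2)" by (simp add: field_simps)
      then show ?thesis by (simp only: powr_def) simp
    qed
    also have "\<dots> = cis (pi / 2 - pi * \<beta> / 2)"
      unfolding cis_conv_exp by (rule arg_cong[where f="\<lambda>x. exp (\<i> * of_real x)"]) (simp add: field_simps)
    also have "\<dots> = Complex (sin (pi * \<beta> / 2)) (cos (pi * \<beta> / 2))"
      by (simp add: cis.ctr cos_diff sin_diff)
    finally show ?thesis by (simp add: complex_eq_iff)
  qed
  finally show ?thesis by (simp only: stable_const_def mult_minus_left mult_minus_right)
qed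

section \<open>One-sided cumulants and tails of a Levy measure\<close>

definition pos_cumulant :: "real measure \<Rightarrow> real \<Rightarrow> complex" where
  "pos_cumulant W s = (\<integral>x. indicator {0<..} x *\<^sub>R (exp (\<i> * of_real (s * x)) - 1 - \<i> * of_real (s * x)) \<partial>W)"

lemma norm_iexp_minus_one_le: "norm (exp (\<i> * of_real u) - 1) \<le> \<bar>u\<bar>"
  using norm_exp_minus_one_le[of "\<i> * of_real u"] by (simp add: norm_mult)

lemma norm_iexp_minus_linear_le: "norm (exp (\<i> * of_real u) - 1 - \<i> * of_real u) \<le> u\<^sup>2"
proof -
  have "norm (exp (\<i> * of_real u) - (\<Sum>k \<le> 1. (\<i> * of_real u) ^ k / fact k)) \<le> \<bar>u\<bar> ^ Suc 1 / fact (Suc 1)"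
    by (rule iexp_approx1)
  also have "\<dots> \<le> u\<^sup>2" by (simp add: power2_eq_square)
  finally show ?thesis by (simp add: algebra_simps)
qed

locale levy_second_moment =
  fixes W :: "real measure"
  assumes levy: "Levy_measure W" and second_moment: "(\<integral>\<^sup>+x. ennreal (x\<^sup>2) \<partial>W) < \<infinity>"
begin

lemma sets_W[simp, measurable_cong]: "sets W = sets borel"
  using levy by (simp add: Levy_measure_def)

lemma space_W[simp]: "space W = UNIV"
  using sets_eq_imp_space_eq[OF sets_W] by simp

lemma integrable_square: "integrable W (\<lambda>x. x\<^sup>2)"
  using second_moment by (intro integrableI_bounded) (auto simp: borel_measurable_iff_ge)

text \<open>
  The second moment. It bounds both the cumulant near the origin and the tails at infinity.
\<close>

definition "V = (\<integral>x. x\<^sup>2 \<partial>W)"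

lemma integrable_away: assumes "v > 0" shows "integrable W (indicator {x. v \<le> \<bar>x\<bar>} :: real \<Rightarrow> real)"
proof (rule Bochner_Integration.integrable_bound)
  show "integrable W (\<lambda>x. x\<^sup>2 / v\<^sup>2)" using integrable_square by simp
  show "AE x in W. norm (indicator {x. v \<le> \<bar>x\<bar>} x :: real) \<le> norm (x\<^sup>2 / v\<^sup>2)"
  proof (rule AE_I2)
    fix x :: real
    have "v\<^sup>2 \<le> x\<^sup>2" if "v \<le> \<bar>x\<bar>" using that assms by (metis abs_le_square_iff abs_of_pos)
    then show "norm (indicator {x. v \<le> \<bar>x\<bar>} x :: real) \<le> norm (x\<^sup>2 / v\<^sup>2)"
      using assms by (auto simp: indicator_def field_simps)
  qed
qed measurable

lemma emeasure_away: assumes "v > 0" shows "emeasure W {x. v \<le> \<bar>x\<bar>} < \<infinity>"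
proof -
  have "{x. v \<le> \<bar>x\<bar>} \<in> sets W" by measurable
  then show ?thesis using integrable_away[OF assms] by (simp add: integrable_indicator_iff)
qed

lemma emeasure_tail: assumes "v > 0" shows "emeasure W {v..} < \<infinity>"
proof -
  have "emeasure W {v..} \<le> emeasure W {x. v \<le> \<bar>x\<bar>}" by (intro emeasure_mono) auto
  then show ?thesis using emeasure_away[OF assms] by simp
qed

lemma sigma_finite_W: "sigma_finite_measure W"
proof
  show "\<exists>A::real set set. countable A \<and> A \<subseteq> sets W \<and> \<Union> A = space W \<and> (\<forall>a\<in>A. emeasure W a \<noteq> \<infinity>)"
  proof (intro exI[of _ "insert {0} (range (\<lambda>n::nat. {x. inverse (real (Suc n)) \<le> \<bar>x\<bar>}))"] conjI ballI)
    show "\<Union> (insert {0} (range (\<lambda>n::nat. {x. inverse (real (Suc n)) \<le> \<bar>x\<bar>}))) = space W"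
    proof -
      have "\<exists>n. inverse (real (Suc n)) \<le> \<bar>x\<bar>" if "x \<noteq> 0" for x :: real
        using reals_Archimedean[of "\<bar>x\<bar>"] that by (auto intro: less_imp_le)
      then show ?thesis by auto
    qed
    show "emeasure W a \<noteq> \<infinity>" if "a \<in> insert {0} (range (\<lambda>n::nat. {x. inverse (real (Suc n)) \<le> \<bar>x\<bar>}))" for a
    proof -
      have "a = {0} \<or> (\<exists>n::nat. a = {x. inverse (real (Suc n)) \<le> \<bar>x\<bar>})" using that by blast
      then consider "a = {0}" | n :: nat where "a = {x. inverse (real (Suc n)) \<le> \<bar>x\<bar>}" by blast
      then show ?thesis
      proof cases
        case 1
        then show ?thesis using levy by (simp add: Levy_measure_def)
      next
        case (2 n)
        then show ?thesis using emeasure_away[of "inverse (real (Suc n))"] by (simp del: of_nat_Suc)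
      qed
    qed
  qed (auto simp del: of_nat_Suc)
qed

lemma tail_le: assumes "v > 0" shows "measure W {v..} \<le> V / v\<^sup>2"
proof -
  have "measure W {v..} = (\<integral>x. indicator {v..} x \<partial>W)" by simp
  also have "\<dots> \<le> (\<integral>x. x\<^sup>2 / v\<^sup>2 \<partial>W)"
  proof (rule integral_mono)
    show "integrable W (indicat_real {v..})" using emeasure_tail[OF assms] by (simp add: integrable_indicator_iff)
    show "integrable W (\<lambda>x. x\<^sup>2 / v\<^sup>2)" using integrable_square by simp
    fix x :: real
    have "v\<^sup>2 \<le> x\<^sup>2" if "v \<le> x" using that assms by (intro power_mono) auto
    then show "indicat_real {v..} x \<le> x\<^sup>2 / v\<^sup>2" using assms by (auto simp: indicator_def field_simps)
  qed
  also have "\<dots> = V / v\<^sup>2" by (simp add: V_def)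
  finally show ?thesis .
qed

lemma V_nonneg: "V \<ge> 0" by (simp add: V_def)

text \<open>
  The power law holds near the origin by assumption; further out Chebyshev's bound \<open>V / x\<^sup>2\<close> is smaller up to a constant,
  since \<open>\<beta> < 2\<close>.
\<close>

lemma tail_powr_bound:
  assumes "\<beta> < 2" "(\<lambda>x. measure W {x..}) \<sim>[at_right 0] (\<lambda>x. c * x powr (- \<beta>))" "c > 0"
  obtains C where "C > 0" "\<And>x. x > 0 \<Longrightarrow> measure W {x..} \<le> C * x powr (- \<beta>)"
proof -
  have "((\<lambda>x. measure W {x..} / (c * x powr (- \<beta>))) \<longlongrightarrow> 1) (at_right 0)"
    using assms(2) by (rule asymp_equivD_strong) (use assms(3) in \<open>auto simp: eventually_at_filter\<close>)
  then have "eventually (\<lambda>x. measure W {x..} / (c * x powr (- \<beta>)) < 2) (at_right 0)"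
    by (rule order_tendstoD) simp
  then obtain x0 where x0: "x0 > 0" "\<And>x. 0 < x \<Longrightarrow> x < x0 \<Longrightarrow> measure W {x..} / (c * x powr (- \<beta>)) < 2"
    unfolding eventually_at_right_field by auto
  define C where "C = 2 * c + V * x0 powr (\<beta> - 2)"
  have C: "C > 0" "2 * c \<le> C" "V * x0 powr (\<beta> - 2) \<le> C" using assms(3) V_nonneg by (auto simp: C_def intro!: add_pos_nonneg)
  have "measure W {x..} \<le> C * x powr (- \<beta>)" if x: "x > 0" for x
  proof (cases "x < x0")
    case True
    then have "measure W {x..} \<le> 2 * c * x powr (- \<beta>)" using x0(2)[OF x True] x assms(3) by (simp add: field_simps)
    also have "\<dots> \<le> C * x powr (- \<beta>)" using C by (intro mult_right_mono) auto
    finally show ?thesis .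
  next
    case False
    have "measure W {x..} \<le> V / x\<^sup>2" by (rule tail_le[OF x])
    also have "\<dots> = V * x powr (\<beta> - 2) * x powr (- \<beta>)"
    proof -
      have "x powr (\<beta> - 2) * x powr (- \<beta>) = x powr (- 2)" by (simp flip: powr_add)
      also have "\<dots> = 1 / x\<^sup>2" using x by (simp add: powr_minus powr_numeral divide_inverse)
      finally show ?thesis by (simp add: mult.assoc)
    qed
    also have "x powr (\<beta> - 2) \<le> x0 powr (\<beta> - 2)" using False x0 assms(1) by (intro powr_mono2') auto
    then have "V * x powr (\<beta> - 2) * x powr (- \<beta>) \<le> V * x0 powr (\<beta> - 2) * x powr (- \<beta>)"
      using V_nonneg by (intro mult_right_mono mult_left_mono) auto
    also have "\<dots> \<le> C * x powr (- \<beta>)" using C by (intro mult_right_mono) auto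
    finally show ?thesis .
  qed
  then show ?thesis using C that by blast
qed

lemma tail_measurable[measurable]: "(\<lambda>v. measure W {v..}) \<in> borel_measurable borel"
proof -
  interpret W: sigma_finite_measure W by (rule sigma_finite_W)
  have "(\<lambda>v. \<integral>x. indicat_real {v..} x \<partial>W) \<in> borel_measurable borel"
  proof (rule W.borel_measurable_lebesgue_integral)
    have "(\<lambda>p::real\<times>real. indicator {fst p..} (snd p) :: real) \<in> borel_measurable (borel \<Otimes>\<^sub>M borel)"
      unfolding indicator_def by simp
    then show "(\<lambda>(v, x). indicator {v..} x :: real) \<in> borel_measurable (borel \<Otimes>\<^sub>M W)"
      by (simp add: case_prod_beta' measurable_cong_sets[OF sets_pair_measure_cong[OF refl sets_W] refl])
  qed
  then show ?thesis by simp
qed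

text \<open>
  Fubini applied to \<open>e\<^sup>i\<^sup>s\<^sup>x - 1 - isx = \<integral>\<^sub>0\<^sup>x is (e\<^sup>i\<^sup>s\<^sup>v - 1) dv\<close>. It expresses the cumulant by the tail function, on which
  the hypotheses are made.
\<close>

lemma pos_cumulant_tail:
  "pos_cumulant W s = (\<integral>v. indicator {0<..} v *\<^sub>R (\<i> * of_real s * (exp (\<i> * of_real (s * v)) - 1) * of_real (measure W {v..})) \<partial>lborel)"
proof -
  interpret W: sigma_finite_measure W by (rule sigma_finite_W)
  interpret P: pair_sigma_finite W lborel by unfold_locales
  let ?g = "\<lambda>v. \<i> * of_real s * (exp (\<i> * of_real (s * v)) - 1) :: complex"
  let ?f = "\<lambda>x v. indicator {0<..} x *\<^sub>R (indicator {0..x} v *\<^sub>R ?g v)"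
  have ind[measurable]: "(\<lambda>p::real\<times>real. indicator {0..fst p} (snd p) :: real) \<in> borel_measurable (borel \<Otimes>\<^sub>M borel)"
    unfolding indicator_def by simp
  have fm[measurable]: "case_prod ?f \<in> borel_measurable (W \<Otimes>\<^sub>M lborel)"
  proof -
    have "(\<lambda>p. indicator {0<..} (fst p) *\<^sub>R (indicator {0..fst p} (snd p) *\<^sub>R ?g (snd p))) \<in> borel_measurable (borel \<Otimes>\<^sub>M borel)"
      using ind by measurable
    then show ?thesis by (simp add: case_prod_beta' measurable_cong_sets[OF sets_pair_measure_cong[OF sets_W sets_lborel] refl])
  qed
  have inner: "has_bochner_integral lborel (\<lambda>v. indicator {0..x} v *\<^sub>R ?g v) (exp (\<i> * of_real (s * x)) - 1 - \<i> * of_real (s * x))"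
    if "x \<ge> 0" for x
  proof -
    let ?F = "\<lambda>v. exp (\<i> * of_real (s * v)) - \<i> * of_real (s * v) :: complex"
    have "has_bochner_integral lborel (\<lambda>v. indicator {0..x} v *\<^sub>R ?g v) (?F x - ?F 0)"
    proof (rule has_bochner_integral_FTC_Icc[OF that])
      fix v :: real
      have "((\<lambda>w. exp (\<i> * of_real s * w) - \<i> * of_real s * w) has_field_derivative (\<i> * of_real s * (exp (\<i> * of_real s * of_real v) - 1))) (at (of_real v))"
        by (auto intro!: derivative_eq_intros simp: algebra_simps)
      from has_vector_derivative_real_field[OF this]
      have "(?F has_vector_derivative ?g v) (at v)"
        by (simp only: of_real_mult mult.assoc)
      then show "(?F has_vector_derivative ?g v) (at v within {0..x})"
        by (rule has_vector_derivative_at_within)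
    qed (intro continuous_intros)
    moreover have "?F x - ?F 0 = exp (\<i> * of_real (s * x)) - 1 - \<i> * of_real (s * x)" by simp
    ultimately show ?thesis by (simp only:)
  qed
  have int: "integrable (W \<Otimes>\<^sub>M lborel) (case_prod ?f)"
  proof (rule P.Fubini_integrable[OF fm])
    show "integrable W (\<lambda>x. \<integral>v. norm (case_prod ?f (x, v)) \<partial>lborel)"
    proof (rule Bochner_Integration.integrable_bound)
      show "integrable W (\<lambda>x. s\<^sup>2 * x\<^sup>2)" using integrable_square by simp
      show "(\<lambda>x. \<integral>v. norm (case_prod ?f (x, v)) \<partial>lborel) \<in> borel_measurable W"
        by measurable
      show "AE x in W. norm (\<integral>v. norm (case_prod ?f (x, v)) \<partial>lborel) \<le> norm (s\<^sup>2 * x\<^sup>2)"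
      proof (rule AE_I2)
        fix x :: real
        have "(\<integral>v. norm (case_prod ?f (x, v)) \<partial>lborel) \<le> (\<integral>v. indicator {0..\<bar>x\<bar>} v * (s\<^sup>2 * \<bar>x\<bar>) \<partial>lborel)"
        proof (rule integral_mono_AE')
          show "integrable lborel (\<lambda>v. indicator {0..\<bar>x\<bar>} v * (s\<^sup>2 * \<bar>x\<bar>))"
            by (intro integrable_mult_left) (simp add: integrable_indicator_iff)
          show "AE v in lborel. norm (case_prod ?f (x, v)) \<le> indicator {0..\<bar>x\<bar>} v * (s\<^sup>2 * \<bar>x\<bar>)"
          proof (rule AE_I2)
            fix v :: real
            show "norm (case_prod ?f (x, v)) \<le> indicator {0..\<bar>x\<bar>} v * (s\<^sup>2 * \<bar>x\<bar>)"
            proof (cases "0 < x \<and> 0 \<le> v \<and> v \<le> x")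
              case True
              have "norm (?g v) \<le> \<bar>s\<bar> * \<bar>s * v\<bar>"
              proof -
                have "norm (?g v) = \<bar>s\<bar> * norm (exp (\<i> * of_real (s * v)) - 1)" by (simp only: norm_mult norm_ii norm_of_real mult_1)
                then show ?thesis by (simp only: mult_left_mono[OF norm_iexp_minus_one_le abs_ge_zero])
              qed
              also have "\<dots> = s\<^sup>2 * v" using True by (simp add: abs_mult power2_eq_square)
              also have "\<dots> \<le> s\<^sup>2 * x" using True by (intro mult_left_mono) auto
              finally show ?thesis using True by simp
            qed (auto simp: indicator_def)
          qed
        qed auto
        also have "\<dots> = s\<^sup>2 * x\<^sup>2" by (simp add: power2_eq_square)
        finally show "norm (\<integral>v. norm (case_prod ?f (x, v)) \<partial>lborel) \<le> norm (s\<^sup>2 * x\<^sup>2)"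
          by simp
      qed
    qed
    show "AE x in W. integrable lborel (\<lambda>v. case_prod ?f (x, v))"
    proof (rule AE_I2)
      fix x :: real
      show "integrable lborel (\<lambda>v. case_prod ?f (x, v))"
        using inner[of x] by (cases "x > 0") (auto simp: has_bochner_integral_iff)
    qed
  qed
  have "pos_cumulant W s = (\<integral>x. (\<integral>v. ?f x v \<partial>lborel) \<partial>W)"
    unfolding pos_cumulant_def
  proof (rule Bochner_Integration.integral_cong[OF refl])
    fix x
    show "indicator {0<..} x *\<^sub>R (exp (\<i> * of_real (s * x)) - 1 - \<i> * of_real (s * x)) = (\<integral>v. ?f x v \<partial>lborel)"
      using has_bochner_integral_integral_eq[OF inner[of x]] by (cases "x > 0") (auto simp del: of_real_mult)
  qed
  also have "\<dots> = (\<integral>v. (\<integral>x. ?f x v \<partial>W) \<partial>lborel)"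
    by (rule P.Fubini_integral[OF int, symmetric])
  also have "\<dots> = (\<integral>v. indicator {0<..} v *\<^sub>R (?g v * of_real (measure W {v..})) \<partial>lborel)"
  proof (rule integral_cong_AE)
    show "(\<lambda>v. \<integral>x. ?f x v \<partial>W) \<in> borel_measurable lborel"
      using measurable_pair_swap[OF fm] by (intro W.borel_measurable_lebesgue_integral) simp
    show "(\<lambda>v. indicator {0<..} v *\<^sub>R (?g v * of_real (measure W {v..}))) \<in> borel_measurable lborel" by measurable
    have "AE v in lborel. v \<noteq> (0::real)" by (rule AE_lborel_singleton)
    then show "AE v in lborel. (\<integral>x. ?f x v \<partial>W) = indicator {0<..} v *\<^sub>R (?g v * of_real (measure W {v..}))"
    proof eventually_elim
      case (elim v)
      show ?case
      proof (cases "v > 0")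
        case True
        have "(\<integral>x. ?f x v \<partial>W) = (\<integral>x. indicator {v..} x *\<^sub>R ?g v \<partial>W)"
          using True by (intro Bochner_Integration.integral_cong) (auto simp: indicator_def)
        also have "\<dots> = measure W {v..} *\<^sub>R ?g v"
          using emeasure_tail[OF True] by (subst integral_scaleR_left) (auto simp: integrable_indicator_iff)
        finally show ?thesis using True by (simp add: scaleR_conv_of_real mult.commute)
      next
        case False
        then have z: "?f x v = 0" for x using elim by (auto simp: indicator_def)
        show ?thesis unfolding z using False by simp
      qed
    qed
  qed
  finally show ?thesis .
qed

text \<open>
  After the substitution \<open>v = y/s\<close> the tail enters as \<open>W([y/s, \<infinity>)) / s\<^sup>\<beta>\<close>, which converges to \<open>c y\<^sup>-\<^sup>\<beta>\<close> and is
  dominated by \<open>tail_powr_bound\<close>; the limit is the oscillatory integral.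
\<close>

lemma pos_cumulant_asymp:
  assumes \<beta>: "1 < \<beta>" "\<beta> < 2" and tail: "(\<lambda>x. measure W {x..}) \<sim>[at_right 0] (\<lambda>x. c * x powr (- \<beta>))" "c > 0"
  shows "((\<lambda>s. pos_cumulant W s / of_real (s powr \<beta>)) \<longlongrightarrow> of_real c * stable_const \<beta>) at_top"
proof -
  let ?G = "\<lambda>s y. indicator {0<..} y *\<^sub>R (\<i> * (exp (\<i> * of_real y) - 1) * of_real (measure W {y / s..} / s powr \<beta>)) :: complex"
  obtain C where C: "C > 0" "\<And>x. x > 0 \<Longrightarrow> measure W {x..} \<le> C * x powr (- \<beta>)"
    using tail_powr_bound[OF \<beta>(2) tail] by blast
  have scale: "(y / s) powr (- \<beta>) / s powr \<beta> = y powr (- \<beta>)" if "s > 0" "y > 0" for s y :: real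
    using that by (simp add: powr_divide powr_minus field_simps)
  have eq: "pos_cumulant W s / of_real (s powr \<beta>) = integral\<^sup>L lborel (?G s)" if s: "s > 0" for s
  proof -
    let ?h = "\<lambda>v. indicator {0<..} v *\<^sub>R (\<i> * of_real s * (exp (\<i> * of_real (s * v)) - 1) * of_real (measure W {v..})) :: complex"
    have "pos_cumulant W s = \<bar>1 / s\<bar> *\<^sub>R (\<integral>y. ?h (0 + (1 / s) * y) \<partial>lborel)"
      unfolding pos_cumulant_tail using s by (intro lborel_integral_real_affine) simp
    also have "\<dots> = (\<integral>y. (1 / s) *\<^sub>R ?h (y / s) \<partial>lborel)"
      using s by (simp only: integral_scaleR_right) simp
    also have "\<dots> = (\<integral>y. of_real (s powr \<beta>) * ?G s y \<partial>lborel)"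
    proof (rule Bochner_Integration.integral_cong[OF refl])
      fix y :: real
      have "indicator {0<..} (y / s) = (indicator {0<..} y :: real)" using s by (simp add: indicator_def zero_less_divide_iff)
      then show "(1 / s) *\<^sub>R ?h (y / s) = of_real (s powr \<beta>) * ?G s y"
        using s by (simp add: scaleR_conv_of_real)
    qed
    also have "\<dots> = of_real (s powr \<beta>) * integral\<^sup>L lborel (?G s)" by (rule integral_mult_right_zero)
    finally show ?thesis using s by simp
  qed
  have R: "((\<lambda>x. measure W {x..} / (c * x powr (- \<beta>))) \<longlongrightarrow> 1) (at_right 0)"
    using tail(1) by (rule asymp_equivD_strong) (use tail(2) in \<open>auto simp: eventually_at_filter\<close>)
  have "((\<lambda>s. integral\<^sup>L lborel (?G s)) \<longlongrightarrow> (\<integral>y. indicator {0<..} y *\<^sub>R (\<i> * (exp (\<i> * of_real y) - 1) * of_real (c * y powr (- \<beta>))) \<partial>lborel)) at_top"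
  proof (rule integral_dominated_convergence_at_top)
    show "integrable lborel (\<lambda>y. 3 * C * (indicator {0<..} y * (min 1 y * y powr (- \<beta>))))"
      using \<beta> by (intro integrable_mult_right integrable_min_powr) auto
    show "AE y in lborel. ((\<lambda>s. ?G s y) \<longlongrightarrow> indicator {0<..} y *\<^sub>R (\<i> * (exp (\<i> * of_real y) - 1) * of_real (c * y powr (- \<beta>)))) at_top"
    proof (rule AE_I2)
      fix y :: real
      show "((\<lambda>s. ?G s y) \<longlongrightarrow> indicator {0<..} y *\<^sub>R (\<i> * (exp (\<i> * of_real y) - 1) * of_real (c * y powr (- \<beta>)))) at_top"
      proof (cases "y > 0")
        case True
        have "filterlim (\<lambda>s. y / s) (at_right 0) at_top"
          unfolding filterlim_at
          using True by (auto intro!: tendsto_divide_0[OF tendsto_const] filterlim_at_top_imp_at_infinity filterlim_ident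
             eventually_mono[OF eventually_gt_at_top[of 0]])
        from filterlim_compose[OF R this]
        have "((\<lambda>s. c * y powr (- \<beta>) * (measure W {y / s..} / (c * (y / s) powr (- \<beta>)))) \<longlongrightarrow> c * y powr (- \<beta>) * 1) at_top"
          by (intro tendsto_mult tendsto_const)
        then have lim: "((\<lambda>s. measure W {y / s..} / s powr \<beta>) \<longlongrightarrow> c * y powr (- \<beta>)) at_top"
          unfolding mult_1_right
        proof (rule Lim_transform_eventually)
          show "eventually (\<lambda>s. c * y powr (- \<beta>) * (measure W {y / s..} / (c * (y / s) powr (- \<beta>))) = measure W {y / s..} / s powr \<beta>) at_top"
            using eventually_gt_at_top[of 0]
          proof eventually_elim
            case (elim s)
            have "(y / s) powr (- \<beta>) > 0" using True elim by simp
            then show ?case using scale[OF elim True] tail(2) elim by (simp add: field_simps)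
          qed
        qed
        show ?thesis by (intro tendsto_intros lim)
      qed simp
    qed
    show "eventually (\<lambda>s. AE y in lborel. norm (?G s y) \<le> 3 * C * (indicator {0<..} y * (min 1 y * y powr (- \<beta>)))) at_top"
      using eventually_gt_at_top[of 0]
    proof eventually_elim
      case (elim s)
      show ?case
      proof (rule AE_I2)
        fix y :: real
        show "norm (?G s y) \<le> 3 * C * (indicator {0<..} y * (min 1 y * y powr (- \<beta>)))"
        proof (cases "y > 0")
          case True
          have "measure W {y / s..} \<le> C * (y / s) powr (- \<beta>)" using True elim by (intro C) simp
          then have "measure W {y / s..} / s powr \<beta> \<le> C * ((y / s) powr (- \<beta>) / s powr \<beta>)"
            using elim by (simp add: divide_right_mono)
          then have 1: "measure W {y / s..} / s powr \<beta> \<le> C * y powr (- \<beta>)" using scale[OF elim True] by simp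
          have 2: "norm (exp (\<i> * of_real y) - 1) \<le> 3 * min 1 y"
            using norm_cexp_minus_one_bound[of "- \<i>" y] True by simp
          have "norm (?G s y) = norm (exp (\<i> * of_real y) - 1) * (measure W {y / s..} / s powr \<beta>)"
            using True elim by (simp add: norm_mult norm_divide)
          also have "\<dots> \<le> 3 * min 1 y * (C * y powr (- \<beta>))"
            using 1 2 True by (intro mult_mono) auto
          finally show ?thesis using True by (simp add: mult_ac)
        qed simp
      qed
    qed
  qed measurable
  moreover have "(\<integral>y. indicator {0<..} y *\<^sub>R (\<i> * (exp (\<i> * of_real y) - 1) * of_real (c * y powr (- \<beta>))) \<partial>lborel) = of_real c * stable_const \<beta>"
  proof -
    have "(\<integral>y. indicator {0<..} y *\<^sub>R (\<i> * (exp (\<i> * of_real y) - 1) * of_real (c * y powr (- \<beta>))) \<partial>lborel)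
      = (\<integral>y. of_real c * (indicator {0<..} y *\<^sub>R (\<i> * (exp (\<i> * of_real y) - 1) * of_real (y powr (- \<beta>)))) \<partial>lborel)"
      by (intro Bochner_Integration.integral_cong) (auto simp: indicator_def)
    then show ?thesis by (simp only: integral_mult_right_zero oscillatory_integral[OF \<beta>])
  qed
  ultimately have lim: "((\<lambda>s. integral\<^sup>L lborel (?G s)) \<longlongrightarrow> of_real c * stable_const \<beta>) at_top"
    by (simp only:)
  have "eventually (\<lambda>s. integral\<^sup>L lborel (?G s) = pos_cumulant W s / of_real (s powr \<beta>)) at_top"
    using eventually_gt_at_top[of "0::real"] by eventually_elim (simp only: eq)
  with lim show ?thesis by (rule Lim_transform_eventually)
qed

end

section \<open>Levy cumulants that look stable at high frequencies\<close>

lemma levy_cumulant_cnj: "levy_cumulant 0 W (- s) = cnj (levy_cumulant 0 W s)"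
proof -
  have "levy_cumulant 0 W (- s) = (\<integral>x. cnj (exp (\<i> * of_real (s * x)) - 1 - \<i> * of_real (s * x)) \<partial>W)"
    unfolding levy_cumulant_def by (simp add: exp_cnj)
  then show ?thesis by (simp only: Bochner_Integration.integral_cnj levy_cumulant_def) simp
qed

lemma stable_cumulant_eq:
  "stable_cumulant \<beta> c1 c2 s = of_real (\<bar>s\<bar> powr \<beta>) *
     (if s \<ge> 0 then of_real c1 * stable_const \<beta> + of_real c2 * cnj (stable_const \<beta>)
      else of_real c2 * stable_const \<beta> + of_real c1 * cnj (stable_const \<beta>))"
  by (cases s "0::real" rule: linorder_cases)
     (auto simp: stable_cumulant_def stable_omega_def stable_const_def complex_eq_iff algebra_simps diff_divide_distrib add_divide_distrib)

lemma stable_const_neg: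
  assumes "1 < \<beta>" "\<beta> < 2" shows "Re (stable_const \<beta>) < 0"
proof -
  have "Gamma (2 - \<beta>) > 0" using assms by (intro Gamma_real_pos) simp
  moreover have "cos (pi * \<beta> / 2) < 0"
  proof -
    have "cos (pi * \<beta> / 2 - pi) > 0" using assms by (intro cos_gt_zero_pi) (auto simp: field_simps)
    then show ?thesis by (simp add: cos_diff)
  qed
  ultimately have "Gamma (2 - \<beta>) / (1 - \<beta>) * cos (pi * \<beta> / 2) > 0"
    using assms by (intro mult_neg_neg divide_pos_neg) auto
  then show ?thesis by (simp add: stable_const_def)
qed

lemma one_minus_cos_ge:
  fixes u :: real assumes "\<bar>u\<bar> \<le> 1" shows "1 - cos u \<ge> u\<^sup>2 / 3"
proof -
  have "cmod (iexp u - (\<Sum>k \<le> 2. (\<i> * u)^k / fact k)) \<le> \<bar>u\<bar>^(Suc 2) / fact (Suc 2)"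
    by (rule iexp_approx1)
  moreover have "(\<Sum>k \<le> 2. (\<i> * u)^k / fact k) = 1 + \<i> * u - u\<^sup>2 / 2"
    by (simp add: numeral_2_eq_2 power2_eq_square complex_eq_iff)
  moreover have "\<bar>Re (iexp u - (1 + \<i> * u - u\<^sup>2 / 2))\<bar> \<le> cmod (iexp u - (1 + \<i> * u - u\<^sup>2 / 2))"
    by (rule abs_Re_le_cmod)
  moreover have "Re (iexp u - (1 + \<i> * u - u\<^sup>2 / 2)) = cos u - 1 + u\<^sup>2 / 2"
    by (simp add: Re_exp flip: of_real_power)
  ultimately have "\<bar>cos u - (1 - u\<^sup>2 / 2)\<bar> \<le> \<bar>u\<bar> ^ 3 / 6"
    by (simp add: numeral_3_eq_3 fact_numeral)
  moreover have "\<bar>u\<bar> ^ 3 \<le> u\<^sup>2"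
    using assms by (simp add: power3_eq_cube power2_eq_square mult_left_le flip: abs_mult)
  ultimately show ?thesis by linarith
qed

text \<open>
  The tails at the origin are those of a \<open>\<beta>\<close>-stable Levy measure; large jumps have finite variance.
  Accordingly \<open>\<kappa>(s)\<close> behaves like the stable cumulant for large \<open>|s|\<close> and like \<open>s\<^sup>2\<close> for small \<open>|s|\<close>.
\<close>

locale stable_like_levy = levy_second_moment +
  fixes \<beta> cp cm :: real
  assumes beta: "1 < \<beta>" "\<beta> < 2" and c_pos: "cp > 0" "cm > 0"
    and right_tail: "(\<lambda>x. measure W {x..}) \<sim>[at_right 0] (\<lambda>x. cp * x powr (- \<beta>))"
    and left_tail: "(\<lambda>x. measure W {..-x}) \<sim>[at_right 0] (\<lambda>x. cm * x powr (- \<beta>))"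
begin

abbreviation "\<kappa> \<equiv> levy_cumulant 0 W"
abbreviation "\<kappa>\<^sub>s \<equiv> stable_cumulant \<beta> cp cm"

lemma kappa_eq: "\<kappa> s = (\<integral>x. (exp (\<i> * of_real (s * x)) - 1 - \<i> * of_real (s * x)) \<partial>W)"
  by (simp add: levy_cumulant_def)

lemma kappa_integrable: "integrable W (\<lambda>x. exp (\<i> * of_real (s * x)) - 1 - \<i> * of_real (s * x))"
proof (rule Bochner_Integration.integrable_bound)
  show "integrable W (\<lambda>x. s\<^sup>2 * x\<^sup>2)" using integrable_square by simp
  show "AE x in W. norm (exp (\<i> * of_real (s * x)) - 1 - \<i> * of_real (s * x)) \<le> norm (s\<^sup>2 * x\<^sup>2)"
    using norm_iexp_minus_linear_le[of "s * x" for x] by (intro AE_I2) (simp only: power_mult_distrib real_norm_def abs_mult abs_power2)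
qed measurable

lemma norm_kappa_le_square: "norm (\<kappa> s) \<le> V * s\<^sup>2"
proof -
  have "norm (\<kappa> s) \<le> (\<integral>x. norm (exp (\<i> * of_real (s * x)) - 1 - \<i> * of_real (s * x)) \<partial>W)"
    unfolding kappa_eq by (rule integral_norm_bound)
  also have "\<dots> \<le> (\<integral>x. s\<^sup>2 * x\<^sup>2 \<partial>W)"
    using norm_iexp_minus_linear_le[of "s * x" for x] integrable_square kappa_integrable
    by (intro integral_mono integrable_norm) (simp_all only: power_mult_distrib integrable_mult_right)
  also have "\<dots> = V * s\<^sup>2" by (simp add: V_def)
  finally show ?thesis .
qed

lemma kappa_continuous: "continuous_on UNIV \<kappa>"
proof (rule continuous_at_imp_continuous_on, rule ballI)
  fix s :: real
  show "isCont \<kappa> s" unfolding continuous_at_sequentially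
  proof (intro allI impI)
    fix f :: "nat \<Rightarrow> real" assume f: "f \<longlonglongrightarrow> s"
    then obtain B where B: "\<And>n. norm (f n) \<le> B" 
      using convergent_imp_bounded[OF f] by (auto simp: bounded_iff)
    show "(\<kappa> \<circ> f) \<longlonglongrightarrow> \<kappa> s"
      unfolding o_def kappa_eq
    proof (rule integral_dominated_convergence)
      show "integrable W (\<lambda>x. B\<^sup>2 * x\<^sup>2)" using integrable_square by simp
      show "AE x in W. (\<lambda>n. exp (\<i> * of_real (f n * x)) - 1 - \<i> * of_real (f n * x)) \<longlonglongrightarrow> exp (\<i> * of_real (s * x)) - 1 - \<i> * of_real (s * x)"
        by (intro AE_I2 tendsto_intros f)
      show "AE x in W. norm (exp (\<i> * of_real (f n * x)) - 1 - \<i> * of_real (f n * x)) \<le> B\<^sup>2 * x\<^sup>2" for n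
      proof (rule AE_I2)
        fix x
        have "(f n)\<^sup>2 \<le> B\<^sup>2" using B[of n] by (metis abs_le_square_iff abs_of_nonneg norm_ge_zero order_trans real_norm_def)
        then have "(f n * x)\<^sup>2 \<le> B\<^sup>2 * x\<^sup>2" by (simp add: power_mult_distrib mult_right_mono)
        then show "norm (exp (\<i> * of_real (f n * x)) - 1 - \<i> * of_real (f n * x)) \<le> B\<^sup>2 * x\<^sup>2"
          using norm_iexp_minus_linear_le[of "f n * x"] by linarith
      qed
    qed measurable
  qed
qed

text \<open>
  The negative jumps are the positive jumps of the reflected measure.
\<close>

abbreviation "W\<^sub>r \<equiv> distr W borel uminus"

lemma reflected: "levy_second_moment W\<^sub>r"
proof
  have "emeasure W\<^sub>r {0} = 0"
    using levy by (subst emeasure_distr) (auto simp: Levy_measure_def vimage_def)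
  moreover have "(\<integral>\<^sup>+x. ennreal (min 1 (x\<^sup>2)) \<partial>W\<^sub>r) < \<infinity>"
    using levy by (subst nn_integral_distr) (auto simp: Levy_measure_def)
  ultimately show "Levy_measure W\<^sub>r" by (simp add: Levy_measure_def)
  show "(\<integral>\<^sup>+x. ennreal (x\<^sup>2) \<partial>W\<^sub>r) < \<infinity>"
    using second_moment by (subst nn_integral_distr) auto
qed

lemma reflected_tail: "measure W\<^sub>r {x..} = measure W {..-x}"
proof -
  have "uminus -` {x..} = {..-x}" by auto
  then show ?thesis by (subst measure_distr) auto
qed

lemma kappa_split: "\<kappa> s = pos_cumulant W s + cnj (pos_cumulant W\<^sub>r s)"
proof -
  let ?f = "\<lambda>x. exp (\<i> * of_real (s * x)) - 1 - \<i> * of_real (s * x) :: complex"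
  have "\<kappa> s = (\<integral>x. indicator {0<..} x *\<^sub>R ?f x + indicator {..<0} x *\<^sub>R ?f x \<partial>W)"
    unfolding kappa_eq
  proof (rule Bochner_Integration.integral_cong[OF refl])
    fix x :: real
    show "?f x = indicator {0<..} x *\<^sub>R ?f x + indicator {..<0} x *\<^sub>R ?f x"
      by (cases x "0::real" rule: linorder_cases) auto
  qed
  also have "\<dots> = pos_cumulant W s + (\<integral>x. indicator {..<0} x *\<^sub>R ?f x \<partial>W)"
    unfolding pos_cumulant_def using kappa_integrable[of s]
    by (intro Bochner_Integration.integral_add integrable_mult_indicator) auto
  also have "(\<integral>x. indicator {..<0} x *\<^sub>R ?f x \<partial>W) = cnj (pos_cumulant W\<^sub>r s)"
  proof -
    have "pos_cumulant W\<^sub>r s = (\<integral>x. indicator {0<..} (- x) *\<^sub>R ?f (- x) \<partial>W)"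
      unfolding pos_cumulant_def by (rule integral_distr) measurable
    then have "cnj (pos_cumulant W\<^sub>r s) = (\<integral>x. cnj (indicator {0<..} (- x) *\<^sub>R ?f (- x)) \<partial>W)"
      by (simp only: Bochner_Integration.integral_cnj)
    also have "\<dots> = (\<integral>x. indicator {..<0} x *\<^sub>R ?f x \<partial>W)"
      by (intro Bochner_Integration.integral_cong) (auto simp: indicator_def exp_cnj)
    finally show ?thesis by simp
  qed
  finally show ?thesis .
qed

definition "A = of_real cp * stable_const \<beta> + of_real cm * cnj (stable_const \<beta>)"

lemma A_neg: "Re A < 0"
  using stable_const_neg[OF beta] c_pos by (simp add: A_def add_neg_neg mult_pos_neg)

lemma kappa_asymp: "((\<lambda>s. \<kappa> s / of_real (s powr \<beta>)) \<longlongrightarrow> A) at_top"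
proof -
  interpret R: levy_second_moment W\<^sub>r by (rule reflected)
  have 1: "((\<lambda>s. pos_cumulant W s / of_real (s powr \<beta>)) \<longlongrightarrow> of_real cp * stable_const \<beta>) at_top"
    by (rule pos_cumulant_asymp[OF beta right_tail c_pos(1)])
  have 2: "((\<lambda>s. pos_cumulant W\<^sub>r s / of_real (s powr \<beta>)) \<longlongrightarrow> of_real cm * stable_const \<beta>) at_top"
    using left_tail c_pos(2) by (intro R.pos_cumulant_asymp[OF beta]) (simp_all add: reflected_tail)
  have "((\<lambda>s. pos_cumulant W s / of_real (s powr \<beta>) + cnj (pos_cumulant W\<^sub>r s / of_real (s powr \<beta>))) \<longlongrightarrow> of_real cp * stable_const \<beta> + cnj (of_real cm * stable_const \<beta>)) at_top"
    by (intro tendsto_add 1 tendsto_cnj 2)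
  then show ?thesis unfolding kappa_split A_def by (simp add: add_divide_distrib)
qed

lemma kappa_scaling_limit: "((\<lambda>L. \<kappa> (L * x) / of_real (L powr \<beta>)) \<longlongrightarrow> \<kappa>\<^sub>s x) at_top"
proof -
  have pos: "((\<lambda>L. \<kappa> (L * x) / of_real (L powr \<beta>)) \<longlongrightarrow> of_real (x powr \<beta>) * A) at_top" if "x > 0" for x
  proof -
    have "filterlim (\<lambda>L. L * x) at_top at_top"
      using that by (rule filterlim_at_top_mult_tendsto_pos[OF tendsto_const _ filterlim_ident])
    from filterlim_compose[OF kappa_asymp this]
    have "((\<lambda>L. of_real (x powr \<beta>) * (\<kappa> (L * x) / of_real ((L * x) powr \<beta>))) \<longlongrightarrow> of_real (x powr \<beta>) * A) at_top"
      by (intro tendsto_mult tendsto_const)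
    then show ?thesis
    proof (rule Lim_transform_eventually)
      show "eventually (\<lambda>L. of_real (x powr \<beta>) * (\<kappa> (L * x) / of_real ((L * x) powr \<beta>)) = \<kappa> (L * x) / of_real (L powr \<beta>)) at_top"
        using eventually_gt_at_top[of 0] by eventually_elim (use that in \<open>simp add: powr_mult\<close>)
    qed
  qed
  consider "x > 0" | "x = 0" | "x < 0" by linarith
  then show ?thesis
  proof cases
    case 1
    then show ?thesis using pos[OF 1] by (simp add: stable_cumulant_eq A_def)
  next
    case 2
    then show ?thesis by (simp add: stable_cumulant_eq levy_cumulant_def)
  next
    case 3
    have lim: "((\<lambda>L. cnj (\<kappa> (L * (- x)) / of_real (L powr \<beta>))) \<longlongrightarrow> cnj (of_real ((- x) powr \<beta>) * A)) at_top"
      using 3 by (intro tendsto_cnj pos) simp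
    have "cnj (\<kappa> (L * (- x)) / of_real (L powr \<beta>)) = \<kappa> (L * x) / of_real (L powr \<beta>)" for L
      using levy_cumulant_cnj[of W "L * x"] by simp
    from lim[unfolded this] show ?thesis using 3 by (simp add: stable_cumulant_eq A_def add.commute)
  qed
qed

text \<open>
  Otherwise the right tail would be bounded near the origin.
\<close>

lemma near_zero_mass:
  assumes "r > 0" shows "(\<integral>x. indicator {-r..r} x * x\<^sup>2 \<partial>W) > 0"
proof (rule ccontr)
  assume "\<not> ?thesis"
  moreover have int: "integrable W (\<lambda>x. indicator {-r..r} x * x\<^sup>2)"
    using integrable_mult_indicator[OF _ integrable_square, of "{-r..r}"] by simp
  ultimately have "(\<integral>x. indicator {-r..r} x * x\<^sup>2 \<partial>W) = 0"
    by (simp add: not_less antisym)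
  then have "AE x in W. indicator {-r..r} x * x\<^sup>2 = 0"
    using int by (subst (asm) integral_nonneg_eq_0_iff_AE) auto
  then have AE0: "AE x in W. x \<notin> {0<..r}" by eventually_elim (auto simp: indicator_def)
  have const: "measure W {x..} \<le> measure W {r..}" if "0 < x" for x
  proof -
    have "emeasure W {x..} \<le> emeasure W {r..}"
      using AE0 that by (intro emeasure_mono_AE) auto
    then show ?thesis using emeasure_tail[OF assms] by (simp add: measure_def enn2real_mono)
  qed
  have "((\<lambda>x. measure W {x..} / (cp * x powr (- \<beta>))) \<longlongrightarrow> 1) (at_right 0)"
    using right_tail by (rule asymp_equivD_strong) (use c_pos(1) in \<open>auto simp: eventually_at_filter\<close>)
  moreover have "((\<lambda>x. measure W {x..} / (cp * x powr (- \<beta>))) \<longlongrightarrow> 0) (at_right 0)"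
  proof (rule Lim_null_comparison)
    show "eventually (\<lambda>x. norm (measure W {x..} / (cp * x powr (- \<beta>))) \<le> measure W {r..} / cp * x powr \<beta>) (at_right 0)"
      unfolding eventually_at_right_field
    proof (intro exI[of _ 1] conjI allI impI)
      fix x :: real assume "0 < x"
      then show "norm (measure W {x..} / (cp * x powr (- \<beta>))) \<le> measure W {r..} / cp * x powr \<beta>"
        using const[of x] c_pos by (simp add: powr_minus field_simps mult_right_mono)
    qed simp
    have "((\<lambda>x. measure W {r..} / cp * x powr \<beta>) \<longlongrightarrow> measure W {r..} / cp * 0 powr \<beta>) (at_right 0)"
      using beta by (intro tendsto_intros tendsto_powr') (auto simp: eventually_at_filter intro!: tendsto_ident_at)
    then show "((\<lambda>x. measure W {r..} / cp * x powr \<beta>) \<longlongrightarrow> 0) (at_right 0)" by simp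
  qed
  ultimately have "(1::real) = 0"
    using tendsto_unique trivial_limit_at_right_real by blast
  then show False by simp
qed

text \<open>
  \<open>- Re \<kappa>(s) = \<integral> (1 - cos(s x)) W(dx)\<close>, and for jumps \<open>|x| \<le> 1/M\<close> the integrand is at least \<open>(s x)\<^sup>2 / 3\<close>.
\<close>

lemma Re_kappa_lower:
  assumes "M > 0" obtains v where "v > 0" "\<And>s. \<bar>s\<bar> \<le> M \<Longrightarrow> v * s\<^sup>2 \<le> - Re (\<kappa> s)"
proof
  let ?v = "(\<integral>x. indicator {-(1/M)..1/M} x * x\<^sup>2 \<partial>W) / 3"
  show "?v > 0" using near_zero_mass[of "1/M"] assms by simp
  fix s assume s: "\<bar>s\<bar> \<le> M"
  have Re_int: "integrable W (\<lambda>x. 1 - cos (s * x))" and Re_eq: "- Re (\<kappa> s) = (\<integral>x. 1 - cos (s * x) \<partial>W)"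
  proof -
    have i: "integrable W (\<lambda>x. - Re (exp (\<i> * of_real (s * x)) - 1 - \<i> * of_real (s * x)))"
      by (intro integrable_minus integrable_Re kappa_integrable)
    have e: "- Re (exp (\<i> * of_real (s * x)) - 1 - \<i> * of_real (s * x)) = 1 - cos (s * x)" for x
      by (simp add: Re_exp)
    show "integrable W (\<lambda>x. 1 - cos (s * x))" using i unfolding e .
    have "- Re (\<kappa> s) = (\<integral>x. - Re (exp (\<i> * of_real (s * x)) - 1 - \<i> * of_real (s * x)) \<partial>W)"
      unfolding kappa_eq using kappa_integrable[of s] by (simp only: integral_minus integral_Re)
    then show "- Re (\<kappa> s) = (\<integral>x. 1 - cos (s * x) \<partial>W)" unfolding e .
  qed
  have "?v * s\<^sup>2 = (\<integral>x. s\<^sup>2 / 3 * (indicator {-(1/M)..1/M} x * x\<^sup>2) \<partial>W)" by simp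
  also have "\<dots> \<le> (\<integral>x. 1 - cos (s * x) \<partial>W)"
  proof (rule integral_mono[OF _ Re_int])
    show "integrable W (\<lambda>x. s\<^sup>2 / 3 * (indicator {-(1/M)..1/M} x * x\<^sup>2))"
      using integrable_mult_indicator[OF _ integrable_square, of "{-(1/M)..1/M}"] by (intro integrable_mult_right) simp
    fix x :: real
    show "s\<^sup>2 / 3 * (indicator {-(1/M)..1/M} x * x\<^sup>2) \<le> 1 - cos (s * x)"
    proof (cases "x \<in> {-(1/M)..1/M}")
      case True
      then have "\<bar>x\<bar> \<le> 1 / M" by auto
      then have "\<bar>s\<bar> * \<bar>x\<bar> \<le> M * (1 / M)" using s assms by (intro mult_mono) auto
      then have "\<bar>s * x\<bar> \<le> 1" using assms by (simp add: abs_mult)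
      then show ?thesis using one_minus_cos_ge[of "s * x"] True by (simp add: power_mult_distrib)
    qed simp
  qed
  finally show "?v * s\<^sup>2 \<le> - Re (\<kappa> s)" unfolding Re_eq .
qed

text \<open>
  For large \<open>|s|\<close> both bounds are read off the asymptotics, whose constant has negative real part. For
  small \<open>|s|\<close> both \<open>|\<kappa>(s)|\<close> and \<open>- Re \<kappa>(s)\<close> are of order \<open>s\<^sup>2\<close>, which is at most of order \<open>|s|\<^sup>\<beta>\<close> as \<open>\<beta> < 2\<close>.
\<close>

lemma kappa_bounds:
  obtains C D where "C > 0" "\<And>s. norm (\<kappa> s) \<le> C * \<bar>s\<bar> powr \<beta>" "D > 0" "\<And>s. norm (\<kappa> s) \<le> D * (- Re (\<kappa> s))"
proof -
  define a where "a = - Re A"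
  have a: "a > 0" using A_neg by (simp add: a_def)
  have "eventually (\<lambda>s. dist (\<kappa> s / of_real (s powr \<beta>)) A < a / 2) at_top"
    using kappa_asymp a by (intro tendstoD) auto
  then obtain M0 where M0: "\<And>s. s \<ge> M0 \<Longrightarrow> dist (\<kappa> s / of_real (s powr \<beta>)) A < a / 2"
    by (auto simp: eventually_at_top_linorder)
  define M where "M = max 1 M0"
  have M: "M \<ge> 1" "M \<ge> M0" by (auto simp: M_def)
  obtain v where v: "v > 0" "\<And>s. \<bar>s\<bar> \<le> M \<Longrightarrow> v * s\<^sup>2 \<le> - Re (\<kappa> s)"
    using Re_kappa_lower[of M] M by auto
  have far_pos: "norm (\<kappa> s) \<le> (cmod A + a) * s powr \<beta>" "a / 2 * s powr \<beta> \<le> - Re (\<kappa> s)" if "s > M" for s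
  proof -
    have s: "s > 0" "s \<ge> M0" using that M by auto
    define z where "z = \<kappa> s / of_real (s powr \<beta>)"
    have \<kappa>: "\<kappa> s = of_real (s powr \<beta>) * z" using s by (simp add: z_def)
    have z: "cmod (z - A) < a / 2" using M0[OF s(2)] by (simp add: dist_norm z_def)
    then have "cmod z \<le> cmod A + a" using norm_triangle_ineq2[of z A] a by linarith
    then show "norm (\<kappa> s) \<le> (cmod A + a) * s powr \<beta>"
      unfolding \<kappa> norm_mult norm_of_real using mult_right_mono[of "cmod z" "cmod A + a" "s powr \<beta>"] by (simp add: mult.commute)
    have "\<bar>Re (z - A)\<bar> < a / 2" using z abs_Re_le_cmod[of "z - A"] by linarith
    then have "a / 2 \<le> - Re z" by (simp add: a_def)
    then have "a / 2 * s powr \<beta> \<le> (- Re z) * s powr \<beta>" by (intro mult_right_mono) auto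
    then show "a / 2 * s powr \<beta> \<le> - Re (\<kappa> s)" unfolding \<kappa> by (simp add: mult.commute)
  qed
  have refl: "norm (\<kappa> s) = norm (\<kappa> \<bar>s\<bar>)" "Re (\<kappa> s) = Re (\<kappa> \<bar>s\<bar>)" for s
    using levy_cumulant_cnj[of W "\<bar>s\<bar>"] by (cases "s \<ge> 0"; simp)+
  have far: "norm (\<kappa> s) \<le> (cmod A + a) * \<bar>s\<bar> powr \<beta>" "a / 2 * \<bar>s\<bar> powr \<beta> \<le> - Re (\<kappa> s)" if "\<bar>s\<bar> > M" for s
    using far_pos[OF that] refl[of s] by auto
  let ?C = "(cmod A + a) + V * M powr (2 - \<beta>)"
  let ?D = "V / v + (cmod A + a) / (a / 2)"
  show ?thesis
  proof
    show "?C > 0" using a V_nonneg norm_ge_zero[of A] by (smt (verit) mult_nonneg_nonneg powr_ge_zero)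
    show "?D > 0" using a V_nonneg v by (intro add_nonneg_pos) (auto intro!: divide_pos_pos add_nonneg_pos)
    fix s :: real
    show "norm (\<kappa> s) \<le> ?C * \<bar>s\<bar> powr \<beta>"
    proof (cases "\<bar>s\<bar> > M")
      case True
      have "(cmod A + a) * \<bar>s\<bar> powr \<beta> \<le> ?C * \<bar>s\<bar> powr \<beta>" using V_nonneg by (intro mult_right_mono) auto
      then show ?thesis using far(1)[OF True] by linarith
    next
      case False
      show ?thesis
      proof (cases "s = 0")
        case True
        then show ?thesis by (simp add: levy_cumulant_def)
      next
        case s0: False
        have "s\<^sup>2 = \<bar>s\<bar> powr (2 - \<beta>) * \<bar>s\<bar> powr \<beta>"
          using s0 by (simp flip: powr_add)
        also have "\<dots> \<le> M powr (2 - \<beta>) * \<bar>s\<bar> powr \<beta>"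
          using False beta by (intro mult_right_mono powr_mono2) auto
        finally have "V * s\<^sup>2 \<le> V * (M powr (2 - \<beta>) * \<bar>s\<bar> powr \<beta>)" using V_nonneg by (rule mult_left_mono)
        also have "\<dots> \<le> ?C * \<bar>s\<bar> powr \<beta>" using a by (simp add: algebra_simps)
        finally show ?thesis using norm_kappa_le_square[of s] by linarith
      qed
    qed
    show "norm (\<kappa> s) \<le> ?D * (- Re (\<kappa> s))"
    proof (cases "\<bar>s\<bar> > M")
      case True
      have "0 \<le> a / 2 * \<bar>s\<bar> powr \<beta>" using a by simp
      then have nn: "0 \<le> - Re (\<kappa> s)" using far(2)[OF True] by (rule order_trans)
      have "(cmod A + a) * \<bar>s\<bar> powr \<beta> = (cmod A + a) / (a / 2) * (a / 2 * \<bar>s\<bar> powr \<beta>)" using a by simp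
      also have "\<dots> \<le> (cmod A + a) / (a / 2) * (- Re (\<kappa> s))" using far(2)[OF True] a by (intro mult_left_mono) auto
      also have "\<dots> \<le> ?D * (- Re (\<kappa> s))"
        using V_nonneg v by (intro mult_right_mono[OF _ nn]) simp
      finally show ?thesis using far(1)[OF True] by linarith
    next
      case False
      then have lo: "v * s\<^sup>2 \<le> - Re (\<kappa> s)" using v(2) by simp
 have "0 \<le> v * s\<^sup>2" using v by simp
      then have nn: "0 \<le> - Re (\<kappa> s)" using lo by (rule order_trans)
      have "V * s\<^sup>2 = V / v * (v * s\<^sup>2)" using v by simp
      also have "\<dots> \<le> V / v * (- Re (\<kappa> s))" using lo V_nonneg v by (intro mult_left_mono) auto
      also have "\<dots> \<le> ?D * (- Re (\<kappa> s))"
        using a by (intro mult_right_mono[OF _ nn]) simp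
      finally show ?thesis using norm_kappa_le_square[of s] by linarith
    qed
  qed
qed

end

lemma stable_cumulant_bounds:
  assumes "1 < \<beta>" "\<beta> < 2" "c1 > 0" "c2 > 0"
  obtains C D where "C > 0" "\<And>s. norm (stable_cumulant \<beta> c1 c2 s) \<le> C * \<bar>s\<bar> powr \<beta>"
    "D > 0" "\<And>s. norm (stable_cumulant \<beta> c1 c2 s) \<le> D * (- Re (stable_cumulant \<beta> c1 c2 s))"
proof -
  let ?Z = "stable_const \<beta>"
  define q where "q = - (c1 + c2) * Re ?Z"
  have q: "q > 0" using stable_const_neg[OF assms(1,2)] assms(3,4) unfolding q_def by (intro mult_neg_neg) auto
  define C where "C = (c1 + c2) * cmod ?Z"
  have Z: "cmod ?Z > 0" using stable_const_neg[OF assms(1,2)] by auto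
  have C: "C > 0" using assms Z by (simp add: C_def)
  have n: "norm (of_real x * ?Z + of_real y * cnj ?Z) \<le> (x + y) * cmod ?Z" if "x > 0" "y > 0" for x y
    using norm_triangle_ineq[of "of_real x * ?Z" "of_real y * cnj ?Z"] that by (simp add: norm_mult algebra_simps)
  have 1: "norm (stable_cumulant \<beta> c1 c2 s) \<le> C * \<bar>s\<bar> powr \<beta>" for s
    unfolding stable_cumulant_eq norm_mult C_def using n[OF assms(3,4)] n[OF assms(4,3)]
    by (simp add: mult.commute[of _ "\<bar>s\<bar> powr \<beta>"] mult_left_mono add.commute)
  have 2: "- Re (stable_cumulant \<beta> c1 c2 s) = q * \<bar>s\<bar> powr \<beta>" for s
    unfolding stable_cumulant_eq q_def by (simp add: algebra_simps)
  show ?thesis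
  proof
    show "C > 0" "C / q > 0" using C q by auto
    show "norm (stable_cumulant \<beta> c1 c2 s) \<le> C * \<bar>s\<bar> powr \<beta>" for s by (rule 1)
    show "norm (stable_cumulant \<beta> c1 c2 s) \<le> C / q * (- Re (stable_cumulant \<beta> c1 c2 s))" for s
      unfolding 2 using 1[of s] q by simp
  qed
qed

lemma stable_cumulant_continuous:
  assumes "\<beta> > 0" shows "continuous_on UNIV (stable_cumulant \<beta> c1 c2)"
proof -
  let ?Z = "stable_const \<beta>"
  have c: "continuous_on UNIV (\<lambda>s::real. of_real (\<bar>s\<bar> powr \<beta>) * w :: complex)" for w
    using assms by (intro continuous_on_mult continuous_on_of_real continuous_on_powr' continuous_on_const continuous_on_rabs continuous_on_id) auto
  have "continuous_on ({0..} \<union> {..0}) (\<lambda>s::real. if s \<ge> 0 then of_real (\<bar>s\<bar> powr \<beta>) * (of_real c1 * ?Z + of_real c2 * cnj ?Z)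
      else of_real (\<bar>s\<bar> powr \<beta>) * (of_real c2 * ?Z + of_real c1 * cnj ?Z))"
    using assms by (intro continuous_on_cases continuous_on_subset[OF c]) auto
  also have "({0..} \<union> {..0}) = (UNIV::real set)" by auto
  also have "(\<lambda>s::real. if s \<ge> 0 then of_real (\<bar>s\<bar> powr \<beta>) * (of_real c1 * ?Z + of_real c2 * cnj ?Z)
      else of_real (\<bar>s\<bar> powr \<beta>) * (of_real c2 * ?Z + of_real c1 * cnj ?Z)) = stable_cumulant \<beta> c1 c2"
    by (auto simp: stable_cumulant_eq)
  finally show ?thesis .
qed

section \<open>Characteristic functions and convergence in probability\<close>

text \<open>
  If the row sums do not tend to zero, the rows contain humps that carry almost all of a fixed
  amount and, since the columns tend to zero, move to infinity along disjoint blocks of columns. Let \<open>I\<close> collect every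
  second block: along the corresponding rows the partial sums over \<open>I\<close> are alternately large and
  small, so that they cannot converge. The exponential form of the hypothesis is what convergence of
  moduli of characteristic functions provides; it admits partial sums that tend to infinity.
\<close>

lemma gliding_hump:
  fixes u :: "nat \<Rightarrow> nat \<Rightarrow> real"
  assumes nonneg: "\<And>n k. u n k \<ge> 0" and summ: "\<And>n. summable (u n)"
    and col: "\<And>k. (\<lambda>n. u n k) \<longlonglongrightarrow> 0"
    and conv: "\<And>I. convergent (\<lambda>n. exp (- (\<Sum>k. if k \<in> I then u n k else 0)))"
  shows "(\<lambda>n. suminf (u n)) \<longlonglongrightarrow> 0"
proof (rule ccontr)
  assume "\<not> ?thesis"
  then obtain \<epsilon> where \<epsilon>: "\<epsilon> > 0" and "\<forall>N. \<exists>n\<ge>N. \<not> norm (suminf (u n) - 0) < \<epsilon>"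
    unfolding LIMSEQ_iff by blast
  then have big: "\<And>N. \<exists>n\<ge>N. suminf (u n) \<ge> \<epsilon>"
    using suminf_nonneg[OF summ nonneg] by (simp add: not_less)
  \<comment> \<open>Row \<open>n\<close> has a sum of at least \<open>\<epsilon>\<close>, of which less than \<open>\<epsilon>/8\<close> lies before column \<open>K\<close> and less than \<open>\<epsilon>/8\<close> from column \<open>K'\<close> on.\<close>
  define good where "good = (\<lambda>K (n, K'). K < K' \<and> (\<Sum>k<K. u n k) < \<epsilon> / 8 \<and> suminf (u n) \<ge> \<epsilon> \<and> suminf (u n) - (\<Sum>k<K'. u n k) < \<epsilon> / 8)"
  have step: "\<exists>n K'. n > N \<and> good K (n, K')" for N K
  proof -
    have "(\<lambda>n. \<Sum>k<K. u n k) \<longlonglongrightarrow> (\<Sum>k<K. 0)" by (intro tendsto_sum col)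
    then have "eventually (\<lambda>n. (\<Sum>k<K. u n k) < \<epsilon> / 8) sequentially"
      using \<epsilon> by (intro order_tendstoD) auto
    then obtain N1 where N1: "\<And>n. n \<ge> N1 \<Longrightarrow> (\<Sum>k<K. u n k) < \<epsilon> / 8" by (auto simp: eventually_sequentially)
    obtain n where n: "n \<ge> max (Suc N) N1" "suminf (u n) \<ge> \<epsilon>" using big by blast
    have "(\<lambda>K'. \<Sum>k<K'. u n k) \<longlonglongrightarrow> suminf (u n)" by (rule summable_LIMSEQ[OF summ])
    then have "eventually (\<lambda>K'. (\<Sum>k<K'. u n k) > suminf (u n) - \<epsilon> / 8) sequentially"
      using \<epsilon> by (intro order_tendstoD) auto
    then have "eventually (\<lambda>K'. K' > K \<and> (\<Sum>k<K'. u n k) > suminf (u n) - \<epsilon> / 8) sequentially"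
      by (intro eventually_conj eventually_gt_at_top)
    then obtain K' where "K' > K" "(\<Sum>k<K'. u n k) > suminf (u n) - \<epsilon> / 8"
      by (auto simp: eventually_sequentially)
    then show ?thesis using n N1[of n] unfolding good_def by (intro exI[of _ n] exI[of _ K']) auto
  qed
  have "\<exists>f. \<forall>j. True \<and> (fst (f (Suc j)) > fst (f j) \<and> good (snd (f j)) (f (Suc j)))"
  proof (rule dependent_nat_choice[where P = "\<lambda>_ _. True" and Q = "\<lambda>_ x y. fst y > fst x \<and> good (snd x) y"])
    fix x :: "nat \<times> nat"
    obtain n K' where "n > fst x" "good (snd x) (n, K')" using step by blast
    then show "\<exists>y. True \<and> fst y > fst x \<and> good (snd x) y" by (intro exI[of _ "(n, K')"]) simp
  qed simp
  then obtain f where f: "\<And>j. fst (f (Suc j)) > fst (f j)" "\<And>j. good (snd (f j)) (f (Suc j))"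
    by blast
  define n where "n = (\<lambda>j. fst (f j))"
  define K where "K = (\<lambda>j. snd (f j))"
  have n_mono: "strict_mono n" using f(1) by (intro strict_mono_Suc_iff[THEN iffD2]) (simp add: n_def)
  have Ks: "K j < K (Suc j)" and head: "(\<Sum>k<K j. u (n (Suc j)) k) < \<epsilon> / 8" and tot: "suminf (u (n (Suc j))) \<ge> \<epsilon>"
    and tail: "suminf (u (n (Suc j))) - (\<Sum>k<K (Suc j). u (n (Suc j)) k) < \<epsilon> / 8" for j
    using f(2)[of j] by (auto simp: good_def n_def K_def split: prod.splits)
  have K_mono: "strict_mono K" using Ks by (simp add: strict_mono_Suc_iff)
  define I where "I = (\<Union>j\<in>{j. even j}. {K j..<K (Suc j)})"
  define g where "g = (\<lambda>n. \<Sum>k. if k \<in> I then u n k else 0)"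
  have sI: "summable (\<lambda>k. if k \<in> I then u n k else 0)" for n
    by (rule summable_comparison_test'[OF summ[of n], of 0]) (use nonneg in auto)
  have even_ge: "g (n (Suc j)) \<ge> 3 * \<epsilon> / 4" if "even j" for j
  proof -
    let ?n = "n (Suc j)"
    have "(\<Sum>k\<in>{K j..<K (Suc j)}. u ?n k) = (\<Sum>k\<in>{K j..<K (Suc j)}. if k \<in> I then u ?n k else 0)"
      using that by (intro sum.cong) (auto simp: I_def)
    also have "\<dots> \<le> g ?n" unfolding g_def using nonneg by (intro sum_le_suminf sI) auto
    finally have "(\<Sum>k\<in>{K j..<K (Suc j)}. u ?n k) \<le> g ?n" .
    moreover have "(\<Sum>k<K (Suc j). u ?n k) = (\<Sum>k<K j. u ?n k) + (\<Sum>k\<in>{K j..<K (Suc j)}. u ?n k)"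
      using Ks[of j] by (subst sum.union_disjoint[symmetric]) (auto intro!: sum.cong)
    ultimately show ?thesis using head[of j] tot[of j] tail[of j] by simp
  qed
  have odd_le: "g (n (Suc j)) \<le> \<epsilon> / 4" if "odd j" for j
  proof -
    let ?n = "n (Suc j)"
    have disj: "k \<notin> I" if k: "k \<in> {K j..<K (Suc j)}" for k
    proof
      assume "k \<in> I"
      then obtain i where i: "even i" "K i \<le> k" "k < K (Suc i)" by (auto simp: I_def)
      from k have "K j \<le> k" "k < K (Suc j)" by auto
      with i have "K i < K (Suc j)" "K j < K (Suc i)" by auto
      then have "i < Suc j" "j < Suc i" using K_mono by (simp_all add: strict_mono_less)
      then show False using i(1) \<open>odd j\<close> by (metis less_antisym not_less_eq)
    qed
    have "g ?n = (\<Sum>k. if k + K (Suc j) \<in> I then u ?n (k + K (Suc j)) else 0) + (\<Sum>k<K (Suc j). if k \<in> I then u ?n k else 0)"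
      unfolding g_def by (rule suminf_split_initial_segment[OF sI])
    moreover have "(\<Sum>k. if k + K (Suc j) \<in> I then u ?n (k + K (Suc j)) else 0) \<le> (\<Sum>k. u ?n (k + K (Suc j)))"
      using nonneg summ[of ?n] sI[of ?n]
      by (intro suminf_le) (auto simp: summable_iff_shift[of "u ?n"] summable_iff_shift[of "\<lambda>k. if k \<in> I then u ?n k else 0"])
    moreover have "suminf (u ?n) = (\<Sum>k. u ?n (k + K (Suc j))) + (\<Sum>k<K (Suc j). u ?n k)"
      by (rule suminf_split_initial_segment[OF summ])
    moreover have "(\<Sum>k<K (Suc j). if k \<in> I then u ?n k else 0) \<le> (\<Sum>k<K j. u ?n k)"
    proof -
      have "(\<Sum>k<K (Suc j). if k \<in> I then u ?n k else 0) = (\<Sum>k<K j. if k \<in> I then u ?n k else 0)"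
        using Ks[of j] disj by (intro sum.mono_neutral_right) auto
      also have "\<dots> \<le> (\<Sum>k<K j. u ?n k)" using nonneg by (intro sum_mono) auto
      finally show ?thesis .
    qed
    ultimately show ?thesis using head[of j] tail[of j] by linarith
  qed
  obtain L where L: "(\<lambda>n. exp (- g n)) \<longlonglongrightarrow> L" using conv[of I] by (auto simp: convergent_def g_def)
  have ev: "strict_mono (\<lambda>j. n (Suc (2 * j)))" "strict_mono (\<lambda>j. n (Suc (2 * j + 1)))"
    using n_mono by (auto simp: strict_mono_def)
  have "(\<lambda>j. exp (- g (n (Suc (2 * j))))) \<longlonglongrightarrow> L" "(\<lambda>j. exp (- g (n (Suc (2 * j + 1))))) \<longlonglongrightarrow> L"
    using LIMSEQ_subseq_LIMSEQ[OF L ev(1)] LIMSEQ_subseq_LIMSEQ[OF L ev(2)] by (simp_all add: o_def)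
  moreover have "exp (- g (n (Suc (2 * j)))) \<le> exp (- (3 * \<epsilon> / 4))" for j using even_ge[of "2 * j"] by simp
  moreover have "exp (- g (n (Suc (2 * j + 1)))) \<ge> exp (- (\<epsilon> / 4))" for j using odd_le[of "2 * j + 1"] by simp
  ultimately have "L \<le> exp (- (3 * \<epsilon> / 4))" "L \<ge> exp (- (\<epsilon> / 4))"
    by (auto intro: LIMSEQ_le_const LIMSEQ_le_const2)
  then have "exp (- (\<epsilon> / 4)) \<le> exp (- (3 * \<epsilon> / 4))" by linarith
  then show False using \<epsilon> by simp
qed

text \<open>
  The integral is a multiple of \<open>|y|\<close>; for a lower bound the range \<open>s \<le> 1/|y|\<close> suffices. It turns bounds on
  characteristic functions into bounds on \<open>E|Y|\<close>.
\<close>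

lemma abs_le_cosine_integral:
  "ennreal (\<bar>y\<bar> / 3) \<le> (\<integral>\<^sup>+s. ennreal (indicator {0<..} s * ((1 - cos (s * y)) / s\<^sup>2)) \<partial>lborel)"
proof (cases "y = 0")
  case False
  have "ennreal (\<bar>y\<bar> / 3) = (\<integral>\<^sup>+s. ennreal (y\<^sup>2 / 3) * indicator {0<..1 / \<bar>y\<bar>} s \<partial>lborel)"
    using False by (subst nn_integral_cmult_indicator) (auto simp: ennreal_mult'[symmetric] power2_eq_square field_simps)
  also have "\<dots> \<le> (\<integral>\<^sup>+s. ennreal (indicator {0<..} s * ((1 - cos (s * y)) / s\<^sup>2)) \<partial>lborel)"
  proof (intro nn_integral_mono)
    fix s :: real
    show "ennreal (y\<^sup>2 / 3) * indicator {0<..1 / \<bar>y\<bar>} s \<le> ennreal (indicator {0<..} s * ((1 - cos (s * y)) / s\<^sup>2))"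
    proof (cases "s \<in> {0<..1 / \<bar>y\<bar>}")
      case True
      then have s: "s > 0" "s * \<bar>y\<bar> \<le> 1" using False by (auto simp: field_simps)
      then have "(s * y)\<^sup>2 / 3 \<le> 1 - cos (s * y)" by (intro one_minus_cos_ge) (simp add: abs_mult)
      then have "y\<^sup>2 / 3 \<le> (1 - cos (s * y)) / s\<^sup>2" using s by (simp add: field_simps power_mult_distrib)
      then show ?thesis using True s by (simp add: ennreal_leI)
    qed simp
  qed
  finally show ?thesis .
qed simp

text \<open>
  Split at \<open>s = N\<^sup>-\<^sup>1\<^sup>/\<^sup>\<beta>\<close>, where the two bounds are of the same order.
\<close>

lemma truncated_powr_integral:
  assumes "1 < \<beta>" "N \<ge> 0"
  shows "(\<integral>\<^sup>+s. ennreal (indicator {0<..} s * (min 2 (N * s powr \<beta>) / s\<^sup>2)) \<partial>lborel)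
     \<le> ennreal ((1 / (\<beta> - 1) + 2) * N powr (1 / \<beta>))"
proof (cases "N = 0")
  case False
  then have N: "N > 0" using assms by simp
  define a where "a = N powr (- (1 / \<beta>))"
  have a: "a > 0" using N by (simp add: a_def)
  have "(\<integral>\<^sup>+s. ennreal (indicator {0<..} s * (min 2 (N * s powr \<beta>) / s\<^sup>2)) \<partial>lborel)
     \<le> (\<integral>\<^sup>+s. ennreal N * ennreal (indicator {0..a} s * s powr (\<beta> - 2)) + ennreal 2 * ennreal (indicator {a..} s * s powr (-2)) \<partial>lborel)"
  proof (intro nn_integral_mono)
    fix s :: real
    show "ennreal (indicator {0<..} s * (min 2 (N * s powr \<beta>) / s\<^sup>2)) \<le> ennreal N * ennreal (indicator {0..a} s * s powr (\<beta> - 2)) + ennreal 2 * ennreal (indicator {a..} s * s powr (-2))"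
    proof (cases "s > 0")
      case True
      have p: "s powr (\<beta> - 2) = s powr \<beta> / s\<^sup>2" "s powr (- 2) = 1 / s\<^sup>2"
        using True by (simp_all add: powr_diff powr_minus powr_numeral divide_inverse)
      show ?thesis
      proof (cases "s \<le> a")
        case sa: True
        have "ennreal (min 2 (N * s powr \<beta>) / s\<^sup>2) \<le> ennreal N * ennreal (s powr (\<beta> - 2))"
          using N True by (simp add: p ennreal_mult'[symmetric]) (intro ennreal_leI divide_right_mono, auto)
        then show ?thesis using True sa by (simp add: add_increasing2)
      next
        case sa: False
        have "ennreal (min 2 (N * s powr \<beta>) / s\<^sup>2) \<le> ennreal 2 * ennreal (s powr (- 2))"
          unfolding p by (subst ennreal_mult'[symmetric]) (auto intro!: ennreal_leI divide_right_mono)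
        then show ?thesis using True sa by (simp add: add_increasing)
      qed
    qed simp
  qed
  also have "\<dots> = ennreal N * ennreal (a powr (\<beta> - 1) / (\<beta> - 1)) + ennreal 2 * ennreal (a powr (- 1))"
  proof -
    have "(\<integral>\<^sup>+s. ennreal (indicator {0..a} s * s powr (\<beta> - 2)) \<partial>lborel) = ennreal (a powr (\<beta> - 2 + 1) / (\<beta> - 2 + 1))"
      using assms a by (intro nn_integral_powr_from_0) auto
    moreover have "(\<integral>\<^sup>+s. ennreal (indicator {a..} s * s powr (-2)) \<partial>lborel) = ennreal (- (a powr (-2 + 1)) / (-2 + 1))"
      using a by (intro nn_integral_powr_to_inf) auto
    ultimately show ?thesis
      by (subst nn_integral_add) (simp_all add: nn_integral_cmult)
  qed
  also have "\<dots> = ennreal (N * (a powr (\<beta> - 1) / (\<beta> - 1)) + 2 * a powr (- 1))"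
  proof -
    have 1: "ennreal N * ennreal (a powr (\<beta> - 1) / (\<beta> - 1)) = ennreal (N * (a powr (\<beta> - 1) / (\<beta> - 1)))"
      by (rule ennreal_mult'[symmetric]) (use N in simp)
    have 2: "ennreal 2 * ennreal (a powr (- 1)) = ennreal (2 * a powr (- 1))"
      by (rule ennreal_mult'[symmetric]) simp
    show ?thesis unfolding 1 2 by (rule ennreal_plus[symmetric]) (use N assms in auto)
  qed
  also have "N * (a powr (\<beta> - 1) / (\<beta> - 1)) + 2 * a powr (- 1) = (1 / (\<beta> - 1) + 2) * N powr (1 / \<beta>)"
  proof -
    have "a powr (- 1) = N powr (1 / \<beta>)" unfolding a_def by (simp only: powr_powr) simp
    moreover have "N * a powr (\<beta> - 1) = N powr (1 / \<beta>)"
    proof -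
      have "N * a powr (\<beta> - 1) = N powr (1 + - (1 / \<beta>) * (\<beta> - 1))"
        unfolding powr_add using N by (simp add: a_def powr_powr)
      also have "1 + - (1 / \<beta>) * (\<beta> - 1) = 1 / \<beta>" using assms by (simp add: field_simps)
      finally show ?thesis .
    qed
    ultimately show ?thesis by (simp add: algebra_simps)
  qed
  finally show ?thesis .
qed simp

context prob_space
begin

definition cf :: "('a \<Rightarrow> real) \<Rightarrow> complex" where "cf Y = (\<integral>\<omega>. iexp (Y \<omega>) \<partial>M)"

lemma cf_integrable: "Y \<in> borel_measurable M \<Longrightarrow> integrable M (\<lambda>\<omega>. iexp (Y \<omega>))"
  by (rule integrable_iexp) auto

lemma char_eq_cf: "Y \<in> borel_measurable M \<Longrightarrow> char (distr M borel Y) s = cf (\<lambda>\<omega>. s * Y \<omega>)"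
  unfolding char_def cf_def by (subst integral_distr) auto

lemma cf_cong_AE:
  assumes [measurable]: "Y \<in> borel_measurable M" "Z \<in> borel_measurable M" and "AE \<omega> in M. Y \<omega> = Z \<omega>"
  shows "cf Y = cf Z"
  unfolding cf_def
proof (rule integral_cong_AE)
  show "AE \<omega> in M. iexp (Y \<omega>) = iexp (Z \<omega>)" using assms(3) by eventually_elim simp
qed measurable

text \<open>
  Convergence in probability implies convergence of characteristic functions: \<open>|e\<^sup>i\<^sup>y - e\<^sup>i\<^sup>z|\<close> is at most \<open>|y - z|\<close> and at most \<open>2\<close>.
\<close>

lemma norm_cf_diff_le:
  assumes [measurable]: "Y \<in> borel_measurable M" "Z \<in> borel_measurable M" and "e > 0"
  shows "norm (cf Y - cf Z) \<le> e + 2 * measure M {\<omega> \<in> space M. \<bar>Y \<omega> - Z \<omega>\<bar> > e}"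
proof -
  let ?B = "{\<omega> \<in> space M. \<bar>Y \<omega> - Z \<omega>\<bar> > e}"
  have [measurable]: "?B \<in> sets M" by measurable
  have "norm (cf Y - cf Z) = norm (\<integral>\<omega>. iexp (Y \<omega>) - iexp (Z \<omega>) \<partial>M)"
    unfolding cf_def by (subst Bochner_Integration.integral_diff) (auto intro: cf_integrable)
  also have "\<dots> \<le> (\<integral>\<omega>. norm (iexp (Y \<omega>) - iexp (Z \<omega>)) \<partial>M)" by (rule integral_norm_bound)
  also have "\<dots> \<le> (\<integral>\<omega>. e + 2 * indicator ?B \<omega> \<partial>M)"
  proof (rule integral_mono)
    show "integrable M (\<lambda>\<omega>. norm (iexp (Y \<omega>) - iexp (Z \<omega>)))"
      by (intro integrable_norm Bochner_Integration.integrable_diff cf_integrable assms)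
    fix \<omega> assume \<omega>: "\<omega> \<in> space M"
    have 1: "norm (iexp (Y \<omega>) - iexp (Z \<omega>)) \<le> \<bar>Y \<omega> - Z \<omega>\<bar>"
    proof -
      have "iexp (Y \<omega>) - iexp (Z \<omega>) = iexp (Z \<omega>) * (iexp (Y \<omega> - Z \<omega>) - 1)"
        by (simp add: algebra_simps flip: exp_add)
      then show ?thesis using norm_iexp_minus_one_le[of "Y \<omega> - Z \<omega>"] by (simp add: norm_mult)
    qed
    have 2: "norm (iexp (Y \<omega>) - iexp (Z \<omega>)) \<le> 2"
      using norm_triangle_ineq4[of "iexp (Y \<omega>)" "iexp (Z \<omega>)"] by simp
    show "norm (iexp (Y \<omega>) - iexp (Z \<omega>)) \<le> e + 2 * indicator ?B \<omega>"
      using 1 2 \<omega> \<open>e > 0\<close> by (cases "\<omega> \<in> ?B") auto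
  next
    show "integrable M (\<lambda>\<omega>. e + 2 * indicat_real ?B \<omega>)"
      by (intro Bochner_Integration.integrable_add integrable_const integrable_mult_right integrable_real_indicator)
         (auto simp: emeasure_eq_measure)
  qed
  also have "\<dots> = e + 2 * measure M ?B"
    by (subst Bochner_Integration.integral_add)
       (auto simp: prob_space emeasure_eq_measure intro!: integrable_mult_right integrable_real_indicator)
  finally show ?thesis .
qed

lemma tendsto_in_prob_cf:
  assumes "tendsto_in_prob M Y Z"
  shows "(\<lambda>n. cf (\<lambda>\<omega>. s * Y n \<omega>)) \<longlonglongrightarrow> cf (\<lambda>\<omega>. s * Z \<omega>)"
proof (rule LIMSEQ_I)
  fix r :: real assume r: "r > 0"
  have [measurable]: "Y n \<in> borel_measurable M" "Z \<in> borel_measurable M" for n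
    using assms by (auto simp: tendsto_in_prob_def)
  define e where "e = r / 4"
  have e: "e > 0" using r by (simp add: e_def)
  define \<epsilon> where "\<epsilon> = e / (\<bar>s\<bar> + 1)"
  have \<epsilon>: "\<epsilon> > 0" using e by (simp add: \<epsilon>_def)
  have "(\<lambda>n. measure M {\<omega> \<in> space M. \<bar>Y n \<omega> - Z \<omega>\<bar> > \<epsilon>}) \<longlonglongrightarrow> 0"
    using assms \<epsilon> by (auto simp: tendsto_in_prob_def)
  then have "eventually (\<lambda>n. measure M {\<omega> \<in> space M. \<bar>Y n \<omega> - Z \<omega>\<bar> > \<epsilon>} < e) sequentially"
    using e by (intro order_tendstoD)
  then obtain N where N: "\<And>n. n \<ge> N \<Longrightarrow> measure M {\<omega> \<in> space M. \<bar>Y n \<omega> - Z \<omega>\<bar> > \<epsilon>} < e"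
    by (auto simp: eventually_sequentially)
  show "\<exists>no. \<forall>n\<ge>no. norm (cf (\<lambda>\<omega>. s * Y n \<omega>) - cf (\<lambda>\<omega>. s * Z \<omega>)) < r"
  proof (intro exI allI impI)
    fix n assume n: "n \<ge> N"
    have "measure M {\<omega> \<in> space M. \<bar>s * Y n \<omega> - s * Z \<omega>\<bar> > e} \<le> measure M {\<omega> \<in> space M. \<bar>Y n \<omega> - Z \<omega>\<bar> > \<epsilon>}"
    proof (rule finite_measure_mono)
      show "{\<omega> \<in> space M. \<bar>s * Y n \<omega> - s * Z \<omega>\<bar> > e} \<subseteq> {\<omega> \<in> space M. \<bar>Y n \<omega> - Z \<omega>\<bar> > \<epsilon>}"
      proof clarify
        fix \<omega> assume "e < \<bar>s * Y n \<omega> - s * Z \<omega>\<bar>"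
        also have "\<dots> = \<bar>s\<bar> * \<bar>Y n \<omega> - Z \<omega>\<bar>" by (simp add: abs_mult flip: right_diff_distrib)
        also have "\<dots> \<le> (\<bar>s\<bar> + 1) * \<bar>Y n \<omega> - Z \<omega>\<bar>" by (simp add: mult_right_mono)
        finally show "\<epsilon> < \<bar>Y n \<omega> - Z \<omega>\<bar>" by (simp add: \<epsilon>_def field_simps)
      qed
    qed measurable
    also have "\<dots> < e" using N n by simp
    finally have "norm (cf (\<lambda>\<omega>. s * Y n \<omega>) - cf (\<lambda>\<omega>. s * Z \<omega>)) < e + 2 * e"
      using norm_cf_diff_le[of "\<lambda>\<omega>. s * Y n \<omega>" "\<lambda>\<omega>. s * Z \<omega>" e] e by simp
    then show "norm (cf (\<lambda>\<omega>. s * Y n \<omega>) - cf (\<lambda>\<omega>. s * Z \<omega>)) < r" using r by (simp add: e_def)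
  qed
qed

lemma AE_imp_tendsto_in_prob:
  assumes [measurable]: "\<And>n. Y n \<in> borel_measurable M" "Z \<in> borel_measurable M"
    and lim: "AE \<omega> in M. (\<lambda>n. Y n \<omega>) \<longlonglongrightarrow> Z \<omega>"
  shows "tendsto_in_prob M Y Z"
  unfolding tendsto_in_prob_def
proof (intro conjI allI impI)
  fix \<epsilon> :: real assume \<epsilon>: "\<epsilon> > 0"
  have "(\<lambda>n. \<integral>\<omega>. indicator {\<omega> \<in> space M. \<bar>Y n \<omega> - Z \<omega>\<bar> > \<epsilon>} \<omega> \<partial>M) \<longlonglongrightarrow> (\<integral>\<omega>. 0 \<partial>M :: real)"
  proof (rule integral_dominated_convergence[where w="\<lambda>_. 1"])
    show "AE \<omega> in M. (\<lambda>n. indicat_real {\<omega> \<in> space M. \<bar>Y n \<omega> - Z \<omega>\<bar> > \<epsilon>} \<omega>) \<longlonglongrightarrow> 0"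
      using lim
    proof eventually_elim
      case (elim \<omega>)
      then have "eventually (\<lambda>n. dist (Y n \<omega>) (Z \<omega>) < \<epsilon>) sequentially" using \<epsilon> by (rule tendstoD)
      then show ?case
        by (intro tendsto_eventually) (auto elim!: eventually_mono simp: dist_real_def)
    qed
  qed (auto simp: indicator_def)
  then show "(\<lambda>n. measure M {\<omega> \<in> space M. \<bar>Y n \<omega> - Z \<omega>\<bar> > \<epsilon>}) \<longlonglongrightarrow> 0" by simp
qed (use assms in auto)

lemma tendsto_in_prob_lincomb:
  assumes Y: "tendsto_in_prob M Y Z" and Y': "tendsto_in_prob M Y' Z'"
  shows "tendsto_in_prob M (\<lambda>n \<omega>. a * Y n \<omega> + Y' n \<omega>) (\<lambda>\<omega>. a * Z \<omega> + Z' \<omega>)"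
  unfolding tendsto_in_prob_def
proof (intro conjI allI impI)
  have [measurable]: "Y n \<in> borel_measurable M" "Z \<in> borel_measurable M" "Y' n \<in> borel_measurable M" "Z' \<in> borel_measurable M" for n
    using assms by (auto simp: tendsto_in_prob_def)
  show "(\<lambda>\<omega>. a * Y n \<omega> + Y' n \<omega>) \<in> borel_measurable M" "(\<lambda>\<omega>. a * Z \<omega> + Z' \<omega>) \<in> borel_measurable M" for n
    by measurable
  fix \<epsilon> :: real assume \<epsilon>: "\<epsilon> > 0"
  define \<delta> where "\<delta> = \<epsilon> / 2 / (\<bar>a\<bar> + 1)"
  have \<delta>: "\<delta> > 0" using \<epsilon> by (simp add: \<delta>_def)
  let ?b = "\<lambda>n. measure M {\<omega> \<in> space M. \<bar>Y n \<omega> - Z \<omega>\<bar> > \<delta>} + measure M {\<omega> \<in> space M. \<bar>Y' n \<omega> - Z' \<omega>\<bar> > \<epsilon> / 2}"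
  have "(\<lambda>n. measure M {\<omega> \<in> space M. \<bar>Y n \<omega> - Z \<omega>\<bar> > \<delta>}) \<longlonglongrightarrow> 0"
    using Y \<delta> unfolding tendsto_in_prob_def by blast
  moreover have "(\<lambda>n. measure M {\<omega> \<in> space M. \<bar>Y' n \<omega> - Z' \<omega>\<bar> > \<epsilon> / 2}) \<longlonglongrightarrow> 0"
    using Y' half_gt_zero[OF \<epsilon>] unfolding tendsto_in_prob_def by blast
  ultimately have lim: "?b \<longlonglongrightarrow> 0 + 0" by (rule tendsto_add)
  have bd: "measure M {\<omega> \<in> space M. \<bar>a * Y n \<omega> + Y' n \<omega> - (a * Z \<omega> + Z' \<omega>)\<bar> > \<epsilon>} \<le> ?b n" for n
  proof -
    have "{\<omega> \<in> space M. \<bar>a * Y n \<omega> + Y' n \<omega> - (a * Z \<omega> + Z' \<omega>)\<bar> > \<epsilon>} \<subseteq> {\<omega> \<in> space M. \<bar>Y n \<omega> - Z \<omega>\<bar> > \<delta>} \<union> {\<omega> \<in> space M. \<bar>Y' n \<omega> - Z' \<omega>\<bar> > \<epsilon> / 2}"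
    proof clarify
      fix \<omega> assume 1: "\<epsilon> < \<bar>a * Y n \<omega> + Y' n \<omega> - (a * Z \<omega> + Z' \<omega>)\<bar>" and 2: "\<not> \<epsilon> / 2 < \<bar>Y' n \<omega> - Z' \<omega>\<bar>"
      have "a * Y n \<omega> + Y' n \<omega> - (a * Z \<omega> + Z' \<omega>) = a * (Y n \<omega> - Z \<omega>) + (Y' n \<omega> - Z' \<omega>)" by (simp add: algebra_simps)
      then have "\<bar>a * Y n \<omega> + Y' n \<omega> - (a * Z \<omega> + Z' \<omega>)\<bar> \<le> \<bar>a\<bar> * \<bar>Y n \<omega> - Z \<omega>\<bar> + \<bar>Y' n \<omega> - Z' \<omega>\<bar>"
        by (metis abs_mult abs_triangle_ineq)
      also have "\<dots> \<le> (\<bar>a\<bar> + 1) * \<bar>Y n \<omega> - Z \<omega>\<bar> + \<bar>Y' n \<omega> - Z' \<omega>\<bar>" by (simp add: mult_right_mono)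
      finally have "\<epsilon> / 2 < (\<bar>a\<bar> + 1) * \<bar>Y n \<omega> - Z \<omega>\<bar>" using 1 2 by linarith
      then show "\<delta> < \<bar>Y n \<omega> - Z \<omega>\<bar>" by (simp add: \<delta>_def field_simps)
    qed
    then have "measure M {\<omega> \<in> space M. \<bar>a * Y n \<omega> + Y' n \<omega> - (a * Z \<omega> + Z' \<omega>)\<bar> > \<epsilon>} \<le> measure M ({\<omega> \<in> space M. \<bar>Y n \<omega> - Z \<omega>\<bar> > \<delta>} \<union> {\<omega> \<in> space M. \<bar>Y' n \<omega> - Z' \<omega>\<bar> > \<epsilon> / 2})"
      by (rule finite_measure_mono) measurable
    also have "\<dots> \<le> ?b n" by (rule measure_subadditive) auto
    finally show ?thesis .
  qed
  show "(\<lambda>n. measure M {\<omega> \<in> space M. \<bar>a * Y n \<omega> + Y' n \<omega> - (a * Z \<omega> + Z' \<omega>)\<bar> > \<epsilon>}) \<longlonglongrightarrow> 0"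
  proof (rule tendsto_sandwich[OF _ _ tendsto_const])
    show "?b \<longlonglongrightarrow> 0" using lim by (simp only: add_0_right)
  qed (rule always_eventually, rule allI, rule measure_nonneg bd)+
qed

text \<open>
  Tonelli's theorem and the two preceding integrals, since \<open>1 - Re cf(s Y)\<close> is the expectation of \<open>1 - cos(s Y)\<close>
  and never exceeds \<open>2\<close>.
\<close>

lemma L1_bound_cf:
  assumes [measurable]: "Y \<in> borel_measurable M" and \<beta>: "1 < \<beta>" and N: "N \<ge> 0"
    and cf: "\<And>s. s > 0 \<Longrightarrow> 1 - Re (cf (\<lambda>\<omega>. s * Y \<omega>)) \<le> N * s powr \<beta>"
  shows "(\<integral>\<^sup>+\<omega>. ennreal \<bar>Y \<omega>\<bar> \<partial>M) \<le> ennreal (3 * (1 / (\<beta> - 1) + 2) * N powr (1 / \<beta>))"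
proof -
  interpret P: pair_sigma_finite M lborel by unfold_locales
  have inner: "(\<integral>\<^sup>+\<omega>. ennreal (1 - cos (s * Y \<omega>)) \<partial>M) = ennreal (1 - Re (cf (\<lambda>\<omega>. s * Y \<omega>)))" for s
  proof -
    have i: "integrable M (\<lambda>\<omega>. iexp (s * Y \<omega>))" by (rule cf_integrable) measurable
    have "(\<integral>\<^sup>+\<omega>. ennreal (1 - cos (s * Y \<omega>)) \<partial>M) = ennreal (\<integral>\<omega>. 1 - cos (s * Y \<omega>) \<partial>M)"
      by (intro nn_integral_eq_integral integrable_const_bound[where B=2])
         (auto simp: abs_le_iff intro!: AE_I2 order_trans[OF cos_ge_minus_one])
    also have "(\<integral>\<omega>. 1 - cos (s * Y \<omega>) \<partial>M) = (\<integral>\<omega>. 1 - Re (iexp (s * Y \<omega>)) \<partial>M)" by (simp add: Re_exp)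
    also have "\<dots> = 1 - (\<integral>\<omega>. Re (iexp (s * Y \<omega>)) \<partial>M)"
      by (subst Bochner_Integration.integral_diff) (simp_all only: integrable_Re[OF i] integrable_const lebesgue_integral_const prob_space scaleR_one)
    also have "(\<integral>\<omega>. Re (iexp (s * Y \<omega>)) \<partial>M) = Re (cf (\<lambda>\<omega>. s * Y \<omega>))"
      unfolding cf_def by (rule integral_Re[OF i])
    finally show ?thesis .
  qed
  have "ennreal (1 / 3) * (\<integral>\<^sup>+\<omega>. ennreal \<bar>Y \<omega>\<bar> \<partial>M) = (\<integral>\<^sup>+\<omega>. ennreal (\<bar>Y \<omega>\<bar> / 3) \<partial>M)"
    by (subst nn_integral_cmult[symmetric]) (auto simp: ennreal_mult'[symmetric])
  also have "\<dots> \<le> (\<integral>\<^sup>+\<omega>. \<integral>\<^sup>+s. ennreal (indicator {0<..} s * ((1 - cos (s * Y \<omega>)) / s\<^sup>2)) \<partial>lborel \<partial>M)"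
    by (intro nn_integral_mono abs_le_cosine_integral)
  also have "\<dots> = (\<integral>\<^sup>+s. \<integral>\<^sup>+\<omega>. ennreal (indicator {0<..} s * ((1 - cos (s * Y \<omega>)) / s\<^sup>2)) \<partial>M \<partial>lborel)"
    by (rule P.Fubini'[symmetric]) measurable
  also have "\<dots> \<le> (\<integral>\<^sup>+s. ennreal (indicator {0<..} s * (min 2 (N * s powr \<beta>) / s\<^sup>2)) \<partial>lborel)"
  proof (intro nn_integral_mono)
    fix s :: real
    show "(\<integral>\<^sup>+\<omega>. ennreal (indicator {0<..} s * ((1 - cos (s * Y \<omega>)) / s\<^sup>2)) \<partial>M) \<le> ennreal (indicator {0<..} s * (min 2 (N * s powr \<beta>) / s\<^sup>2))"
    proof (cases "s > 0")
      case True
      have "(\<integral>\<^sup>+\<omega>. ennreal (indicator {0<..} s * ((1 - cos (s * Y \<omega>)) / s\<^sup>2)) \<partial>M) = (\<integral>\<^sup>+\<omega>. ennreal (1 / s\<^sup>2) * ennreal (1 - cos (s * Y \<omega>)) \<partial>M)"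
        using True by (simp add: ennreal_mult'[symmetric])
      also have "\<dots> = ennreal (1 / s\<^sup>2) * ennreal (1 - Re (cf (\<lambda>\<omega>. s * Y \<omega>)))"
        by (subst nn_integral_cmult) (simp_all add: inner)
      also have "\<dots> \<le> ennreal (1 / s\<^sup>2) * ennreal (min 2 (N * s powr \<beta>))"
      proof (intro mult_left_mono ennreal_leI)
        have "norm (cf (\<lambda>\<omega>. s * Y \<omega>)) \<le> 1"
        proof -
          have "norm (cf (\<lambda>\<omega>. s * Y \<omega>)) \<le> (\<integral>\<omega>. norm (iexp (s * Y \<omega>)) \<partial>M)" unfolding cf_def by (rule integral_norm_bound)
          then show ?thesis by (simp add: prob_space del: of_real_mult)
        qed
        then have "\<bar>Re (cf (\<lambda>\<omega>. s * Y \<omega>))\<bar> \<le> 1" using abs_Re_le_cmod order_trans by blast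
        then show "1 - Re (cf (\<lambda>\<omega>. s * Y \<omega>)) \<le> min 2 (N * s powr \<beta>)" using cf[OF True] by auto
      qed simp
      also have "\<dots> = ennreal (min 2 (N * s powr \<beta>) / s\<^sup>2)" by (simp add: ennreal_mult'[symmetric])
      finally show ?thesis using True by simp
    qed simp
  qed
  also have "\<dots> \<le> ennreal ((1 / (\<beta> - 1) + 2) * N powr (1 / \<beta>))"
    by (rule truncated_powr_integral[OF \<beta> N])
  finally have le: "ennreal (1 / 3) * (\<integral>\<^sup>+\<omega>. ennreal \<bar>Y \<omega>\<bar> \<partial>M) \<le> ennreal ((1 / (\<beta> - 1) + 2) * N powr (1 / \<beta>))" .
  have "(\<integral>\<^sup>+\<omega>. ennreal \<bar>Y \<omega>\<bar> \<partial>M) = (ennreal 3 * ennreal (1 / 3)) * (\<integral>\<^sup>+\<omega>. ennreal \<bar>Y \<omega>\<bar> \<partial>M)"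
    by (subst ennreal_mult'[symmetric]) auto
  also have "\<dots> = ennreal 3 * (ennreal (1 / 3) * (\<integral>\<^sup>+\<omega>. ennreal \<bar>Y \<omega>\<bar> \<partial>M))" by (simp only: mult.assoc)
  also have "\<dots> \<le> ennreal 3 * ennreal ((1 / (\<beta> - 1) + 2) * N powr (1 / \<beta>))" by (intro mult_left_mono le) simp
  also have "\<dots> = ennreal (3 * (1 / (\<beta> - 1) + 2) * N powr (1 / \<beta>))" by (subst ennreal_mult'[symmetric]) (simp_all only: mult.assoc zero_le_numeral)
  finally show ?thesis .
qed

end

section \<open>Independently scattered random measures\<close>

text \<open>
  The bound with \<open>C\<close> makes \<open>L\<^sup>\<beta>(m)\<close> a space of integrands. The bound with \<open>D\<close> says that the values of \<open>\<kappa>\<close> lie in a sector around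
  the negative axis, so that \<open>|cf|\<close>, which only sees the real part, controls \<open>\<kappa>\<close> itself.
\<close>

locale random_measure = prob_space M for M :: "'w measure" +
  fixes \<Omega> :: "'e set" and S :: "'e set set" and m :: "'e measure" and \<Lambda> :: "'e set \<Rightarrow> 'w \<Rightarrow> real"
    and \<kappa> :: "real \<Rightarrow> complex" and \<beta> C D :: real
  assumes ring: "exhausting_delta_ring \<Omega> S" and S_m: "S \<subseteq> sets m" and null: "AE x in m. x \<in> \<Omega>"
    and scattered: "independently_scattered M S \<Lambda>" and cumulant: "has_cumulant_measure M S \<Lambda> m \<kappa>"
    and \<kappa>_cont: "continuous_on UNIV \<kappa>" and \<beta>: "1 < \<beta>" "\<beta> < 2"
    and C: "C > 0" "\<And>s. norm (\<kappa> s) \<le> C * \<bar>s\<bar> powr \<beta>"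
    and D: "D > 0" "\<And>s. norm (\<kappa> s) \<le> D * (- Re (\<kappa> s))"
begin

sublocale S: ring_of_sets \<Omega> S using ring by (simp add: exhausting_delta_ring_def)

lemma S_INT: "range A \<subseteq> S \<Longrightarrow> (\<Inter>n::nat. A n) \<in> S"
  using ring by (auto simp: exhausting_delta_ring_def)

lemma \<kappa>_0[simp]: "\<kappa> 0 = 0" using C(2)[of 0] by simp

lemma \<kappa>_meas[measurable]: "\<kappa> \<in> borel_measurable borel"
  using \<kappa>_cont by (rule borel_measurable_continuous_onI)

lemma Re_\<kappa>_le: "Re (\<kappa> s) \<le> 0"
proof -
  have "0 \<le> D * (- Re (\<kappa> s))" using D(2)[of s] norm_ge_zero order_trans by blast
  then show ?thesis using D(1) by (simp add: mult_le_0_iff)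
qed

lemma \<Lambda>_meas[measurable]: "A \<in> S \<Longrightarrow> \<Lambda> A \<in> borel_measurable M"
  using scattered by (auto simp: independently_scattered_def)

text \<open>
  A ring closed under countable intersections is an ideal in the sigma-algebra that it generates.
\<close>

lemma S_Int: "A \<in> sigma_sets \<Omega> S \<Longrightarrow> B \<in> S \<Longrightarrow> A \<inter> B \<in> S"
proof (induction arbitrary: B rule: sigma_sets.induct)
  case (Basic a)
  then show ?case by auto
next
  case Empty
  then show ?case by auto
next
  case (Compl a)
  have "(\<Omega> - a) \<inter> B = B - a \<inter> B" using S.sets_into_space[OF Compl.prems] by auto
  then show ?case using Compl by auto
next
  case (Union a)
  have eq: "(\<Union>i. a i) \<inter> B = B - (\<Inter>i. B - a i \<inter> B)" by auto
  have "(\<Inter>i. B - a i \<inter> B) \<in> S" using Union by (intro S_INT) auto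
  then have "B - (\<Inter>i. B - a i \<inter> B) \<in> S" by (rule S.Diff[OF Union.prems])
  then show ?case by (simp only: eq)
qed

lemma \<Omega>_sigma: "\<Omega> \<in> sigma_sets \<Omega> S" by (rule sigma_sets_top)

lemma \<Omega>_m: "\<Omega> \<in> sets m"
proof -
  obtain A :: "nat \<Rightarrow> 'e set" where "range A \<subseteq> S" "(\<Union>n. A n) = \<Omega>"
    using ring by (auto simp: exhausting_delta_ring_def)
  then show ?thesis using S_m by (metis sets.countable_UN subset_trans)
qed

lemma sigma_m: "A \<in> sigma_sets \<Omega> S \<Longrightarrow> A \<in> sets m"
  by (induction rule: sigma_sets.induct) (use S_m \<Omega>_m in auto)

lemma sigma_sub: "A \<in> sigma_sets \<Omega> S \<Longrightarrow> A \<subseteq> \<Omega>"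
  using sigma_sets_into_sp[OF S.space_closed] by blast

abbreviation "\<Sigma> \<equiv> sigma \<Omega> S"

lemma sets_\<Sigma>[simp]: "sets \<Sigma> = sigma_sets \<Omega> S" using S.space_closed by simp
lemma space_\<Sigma>[simp]: "space \<Sigma> = \<Omega>" using S.space_closed by (rule space_measure_of)

lemma \<Lambda>_empty: "AE \<omega> in M. \<Lambda> {} \<omega> = 0"
proof -
  have "AE \<omega> in M. (\<lambda>n::nat. \<Lambda> {} \<omega>) sums \<Lambda> {} \<omega>"
    using scattered unfolding independently_scattered_def
    by (auto dest!: spec[of _ "\<lambda>_::nat. {}"] simp: disjoint_family_on_def)
  then show ?thesis
    by eventually_elim (auto dest!: sums_summable simp: summable_const_iff)
qed

text \<open>
  Independence and additivity are assumed for sequences only; a finite disjoint family becomes a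
  sequence by appending empty sets, whose values vanish almost surely.
\<close>

lemma enumerate_disjoint:
  fixes Q :: "'j \<Rightarrow> 'e set"
  assumes J: "finite J" and DS: "\<And>j. j \<in> J \<Longrightarrow> Q j \<in> S" and disj: "disjoint_family_on Q J"
  obtains h where "bij_betw h {..<card J} J" 
    "indep_vars (\<lambda>_. borel) (\<lambda>k. \<Lambda> (Q (h k))) {..<card J}"
    "AE \<omega> in M. \<Lambda> (\<Union>j\<in>J. Q j) \<omega> = (\<Sum>j\<in>J. \<Lambda> (Q j) \<omega>)"
proof -
  obtain h where h: "bij_betw h {..<card J} J"
    using ex_bij_betw_nat_finite[OF J] by (auto simp: lessThan_atLeast0)
  define A where "A = (\<lambda>k. if k < card J then Q (h k) else {})"
  have hJ: "h k \<in> J" if "k < card J" for k using h that by (auto simp: bij_betw_def)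
  have A: "range A \<subseteq> S" using DS hJ by (auto simp: A_def)
  have dA: "disjoint_family A"
  proof (unfold disjoint_family_on_def, intro ballI impI)
    fix k l :: nat assume "k \<noteq> l"
    then show "A k \<inter> A l = {}"
    proof (cases "k < card J \<and> l < card J")
      case True
      then have "h k \<noteq> h l" using h \<open>k \<noteq> l\<close> by (auto simp: bij_betw_def inj_on_def)
      then show ?thesis using disj hJ True by (simp add: A_def disjoint_family_on_def)
    qed (auto simp: A_def)
  qed
  have UA: "(\<Union>k. A k) = (\<Union>j\<in>J. Q j)"
    using h by (auto simp: A_def bij_betw_def) (metis imageE lessThan_iff)
  have "(\<Union>j\<in>J. Q j) \<in> S" using J DS by auto
  then have 1: "indep_vars (\<lambda>_. borel) (\<lambda>k. \<Lambda> (A k)) UNIV" and 2: "AE \<omega> in M. (\<lambda>k. \<Lambda> (A k) \<omega>) sums \<Lambda> (\<Union>j\<in>J. Q j) \<omega>"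
    using scattered A dA unfolding independently_scattered_def UA[symmetric] by blast+
  have "indep_vars (\<lambda>_. borel) (\<lambda>k. \<Lambda> (A k)) {..<card J}"
    by (rule indep_vars_subset[OF 1]) simp
  then have i: "indep_vars (\<lambda>_. borel) (\<lambda>k. \<Lambda> (Q (h k))) {..<card J}"
    by (rule indep_vars_cong[THEN iffD1, rotated -1]) (auto simp: A_def)
  from 2 \<Lambda>_empty have a: "AE \<omega> in M. \<Lambda> (\<Union>j\<in>J. Q j) \<omega> = (\<Sum>j\<in>J. \<Lambda> (Q j) \<omega>)"
  proof eventually_elim
    case (elim \<omega>)
    have "(\<lambda>k. \<Lambda> (A k) \<omega>) sums (\<Sum>k<card J. \<Lambda> (A k) \<omega>)"
      using elim(2) by (intro sums_finite) (auto simp: A_def)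
    with elim(1) have "\<Lambda> (\<Union>j\<in>J. Q j) \<omega> = (\<Sum>k<card J. \<Lambda> (A k) \<omega>)" by (rule sums_unique2)
    also have "\<dots> = (\<Sum>k<card J. \<Lambda> (Q (h k)) \<omega>)" by (simp add: A_def)
    also have "\<dots> = (\<Sum>j\<in>J. \<Lambda> (Q j) \<omega>)" by (rule sum.reindex_bij_betw[OF h])
    finally show ?case .
  qed
  show ?thesis by (rule that[OF h i a])
qed

lemma finitely_additive:
  fixes Q :: "'j \<Rightarrow> 'e set"
  assumes "finite J" "\<And>j. j \<in> J \<Longrightarrow> Q j \<in> S" "disjoint_family_on Q J"
  shows "AE \<omega> in M. \<Lambda> (\<Union>j\<in>J. Q j) \<omega> = (\<Sum>j\<in>J. \<Lambda> (Q j) \<omega>)"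
  using enumerate_disjoint[OF assms] by blast

lemma cf_single:
  assumes "A \<in> S" "emeasure m A < \<infinity>"
  shows "cf (\<lambda>\<omega>. s * \<Lambda> A \<omega>) = exp (of_real (measure m A) * \<kappa> s)"
  using cumulant assms char_eq_cf[OF \<Lambda>_meas[OF assms(1)], of s]
  by (auto simp: has_cumulant_measure_def has_cumulant_def)

lemma cf_disjoint_sum:
  fixes Q :: "'j \<Rightarrow> 'e set"
  assumes J: "finite J" and DS: "\<And>j. j \<in> J \<Longrightarrow> Q j \<in> S" and disj: "disjoint_family_on Q J"
    and fin: "\<And>j. j \<in> J \<Longrightarrow> emeasure m (Q j) < \<infinity>"
  shows "cf (\<lambda>\<omega>. \<Sum>j\<in>J. c j * \<Lambda> (Q j) \<omega>) = exp (\<Sum>j\<in>J. of_real (measure m (Q j)) * \<kappa> (c j))"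
proof -
  obtain h where h: "bij_betw h {..<card J} J" "indep_vars (\<lambda>_. borel) (\<lambda>k. \<Lambda> (Q (h k))) {..<card J}"
    using enumerate_disjoint[OF J DS disj] by blast
  have hJ: "h k \<in> J" if "k < card J" for k using h(1) that by (auto simp: bij_betw_def)
  have i: "indep_vars (\<lambda>_. borel) (\<lambda>k \<omega>. c (h k) * \<Lambda> (Q (h k)) \<omega>) {..<card J}"
    using h(2) by (rule indep_vars_compose2) simp
  have eq: "(\<lambda>\<omega>. \<Sum>j\<in>J. c j * \<Lambda> (Q j) \<omega>) = (\<lambda>\<omega>. \<Sum>k<card J. c (h k) * \<Lambda> (Q (h k)) \<omega>)"
    by (rule ext, rule sum.reindex_bij_betw[OF h(1), symmetric])
  have Dm[measurable]: "\<Lambda> (Q (h k)) \<in> borel_measurable M" if "k < card J" for k using DS hJ that by auto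
  have "cf (\<lambda>\<omega>. \<Sum>j\<in>J. c j * \<Lambda> (Q j) \<omega>) = char (distr M borel (\<lambda>\<omega>. \<Sum>k<card J. c (h k) * \<Lambda> (Q (h k)) \<omega>)) 1"
    unfolding eq by (subst char_eq_cf) auto
  also have "\<dots> = (\<Prod>k<card J. char (distr M borel (\<lambda>\<omega>. c (h k) * \<Lambda> (Q (h k)) \<omega>)) 1)"
    by (rule char_distr_sum[OF i])
  also have "\<dots> = (\<Prod>k<card J. exp (of_real (measure m (Q (h k))) * \<kappa> (c (h k))))"
    using DS fin hJ by (intro prod.cong) (auto simp: char_eq_cf cf_single)
  also have "\<dots> = (\<Prod>j\<in>J. exp (of_real (measure m (Q j)) * \<kappa> (c j)))"
    by (rule prod.reindex_bij_betw[OF h(1)])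
  also have "\<dots> = exp (\<Sum>j\<in>J. of_real (measure m (Q j)) * \<kappa> (c j))" by (rule exp_sum[OF J, symmetric])
  finally show ?thesis .
qed

text \<open>
  The cumulants are known on sets of finite measure only, whereas an integral may be approximated by simple
  functions over any sets of the ring. An integrable \<open>f\<close> without zeros cuts \<open>B\<close> into countably many pieces of
  finite measure. If their measures added up to infinity, the characteristic function of \<open>\<Lambda> B\<close>, being a limit of
  \<open>exp(m\<^sub>n \<kappa>(s))\<close> with \<open>m\<^sub>n \<rightarrow> \<infinity>\<close>, would vanish at all \<open>s \<noteq> 0\<close> and so be discontinuous at the origin.
\<close>

lemma finite_measure_on_S:
  assumes neg: "\<And>s. s \<noteq> 0 \<Longrightarrow> Re (\<kappa> s) < 0"
    and f: "f \<in> borel_measurable \<Sigma>" "AE x in m. f x \<noteq> 0" "(\<integral>\<^sup>+x\<in>\<Omega>. ennreal (\<bar>f x\<bar> powr \<beta>) \<partial>m) < \<infinity>"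
    and B: "B \<in> S"
  shows "emeasure m B < \<infinity>"
proof (rule ccontr)
  assume "\<not> emeasure m B < \<infinity>"
  then have inf: "emeasure m B = \<infinity>" using less_top[of "emeasure m B"] by auto
  define E where "E = (\<lambda>n::nat. {x\<in>\<Omega>. \<bar>f x\<bar> > inverse (real (Suc n))})"
  have E\<Sigma>: "E n \<in> sigma_sets \<Omega> S" for n
  proof -
    have "{x\<in>space \<Sigma>. \<bar>f x\<bar> > inverse (real (Suc n))} \<in> sets \<Sigma>" using f(1) by measurable
    then show ?thesis unfolding E_def by simp
  qed
  have E_inc: "E i \<subseteq> E j" if "i \<le> j" for i j
  proof -
    have "inverse (real (Suc j)) \<le> inverse (real (Suc i))" using that by (intro le_imp_inverse_le) auto
    from le_less_trans[OF this] show ?thesis unfolding E_def by blast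
  qed
  have Efin: "emeasure m (E n) < \<infinity>" for n
  proof -
    let ?c = "inverse (real (Suc n)) powr \<beta>"
    have c: "?c > 0" by simp
    have "ennreal ?c * emeasure m (E n) = (\<integral>\<^sup>+x. ennreal ?c * indicator (E n) x \<partial>m)"
      using sigma_m[OF E\<Sigma>] by (simp add: nn_integral_cmult_indicator)
    also have "\<dots> \<le> (\<integral>\<^sup>+x\<in>\<Omega>. ennreal (\<bar>f x\<bar> powr \<beta>) \<partial>m)"
    proof (intro nn_integral_mono)
      fix x
      have "?c \<le> \<bar>f x\<bar> powr \<beta>" if "x \<in> E n"
        using that \<beta> by (intro powr_mono2) (auto simp: E_def)
      then show "ennreal ?c * indicator (E n) x \<le> ennreal (\<bar>f x\<bar> powr \<beta>) * indicator \<Omega> x"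
        by (auto simp: indicator_def E_def ennreal_leI)
    qed
    finally have "ennreal ?c * emeasure m (E n) < \<infinity>" using f(3) by (rule le_less_trans)
    then show ?thesis using c by (auto simp: ennreal_mult_less_top less_top)
  qed
  \<comment> \<open>Piece number zero collects the zeros of \<open>f\<close> and is a null set.\<close>
  define G where "G = (\<lambda>n. case n of 0 \<Rightarrow> B - (\<Union>k. E k) \<inter> B | Suc k \<Rightarrow> disjointed E k \<inter> B)"
  have disE: "disjointed E k \<in> sigma_sets \<Omega> S" for k
    using sets.range_disjointed_sets[of E \<Sigma>] E\<Sigma> by auto
  have G_S: "G n \<in> S" for n
  proof (cases n)
    case 0
    have "(\<Union>k. E k) \<in> sigma_sets \<Omega> S" using E\<Sigma> by (intro sigma_sets.Union) 
    then show ?thesis using 0 B S_Int by (auto simp: G_def)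
  next
    case (Suc k)
    then show ?thesis using S_Int[OF disE B] by (simp add: G_def)
  qed
  have G_disj: "disjoint_family G"
    unfolding disjoint_family_on_def
  proof (intro ballI impI)
    fix i j :: nat assume "i \<noteq> j"
    have dd: "disjointed E a \<inter> disjointed E b = {}" if "a \<noteq> b" for a b
      using disjoint_family_disjointed[of E] that by (simp add: disjoint_family_on_def)
    have g0: "G 0 \<inter> disjointed E a = {}" for a using disjointed_subset[of E a] by (auto simp: G_def)
    have gs: "G (Suc a) \<subseteq> disjointed E a" for a by (simp add: G_def)
    show "G i \<inter> G j = {}"
    proof (cases i)
      case 0
      then obtain b where "j = Suc b" using \<open>i \<noteq> j\<close> by (cases j) auto
      then show ?thesis using g0[of b] gs[of b] 0 by blast
    next
      case (Suc a)
      show ?thesis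
      proof (cases j)
        case 0
        then show ?thesis using g0[of a] gs[of a] Suc by blast
      next
        case j: (Suc b)
        then have "a \<noteq> b" using \<open>i \<noteq> j\<close> Suc by simp
        then show ?thesis using dd[of a b] gs[of a] gs[of b] Suc j by blast
      qed
    qed
  qed
  have G_Un: "(\<Union>n. G n) = B"
  proof -
    have "(\<Union>n. G n) = G 0 \<union> (\<Union>k. G (Suc k))"
    proof -
      have "(\<Union>n. G n) = (\<Union>n\<in>insert 0 (range Suc). G n)" by (simp only: UNIV_nat_eq[symmetric])
      then show ?thesis by simp
    qed
    also have "(\<Union>k. G (Suc k)) = (\<Union>k. disjointed E k) \<inter> B" by (auto simp: G_def)
    also have "\<dots> = (\<Union>k. E k) \<inter> B" by (simp add: UN_disjointed_eq)
    finally show ?thesis by (auto simp: G_def)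
  qed
  have G_fin: "emeasure m (G n) < \<infinity>" for n
  proof (cases n)
    case 0
    have "AE x in m. x \<notin> G 0" using f(2) null
    proof eventually_elim
      case (elim x)
      then obtain n where "inverse (real (Suc n)) < \<bar>f x\<bar>" using reals_Archimedean[of "\<bar>f x\<bar>"] by auto
      then have "x \<in> E n" using elim by (simp add: E_def)
      then show ?case by (auto simp: G_def)
    qed
    then have "emeasure m (G 0) = 0" using G_S[of 0] S_m by (subst (asm) AE_iff_measurable[of "G 0"]) (auto dest: sets.sets_into_space)
    then show ?thesis using 0 by simp
  next
    case (Suc k)
    have "emeasure m (G n) \<le> emeasure m (E k)"
      using Suc disjointed_subset[of E k] sigma_m[OF E\<Sigma>] by (intro emeasure_mono) (auto simp: G_def)
    then show ?thesis using Efin[of k] by (rule le_less_trans)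
  qed
  have "AE \<omega> in M. (\<lambda>n. \<Lambda> (G n) \<omega>) sums \<Lambda> B \<omega>"
  proof -
    have "range G \<subseteq> S \<and> disjoint_family G \<longrightarrow> ((\<Union>n. G n) \<in> S \<longrightarrow> (AE \<omega> in M. (\<lambda>n. \<Lambda> (G n) \<omega>) sums \<Lambda> (\<Union>n. G n) \<omega>))"
      using scattered unfolding independently_scattered_def by blast
    moreover have "range G \<subseteq> S" using G_S by blast
    ultimately show ?thesis using G_disj B unfolding G_Un by blast
  qed
  then have lim: "tendsto_in_prob M (\<lambda>n \<omega>. \<Sum>k<n. \<Lambda> (G k) \<omega>) (\<Lambda> B)"
    using G_S B by (intro AE_imp_tendsto_in_prob) (auto simp: sums_def)
  have "(\<lambda>n. \<Sum>k<n. emeasure m (G k)) \<longlonglongrightarrow> emeasure m B"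
  proof -
    have "(\<Sum>k. emeasure m (G k)) = emeasure m B"
      using suminf_emeasure[of G m] G_S S_m G_disj by (auto simp: G_Un)
    then show ?thesis using summable_LIMSEQ[of "\<lambda>k. emeasure m (G k)"] by simp
  qed
  moreover have "(\<Sum>k<n. emeasure m (G k)) = ennreal (\<Sum>k<n. measure m (G k))" for n
    using G_fin by (simp add: emeasure_eq_ennreal_measure less_top)
  ultimately have "(\<lambda>n. ennreal (\<Sum>k<n. measure m (G k))) \<longlonglongrightarrow> \<infinity>" using inf by simp
  then have m_inf: "filterlim (\<lambda>n. \<Sum>k<n. measure m (G k)) at_top sequentially"
    by (simp add: ennreal_tendsto_top_eq_at_top)
  have zero: "cf (\<lambda>\<omega>. s * \<Lambda> B \<omega>) = 0" if "s \<noteq> 0" for s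
  proof -
    have cfn: "cf (\<lambda>\<omega>. s * (\<Sum>k<n. \<Lambda> (G k) \<omega>)) = exp (of_real (\<Sum>k<n. measure m (G k)) * \<kappa> s)" for n
    proof -
      have "disjoint_family_on G {..<n}" using G_disj by (rule disjoint_family_on_mono[rotated]) simp
      then show ?thesis using cf_disjoint_sum[of "{..<n}" G "\<lambda>_. s"] G_S G_fin
        by (simp add: sum_distrib_left sum_distrib_right)
    qed
    have "filterlim (\<lambda>n. (\<Sum>k<n. measure m (G k)) * Re (\<kappa> s)) at_bot sequentially"
      using filterlim_tendsto_neg_mult_at_bot[OF tendsto_const neg[OF that] m_inf] by (simp only: mult.commute)
    then have "(\<lambda>n. exp ((\<Sum>k<n. measure m (G k)) * Re (\<kappa> s))) \<longlonglongrightarrow> 0"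
      by (rule filterlim_compose[OF exp_at_bot])
    then have "(\<lambda>n. norm (cf (\<lambda>\<omega>. s * (\<Sum>k<n. \<Lambda> (G k) \<omega>)))) \<longlonglongrightarrow> 0" unfolding cfn by simp
    moreover have "(\<lambda>n. norm (cf (\<lambda>\<omega>. s * (\<Sum>k<n. \<Lambda> (G k) \<omega>)))) \<longlonglongrightarrow> norm (cf (\<lambda>\<omega>. s * \<Lambda> B \<omega>))"
      by (intro tendsto_norm tendsto_in_prob_cf lim)
    ultimately have "norm (cf (\<lambda>\<omega>. s * \<Lambda> B \<omega>)) = 0" by (rule LIMSEQ_unique[rotated])
    then show ?thesis by simp
  qed
  interpret B: real_distribution "distr M borel (\<Lambda> B)" using B by (intro real_distribution_distr) simp
  have "(\<lambda>n. char (distr M borel (\<Lambda> B)) (inverse (real (Suc n)))) \<longlonglongrightarrow> char (distr M borel (\<Lambda> B)) 0"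
    by (rule isCont_tendsto_compose[OF B.isCont_char LIMSEQ_inverse_real_of_nat])
  moreover have "char (distr M borel (\<Lambda> B)) (inverse (real (Suc n))) = 0" for n
    using B by (subst char_eq_cf) (auto intro!: zero simp del: of_nat_Suc)
  ultimately have "char (distr M borel (\<Lambda> B)) 0 = 0" by (simp add: LIMSEQ_const_iff)
  then show False by (simp add: B.char_zero)
qed

end

section \<open>Integrals of simple functions\<close>

definition restrict_simple :: "'e set \<Rightarrow> (real \<times> 'e set) list \<Rightarrow> (real \<times> 'e set) list" where
  "restrict_simple A xs = map (\<lambda>(a, B). (a, A \<inter> B)) xs"

definition scale_simple :: "real \<Rightarrow> (real \<times> 'e set) list \<Rightarrow> (real \<times> 'e set) list" where
  "scale_simple c xs = map (\<lambda>(a, B). (c * a, B)) xs"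

lemma simple_val_restrict: "simple_val (restrict_simple A xs) x = indicator A x * simple_val xs x"
  by (induction xs) (auto simp: simple_val_def restrict_simple_def indicator_def algebra_simps)

lemma simple_val_scale: "simple_val (scale_simple c xs) x = c * simple_val xs x"
  by (induction xs) (auto simp: simple_val_def scale_simple_def algebra_simps)

lemma simple_val_append: "simple_val (xs @ ys) x = simple_val xs x + simple_val ys x"
  by (simp add: simple_val_def)

lemma simple_integral_restrict: "simple_integral_on \<Lambda> A' (restrict_simple A xs) \<omega> = simple_integral_on \<Lambda> (A' \<inter> A) xs \<omega>"
  by (induction xs) (auto simp: simple_integral_on_def restrict_simple_def Int_assoc)

lemma simple_integral_scale: "simple_integral_on \<Lambda> A (scale_simple c xs) \<omega> = c * simple_integral_on \<Lambda> A xs \<omega>"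
  by (induction xs) (auto simp: simple_integral_on_def scale_simple_def algebra_simps)

lemma simple_integral_append: "simple_integral_on \<Lambda> A (xs @ ys) \<omega> = simple_integral_on \<Lambda> A xs \<omega> + simple_integral_on \<Lambda> A ys \<omega>"
  by (simp add: simple_integral_on_def)

lemma simple_val_nth: "simple_val xs x = (\<Sum>i<length xs. fst (xs ! i) * indicator (snd (xs ! i)) x)"
  unfolding simple_val_def by (simp add: sum_list_sum_nth case_prod_beta' lessThan_atLeast0)

lemma simple_integral_nth: "simple_integral_on \<Lambda> A xs \<omega> = (\<Sum>i<length xs. fst (xs ! i) * \<Lambda> (A \<inter> snd (xs ! i)) \<omega>)"
  unfolding simple_integral_on_def by (simp add: sum_list_sum_nth case_prod_beta' lessThan_atLeast0)

lemma snd_restrict: "snd ` set xs \<subseteq> S \<Longrightarrow> (\<And>B. B \<in> S \<Longrightarrow> A \<inter> B \<in> S) \<Longrightarrow> snd ` set (restrict_simple A xs) \<subseteq> S"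
  by (auto simp: restrict_simple_def)

lemma snd_scale: "snd ` set (scale_simple c xs) = snd ` set xs"
  by (simp add: scale_simple_def image_image case_prod_beta')

context random_measure
begin

abbreviation "RR \<equiv> has_RR_integral M \<Omega> S m \<Lambda>"

lemma simple_val_meas:
  assumes "snd ` set xs \<subseteq> S"
  shows "simple_val xs \<in> borel_measurable \<Sigma>" "simple_val xs \<in> borel_measurable m"
proof -
  have i: "snd (xs ! i) \<in> S" if "i < length xs" for i using assms nth_mem[OF that] by blast
  have "(\<lambda>x. \<Sum>i<length xs. fst (xs ! i) * indicator (snd (xs ! i)) x) \<in> borel_measurable \<Sigma>"
    using i by (intro borel_measurable_sum borel_measurable_times borel_measurable_const borel_measurable_indicator) auto
  then show "simple_val xs \<in> borel_measurable \<Sigma>" by (simp add: simple_val_nth[abs_def])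
  have "(\<lambda>x. \<Sum>i<length xs. fst (xs ! i) * indicator (snd (xs ! i)) x) \<in> borel_measurable m"
    using i S_m by (intro borel_measurable_sum borel_measurable_times borel_measurable_const borel_measurable_indicator) auto
  then show "simple_val xs \<in> borel_measurable m" by (simp add: simple_val_nth[abs_def])
qed

text \<open>
  An integrand is a limit of simple functions over the ring and hence agrees almost everywhere with a function
  that is measurable with respect to the generated sigma-algebra. This sigma-algebra may be smaller than that of \<open>m\<close>.
\<close>

lemma RR_version:
  assumes "RR f Y" shows "\<exists>f'\<in>borel_measurable \<Sigma>. AE x in m. f x = f' x"
proof -
  obtain \<phi> where \<phi>: "\<And>n. snd ` set (\<phi> n) \<subseteq> S" "AE x in m. (\<lambda>n. simple_val (\<phi> n) x) \<longlonglongrightarrow> f x"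
    using assms unfolding has_RR_integral_def by blast
  have [measurable]: "simple_val (\<phi> n) \<in> borel_measurable \<Sigma>" for n by (rule simple_val_meas(1)[OF \<phi>(1)])
  show ?thesis
  proof (intro bexI[of _ "\<lambda>x. lim (\<lambda>n. simple_val (\<phi> n) x)"])
    show "AE x in m. f x = lim (\<lambda>n. simple_val (\<phi> n) x)"
      using \<phi>(2) by eventually_elim (simp add: limI)
    show "(\<lambda>x. lim (\<lambda>n. simple_val (\<phi> n) x)) \<in> borel_measurable \<Sigma>" by measurable
  qed
qed

end

locale finite_random_measure = random_measure +
  assumes finite_S: "\<And>B. B \<in> S \<Longrightarrow> emeasure m B < \<infinity>"
begin

lemma simple_integral_meas[measurable]:
  assumes "snd ` set xs \<subseteq> S" "A \<in> sigma_sets \<Omega> S"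
  shows "simple_integral_on \<Lambda> A xs \<in> borel_measurable M"
proof -
  have "(\<lambda>\<omega>. \<Sum>i<length xs. fst (xs ! i) * \<Lambda> (A \<inter> snd (xs ! i)) \<omega>) \<in> borel_measurable M"
  proof (intro borel_measurable_sum borel_measurable_times borel_measurable_const \<Lambda>_meas)
    fix i assume "i \<in> {..<length xs}"
    then have "snd (xs ! i) \<in> S" using assms(1) nth_mem[of i xs] by blast
    then show "A \<inter> snd (xs ! i) \<in> S" by (rule S_Int[OF assms(2)])
  qed
  then show ?thesis by (simp add: simple_integral_nth[abs_def])
qed

lemma simple_val_outside:
  assumes "snd ` set xs \<subseteq> S" "x \<notin> \<Omega>" shows "simple_val xs x = 0"
proof -
  have "x \<notin> snd (xs ! i)" if "i < length xs" for i
  proof -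
    have "snd (xs ! i) \<in> S" using assms(1) nth_mem[OF that] by blast
    then show ?thesis using S.sets_into_space assms(2) by blast
  qed
  then show ?thesis by (simp add: simple_val_nth)
qed

text \<open>
  Pass to the atoms of the finite algebra generated by the sets of the list. They are disjoint, the simple function is
  constant on each of them, and the values of \<open>\<Lambda>\<close> on them are independent.
\<close>

lemma cf_simple_aux:
  assumes xs: "snd ` set xs \<subseteq> S"
  shows "cf (simple_integral_on \<Lambda> \<Omega> xs) = exp (\<integral>x. \<kappa> (simple_val xs x) \<partial>m)"
    and "integrable m (\<lambda>x. \<kappa> (simple_val xs x))"
    and "(\<integral>\<^sup>+x. ennreal (\<bar>simple_val xs x\<bar> powr \<beta>) \<partial>m) < \<infinity>"
proof -
  define k where "k = length xs"
  define a where "a = (\<lambda>i. fst (xs ! i))"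
  define B where "B = (\<lambda>i. snd (xs ! i))"
  have BS: "B i \<in> S" if "i < k" for i using xs nth_mem[of i xs] that unfolding B_def k_def by blast
  define I where "I = (\<lambda>x. {i. i < k \<and> x \<in> B i})"
  \<comment> \<open>Atoms are indexed by the set of list positions whose sets contain the given point; off all sets the simple function is zero.\<close>
  define J where "J = Pow {..<k} - {{}}"
  define Q where "Q = (\<lambda>N. {x\<in>\<Omega>. I x = N})"
  have J: "finite J" by (simp add: J_def)
  have QS: "Q N \<in> S" if "N \<in> J" for N
  proof -
    have N: "N \<subseteq> {..<k}" "N \<noteq> {}" "finite N" using that by (auto simp: J_def intro: finite_subset)
    have "Q N = (\<Inter>i\<in>N. B i) - (\<Union>i\<in>{..<k} - N. B i)"
    proof -
      have "x \<in> \<Omega>" if "x \<in> (\<Inter>i\<in>N. B i)" for x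
        using that N BS S.sets_into_space by blast
      then show ?thesis using N by (auto simp: Q_def I_def)
    qed
    moreover have "(\<Inter>i\<in>N. B i) \<in> S" using N BS by (intro S.finite_INT) auto
    moreover have "(\<Union>i\<in>{..<k} - N. B i) \<in> S" using BS by (intro S.finite_UN) auto
    ultimately show ?thesis by auto
  qed
  have Qdisj: "disjoint_family_on Q J'" for J' by (auto simp: disjoint_family_on_def Q_def)
  have Qfin: "emeasure m (Q N) < \<infinity>" if "N \<in> J" for N using finite_S QS that by blast
  have BQ: "B i = (\<Union>N\<in>{N\<in>J. i \<in> N}. Q N)" if "i < k" for i
  proof -
    have "x \<in> \<Omega>" if "x \<in> B i" for x using that BS[OF \<open>i < k\<close>] S.sets_into_space by blast
    then show ?thesis using that by (auto simp: Q_def I_def J_def)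
  qed
  have "AE \<omega> in M. \<forall>i\<in>{..<k}. \<Lambda> (B i) \<omega> = (\<Sum>N\<in>{N\<in>J. i \<in> N}. \<Lambda> (Q N) \<omega>)"
  proof (rule AE_finite_allI[OF finite_lessThan])
    fix i assume "i \<in> {..<k}"
    then have "B i = (\<Union>N\<in>{N\<in>J. i \<in> N}. Q N)" by (intro BQ) simp
    then show "AE \<omega> in M. \<Lambda> (B i) \<omega> = (\<Sum>N\<in>{N\<in>J. i \<in> N}. \<Lambda> (Q N) \<omega>)"
      using finitely_additive[of "{N\<in>J. i \<in> N}" Q] J QS Qdisj by auto
  qed
  then have "AE \<omega> in M. simple_integral_on \<Lambda> \<Omega> xs \<omega> = (\<Sum>N\<in>J. (\<Sum>i\<in>N. a i) * \<Lambda> (Q N) \<omega>)"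
  proof eventually_elim
    case (elim \<omega>)
    have "simple_integral_on \<Lambda> \<Omega> xs \<omega> = (\<Sum>i<k. a i * \<Lambda> (B i) \<omega>)"
      unfolding simple_integral_nth k_def[symmetric] a_def B_def
      using BS S.sets_into_space unfolding B_def by (intro sum.cong) (auto simp: Int_absorb1)
    also have "\<dots> = (\<Sum>i<k. \<Sum>N\<in>J. if i \<in> N then a i * \<Lambda> (Q N) \<omega> else 0)"
      using elim J by (intro sum.cong) (auto simp: sum_distrib_left sum.If_cases Int_def)
    also have "\<dots> = (\<Sum>N\<in>J. \<Sum>i<k. if i \<in> N then a i * \<Lambda> (Q N) \<omega> else 0)" by (rule sum.swap)
    also have "\<dots> = (\<Sum>N\<in>J. (\<Sum>i\<in>N. a i) * \<Lambda> (Q N) \<omega>)"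
    proof (intro sum.cong refl)
      fix N assume "N \<in> J"
      then have "{..<k} \<inter> N = N" by (auto simp: J_def)
      then show "(\<Sum>i<k. if i \<in> N then a i * \<Lambda> (Q N) \<omega> else 0) = (\<Sum>i\<in>N. a i) * \<Lambda> (Q N) \<omega>"
        by (simp add: sum.If_cases sum_distrib_right)
    qed
    finally show ?case .
  qed
  moreover have "(\<lambda>\<omega>. \<Sum>N\<in>J. (\<Sum>i\<in>N. a i) * \<Lambda> (Q N) \<omega>) \<in> borel_measurable M"
    using QS by (intro borel_measurable_sum borel_measurable_times borel_measurable_const \<Lambda>_meas)
  ultimately have "cf (simple_integral_on \<Lambda> \<Omega> xs) = cf (\<lambda>\<omega>. \<Sum>N\<in>J. (\<Sum>i\<in>N. a i) * \<Lambda> (Q N) \<omega>)"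
    using simple_integral_meas[OF xs \<Omega>_sigma] by (intro cf_cong_AE)
  also have "\<dots> = exp (\<Sum>N\<in>J. of_real (measure m (Q N)) * \<kappa> (\<Sum>i\<in>N. a i))"
    by (rule cf_disjoint_sum[OF J QS Qdisj Qfin])
  finally have 1: "cf (simple_integral_on \<Lambda> \<Omega> xs) = exp (\<Sum>N\<in>J. of_real (measure m (Q N)) * \<kappa> (\<Sum>i\<in>N. a i))" .
  have sv: "h (simple_val xs x) = (\<Sum>N\<in>J. indicator (Q N) x *\<^sub>R h (\<Sum>i\<in>N. a i))" if "h 0 = 0" for h :: "real \<Rightarrow> 'r::real_vector" and x
  proof (cases "x \<in> \<Omega>")
    case True
    have val: "simple_val xs x = (\<Sum>i\<in>I x. a i)"
    proof -
      have "simple_val xs x = (\<Sum>i<k. if i \<in> I x then a i else 0)"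
        unfolding simple_val_nth k_def[symmetric] by (intro sum.cong) (auto simp: a_def I_def B_def indicator_def)
      also have "\<dots> = (\<Sum>i\<in>I x. a i)" by (subst sum.inter_restrict[symmetric]) (auto simp: I_def intro!: sum.cong)
      finally show ?thesis .
    qed
    have "(\<Sum>N\<in>J. indicator (Q N) x *\<^sub>R h (\<Sum>i\<in>N. a i)) = (\<Sum>N\<in>J. if N = I x then h (\<Sum>i\<in>I x. a i) else 0)"
      using True by (intro sum.cong) (auto simp: Q_def indicator_def)
    also have "\<dots> = h (simple_val xs x)"
    proof -
      have "I x \<in> J \<longleftrightarrow> I x \<noteq> {}" by (auto simp: J_def I_def)
      then show ?thesis using J that unfolding val by (cases "I x = {}") auto
    qed
    finally show ?thesis ..
  next
    case False
    then have "x \<notin> Q N" for N by (simp add: Q_def)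
    then show ?thesis using simple_val_outside[OF xs False] that by simp
  qed
  have hb: "has_bochner_integral m (\<lambda>x. indicator (Q N) x *\<^sub>R c) (measure m (Q N) *\<^sub>R c)" if "N \<in> J" for N and c :: "'q::{banach, second_countable_topology}"
    using QS[OF that] Qfin[OF that] S_m by (intro has_bochner_integral_scaleR_left has_bochner_integral_real_indicator) auto
  have "has_bochner_integral m (\<lambda>x. \<kappa> (simple_val xs x)) (\<Sum>N\<in>J. measure m (Q N) *\<^sub>R \<kappa> (\<Sum>i\<in>N. a i))"
    unfolding sv[of \<kappa>, OF \<kappa>_0] by (intro has_bochner_integral_sum hb)
  then show "integrable m (\<lambda>x. \<kappa> (simple_val xs x))" "cf (simple_integral_on \<Lambda> \<Omega> xs) = exp (\<integral>x. \<kappa> (simple_val xs x) \<partial>m)"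
    unfolding 1 by (auto simp: has_bochner_integral_iff scaleR_conv_of_real)
  have "has_bochner_integral m (\<lambda>x. \<bar>simple_val xs x\<bar> powr \<beta>) (\<Sum>N\<in>J. measure m (Q N) *\<^sub>R (\<bar>\<Sum>i\<in>N. a i\<bar> powr \<beta>))"
    using \<beta> by (subst sv[of "\<lambda>x. \<bar>x\<bar> powr \<beta>"]) (simp, intro has_bochner_integral_sum hb)
  then have "integrable m (\<lambda>x. \<bar>simple_val xs x\<bar> powr \<beta>)" by (simp add: has_bochner_integral_iff)
  then show "(\<integral>\<^sup>+x. ennreal (\<bar>simple_val xs x\<bar> powr \<beta>) \<partial>m) < \<infinity>"
    by (auto simp: integrable_iff_bounded)
qed

lemma cf_simple:
  assumes xs: "snd ` set xs \<subseteq> S" and A: "A \<in> sigma_sets \<Omega> S"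
  shows "cf (\<lambda>\<omega>. s * simple_integral_on \<Lambda> A xs \<omega>) = exp (\<integral>x. \<kappa> (s * (indicator A x * simple_val xs x)) \<partial>m)"
    and "integrable m (\<lambda>x. \<kappa> (s * (indicator A x * simple_val xs x)))"
proof -
  let ?ys = "scale_simple s (restrict_simple A xs)"
  have ys: "snd ` set ?ys \<subseteq> S"
    unfolding snd_scale using xs S_Int[OF A] by (rule snd_restrict)
  have "\<Omega> \<inter> A = A" using sigma_sub[OF A] by auto
  then have "simple_integral_on \<Lambda> \<Omega> ?ys = (\<lambda>\<omega>. s * simple_integral_on \<Lambda> A xs \<omega>)"
    by (simp add: fun_eq_iff simple_integral_scale simple_integral_restrict)
  moreover have "simple_val ?ys = (\<lambda>x. s * (indicator A x * simple_val xs x))"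
    by (simp add: fun_eq_iff simple_val_scale simple_val_restrict)
  ultimately show "cf (\<lambda>\<omega>. s * simple_integral_on \<Lambda> A xs \<omega>) = exp (\<integral>x. \<kappa> (s * (indicator A x * simple_val xs x)) \<partial>m)"
    "integrable m (\<lambda>x. \<kappa> (s * (indicator A x * simple_val xs x)))"
    using cf_simple_aux(1,2)[OF ys] by simp_all
qed

definition "L1_const = 3 * (1 / (\<beta> - 1) + 2) * C powr (1 / \<beta>)"

lemma L1_const_nonneg: "L1_const \<ge> 0" using \<beta> C by (simp add: L1_const_def)

text \<open>
  \<open>1 - Re cf(s Y) \<le> |exp(\<integral> \<kappa>(s f) dm) - 1| \<le> \<integral> |\<kappa>(s f)| dm \<le> C |s|\<^sup>\<beta> \<integral> |f|\<^sup>\<beta> dm\<close>.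
\<close>

lemma L1_bound_of_cf:
  assumes Y: "Y \<in> borel_measurable M" and f: "f \<in> borel_measurable m"
    and cf: "\<And>s. cf (\<lambda>\<omega>. s * Y \<omega>) = exp (\<integral>x. \<kappa> (s * f x) \<partial>m)"
    and N: "(\<integral>\<^sup>+x. ennreal (\<bar>f x\<bar> powr \<beta>) \<partial>m) \<le> ennreal N" "N \<ge> 0"
  shows "(\<integral>\<^sup>+\<omega>. ennreal \<bar>Y \<omega>\<bar> \<partial>M) \<le> ennreal (L1_const * N powr (1 / \<beta>))"
proof -
  have [measurable]: "f \<in> borel_measurable m" by (rule f)
  have "(\<integral>\<^sup>+x. ennreal (\<bar>f x\<bar> powr \<beta>) \<partial>m) < \<infinity>" using N(1) by (rule le_less_trans) simp
  then have fi: "integrable m (\<lambda>x. \<bar>f x\<bar> powr \<beta>)" by (intro integrableI_bounded) auto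
  have fN: "(\<integral>x. \<bar>f x\<bar> powr \<beta> \<partial>m) \<le> N"
    using N nn_integral_eq_integral[OF fi] by simp
  have "1 - Re (cf (\<lambda>\<omega>. s * Y \<omega>)) \<le> C * N * s powr \<beta>" if s: "s > 0" for s
  proof -
    let ?I = "\<integral>x. \<kappa> (s * f x) \<partial>m"
    have b: "norm (\<kappa> (s * f x)) \<le> C * s powr \<beta> * \<bar>f x\<bar> powr \<beta>" for x
      using C(2)[of "s * f x"] s by (simp add: abs_mult powr_mult mult.assoc)
    have int: "integrable m (\<lambda>x. \<kappa> (s * f x))"
      by (rule Bochner_Integration.integrable_bound[OF integrable_mult_right[OF fi, of "C * s powr \<beta>"]])
         (use b C in \<open>auto intro!: AE_I2 simp: abs_mult\<close>)
    have "Re ?I = (\<integral>x. Re (\<kappa> (s * f x)) \<partial>m)" using int by (rule integral_Re[symmetric])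
    also have "\<dots> \<le> 0" using integral_mono[OF integrable_Re[OF int] integrable_zero Re_\<kappa>_le] by simp
    finally have Re0: "Re ?I \<le> 0" .
    have "1 - Re (exp ?I) \<le> norm (exp ?I - 1)"
      using abs_Re_le_cmod[of "exp ?I - 1"] by simp
    also have "\<dots> \<le> norm ?I" by (rule norm_exp_minus_one_le[OF Re0])
    also have "\<dots> \<le> (\<integral>x. norm (\<kappa> (s * f x)) \<partial>m)" by (rule integral_norm_bound)
    also have "\<dots> \<le> (\<integral>x. C * s powr \<beta> * \<bar>f x\<bar> powr \<beta> \<partial>m)"
      using int fi b by (intro integral_mono integrable_norm integrable_mult_right) auto
    also have "\<dots> = C * s powr \<beta> * (\<integral>x. \<bar>f x\<bar> powr \<beta> \<partial>m)" by simp
    also have "\<dots> \<le> C * s powr \<beta> * N" using fN C by (intro mult_left_mono) auto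
    finally show ?thesis unfolding cf by (simp add: mult_ac)
  qed
  then have "(\<integral>\<^sup>+\<omega>. ennreal \<bar>Y \<omega>\<bar> \<partial>M) \<le> ennreal (3 * (1 / (\<beta> - 1) + 2) * (C * N) powr (1 / \<beta>))"
    using C N by (intro L1_bound_cf Y \<beta>) auto
  also have "3 * (1 / (\<beta> - 1) + 2) * (C * N) powr (1 / \<beta>) = L1_const * N powr (1 / \<beta>)"
    using C N by (simp add: L1_const_def powr_mult mult.assoc)
  finally show ?thesis .
qed

end

section \<open>Existence and uniqueness of Rajput--Rosinski integrals\<close>

context finite_random_measure
begin

lemma cf_simple_full:
  assumes xs: "snd ` set xs \<subseteq> S"
  shows "cf (\<lambda>\<omega>. s * simple_integral_on \<Lambda> \<Omega> xs \<omega>) = exp (\<integral>x. \<kappa> (s * simple_val xs x) \<partial>m)"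
    and "integrable m (\<lambda>x. \<kappa> (s * simple_val xs x))"
  using cf_simple_aux(1,2)[of "scale_simple s xs"] xs
  by (simp_all add: snd_scale simple_val_scale simple_integral_scale[abs_def])

lemma norm_cf_simple:
  assumes xs: "snd ` set xs \<subseteq> S" and A: "A \<in> sigma_sets \<Omega> S"
  shows "norm (cf (\<lambda>\<omega>. s * simple_integral_on \<Lambda> A xs \<omega>)) = exp (- (\<integral>x. indicator A x * (- Re (\<kappa> (s * simple_val xs x))) \<partial>m))"
proof -
  have "Re (\<integral>x. \<kappa> (s * (indicator A x * simple_val xs x)) \<partial>m) = (\<integral>x. Re (\<kappa> (s * (indicator A x * simple_val xs x))) \<partial>m)"
    by (rule integral_Re[symmetric, OF cf_simple(2)[OF xs A]])
  also have "\<dots> = (\<integral>x. - (indicator A x * (- Re (\<kappa> (s * simple_val xs x)))) \<partial>m)"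
    by (intro Bochner_Integration.integral_cong) (auto simp: indicator_def)
  also have "\<dots> = - (\<integral>x. indicator A x * (- Re (\<kappa> (s * simple_val xs x))) \<partial>m)"
    by (rule Bochner_Integration.integral_minus)
  finally show ?thesis unfolding cf_simple(1)[OF xs A] by simp
qed

lemma exhausting: "\<exists>A::nat \<Rightarrow> 'b set. (\<forall>n. A n \<in> S) \<and> incseq A \<and> (\<Union>n. A n) = \<Omega>"
proof -
  obtain A :: "nat \<Rightarrow> 'b set" where "range A \<subseteq> S" "incseq A" "(\<Union>n. A n) = \<Omega>"
    using ring unfolding exhausting_delta_ring_def by blast
  then show ?thesis by (intro exI[of _ A]) auto
qed

text \<open>
  The reason why Rajput--Rosinski integrals are determined by their integrands. Let \<open>\<nu>\<^sub>n\<close> have density \<open>- Re \<kappa>(s \<eta>\<^sub>n)\<close>. The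
  moduli of the characteristic functions over \<open>A\<close> are \<open>exp(- \<nu>\<^sub>n(A))\<close>, so that these converge for every \<open>A\<close>. There are
  countably many disjoint sets \<open>F\<^sub>k\<close> that cover almost everything with \<open>\<nu>\<^sub>n(F\<^sub>k) \<rightarrow> 0\<close> by dominated convergence. The
  gliding hump then forces \<open>\<nu>\<^sub>n(\<Omega>) \<rightarrow> 0\<close>, and the sector condition gives \<open>\<integral> \<kappa>(s \<eta>\<^sub>n) dm \<rightarrow> 0\<close>.
\<close>

lemma null_sequence_cf:
  assumes \<eta>: "\<And>n. snd ` set (\<eta> n) \<subseteq> S" and lim: "AE x in m. (\<lambda>n. simple_val (\<eta> n) x) \<longlonglongrightarrow> 0"
    and conv: "\<And>A. A \<in> sigma_sets \<Omega> S \<Longrightarrow> \<exists>J. tendsto_in_prob M (\<lambda>n. simple_integral_on \<Lambda> A (\<eta> n)) J"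
  shows "(\<lambda>n. cf (\<lambda>\<omega>. s * simple_integral_on \<Lambda> \<Omega> (\<eta> n) \<omega>)) \<longlonglongrightarrow> 1"
proof -
  define v where "v = (\<lambda>n x. s * simple_val (\<eta> n) x)"
  define g where "g = (\<lambda>n x. - Re (\<kappa> (v n x)))"
  have v_meas[measurable]: "v n \<in> borel_measurable \<Sigma>" "v n \<in> borel_measurable m" for n
    unfolding v_def using simple_val_meas[OF \<eta>] by simp_all
  have g0: "g n x \<ge> 0" for n x using Re_\<kappa>_le by (simp add: g_def)
  have \<kappa>int: "integrable m (\<lambda>x. \<kappa> (v n x))" for n unfolding v_def by (rule cf_simple_full(2)[OF \<eta>])
  have gint: "integrable m (g n)" for n unfolding g_def by (intro Bochner_Integration.integrable_minus integrable_Re \<kappa>int)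
  have [measurable]: "g n \<in> borel_measurable m" for n using gint by simp
  define \<nu> where "\<nu> = (\<lambda>n. density m (\<lambda>x. ennreal (g n x)))"
  have \<nu>_eq: "emeasure (\<nu> n) A = ennreal (\<integral>x. indicator A x * g n x \<partial>m)" if "A \<in> sets m" for n A
  proof -
    have "emeasure (\<nu> n) A = (\<integral>\<^sup>+x. ennreal (indicator A x * g n x) \<partial>m)"
      unfolding \<nu>_def using that by (subst emeasure_density) (auto intro!: nn_integral_cong simp: indicator_def)
    also have "\<dots> = ennreal (\<integral>x. indicator A x * g n x \<partial>m)"
      using integrable_mult_indicator[OF that gint[of n]] g0 by (intro nn_integral_eq_integral) auto
    finally show ?thesis .
  qed
  have \<nu>_meas: "measure (\<nu> n) A = (\<integral>x. indicator A x * g n x \<partial>m)" if "A \<in> sets m" for n A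
    unfolding measure_def \<nu>_eq[OF that] using g0 by (intro enn2real_ennreal integral_nonneg_AE AE_I2) simp
  have \<nu>_fin: "finite_measure (\<nu> n)" for n
    by (rule finite_measureI) (use \<nu>_eq[of "space m" n] in \<open>simp add: \<nu>_def\<close>)
  have \<nu>_sets: "sets (\<nu> n) = sets m" for n by (simp add: \<nu>_def)
  obtain A0 where A0: "\<And>n. A0 n \<in> S" "incseq A0" "(\<Union>n. A0 n) = \<Omega>" using exhausting by blast
  \<comment> \<open>From index \<open>N\<close> on the integrands are bounded by one on \<open>G N\<close>, a set of finite measure.\<close>
  define G where "G = (\<lambda>N. A0 N \<inter> {x\<in>\<Omega>. \<forall>n\<ge>N. \<bar>v n x\<bar> \<le> 1})"
  define F where "F = disjointed G"
  have G\<Sigma>: "G N \<in> sigma_sets \<Omega> S" for N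
  proof -
    have "{x\<in>space \<Sigma>. \<forall>n\<ge>N. \<bar>v n x\<bar> \<le> 1} \<in> sets \<Sigma>" by measurable
    moreover have "A0 N \<in> sets \<Sigma>" using A0(1) by auto
    ultimately have "A0 N \<inter> {x\<in>space \<Sigma>. \<forall>n\<ge>N. \<bar>v n x\<bar> \<le> 1} \<in> sets \<Sigma>" by (rule sets.Int[rotated])
    then show ?thesis by (simp add: G_def)
  qed
  have F\<Sigma>: "F k \<in> sigma_sets \<Omega> S" for k
    unfolding F_def using sets.range_disjointed_sets[of G \<Sigma>] G\<Sigma> by auto
  have Fdisj: "disjoint_family F" unfolding F_def by (rule disjoint_family_disjointed)
  have FG: "F k \<subseteq> G k" for k unfolding F_def by (rule disjointed_subset)
  have UF: "AE x in m. x \<in> (\<Union>k. F k)"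
    using lim null
  proof eventually_elim
    case (elim x)
    have "(\<lambda>n. v n x) \<longlonglongrightarrow> s * 0" unfolding v_def by (intro tendsto_mult tendsto_const elim(1))
    then have "eventually (\<lambda>n. dist (v n x) 0 < 1) sequentially" by (intro tendstoD) auto
    then obtain N1 where N1: "\<And>n. n \<ge> N1 \<Longrightarrow> \<bar>v n x\<bar> \<le> 1"
      by (auto simp: eventually_sequentially intro: less_imp_le)
    obtain N2 where "x \<in> A0 N2" using elim(2) A0(3) by blast
    then have "x \<in> A0 (max N1 N2)" using incseqD[OF A0(2), of N2 "max N1 N2"] by auto
    then have "x \<in> G (max N1 N2)" using N1 elim(2) by (auto simp: G_def)
    then show ?case unfolding F_def UN_disjointed_eq by blast
  qed
  define u where "u = (\<lambda>n k. measure (\<nu> n) (F k))"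
  have usum: "(\<lambda>k. if k \<in> I then u n k else 0) sums measure (\<nu> n) (\<Union>k. if k \<in> I then F k else {})" for n I
  proof -
    interpret N: finite_measure "\<nu> n" by (rule \<nu>_fin)
    have "(\<lambda>k. measure (\<nu> n) (if k \<in> I then F k else {})) sums measure (\<nu> n) (\<Union>k. if k \<in> I then F k else {})"
    proof (rule N.finite_measure_UNION)
      show "range (\<lambda>k. if k \<in> I then F k else {}) \<subseteq> sets (\<nu> n)" using F\<Sigma> sigma_m by (auto simp: \<nu>_sets)
      show "disjoint_family (\<lambda>k. if k \<in> I then F k else {})" using Fdisj by (auto simp: disjoint_family_on_def)
    qed
    moreover have "measure (\<nu> n) (if k \<in> I then F k else {}) = (if k \<in> I then u n k else 0)" for k by (simp add: u_def)
    ultimately show ?thesis by simp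
  qed
  have usum_all: "u n sums measure (\<nu> n) (\<Union>k. F k)" for n
  proof -
    have "(\<lambda>k. if k \<in> UNIV then u n k else 0) sums measure (\<nu> n) (\<Union>k. if k \<in> UNIV then F k else {})" by (rule usum)
    then show ?thesis by simp
  qed
  have "(\<lambda>n. suminf (u n)) \<longlonglongrightarrow> 0"
  proof (rule gliding_hump)
    show "u n k \<ge> 0" for n k by (simp add: u_def)
    show "summable (u n)" for n using usum_all by (rule sums_summable)
    show "convergent (\<lambda>n. exp (- (\<Sum>k. if k \<in> I then u n k else 0)))" for I
    proof -
      let ?A = "\<Union>k. if k \<in> I then F k else {}"
      have A: "?A \<in> sigma_sets \<Omega> S" using F\<Sigma> by (intro sigma_sets.Union) (auto intro: sigma_sets.Empty)
      obtain J where "tendsto_in_prob M (\<lambda>n. simple_integral_on \<Lambda> ?A (\<eta> n)) J" using conv[OF A] by blast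
      then have "(\<lambda>n. norm (cf (\<lambda>\<omega>. s * simple_integral_on \<Lambda> ?A (\<eta> n) \<omega>))) \<longlonglongrightarrow> norm (cf (\<lambda>\<omega>. s * J \<omega>))"
        by (intro tendsto_norm tendsto_in_prob_cf)
      moreover have "norm (cf (\<lambda>\<omega>. s * simple_integral_on \<Lambda> ?A (\<eta> n) \<omega>)) = exp (- (\<Sum>k. if k \<in> I then u n k else 0))" for n
        unfolding norm_cf_simple[OF \<eta> A] sums_unique[OF usum, symmetric] \<nu>_meas[OF sigma_m[OF A]] g_def v_def ..
      ultimately show ?thesis by (auto simp: convergent_def)
    qed
    show "(\<lambda>n. u n k) \<longlonglongrightarrow> 0" for k
    proof (rule LIMSEQ_offset[of _ k])
      have Fm: "F k \<in> sets m" by (rule sigma_m[OF F\<Sigma>])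
      have "emeasure m (F k) \<le> emeasure m (A0 k)"
        using FG[of k] A0(1) S_m by (intro emeasure_mono) (auto simp: G_def)
      also have "\<dots> < \<infinity>" by (rule finite_S[OF A0(1)])
      finally have Ffin: "emeasure m (F k) < \<infinity>" .
      have "(\<lambda>n. \<integral>x. indicator (F k) x * g (n + k) x \<partial>m) \<longlonglongrightarrow> (\<integral>x. 0 \<partial>m)"
      proof (rule integral_dominated_convergence)
        show "integrable m (\<lambda>x. C * indicat_real (F k) x)"
          using Fm Ffin by (intro integrable_mult_right integrable_real_indicator)
        show "AE x in m. (\<lambda>n. indicator (F k) x * g (n + k) x) \<longlonglongrightarrow> 0"
          using lim
        proof eventually_elim
          case (elim x)
          have "(\<lambda>n. v n x) \<longlonglongrightarrow> s * 0" unfolding v_def by (intro tendsto_mult tendsto_const elim)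
          then have "(\<lambda>n. \<kappa> (v n x)) \<longlonglongrightarrow> \<kappa> (s * 0)"
            by (intro continuous_on_tendsto_compose[OF \<kappa>_cont]) auto
          then have "(\<lambda>n. g n x) \<longlonglongrightarrow> - Re (\<kappa> (s * 0))" unfolding g_def by (intro tendsto_intros)
          then have "(\<lambda>n. g n x) \<longlonglongrightarrow> 0" by simp
          then have "(\<lambda>n. g (n + k) x) \<longlonglongrightarrow> 0" by (rule LIMSEQ_ignore_initial_segment)
          then show ?case by (rule tendsto_mult_right_zero)
        qed
        show "AE x in m. norm (indicator (F k) x * g (n + k) x) \<le> C * indicat_real (F k) x" for n
        proof (rule AE_I2)
          fix x
          show "norm (indicator (F k) x * g (n + k) x) \<le> C * indicat_real (F k) x"
          proof (cases "x \<in> F k")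
            case True
            then have "\<bar>v (n + k) x\<bar> \<le> 1" using FG[of k] by (auto simp: G_def)
            then have "\<bar>v (n + k) x\<bar> powr \<beta> \<le> 1" using \<beta> by (intro powr_le1) auto
            then have "C * \<bar>v (n + k) x\<bar> powr \<beta> \<le> C" using C(1) by simp
            then have "norm (\<kappa> (v (n + k) x)) \<le> C" using C(2)[of "v (n + k) x"] by linarith
            then have "\<bar>g (n + k) x\<bar> \<le> C" using abs_Re_le_cmod[of "\<kappa> (v (n + k) x)"] by (simp add: g_def)
            then show ?thesis using True by simp
          qed simp
        qed
      qed (use Fm in auto)
      then show "(\<lambda>n. u (n + k) k) \<longlonglongrightarrow> 0" by (simp add: u_def \<nu>_meas[OF Fm])
    qed
  qed
  moreover have "suminf (u n) = (\<integral>x. g n x \<partial>m)" for n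
  proof -
    have UFm: "(\<Union>k. F k) \<in> sets m" using F\<Sigma> sigma_m by auto
    have "suminf (u n) = (\<integral>x. indicator (\<Union>k. F k) x * g n x \<partial>m)"
      using sums_unique[OF usum_all[of n]] \<nu>_meas[OF UFm] by simp
    also have "\<dots> = (\<integral>x. g n x \<partial>m)"
    proof (rule integral_cong_AE)
      show "AE x in m. indicator (\<Union>k. F k) x * g n x = g n x" using UF by eventually_elim simp
    qed (use UFm in auto)
    finally show ?thesis .
  qed
  ultimately have g_lim: "(\<lambda>n. \<integral>x. g n x \<partial>m) \<longlonglongrightarrow> 0" by simp
  have "(\<lambda>n. \<integral>x. \<kappa> (v n x) \<partial>m) \<longlonglongrightarrow> 0"
  proof (rule Lim_null_comparison)
    show "eventually (\<lambda>n. norm (\<integral>x. \<kappa> (v n x) \<partial>m) \<le> D * (\<integral>x. g n x \<partial>m)) sequentially"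
    proof (intro always_eventually allI)
      fix n
      have "norm (\<integral>x. \<kappa> (v n x) \<partial>m) \<le> (\<integral>x. norm (\<kappa> (v n x)) \<partial>m)" by (rule integral_norm_bound)
      also have "\<dots> \<le> (\<integral>x. D * g n x \<partial>m)"
        using D(2) \<kappa>int gint by (intro integral_mono integrable_norm integrable_mult_right) (auto simp: g_def)
      finally show "norm (\<integral>x. \<kappa> (v n x) \<partial>m) \<le> D * (\<integral>x. g n x \<partial>m)" by simp
    qed
    show "(\<lambda>n. D * (\<integral>x. g n x \<partial>m)) \<longlonglongrightarrow> 0" by (rule tendsto_mult_right_zero[OF g_lim])
  qed
  then have "(\<lambda>n. exp (\<integral>x. \<kappa> (v n x) \<partial>m)) \<longlonglongrightarrow> exp 0" by (rule tendsto_exp)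
  then show ?thesis unfolding cf_simple_full(1)[OF \<eta>] v_def by simp
qed

lemma RR_D:
  "RR f Y \<Longrightarrow> \<exists>\<phi>. (\<forall>n. snd ` set (\<phi> n) \<subseteq> S) \<and> (AE x in m. (\<lambda>n. simple_val (\<phi> n) x) \<longlonglongrightarrow> f x) \<and>
    (\<forall>A\<in>sigma_sets \<Omega> S. \<exists>J. tendsto_in_prob M (\<lambda>n. simple_integral_on \<Lambda> A (\<phi> n)) J) \<and>
    tendsto_in_prob M (\<lambda>n. simple_integral_on \<Lambda> \<Omega> (\<phi> n)) Y"
  unfolding has_RR_integral_def by blast

lemma RR_meas: "RR f Y \<Longrightarrow> Y \<in> borel_measurable M"
  by (auto simp: has_RR_integral_def tendsto_in_prob_def)

lemma RR_zero: "RR (\<lambda>_. 0) (\<lambda>_. 0)"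
  unfolding has_RR_integral_def
  by (intro exI[of _ "\<lambda>_. []"]) (auto simp: simple_val_def simple_integral_on_def[abs_def] tendsto_in_prob_def intro!: exI[of _ "\<lambda>_. 0"])

lemma RR_lincomb:
  assumes "RR f Y" "RR h Z"
  shows "RR (\<lambda>x. a * f x + h x) (\<lambda>\<omega>. a * Y \<omega> + Z \<omega>)"
proof -
  obtain \<phi> where \<phi>: "\<And>n. snd ` set (\<phi> n) \<subseteq> S" "AE x in m. (\<lambda>n. simple_val (\<phi> n) x) \<longlonglongrightarrow> f x"
    "\<And>A. A \<in> sigma_sets \<Omega> S \<Longrightarrow> \<exists>J. tendsto_in_prob M (\<lambda>n. simple_integral_on \<Lambda> A (\<phi> n)) J"
    "tendsto_in_prob M (\<lambda>n. simple_integral_on \<Lambda> \<Omega> (\<phi> n)) Y"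
    using RR_D[OF assms(1)] by blast
  obtain \<psi> where \<psi>: "\<And>n. snd ` set (\<psi> n) \<subseteq> S" "AE x in m. (\<lambda>n. simple_val (\<psi> n) x) \<longlonglongrightarrow> h x"
    "\<And>A. A \<in> sigma_sets \<Omega> S \<Longrightarrow> \<exists>J. tendsto_in_prob M (\<lambda>n. simple_integral_on \<Lambda> A (\<psi> n)) J"
    "tendsto_in_prob M (\<lambda>n. simple_integral_on \<Lambda> \<Omega> (\<psi> n)) Z"
    using RR_D[OF assms(2)] by blast
  let ?\<chi> = "\<lambda>n. scale_simple a (\<phi> n) @ \<psi> n"
  have si: "simple_integral_on \<Lambda> A (?\<chi> n) = (\<lambda>\<omega>. a * simple_integral_on \<Lambda> A (\<phi> n) \<omega> + simple_integral_on \<Lambda> A (\<psi> n) \<omega>)" for A n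
    by (simp add: fun_eq_iff simple_integral_append simple_integral_scale)
  show ?thesis
    unfolding has_RR_integral_def
  proof (intro exI[of _ ?\<chi>] conjI allI ballI)
    show "snd ` set (?\<chi> n) \<subseteq> S" for n using \<phi>(1)[of n] \<psi>(1)[of n] by (simp add: image_Un snd_scale)
    show "AE x in m. (\<lambda>n. simple_val (?\<chi> n) x) \<longlonglongrightarrow> a * f x + h x"
      using \<phi>(2) \<psi>(2)
    proof eventually_elim
      case (elim x)
      show ?case unfolding simple_val_append simple_val_scale by (intro tendsto_intros elim)
    qed
    show "\<exists>J. tendsto_in_prob M (\<lambda>n. simple_integral_on \<Lambda> A (?\<chi> n)) J" if "A \<in> sigma_sets \<Omega> S" for A
      unfolding si using \<phi>(3)[OF that] \<psi>(3)[OF that] tendsto_in_prob_lincomb by blast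
    show "tendsto_in_prob M (\<lambda>n. simple_integral_on \<Lambda> \<Omega> (?\<chi> n)) (\<lambda>\<omega>. a * Y \<omega> + Z \<omega>)"
      unfolding si using \<phi>(4) \<psi>(4) by (rule tendsto_in_prob_lincomb)
  qed
qed

lemma RR_null:
  assumes "RR f Y" "AE x in m. f x = 0"
  shows "AE \<omega> in M. Y \<omega> = 0"
proof -
  obtain \<phi> where \<phi>: "\<And>n. snd ` set (\<phi> n) \<subseteq> S" "AE x in m. (\<lambda>n. simple_val (\<phi> n) x) \<longlonglongrightarrow> f x"
    "\<And>A. A \<in> sigma_sets \<Omega> S \<Longrightarrow> \<exists>J. tendsto_in_prob M (\<lambda>n. simple_integral_on \<Lambda> A (\<phi> n)) J"
    "tendsto_in_prob M (\<lambda>n. simple_integral_on \<Lambda> \<Omega> (\<phi> n)) Y"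
    using RR_D[OF assms(1)] by blast
  have lim: "AE x in m. (\<lambda>n. simple_val (\<phi> n) x) \<longlonglongrightarrow> 0" using \<phi>(2) assms(2) by eventually_elim simp
  have [measurable]: "Y \<in> borel_measurable M" using assms(1) by (rule RR_meas)
  have "cf (\<lambda>\<omega>. s * Y \<omega>) = 1" for s
    by (rule LIMSEQ_unique[OF tendsto_in_prob_cf[OF \<phi>(4)] null_sequence_cf[OF \<phi>(1) lim \<phi>(3)]])
  then have "(\<integral>\<^sup>+\<omega>. ennreal \<bar>Y \<omega>\<bar> \<partial>M) \<le> ennreal (3 * (1 / (\<beta> - 1) + 2) * 0 powr (1 / \<beta>))"
    by (intro L1_bound_cf \<beta>) auto
  then have "(\<integral>\<^sup>+\<omega>. ennreal \<bar>Y \<omega>\<bar> \<partial>M) = 0" by simp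
  then show ?thesis by (subst (asm) nn_integral_0_iff_AE) auto
qed

lemma RR_unique:
  assumes "RR f Y" "RR f Z"
  shows "AE \<omega> in M. Y \<omega> = Z \<omega>"
proof -
  have "AE \<omega> in M. - 1 * Y \<omega> + Z \<omega> = 0"
    by (rule RR_null[OF RR_lincomb[OF assms, of "- 1"]]) simp
  then show ?thesis by eventually_elim simp
qed

lemma abs_add_powr_le:
  fixes a b :: real assumes "p > 0"
  shows "\<bar>a + b\<bar> powr p \<le> 2 powr p * (\<bar>a\<bar> powr p + \<bar>b\<bar> powr p)"
proof -
  have "\<bar>a + b\<bar> powr p \<le> (2 * max \<bar>a\<bar> \<bar>b\<bar>) powr p" using assms by (intro powr_mono2) auto
  also have "\<dots> = 2 powr p * (max \<bar>a\<bar> \<bar>b\<bar>) powr p" by (rule powr_mult)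
  also have "(max \<bar>a\<bar> \<bar>b\<bar>) powr p \<le> \<bar>a\<bar> powr p + \<bar>b\<bar> powr p" by (auto simp: max_def)
  finally show ?thesis by simp
qed

text \<open>
  Usual simple approximations are multiplied by the indicators of an exhausting sequence of the ring, because
  only sets of the ring, not of the generated sigma-algebra, may occur in the list.
\<close>

lemma simple_approximation:
  assumes f': "f' \<in> borel_measurable \<Sigma>"
  obtains \<phi> where "\<And>n. snd ` set (\<phi> n) \<subseteq> S" "\<And>x. x \<in> \<Omega> \<Longrightarrow> (\<lambda>n. simple_val (\<phi> n) x) \<longlonglongrightarrow> f' x"
    "\<And>n x. x \<in> \<Omega> \<Longrightarrow> \<bar>simple_val (\<phi> n) x\<bar> \<le> 2 * \<bar>f' x\<bar>"
proof -
  obtain F where F: "\<And>i. simple_function \<Sigma> (F i)" "\<And>x. x \<in> space \<Sigma> \<Longrightarrow> (\<lambda>i. F i x) \<longlonglongrightarrow> f' x"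
    "\<And>i x. x \<in> space \<Sigma> \<Longrightarrow> dist (F i x) 0 \<le> 2 * dist (f' x) 0"
    using borel_measurable_implies_sequence_metric[OF f', of 0] by blast
  obtain A0 where A0: "\<And>n. A0 n \<in> S" "incseq A0" "(\<Union>n. A0 n) = \<Omega>" using exhausting by blast
  define \<phi> where "\<phi> = (\<lambda>n. map (\<lambda>v. (v, {x\<in>\<Omega>. F n x = v} \<inter> A0 n)) (sorted_list_of_set (F n ` \<Omega>)))"
  have fin: "finite (F n ` \<Omega>)" for n using simple_functionD(1)[OF F(1)[of n]] by simp
  have val: "simple_val (\<phi> n) x = indicator (A0 n) x * F n x" if x: "x \<in> \<Omega>" for n x
  proof -
    have "simple_val (\<phi> n) x = sum_list (map (\<lambda>v. v * indicator ({x\<in>\<Omega>. F n x = v} \<inter> A0 n) x) (sorted_list_of_set (F n ` \<Omega>)))"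
      unfolding simple_val_def \<phi>_def by (simp add: o_def)
    also have "\<dots> = (\<Sum>v\<in>F n ` \<Omega>. v * indicator ({x\<in>\<Omega>. F n x = v} \<inter> A0 n) x)"
      using fin by (subst sum_list_distinct_conv_sum_set) auto
    also have "\<dots> = (\<Sum>v\<in>F n ` \<Omega>. if v = F n x then indicator (A0 n) x * F n x else 0)"
      using x by (intro sum.cong) (auto simp: indicator_def)
    also have "\<dots> = indicator (A0 n) x * F n x" using fin x by (subst sum.delta) auto
    finally show ?thesis .
  qed
  show ?thesis
  proof
    show "snd ` set (\<phi> n) \<subseteq> S" for n
    proof -
      have "{x\<in>\<Omega>. F n x = v} \<inter> A0 n \<in> S" for v
      proof (rule S_Int[OF _ A0(1)])
        have "F n -` {v} \<inter> space \<Sigma> \<in> sets \<Sigma>" by (rule simple_functionD(2)[OF F(1)])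
        moreover have "F n -` {v} \<inter> space \<Sigma> = {x\<in>\<Omega>. F n x = v}" by auto
        ultimately show "{x\<in>\<Omega>. F n x = v} \<in> sigma_sets \<Omega> S" by simp
      qed
      then show ?thesis by (auto simp: \<phi>_def)
    qed
    fix x assume x: "x \<in> \<Omega>"
    then obtain N where N: "x \<in> A0 N" using A0(3) by blast
    have "x \<in> A0 n" if "n \<ge> N" for n using incseqD[OF A0(2) that] N by blast
    then have "eventually (\<lambda>n. F n x = simple_val (\<phi> n) x) sequentially"
      unfolding eventually_sequentially using val[OF x] by (intro exI[of _ N]) auto
    moreover have "(\<lambda>n. F n x) \<longlonglongrightarrow> f' x" using F(2) x by simp
    ultimately show "(\<lambda>n. simple_val (\<phi> n) x) \<longlonglongrightarrow> f' x" by (rule Lim_transform_eventually[rotated])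
    show "\<bar>simple_val (\<phi> n) x\<bar> \<le> 2 * \<bar>f' x\<bar>" for n
      using F(3)[of x n] x val[OF x, of n] by (auto simp: indicator_def)
  qed
qed

lemma L1_summable_converges:
  assumes [measurable]: "\<And>j. Z j \<in> borel_measurable M"
    and le: "\<And>j. (\<integral>\<^sup>+\<omega>. ennreal \<bar>Z (Suc j) \<omega> - Z j \<omega>\<bar> \<partial>M) \<le> ennreal (K * (1/2) ^ j)" and "K \<ge> 0"
  shows "tendsto_in_prob M Z (\<lambda>\<omega>. lim (\<lambda>j. Z j \<omega>))"
proof (rule AE_imp_tendsto_in_prob)
  show "(\<lambda>\<omega>. lim (\<lambda>j. Z j \<omega>)) \<in> borel_measurable M" by measurable
  have "(\<integral>\<^sup>+\<omega>. (\<Sum>j. ennreal \<bar>Z (Suc j) \<omega> - Z j \<omega>\<bar>) \<partial>M) = (\<Sum>j. \<integral>\<^sup>+\<omega>. ennreal \<bar>Z (Suc j) \<omega> - Z j \<omega>\<bar> \<partial>M)"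
    by (rule nn_integral_suminf) measurable
  also have "\<dots> \<le> (\<Sum>j. ennreal (K * (1/2) ^ j))" by (intro suminf_le le) auto
  also have "\<dots> = ennreal (\<Sum>j. K * (1/2) ^ j)"
    using \<open>K \<ge> 0\<close> by (intro suminf_ennreal2) (auto intro!: summable_mult summable_geometric)
  also have "\<dots> < \<infinity>" by simp
  finally have "AE \<omega> in M. (\<Sum>j. ennreal \<bar>Z (Suc j) \<omega> - Z j \<omega>\<bar>) \<noteq> \<infinity>"
    by (intro nn_integral_noteq_infinite) auto
  then show "AE \<omega> in M. (\<lambda>j. Z j \<omega>) \<longlonglongrightarrow> lim (\<lambda>j. Z j \<omega>)"
  proof eventually_elim
    case (elim \<omega>)
    then have "summable (\<lambda>j. \<bar>Z (Suc j) \<omega> - Z j \<omega>\<bar>)" by (intro summable_suminf_not_top) auto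
    then have "summable (\<lambda>j. Z (Suc j) \<omega> - Z j \<omega>)" by (rule summable_rabs_cancel)
    then have "(\<lambda>n. \<Sum>j<n. Z (Suc j) \<omega> - Z j \<omega>) \<longlonglongrightarrow> (\<Sum>j. Z (Suc j) \<omega> - Z j \<omega>)" by (rule summable_LIMSEQ)
    then have "(\<lambda>n. Z n \<omega> - Z 0 \<omega>) \<longlonglongrightarrow> (\<Sum>j. Z (Suc j) \<omega> - Z j \<omega>)" unfolding sum_lessThan_telescope[of "\<lambda>j. Z j \<omega>"] .
    then have "(\<lambda>n. Z n \<omega> - Z 0 \<omega> + Z 0 \<omega>) \<longlonglongrightarrow> (\<Sum>j. Z (Suc j) \<omega> - Z j \<omega>) + Z 0 \<omega>" by (intro tendsto_add tendsto_const)
    then have "convergent (\<lambda>n. Z n \<omega>)" by (auto simp: convergent_def)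
    then show ?case by (simp add: convergent_LIMSEQ_iff)
  qed
qed simp

text \<open>
  A subsequence of simple approximations converges so fast in \<open>L\<^sup>\<beta>(m)\<close> that, by the \<open>L\<^sup>1\<close> bound, its integrals over any
  set converge almost surely.
\<close>

lemma RR_exists:
  assumes f': "f' \<in> borel_measurable \<Sigma>" and ae: "AE x in m. f x = f' x"
    and f[measurable]: "f \<in> borel_measurable m" and fin: "(\<integral>\<^sup>+x. ennreal (\<bar>f x\<bar> powr \<beta>) \<partial>m) < \<infinity>"
  shows "\<exists>Y. RR f Y \<and> cf Y = exp (\<integral>x. \<kappa> (f x) \<partial>m)"
proof -
  obtain \<phi> where \<phi>: "\<And>n. snd ` set (\<phi> n) \<subseteq> S" "\<And>x. x \<in> \<Omega> \<Longrightarrow> (\<lambda>n. simple_val (\<phi> n) x) \<longlonglongrightarrow> f' x"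
    "\<And>n x. x \<in> \<Omega> \<Longrightarrow> \<bar>simple_val (\<phi> n) x\<bar> \<le> 2 * \<bar>f' x\<bar>"
    using simple_approximation[OF f'] by blast
  define w where "w = (\<lambda>n. simple_val (\<phi> n))"
  have w_meas[measurable]: "w n \<in> borel_measurable m" for n unfolding w_def by (rule simple_val_meas(2)[OF \<phi>(1)])
  have fint: "integrable m (\<lambda>x. \<bar>f x\<bar> powr \<beta>)" using fin by (intro integrableI_bounded) auto
  have w_lim: "AE x in m. (\<lambda>n. w n x) \<longlonglongrightarrow> f x" using ae null by eventually_elim (simp add: w_def \<phi>(2))
  have w_le: "AE x in m. \<forall>n. \<bar>w n x\<bar> \<le> 2 * \<bar>f x\<bar>" using ae null by eventually_elim (simp add: w_def \<phi>(3))
  define Nn where "Nn = (\<lambda>n. \<integral>x. \<bar>w n x - f x\<bar> powr \<beta> \<partial>m)"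
  have diff_le: "AE x in m. \<bar>w n x - f x\<bar> powr \<beta> \<le> 3 powr \<beta> * \<bar>f x\<bar> powr \<beta>" for n
    using w_le
  proof eventually_elim
    case (elim x)
    have "\<bar>w n x\<bar> \<le> 2 * \<bar>f x\<bar>" using elim by blast
    then have "\<bar>w n x - f x\<bar> \<le> 3 * \<bar>f x\<bar>" by linarith
    then have "\<bar>w n x - f x\<bar> powr \<beta> \<le> (3 * \<bar>f x\<bar>) powr \<beta>" using \<beta> by (intro powr_mono2) auto
    then show ?case by (simp add: powr_mult)
  qed
  have dint: "integrable m (\<lambda>x. \<bar>w n x - f x\<bar> powr \<beta>)" for n
    by (rule Bochner_Integration.integrable_bound[OF integrable_mult_right[OF fint, of "3 powr \<beta>"]])
       (use diff_le[of n] in auto)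
  have "Nn \<longlonglongrightarrow> (\<integral>x. 0 \<partial>m)"
    unfolding Nn_def
  proof (rule integral_dominated_convergence)
    show "integrable m (\<lambda>x. 3 powr \<beta> * \<bar>f x\<bar> powr \<beta>)" by (intro integrable_mult_right fint)
    show "AE x in m. (\<lambda>n. \<bar>w n x - f x\<bar> powr \<beta>) \<longlonglongrightarrow> 0"
      using w_lim
    proof eventually_elim
      case (elim x)
      have "(\<lambda>n. \<bar>w n x - f x\<bar>) \<longlonglongrightarrow> \<bar>f x - f x\<bar>" by (intro tendsto_intros elim)
      then have "(\<lambda>n. \<bar>w n x - f x\<bar> powr \<beta>) \<longlonglongrightarrow> 0 powr \<beta>"
        using \<beta> by (intro tendsto_powr') auto
      then show ?case by simp
    qed
    show "AE x in m. norm (\<bar>w n x - f x\<bar> powr \<beta>) \<le> 3 powr \<beta> * \<bar>f x\<bar> powr \<beta>" for n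
      using diff_le[of n] by simp
  qed auto
  then have Nn0: "Nn \<longlonglongrightarrow> 0" by simp
  have "\<exists>n\<ge>j. Nn n \<le> ((1/2) ^ j) powr \<beta>" for j
  proof -
    have "eventually (\<lambda>n. Nn n < ((1/2) ^ j) powr \<beta>) sequentially" by (rule order_tendstoD[OF Nn0]) simp
    then have "eventually (\<lambda>n. n \<ge> j \<and> Nn n < ((1/2) ^ j) powr \<beta>) sequentially"
      by (intro eventually_conj eventually_ge_at_top)
    then show ?thesis by (auto simp: eventually_sequentially intro: less_imp_le)
  qed
  then obtain r where r: "\<And>j. r j \<ge> j" "\<And>j. Nn (r j) \<le> ((1/2) ^ j) powr \<beta>" by metis
  have r_top: "filterlim r at_top sequentially"
    by (rule filterlim_at_top_mono[OF filterlim_ident]) (simp add: r(1))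
  define \<psi> where "\<psi> = (\<lambda>j. \<phi> (r j))"
  have \<psi>S: "snd ` set (\<psi> j) \<subseteq> S" for j by (simp add: \<psi>_def \<phi>(1))
  define K where "K = L1_const * (2 powr (\<beta> + 1)) powr (1 / \<beta>)"
  have K0: "K \<ge> 0" using L1_const_nonneg by (simp add: K_def)
  have step: "(\<integral>\<^sup>+\<omega>. ennreal \<bar>simple_integral_on \<Lambda> A (\<psi> (Suc j)) \<omega> - simple_integral_on \<Lambda> A (\<psi> j) \<omega>\<bar> \<partial>M) \<le> ennreal (K * (1/2) ^ j)"
    if A: "A \<in> sigma_sets \<Omega> S" for A j
  proof -
    let ?\<eta> = "\<psi> (Suc j) @ scale_simple (- 1) (\<psi> j)"
    let ?\<epsilon> = "((1/2::real) ^ j) powr \<beta>"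
    have \<eta>: "snd ` set ?\<eta> \<subseteq> S" using \<psi>S[of j] \<psi>S[of "Suc j"] by (simp add: image_Un snd_scale)
    have Am[measurable]: "A \<in> sets m" by (rule sigma_m[OF A])
    let ?d = "\<lambda>x. indicator A x * simple_val ?\<eta> x"
    have dval: "simple_val ?\<eta> x = w (r (Suc j)) x - w (r j) x" for x
      by (simp add: simple_val_append simple_val_scale \<psi>_def w_def)
    have le: "\<bar>?d x\<bar> powr \<beta> \<le> 2 powr \<beta> * (\<bar>w (r (Suc j)) x - f x\<bar> powr \<beta> + \<bar>w (r j) x - f x\<bar> powr \<beta>)" for x
    proof -
      have "\<bar>?d x\<bar> powr \<beta> \<le> \<bar>(w (r (Suc j)) x - f x) + (f x - w (r j) x)\<bar> powr \<beta>"
        using \<beta> unfolding dval by (intro powr_mono2) (auto simp: indicator_def)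
      also have "\<dots> \<le> 2 powr \<beta> * (\<bar>w (r (Suc j)) x - f x\<bar> powr \<beta> + \<bar>f x - w (r j) x\<bar> powr \<beta>)"
        using \<beta> by (intro abs_add_powr_le) auto
      finally show ?thesis by (simp add: abs_minus_commute)
    qed
    have "(\<integral>\<^sup>+x. ennreal (\<bar>?d x\<bar> powr \<beta>) \<partial>m) \<le> (\<integral>\<^sup>+x. ennreal (2 powr \<beta> * (\<bar>w (r (Suc j)) x - f x\<bar> powr \<beta> + \<bar>w (r j) x - f x\<bar> powr \<beta>)) \<partial>m)"
      by (intro nn_integral_mono ennreal_leI le)
    also have "\<dots> = ennreal (\<integral>x. 2 powr \<beta> * (\<bar>w (r (Suc j)) x - f x\<bar> powr \<beta> + \<bar>w (r j) x - f x\<bar> powr \<beta>) \<partial>m)"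
      by (intro nn_integral_eq_integral integrable_mult_right Bochner_Integration.integrable_add dint) auto
    also have "(\<integral>x. 2 powr \<beta> * (\<bar>w (r (Suc j)) x - f x\<bar> powr \<beta> + \<bar>w (r j) x - f x\<bar> powr \<beta>) \<partial>m) = 2 powr \<beta> * (Nn (r (Suc j)) + Nn (r j))"
      unfolding Nn_def using dint by simp
    also have "\<dots> \<le> 2 powr \<beta> * (?\<epsilon> + ?\<epsilon>)"
    proof (intro mult_left_mono add_mono)
      have "((1/2::real) ^ Suc j) powr \<beta> \<le> ?\<epsilon>" using \<beta> by (intro powr_mono2) auto
      then show "Nn (r (Suc j)) \<le> ?\<epsilon>" using r(2)[of "Suc j"] by linarith
    qed (use r(2) in auto)
    also have "\<dots> = 2 powr (\<beta> + 1) * ?\<epsilon>" by (simp add: powr_add)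
    finally have N: "(\<integral>\<^sup>+x. ennreal (\<bar>?d x\<bar> powr \<beta>) \<partial>m) \<le> ennreal (2 powr (\<beta> + 1) * ?\<epsilon>)" by (simp add: ennreal_leI)
    have "(\<integral>\<^sup>+\<omega>. ennreal \<bar>simple_integral_on \<Lambda> A ?\<eta> \<omega>\<bar> \<partial>M) \<le> ennreal (L1_const * (2 powr (\<beta> + 1) * ?\<epsilon>) powr (1 / \<beta>))"
    proof (rule L1_bound_of_cf[OF simple_integral_meas[OF \<eta> A] _ cf_simple(1)[OF \<eta> A] N])
      show "(\<lambda>x. indicator A x * simple_val ?\<eta> x) \<in> borel_measurable m" unfolding dval by measurable
    qed simp
    also have "(2 powr (\<beta> + 1) * ?\<epsilon>) powr (1 / \<beta>) = (2 powr (\<beta> + 1)) powr (1 / \<beta>) * (1/2) ^ j"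
      using \<beta> by (simp add: powr_mult powr_powr)
    finally show ?thesis by (simp add: simple_integral_append simple_integral_scale K_def mult.assoc)
  qed
  have conv: "tendsto_in_prob M (\<lambda>j. simple_integral_on \<Lambda> A (\<psi> j)) (\<lambda>\<omega>. lim (\<lambda>j. simple_integral_on \<Lambda> A (\<psi> j) \<omega>))"
    if A: "A \<in> sigma_sets \<Omega> S" for A
    by (rule L1_summable_converges[OF simple_integral_meas[OF \<psi>S A] step[OF A] K0])
  define Y where "Y = (\<lambda>\<omega>. lim (\<lambda>j. simple_integral_on \<Lambda> \<Omega> (\<psi> j) \<omega>))"
  have RR: "RR f Y"
    unfolding has_RR_integral_def
  proof (intro exI[of _ \<psi>] conjI allI ballI)
    show "AE x in m. (\<lambda>n. simple_val (\<psi> n) x) \<longlonglongrightarrow> f x"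
      using w_lim
    proof eventually_elim
      case (elim x)
      show ?case using filterlim_compose[OF elim r_top] by (simp add: w_def \<psi>_def)
    qed
    show "tendsto_in_prob M (\<lambda>n. simple_integral_on \<Lambda> \<Omega> (\<psi> n)) Y" unfolding Y_def by (rule conv[OF \<Omega>_sigma])
  qed (use \<psi>S conv in blast)+
  have "(\<lambda>j. cf (\<lambda>\<omega>. 1 * simple_integral_on \<Lambda> \<Omega> (\<psi> j) \<omega>)) \<longlonglongrightarrow> cf (\<lambda>\<omega>. 1 * Y \<omega>)"
    unfolding Y_def by (rule tendsto_in_prob_cf[OF conv[OF \<Omega>_sigma]])
  moreover have "cf (\<lambda>\<omega>. 1 * simple_integral_on \<Lambda> \<Omega> (\<psi> j) \<omega>) = exp (\<integral>x. \<kappa> (w (r j) x) \<partial>m)" for j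
    unfolding cf_simple_full(1)[OF \<psi>S] by (simp add: \<psi>_def w_def)
  moreover have "(\<lambda>j. exp (\<integral>x. \<kappa> (w (r j) x) \<partial>m)) \<longlonglongrightarrow> exp (\<integral>x. \<kappa> (f x) \<partial>m)"
  proof (intro tendsto_exp integral_dominated_convergence)
    show "integrable m (\<lambda>x. C * 2 powr \<beta> * \<bar>f x\<bar> powr \<beta>)" by (intro integrable_mult_right fint)
    show "AE x in m. (\<lambda>j. \<kappa> (w (r j) x)) \<longlonglongrightarrow> \<kappa> (f x)"
      using w_lim
    proof eventually_elim
      case (elim x)
      show ?case by (rule continuous_on_tendsto_compose[OF \<kappa>_cont filterlim_compose[OF elim r_top]]) auto
    qed
    show "AE x in m. norm (\<kappa> (w (r j) x)) \<le> C * 2 powr \<beta> * \<bar>f x\<bar> powr \<beta>" for j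
      using w_le
    proof eventually_elim
      case (elim x)
      have "\<bar>w (r j) x\<bar> powr \<beta> \<le> (2 * \<bar>f x\<bar>) powr \<beta>" using elim \<beta> by (intro powr_mono2) auto
      then have "C * \<bar>w (r j) x\<bar> powr \<beta> \<le> C * (2 powr \<beta> * \<bar>f x\<bar> powr \<beta>)" using C(1) by (simp add: powr_mult)
      then show ?case using C(2)[of "w (r j) x"] by (simp add: mult.assoc)
    qed
  qed auto
  ultimately have "cf (\<lambda>\<omega>. 1 * Y \<omega>) = exp (\<integral>x. \<kappa> (f x) \<partial>m)" by (simp only:) (rule LIMSEQ_unique)
  with RR show ?thesis by auto
qed

lemma RR_cf:
  assumes "RR f Y" "f \<in> borel_measurable m" "(\<integral>\<^sup>+x. ennreal (\<bar>f x\<bar> powr \<beta>) \<partial>m) < \<infinity>"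
  shows "cf Y = exp (\<integral>x. \<kappa> (f x) \<partial>m)"
proof -
  obtain f' where "f' \<in> borel_measurable \<Sigma>" "AE x in m. f x = f' x" using RR_version[OF assms(1)] by blast
  then obtain Z where Z: "RR f Z" "cf Z = exp (\<integral>x. \<kappa> (f x) \<partial>m)" using RR_exists assms(2,3) by blast
  have "cf Y = cf Z" by (rule cf_cong_AE[OF RR_meas[OF assms(1)] RR_meas[OF Z(1)] RR_unique[OF assms(1) Z(1)]])
  then show ?thesis using Z by simp
qed

lemma RR_scale: "RR f Y \<Longrightarrow> RR (\<lambda>x. a * f x) (\<lambda>\<omega>. a * Y \<omega>)"
  using RR_lincomb[OF _ RR_zero, of f Y a] by simp

lemma RR_sum:
  assumes "finite I" "\<And>i. i \<in> I \<Longrightarrow> RR (f i) (Y i)"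
  shows "RR (\<lambda>x. \<Sum>i\<in>I. a i * f i x) (\<lambda>\<omega>. \<Sum>i\<in>I. a i * Y i \<omega>)"
  using assms
proof (induction rule: finite_induct)
  case empty
  then show ?case by (simp add: RR_zero)
next
  case (insert i I)
  have "RR (\<lambda>x. a i * f i x + (\<Sum>i\<in>I. a i * f i x)) (\<lambda>\<omega>. a i * Y i \<omega> + (\<Sum>i\<in>I. a i * Y i \<omega>))"
    using insert by (intro RR_lincomb) auto
  then show ?case using insert by simp
qed

lemma RR_L1:
  assumes "RR f Y" "f \<in> borel_measurable m" "(\<integral>\<^sup>+x. ennreal (\<bar>f x\<bar> powr \<beta>) \<partial>m) \<le> ennreal N" "N \<ge> 0"
  shows "(\<integral>\<^sup>+\<omega>. ennreal \<bar>Y \<omega>\<bar> \<partial>M) \<le> ennreal (L1_const * N powr (1 / \<beta>))"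
proof (rule L1_bound_of_cf[OF RR_meas[OF assms(1)] assms(2) _ assms(3,4)])
  fix s
  show "cf (\<lambda>\<omega>. s * Y \<omega>) = exp (\<integral>x. \<kappa> (s * f x) \<partial>m)"
  proof (rule RR_cf[OF RR_scale[OF assms(1)]])
    have [measurable]: "f \<in> borel_measurable m" by (rule assms(2))
    show "(\<lambda>x. s * f x) \<in> borel_measurable m" by measurable
    have "(\<integral>\<^sup>+x. ennreal (\<bar>s * f x\<bar> powr \<beta>) \<partial>m) = ennreal (\<bar>s\<bar> powr \<beta>) * (\<integral>\<^sup>+x. ennreal (\<bar>f x\<bar> powr \<beta>) \<partial>m)"
      by (subst nn_integral_cmult[symmetric]) (auto simp: abs_mult powr_mult ennreal_mult)
    also have "\<dots> < \<infinity>" using assms(3) by (auto simp: ennreal_mult_less_top intro: le_less_trans)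
    finally show "(\<integral>\<^sup>+x. ennreal (\<bar>s * f x\<bar> powr \<beta>) \<partial>m) < \<infinity>" .
  qed
qed

end

section \<open>Stochastic Fubini theorem\<close>

text \<open>
  A field of integrals \<open>X(y) = \<integral> k(y, \<cdot>) d\<Lambda>\<close> with kernels that are continuous in \<open>y\<close> and dominated in \<open>L\<^sup>\<beta>(m)\<close> locally
  uniformly in \<open>y\<close>, and a weight \<open>\<theta>\<close> against which it is averaged.
\<close>

locale RR_field = finite_random_measure M \<Omega> S m \<Lambda> \<kappa> \<beta> C D
  for M :: "'w measure" and \<Omega> :: "'e set" and S m \<Lambda> \<kappa> \<beta> C D +
  fixes k :: "'y::euclidean_space \<Rightarrow> 'e \<Rightarrow> real" and X :: "'y \<Rightarrow> 'w \<Rightarrow> real" and dom :: "real \<Rightarrow> 'e \<Rightarrow> real"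
  assumes X_joint: "(\<lambda>(y, \<omega>). X y \<omega>) \<in> borel_measurable (lborel \<Otimes>\<^sub>M M)"
    and X_RR: "\<And>y. RR (k y) (X y)"
    and k_joint: "(\<lambda>(y, x). k y x) \<in> borel_measurable (lborel \<Otimes>\<^sub>M m)"
    and k_cont: "\<And>x. x \<in> \<Omega> \<Longrightarrow> continuous_on UNIV (\<lambda>y. k y x)"
    and dom_meas: "\<And>R. dom R \<in> borel_measurable m"
    and dom_fin: "\<And>R. (\<integral>\<^sup>+x. ennreal (\<bar>dom R x\<bar> powr \<beta>) \<partial>m) < \<infinity>"
    and dom_le: "\<And>R y x. norm y \<le> R \<Longrightarrow> x \<in> \<Omega> \<Longrightarrow> \<bar>k y x\<bar> \<le> dom R x"
  fixes \<theta> :: "'y \<Rightarrow> real" and R c :: real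
  assumes \<theta>_meas[measurable]: "\<theta> \<in> borel_measurable borel" and \<theta>_le: "\<And>y. \<bar>\<theta> y\<bar> \<le> c * indicator (cball 0 R) y"
begin

sublocale P: pair_sigma_finite lborel M by unfold_locales

lemma k_meas[measurable]: "k y \<in> borel_measurable m"
  using measurable_compose[OF measurable_Pair1' k_joint, of y] by simp

lemma X_meas[measurable]: "X y \<in> borel_measurable M"
  by (rule RR_meas[OF X_RR])

lemma \<theta>_int: "integrable lborel \<theta>"
proof (rule Bochner_Integration.integrable_bound)
  show "integrable lborel (\<lambda>y. c * indicat_real (cball 0 R :: 'y set) y)"
    using emeasure_compact_finite[of "cball 0 R :: 'y set"] by (intro integrable_mult_right integrable_real_indicator) auto
  show "AE y in lborel. norm (\<theta> y) \<le> norm (c * indicat_real (cball 0 R) y)"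
    unfolding real_norm_def by (intro AE_I2 order_trans[OF \<theta>_le abs_ge_self])
qed simp

lemma \<theta>_outside: "norm y > R \<Longrightarrow> \<theta> y = 0" using \<theta>_le[of y] by simp

lemma dom_int: "integrable m (\<lambda>x. \<bar>dom r x\<bar> powr \<beta>)"
proof -
  have [measurable]: "dom r \<in> borel_measurable m" by (rule dom_meas)
  show ?thesis using dom_fin[of r] by (intro integrableI_bounded) auto
qed

text \<open>
  Discretisations of the index: \<open>q i\<close> takes finitely many values and tends to the identity. The bound \<open>2 |y|\<close>
  is the reason for the radius \<open>2 R\<close> below.
\<close>

definition "q = (SOME q. (\<forall>i. simple_function borel (q i)) \<and> (\<forall>y::'y. (\<lambda>i. q i y) \<longlonglongrightarrow> y) \<and> (\<forall>i y. norm (q i y) \<le> 2 * norm y))"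

lemma q: "simple_function borel (q i)" "(\<lambda>i. q i y) \<longlonglongrightarrow> y" "norm (q i y) \<le> 2 * norm y"
proof -
  have "(\<lambda>y::'y. y) \<in> borel_measurable borel" by simp
  from borel_measurable_implies_sequence_metric[OF this, of 0]
  have "\<exists>q. (\<forall>i. simple_function borel (q i)) \<and> (\<forall>y::'y. (\<lambda>i. q i y) \<longlonglongrightarrow> y) \<and> (\<forall>i y. norm (q i y) \<le> 2 * norm y)"
    by auto
  from someI_ex[OF this] show "simple_function borel (q i)" "(\<lambda>i. q i y) \<longlonglongrightarrow> y" "norm (q i y) \<le> 2 * norm y"
    unfolding q_def[symmetric] by blast+
qed

lemma q_meas[measurable]: "q i \<in> borel_measurable borel" by (rule borel_measurable_simple_function[OF q(1)])

lemma q_fin: "finite (range (q i))" using simple_functionD(1)[OF q(1)[of i]] by simp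

text \<open>
  The weight of the level set of \<open>q i\<close> at \<open>z\<close>; averages along \<open>q i\<close> are finite sums with these weights.
\<close>

definition "wt i z = (\<integral>y. \<theta> y * indicator {y. q i y = z} y \<partial>lborel)"

lemma level_set[measurable]: "{y. q i y = z} \<in> sets borel"
  using simple_functionD(2)[OF q(1)[of i], of "{z}"] by (simp add: vimage_def)

lemma discretised_integral:
  "has_bochner_integral lborel (\<lambda>y. \<theta> y * h (q i y)) (\<Sum>z\<in>range (q i). wt i z * h z)"
proof -
  have eq: "\<theta> y * h (q i y) = (\<Sum>z\<in>range (q i). \<theta> y * indicator {y. q i y = z} y * h z)" for y
  proof -
    have "(\<Sum>z\<in>range (q i). \<theta> y * indicator {y. q i y = z} y * h z) = (\<Sum>z\<in>range (q i). if z = q i y then \<theta> y * h z else 0)"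
      by (intro sum.cong) auto
    then show ?thesis using q_fin by simp
  qed
  have "has_bochner_integral lborel (\<lambda>y. \<theta> y * indicator {y. q i y = z} y) (wt i z)" for z
    unfolding wt_def has_bochner_integral_iff using integrable_mult_indicator[OF _ \<theta>_int, of "{y. q i y = z}"] level_set
    by (simp add: mult.commute)
  then show ?thesis unfolding eq by (intro has_bochner_integral_sum has_bochner_integral_mult_left) auto
qed

definition "H x = (\<integral>y. \<theta> y * k y x \<partial>lborel)"
definition "Hn i x = (\<Sum>z\<in>range (q i). wt i z * k z x)"

lemma Hn_eq: "Hn i x = (\<integral>y. \<theta> y * k (q i y) x \<partial>lborel)"
  unfolding Hn_def using has_bochner_integral_integral_eq[OF discretised_integral[of "\<lambda>z. k z x" i]] by simp

lemma norm_\<theta>_k: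
  assumes "x \<in> \<Omega>" shows "\<bar>\<theta> y * k y x\<bar> \<le> \<bar>\<theta> y\<bar> * dom (2 * R) x" "\<bar>\<theta> y * k (q i y) x\<bar> \<le> \<bar>\<theta> y\<bar> * dom (2 * R) x"
proof -
  show "\<bar>\<theta> y * k y x\<bar> \<le> \<bar>\<theta> y\<bar> * dom (2 * R) x"
  proof (cases "norm y \<le> R")
    case True
    then have "norm y \<le> 2 * R" using norm_ge_zero[of y] by linarith
    then show ?thesis unfolding abs_mult using assms by (intro mult_left_mono dom_le) auto
  qed (simp add: \<theta>_outside)
  show "\<bar>\<theta> y * k (q i y) x\<bar> \<le> \<bar>\<theta> y\<bar> * dom (2 * R) x"
  proof (cases "norm y \<le> R")
    case True
    then have "norm (q i y) \<le> 2 * R" using q(3)[of i y] by linarith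
    then show ?thesis unfolding abs_mult using assms by (intro mult_left_mono dom_le) auto
  qed (simp add: \<theta>_outside)
qed

lemma k_meas1: "x \<in> space m \<Longrightarrow> (\<lambda>y. k y x) \<in> borel_measurable lborel"
  using measurable_compose[OF measurable_Pair2' k_joint, of x] by simp

lemma \<Omega>_space: "\<Omega> \<subseteq> space m" using \<Omega>_m by (rule sets.sets_into_space)

definition "T = (\<integral>y. \<bar>\<theta> y\<bar> \<partial>lborel)"

lemma T_nonneg: "T \<ge> 0" by (simp add: T_def)

lemma H_bounds:
  assumes x: "x \<in> \<Omega>" shows "\<bar>H x\<bar> \<le> T * dom (2 * R) x" "\<bar>Hn i x\<bar> \<le> T * dom (2 * R) x" "(\<lambda>i. Hn i x) \<longlonglongrightarrow> H x"
proof -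
  have [measurable]: "(\<lambda>y. k y x) \<in> borel_measurable borel" using k_meas1[of x] x \<Omega>_space by auto
  have I: "integrable lborel (\<lambda>y. \<bar>\<theta> y\<bar> * dom (2 * R) x)" using \<theta>_int by simp
  have km: "(\<lambda>y. k (q i y) x) \<in> borel_measurable borel" for i
    by (rule measurable_compose[OF q_meas]) simp
  have "\<bar>\<integral>y. f y \<partial>lborel\<bar> \<le> T * dom (2 * R) x" if f: "\<And>y. \<bar>f y\<bar> \<le> \<bar>\<theta> y\<bar> * dom (2 * R) x" and [measurable]: "f \<in> borel_measurable lborel" for f
  proof -
    have "\<bar>\<integral>y. f y \<partial>lborel\<bar> \<le> (\<integral>y. \<bar>f y\<bar> \<partial>lborel)" by (rule integral_abs_bound)
    also have "\<dots> \<le> (\<integral>y. \<bar>\<theta> y\<bar> * dom (2 * R) x \<partial>lborel)"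
    proof (rule integral_mono[OF _ I f])
      show "integrable lborel (\<lambda>y. \<bar>f y\<bar>)"
        by (rule Bochner_Integration.integrable_bound[OF I]) (use f in \<open>auto intro!: AE_I2 order_trans[OF _ abs_ge_self]\<close>)
    qed
    finally show ?thesis by (simp add: T_def)
  qed note b = this
  show "\<bar>H x\<bar> \<le> T * dom (2 * R) x" unfolding H_def by (rule b[OF norm_\<theta>_k(1)[OF x]]) measurable
  show "\<bar>Hn i x\<bar> \<le> T * dom (2 * R) x" unfolding Hn_eq by (rule b[OF norm_\<theta>_k(2)[OF x]]) (use km in measurable)
  show "(\<lambda>i. Hn i x) \<longlonglongrightarrow> H x"
    unfolding Hn_eq H_def
  proof (rule integral_dominated_convergence[OF _ _ I])
    show "AE y in lborel. (\<lambda>i. \<theta> y * k (q i y) x) \<longlonglongrightarrow> \<theta> y * k y x"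
      by (intro AE_I2 tendsto_mult tendsto_const continuous_on_tendsto_compose[OF k_cont[OF x] q(2)]) auto
    show "AE y in lborel. norm (\<theta> y * k (q i y) x) \<le> \<bar>\<theta> y\<bar> * dom (2 * R) x" for i
      using norm_\<theta>_k(2)[OF x] by (intro AE_I2) simp
  qed (use km in auto)
qed

lemma H_meas[measurable]: "H \<in> borel_measurable m"
proof -
  have "(\<lambda>x. \<integral>y. \<theta> y * k y x \<partial>lborel) \<in> borel_measurable m"
  proof (rule lborel.borel_measurable_lebesgue_integral)
    have 1: "(\<lambda>p. k (snd p) (fst p)) \<in> borel_measurable (m \<Otimes>\<^sub>M lborel)"
      using measurable_pair_swap[OF k_joint] by (simp add: case_prod_beta')
    have 2: "(\<lambda>p. \<theta> (snd p)) \<in> borel_measurable (m \<Otimes>\<^sub>M lborel)" by measurable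
    show "(\<lambda>(x, y). \<theta> y * k y x) \<in> borel_measurable (m \<Otimes>\<^sub>M lborel)"
      unfolding case_prod_beta' using borel_measurable_times[OF 2 1] by simp
  qed
  then show ?thesis by (simp add: H_def[abs_def])
qed

lemma Hn_meas[measurable]: "Hn i \<in> borel_measurable m"
proof -
  have "(\<lambda>x. \<Sum>z\<in>range (q i). wt i z * k z x) \<in> borel_measurable m" by measurable
  then show ?thesis by (simp add: Hn_def[abs_def])
qed

lemma powr_bound_fin:
  assumes [measurable]: "f \<in> borel_measurable m" and "\<And>x. x \<in> \<Omega> \<Longrightarrow> \<bar>f x\<bar> \<le> t * dom r x" "t \<ge> 0"
  shows "(\<integral>\<^sup>+x. ennreal (\<bar>f x\<bar> powr \<beta>) \<partial>m) \<le> ennreal (t powr \<beta> * (\<integral>x. \<bar>dom r x\<bar> powr \<beta> \<partial>m))"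
proof -
  have "(\<integral>\<^sup>+x. ennreal (\<bar>f x\<bar> powr \<beta>) \<partial>m) \<le> (\<integral>\<^sup>+x. ennreal (t powr \<beta> * \<bar>dom r x\<bar> powr \<beta>) \<partial>m)"
  proof (intro nn_integral_mono_AE)
    show "AE x in m. ennreal (\<bar>f x\<bar> powr \<beta>) \<le> ennreal (t powr \<beta> * \<bar>dom r x\<bar> powr \<beta>)"
      using null
    proof eventually_elim
      case (elim x)
      have "\<bar>f x\<bar> \<le> t * \<bar>dom r x\<bar>" using assms(2)[OF elim] assms(3) mult_left_mono[OF abs_ge_self[of "dom r x"] assms(3)] by linarith
      then have "\<bar>f x\<bar> powr \<beta> \<le> (t * \<bar>dom r x\<bar>) powr \<beta>" using \<beta> by (intro powr_mono2) auto
      then show ?case using assms(3) by (simp add: powr_mult ennreal_leI)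
    qed
  qed
  also have "\<dots> = ennreal (\<integral>x. t powr \<beta> * \<bar>dom r x\<bar> powr \<beta> \<partial>m)"
    using dom_int by (intro nn_integral_eq_integral integrable_mult_right) auto
  finally show ?thesis by simp
qed

lemma Hn_fin: "(\<integral>\<^sup>+x. ennreal (\<bar>Hn i x\<bar> powr \<beta>) \<partial>m) < \<infinity>"
  using powr_bound_fin[OF Hn_meas H_bounds(2) T_nonneg] by (rule le_less_trans) auto

text \<open>
  The averaged kernel is an almost everywhere limit of finite combinations of the kernels \<open>k y\<close>, each of which has a
  version measurable with respect to the sigma-algebra of the ring.
\<close>

lemma H_version: "\<exists>f'\<in>borel_measurable \<Sigma>. AE x in m. H x = f' x"
proof -
  obtain k' where k': "\<And>z. k' z \<in> borel_measurable \<Sigma>" "\<And>z. AE x in m. k z x = k' z x"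
    using RR_version[OF X_RR] by metis
  let ?H' = "\<lambda>i x. \<Sum>z\<in>range (q i). wt i z * k' z x"
  have [measurable]: "?H' i \<in> borel_measurable \<Sigma>" for i using k'(1) by measurable
  have "AE x in m. \<forall>i. Hn i x = ?H' i x"
  proof (subst AE_all_countable, rule allI)
    fix i
    have "AE x in m. \<forall>z\<in>range (q i). k z x = k' z x" by (rule AE_finite_allI[OF q_fin]) (rule k'(2))
    then show "AE x in m. Hn i x = ?H' i x" by eventually_elim (auto simp: Hn_def intro!: sum.cong)
  qed
  then have "AE x in m. H x = lim (\<lambda>i. ?H' i x)" using null
  proof eventually_elim
    case (elim x)
    have "(\<lambda>i. ?H' i x) \<longlonglongrightarrow> H x" using H_bounds(3)[OF elim(2)] elim(1) by simp
    then show ?case by (simp add: limI)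
  qed
  moreover have "(\<lambda>x. lim (\<lambda>i. ?H' i x)) \<in> borel_measurable \<Sigma>" by measurable
  ultimately show ?thesis by (intro bexI)
qed

definition "V \<omega> = (\<integral>y. \<theta> y * X y \<omega> \<partial>lborel)"
definition "Vn i \<omega> = (\<Sum>z\<in>range (q i). wt i z * X z \<omega>)"

lemma X_joint'[measurable]: "(\<lambda>p. X (fst p) (snd p)) \<in> borel_measurable (lborel \<Otimes>\<^sub>M M)"
  using X_joint by (simp add: case_prod_beta')

lemma Xq_joint[measurable]: "(\<lambda>p. X (q i (fst p)) (snd p)) \<in> borel_measurable (lborel \<Otimes>\<^sub>M M)"
proof -
  have "(\<lambda>p. (q i (fst p), snd p)) \<in> measurable (lborel \<Otimes>\<^sub>M M) (lborel \<Otimes>\<^sub>M M)"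
    using q_meas by measurable
  from measurable_compose[OF this X_joint'] show ?thesis by simp
qed

lemma X_L1: 
  assumes "norm y \<le> r"
  shows "(\<integral>\<^sup>+\<omega>. ennreal \<bar>X y \<omega>\<bar> \<partial>M) \<le> ennreal (L1_const * (\<integral>x. \<bar>dom r x\<bar> powr \<beta> \<partial>m) powr (1 / \<beta>))"
  using powr_bound_fin[OF k_meas[of y], of 1 r] dom_le[OF assms]
  by (intro RR_L1[OF X_RR k_meas]) auto

lemma \<theta>X_swap[measurable]: "(\<lambda>p. \<theta> (snd p) * X (snd p) (fst p)) \<in> borel_measurable (M \<Otimes>\<^sub>M lborel)"
proof (rule borel_measurable_times)
  show "(\<lambda>p. X (snd p) (fst p)) \<in> borel_measurable (M \<Otimes>\<^sub>M lborel)"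
    using measurable_pair_swap[OF X_joint] by (simp add: case_prod_beta')
qed measurable

lemma \<theta>X_integrable: "AE \<omega> in M. integrable lborel (\<lambda>y. \<theta> y * X y \<omega>)"
proof -
  let ?B = "ennreal (L1_const * (\<integral>x. \<bar>dom R x\<bar> powr \<beta> \<partial>m) powr (1 / \<beta>))"
  have [measurable]: "(\<lambda>p. ennreal (\<bar>\<theta> (fst p) * X (fst p) (snd p)\<bar>)) \<in> borel_measurable (lborel \<Otimes>\<^sub>M M)" by measurable
  have "(\<integral>\<^sup>+\<omega>. \<integral>\<^sup>+y. ennreal \<bar>\<theta> y * X y \<omega>\<bar> \<partial>lborel \<partial>M) = (\<integral>\<^sup>+y. \<integral>\<^sup>+\<omega>. ennreal \<bar>\<theta> y * X y \<omega>\<bar> \<partial>M \<partial>lborel)"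
    by (rule P.Fubini') (simp add: case_prod_beta')
  also have "\<dots> \<le> (\<integral>\<^sup>+y. ennreal \<bar>\<theta> y\<bar> * ?B \<partial>lborel)"
  proof (intro nn_integral_mono)
    fix y :: 'y
    have "(\<integral>\<^sup>+\<omega>. ennreal \<bar>\<theta> y * X y \<omega>\<bar> \<partial>M) = ennreal \<bar>\<theta> y\<bar> * (\<integral>\<^sup>+\<omega>. ennreal \<bar>X y \<omega>\<bar> \<partial>M)"
      by (subst nn_integral_cmult[symmetric]) (auto simp: abs_mult ennreal_mult)
    also have "\<dots> \<le> ennreal \<bar>\<theta> y\<bar> * ?B"
    proof (cases "norm y \<le> R")
      case True
      then show ?thesis by (intro mult_left_mono X_L1) auto
    qed (simp add: \<theta>_outside)
    finally show "(\<integral>\<^sup>+\<omega>. ennreal \<bar>\<theta> y * X y \<omega>\<bar> \<partial>M) \<le> ennreal \<bar>\<theta> y\<bar> * ?B" .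
  qed
  also have "\<dots> = ennreal T * ?B"
    using \<theta>_int by (subst nn_integral_multc) (auto simp: T_def nn_integral_eq_integral)
  also have "\<dots> < \<infinity>" by (simp add: ennreal_mult_less_top)
  finally have "AE \<omega> in M. (\<integral>\<^sup>+y. ennreal \<bar>\<theta> y * X y \<omega>\<bar> \<partial>lborel) \<noteq> \<infinity>"
  proof (intro nn_integral_noteq_infinite)
    show "(\<lambda>\<omega>. \<integral>\<^sup>+y. ennreal \<bar>\<theta> y * X y \<omega>\<bar> \<partial>lborel) \<in> borel_measurable M"
      by (rule lborel.borel_measurable_nn_integral) (simp add: case_prod_beta')
  qed auto
  then show ?thesis
  proof (rule AE_mp[OF _ AE_I2], intro impI)
    fix \<omega> assume \<omega>: "\<omega> \<in> space M" and fin: "(\<integral>\<^sup>+y. ennreal \<bar>\<theta> y * X y \<omega>\<bar> \<partial>lborel) \<noteq> \<infinity>"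
    have [measurable]: "(\<lambda>y. X y \<omega>) \<in> borel_measurable borel"
      using measurable_compose[OF measurable_Pair2'[OF \<omega>] X_joint'] by simp
    show "integrable lborel (\<lambda>y. \<theta> y * X y \<omega>)"
      using fin by (intro integrableI_bounded) (auto simp: less_top)
  qed
qed

lemma V_meas[measurable]: "V \<in> borel_measurable M"
proof -
  have "(\<lambda>\<omega>. \<integral>y. \<theta> y * X y \<omega> \<partial>lborel) \<in> borel_measurable M"
    by (rule lborel.borel_measurable_lebesgue_integral) (simp add: case_prod_beta')
  then show ?thesis by (simp add: V_def[abs_def])
qed

lemma Vn_meas[measurable]: "Vn i \<in> borel_measurable M"
proof -
  have "(\<lambda>\<omega>. \<Sum>z\<in>range (q i). wt i z * X z \<omega>) \<in> borel_measurable M" by measurable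
  then show ?thesis by (simp add: Vn_def[abs_def])
qed

definition "err i y = (\<integral>\<^sup>+\<omega>. ennreal \<bar>X y \<omega> - X (q i y) \<omega>\<bar> \<partial>M)"

lemma err_meas[measurable]: "err i \<in> borel_measurable lborel"
proof -
  have "(\<lambda>y. \<integral>\<^sup>+\<omega>. ennreal \<bar>X y \<omega> - X (q i y) \<omega>\<bar> \<partial>M) \<in> borel_measurable lborel"
    by (rule borel_measurable_nn_integral) (simp add: case_prod_beta')
  then show ?thesis by (simp add: err_def[abs_def])
qed

text \<open>
  \<open>X\<close> is continuous in \<open>L\<^sup>1\<close>, because its kernel is continuous in \<open>L\<^sup>\<beta>(m)\<close> by dominated convergence.
\<close>

lemma err_bounds:
  assumes y: "norm y \<le> R"
  shows "err i y \<le> ennreal (L1_const * (2 powr \<beta> * (\<integral>x. \<bar>dom (2 * R) x\<bar> powr \<beta> \<partial>m)) powr (1 / \<beta>))"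
    and "(\<lambda>i. err i y) \<longlonglongrightarrow> 0"
proof -
  let ?d = "\<lambda>i x. k y x - k (q i y) x"
  have RRd: "RR (?d i) (\<lambda>\<omega>. X y \<omega> - X (q i y) \<omega>)" for i
    using RR_lincomb[OF X_RR[of "q i y"] X_RR[of y], of "- 1"] by simp
  have y2: "norm y \<le> 2 * R" "norm (q i y) \<le> 2 * R" for i
    using y q(3)[of i y] norm_ge_zero[of y] by linarith+
  have dle: "\<bar>?d i x\<bar> \<le> 2 * dom (2 * R) x" if "x \<in> \<Omega>" for i x
    using dom_le[OF y2(1) that] dom_le[OF y2(2) that, of i] by linarith
  show "err i y \<le> ennreal (L1_const * (2 powr \<beta> * (\<integral>x. \<bar>dom (2 * R) x\<bar> powr \<beta> \<partial>m)) powr (1 / \<beta>))"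
    unfolding err_def by (rule RR_L1[OF RRd _ powr_bound_fin[OF _ dle]]) auto
  define Nn where "Nn = (\<lambda>i. \<integral>x. \<bar>?d i x\<bar> powr \<beta> \<partial>m)"
  have dle': "AE x in m. \<bar>?d i x\<bar> powr \<beta> \<le> 2 powr \<beta> * \<bar>dom (2 * R) x\<bar> powr \<beta>" for i
    using null
  proof eventually_elim
    case (elim x)
    have "\<bar>?d i x\<bar> \<le> 2 * \<bar>dom (2 * R) x\<bar>" using dle[OF elim, of i] by linarith
    then have "\<bar>?d i x\<bar> powr \<beta> \<le> (2 * \<bar>dom (2 * R) x\<bar>) powr \<beta>" using \<beta> by (intro powr_mono2) auto
    then show ?case by (simp add: powr_mult)
  qed
  have dint: "integrable m (\<lambda>x. \<bar>?d i x\<bar> powr \<beta>)" for i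
    by (rule Bochner_Integration.integrable_bound[OF integrable_mult_right[OF dom_int, of "2 powr \<beta>" "2 * R"]])
       (use dle'[of i] in auto)
  have "Nn \<longlonglongrightarrow> (\<integral>x. 0 \<partial>m)"
    unfolding Nn_def
  proof (rule integral_dominated_convergence)
    show "integrable m (\<lambda>x. 2 powr \<beta> * \<bar>dom (2 * R) x\<bar> powr \<beta>)" by (intro integrable_mult_right dom_int)
    show "AE x in m. (\<lambda>i. \<bar>?d i x\<bar> powr \<beta>) \<longlonglongrightarrow> 0"
      using null
    proof eventually_elim
      case (elim x)
      have "(\<lambda>i. k (q i y) x) \<longlonglongrightarrow> k y x" by (rule continuous_on_tendsto_compose[OF k_cont[OF elim] q(2)]) auto
      then have "(\<lambda>i. \<bar>?d i x\<bar>) \<longlonglongrightarrow> \<bar>k y x - k y x\<bar>" by (intro tendsto_intros)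
      then have "(\<lambda>i. \<bar>?d i x\<bar> powr \<beta>) \<longlonglongrightarrow> 0 powr \<beta>" using \<beta> by (intro tendsto_powr') auto
      then show ?case by simp
    qed
    show "AE x in m. norm (\<bar>?d i x\<bar> powr \<beta>) \<le> 2 powr \<beta> * \<bar>dom (2 * R) x\<bar> powr \<beta>" for i using dle'[of i] by simp
  qed auto
  then have Nn0: "Nn \<longlonglongrightarrow> 0" by simp
  have le: "err i y \<le> ennreal (L1_const * Nn i powr (1 / \<beta>))" for i
    unfolding err_def Nn_def using nn_integral_eq_integral[OF dint[of i]]
    by (intro RR_L1[OF RRd]) auto
  have "(\<lambda>i. L1_const * Nn i powr (1 / \<beta>)) \<longlonglongrightarrow> L1_const * 0 powr (1 / \<beta>)"
    using \<beta> Nn0 by (intro tendsto_mult tendsto_const tendsto_powr') (auto simp: Nn_def)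
  then have "(\<lambda>i. ennreal (L1_const * Nn i powr (1 / \<beta>))) \<longlonglongrightarrow> 0" using tendsto_ennrealI by fastforce
  then show "(\<lambda>i. err i y) \<longlonglongrightarrow> 0"
    by (rule tendsto_sandwich[OF _ _ tendsto_const, rotated 2]) (auto simp: le)
qed

lemma V_diff_le: "(\<integral>\<^sup>+\<omega>. ennreal \<bar>V \<omega> - Vn i \<omega>\<bar> \<partial>M) \<le> (\<integral>\<^sup>+y. ennreal \<bar>\<theta> y\<bar> * err i y \<partial>lborel)"
proof -
  let ?f = "\<lambda>y \<omega>. \<bar>\<theta> y\<bar> * \<bar>X y \<omega> - X (q i y) \<omega>\<bar>"
  have "(\<integral>\<^sup>+\<omega>. ennreal \<bar>V \<omega> - Vn i \<omega>\<bar> \<partial>M) \<le> (\<integral>\<^sup>+\<omega>. \<integral>\<^sup>+y. ennreal (?f y \<omega>) \<partial>lborel \<partial>M)"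
  proof (rule nn_integral_mono_AE)
    show "AE \<omega> in M. ennreal \<bar>V \<omega> - Vn i \<omega>\<bar> \<le> (\<integral>\<^sup>+y. ennreal (?f y \<omega>) \<partial>lborel)"
      using \<theta>X_integrable
    proof eventually_elim
      case (elim \<omega>)
      have d: "has_bochner_integral lborel (\<lambda>y. \<theta> y * X (q i y) \<omega>) (Vn i \<omega>)"
        unfolding Vn_def by (rule discretised_integral)
      have i: "integrable lborel (\<lambda>y. \<theta> y * X y \<omega> - \<theta> y * X (q i y) \<omega>)"
        using elim d by (auto simp: has_bochner_integral_iff)
      have "V \<omega> - Vn i \<omega> = (\<integral>y. \<theta> y * X y \<omega> - \<theta> y * X (q i y) \<omega> \<partial>lborel)"
        unfolding V_def using elim d by (auto simp: has_bochner_integral_iff)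
      then have "ennreal \<bar>V \<omega> - Vn i \<omega>\<bar> \<le> (\<integral>\<^sup>+y. ennreal (norm (\<theta> y * X y \<omega> - \<theta> y * X (q i y) \<omega>)) \<partial>lborel)"
        using integral_norm_bound_ennreal[OF i] by simp
      also have "\<dots> = (\<integral>\<^sup>+y. ennreal (?f y \<omega>) \<partial>lborel)" by (simp add: abs_mult flip: right_diff_distrib)
      finally show ?case .
    qed
  qed
  also have "\<dots> = (\<integral>\<^sup>+y. \<integral>\<^sup>+\<omega>. ennreal (?f y \<omega>) \<partial>M \<partial>lborel)"
    by (rule P.Fubini') (simp add: case_prod_beta')
  also have "\<dots> = (\<integral>\<^sup>+y. ennreal \<bar>\<theta> y\<bar> * err i y \<partial>lborel)"
    unfolding err_def by (intro nn_integral_cong) (simp add: ennreal_mult nn_integral_cmult)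
  finally show ?thesis .
qed

lemma V_L1_limit: "(\<lambda>i. \<integral>\<^sup>+\<omega>. ennreal \<bar>V \<omega> - Vn i \<omega>\<bar> \<partial>M) \<longlonglongrightarrow> 0"
proof -
  let ?B = "ennreal (L1_const * (2 powr \<beta> * (\<integral>x. \<bar>dom (2 * R) x\<bar> powr \<beta> \<partial>m)) powr (1 / \<beta>))"
  have "(\<lambda>i. \<integral>\<^sup>+y. ennreal \<bar>\<theta> y\<bar> * err i y \<partial>lborel) \<longlonglongrightarrow> (\<integral>\<^sup>+y. 0 \<partial>(lborel :: 'y measure))"
  proof (rule nn_integral_dominated_convergence[where w = "\<lambda>y. ennreal \<bar>\<theta> y\<bar> * ?B"])
    show "AE y in lborel. ennreal \<bar>\<theta> y\<bar> * err i y \<le> ennreal \<bar>\<theta> y\<bar> * ?B" for i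
    proof (rule AE_I2)
      fix y show "ennreal \<bar>\<theta> y\<bar> * err i y \<le> ennreal \<bar>\<theta> y\<bar> * ?B"
        by (cases "norm y \<le> R") (auto intro!: mult_left_mono err_bounds(1) simp: \<theta>_outside)
    qed
    have "(\<integral>\<^sup>+y. ennreal \<bar>\<theta> y\<bar> * ?B \<partial>lborel) = ennreal T * ?B"
      using \<theta>_int by (subst nn_integral_multc) (auto simp: T_def nn_integral_eq_integral)
    also have "\<dots> < \<infinity>" by (simp add: ennreal_mult_less_top)
    finally show "(\<integral>\<^sup>+y. ennreal \<bar>\<theta> y\<bar> * ?B \<partial>lborel) < \<infinity>" .
    show "AE y in lborel. (\<lambda>i. ennreal \<bar>\<theta> y\<bar> * err i y) \<longlonglongrightarrow> 0"
    proof (rule AE_I2)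
      fix y show "(\<lambda>i. ennreal \<bar>\<theta> y\<bar> * err i y) \<longlonglongrightarrow> 0"
      proof (cases "norm y \<le> R")
        case True
        have "(\<lambda>i. ennreal \<bar>\<theta> y\<bar> * err i y) \<longlonglongrightarrow> ennreal \<bar>\<theta> y\<bar> * 0"
          by (intro ennreal_tendsto_cmult err_bounds(2)[OF True]) simp
        then show ?thesis by simp
      qed (simp add: \<theta>_outside)
    qed
  qed measurable
  then have "(\<lambda>i. \<integral>\<^sup>+y. ennreal \<bar>\<theta> y\<bar> * err i y \<partial>lborel) \<longlonglongrightarrow> 0" by simp
  then show ?thesis
    by (rule tendsto_sandwich[OF _ _ tendsto_const, rotated 2]) (auto simp: V_diff_le)
qed

lemma norm_cf_diff_L1:
  assumes [measurable]: "Y \<in> borel_measurable M" "Z \<in> borel_measurable M"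
  shows "ennreal (norm (cf Y - cf Z)) \<le> (\<integral>\<^sup>+\<omega>. ennreal \<bar>Y \<omega> - Z \<omega>\<bar> \<partial>M)"
proof -
  have i: "integrable M (\<lambda>\<omega>. iexp (Y \<omega>) - iexp (Z \<omega>))"
    by (intro Bochner_Integration.integrable_diff cf_integrable assms)
  have "cf Y - cf Z = (\<integral>\<omega>. iexp (Y \<omega>) - iexp (Z \<omega>) \<partial>M)"
    unfolding cf_def by (intro Bochner_Integration.integral_diff[symmetric] cf_integrable assms)
  then have "ennreal (norm (cf Y - cf Z)) \<le> (\<integral>\<^sup>+\<omega>. ennreal (norm (iexp (Y \<omega>) - iexp (Z \<omega>))) \<partial>M)"
    using integral_norm_bound_ennreal[OF i] by simp
  also have "\<dots> \<le> (\<integral>\<^sup>+\<omega>. ennreal \<bar>Y \<omega> - Z \<omega>\<bar> \<partial>M)"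
  proof (intro nn_integral_mono ennreal_leI)
    fix \<omega>
    have "iexp (Y \<omega>) - iexp (Z \<omega>) = iexp (Z \<omega>) * (iexp (Y \<omega> - Z \<omega>) - 1)"
      by (simp add: algebra_simps flip: exp_add)
    then show "norm (iexp (Y \<omega>) - iexp (Z \<omega>)) \<le> \<bar>Y \<omega> - Z \<omega>\<bar>"
      using norm_iexp_minus_one_le[of "Y \<omega> - Z \<omega>"] by (simp add: norm_mult)
  qed
  finally show ?thesis .
qed

text \<open>
  The claim holds for the finite sums obtained by discretising \<open>y\<close>, by linearity of the integral. These sums
  converge in \<open>L\<^sup>1\<close> on the left and their kernels in \<open>L\<^sup>\<beta>(m)\<close> on the right.
\<close>

lemma stochastic_Fubini: "cf V = exp (\<integral>x. \<kappa> (H x) \<partial>m)"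
proof -
  have RRn: "RR (Hn i) (Vn i)" for i
    unfolding Hn_def[abs_def] Vn_def[abs_def] by (rule RR_sum[OF q_fin X_RR])
  have cfn: "cf (Vn i) = exp (\<integral>x. \<kappa> (Hn i x) \<partial>m)" for i
    by (rule RR_cf[OF RRn Hn_meas Hn_fin])
  have "(\<lambda>i. exp (\<integral>x. \<kappa> (Hn i x) \<partial>m)) \<longlonglongrightarrow> exp (\<integral>x. \<kappa> (H x) \<partial>m)"
  proof (intro tendsto_exp integral_dominated_convergence)
    show "integrable m (\<lambda>x. C * T powr \<beta> * \<bar>dom (2 * R) x\<bar> powr \<beta>)" by (intro integrable_mult_right dom_int)
    show "AE x in m. (\<lambda>i. \<kappa> (Hn i x)) \<longlonglongrightarrow> \<kappa> (H x)"
      using null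
    proof eventually_elim
      case (elim x)
      show ?case by (rule continuous_on_tendsto_compose[OF \<kappa>_cont H_bounds(3)[OF elim]]) auto
    qed
    show "AE x in m. norm (\<kappa> (Hn i x)) \<le> C * T powr \<beta> * \<bar>dom (2 * R) x\<bar> powr \<beta>" for i
      using null
    proof eventually_elim
      case (elim x)
      have "\<bar>Hn i x\<bar> \<le> T * \<bar>dom (2 * R) x\<bar>"
        using H_bounds(2)[OF elim, of i] mult_left_mono[OF abs_ge_self[of "dom (2 * R) x"] T_nonneg] by linarith
      then have "\<bar>Hn i x\<bar> powr \<beta> \<le> (T * \<bar>dom (2 * R) x\<bar>) powr \<beta>" using \<beta> by (intro powr_mono2) auto
      then have "C * \<bar>Hn i x\<bar> powr \<beta> \<le> C * (T powr \<beta> * \<bar>dom (2 * R) x\<bar> powr \<beta>)" using C(1) T_nonneg by (simp add: powr_mult)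
      then show ?case using C(2)[of "Hn i x"] by (simp add: mult.assoc)
    qed
  qed auto
  moreover have "(\<lambda>i. cf (Vn i)) \<longlonglongrightarrow> cf V"
  proof -
    have "(\<lambda>i. ennreal (norm (cf (Vn i) - cf V))) \<longlonglongrightarrow> 0"
    proof (rule tendsto_sandwich[OF _ _ tendsto_const V_L1_limit])
      show "eventually (\<lambda>i. ennreal (norm (cf (Vn i) - cf V)) \<le> (\<integral>\<^sup>+\<omega>. ennreal \<bar>V \<omega> - Vn i \<omega>\<bar> \<partial>M)) sequentially"
        using norm_cf_diff_L1[OF V_meas Vn_meas] by (simp add: norm_minus_commute)
    qed simp
    then have "(\<lambda>i. norm (cf (Vn i) - cf V)) \<longlonglongrightarrow> 0"
      using tendsto_ennreal_iff[of "\<lambda>i. norm (cf (Vn i) - cf V)" sequentially 0] by simp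
    then show ?thesis by (simp add: LIM_zero_iff tendsto_norm_zero_iff)
  qed
  ultimately show ?thesis unfolding cfn by (rule LIMSEQ_unique[rotated])
qed

end

section \<open>The exponential kernel\<close>

text \<open>
  Layer-cake formula: the ball of radius \<open>x\<close> has volume proportional to \<open>x\<^sup>d\<close>, which leaves a Gamma integral.
\<close>

lemma exp_norm_integral:
  assumes a: "a > 0"
  shows "(\<integral>\<^sup>+(u::'a::euclidean_space). ennreal (exp (- a * norm u)) \<partial>lborel)
     = ennreal (unit_ball_vol (real DIM('a)) * Gamma (real DIM('a) + 1) * a powr (- real DIM('a)))"
proof -
  let ?d = "DIM('a)"
  have e: "ennreal (exp (- a * norm u)) = (\<integral>\<^sup>+x. ennreal (a * exp (- a * x)) * indicator {norm u..} x \<partial>lborel)" for u :: 'a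
  proof -
    have "(\<integral>\<^sup>+x. ennreal (a * exp (- a * x)) * indicator {norm u..} x \<partial>lborel) = ennreal (0 - (- exp (- a * norm u)))"
    proof (rule nn_integral_FTC_atLeast)
      show "DERIV (\<lambda>x. - exp (- a * x)) x :> a * exp (- a * x)" for x
        by (auto intro!: derivative_eq_intros)
      have "((\<lambda>x. exp (- a * x)) \<longlongrightarrow> 0) at_top"
        using a by (intro filterlim_compose[OF exp_at_bot] filterlim_tendsto_neg_mult_at_bot[OF tendsto_const] filterlim_ident) auto
      then show "((\<lambda>x. - exp (- a * x)) \<longlongrightarrow> 0) at_top" using tendsto_minus by fastforce
    qed (use a in auto)
    then show ?thesis by simp
  qed
  have "(\<integral>\<^sup>+(u::'a). ennreal (exp (- a * norm u)) \<partial>lborel)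
     = (\<integral>\<^sup>+(u::'a). \<integral>\<^sup>+x. ennreal (a * exp (- a * x)) * indicator {norm u..} x \<partial>lborel \<partial>lborel)"
    by (simp only: e)
  also have "\<dots> = (\<integral>\<^sup>+x. \<integral>\<^sup>+(u::'a). ennreal (a * exp (- a * x)) * indicator {norm u..} x \<partial>lborel \<partial>lborel)"
  proof (rule lborel_pair.Fubini')
    have "(\<lambda>p::real\<times>'a. indicator {norm (snd p)..} (fst p) :: ennreal) \<in> borel_measurable (lborel \<Otimes>\<^sub>M lborel)"
      unfolding indicator_def atLeast_iff by measurable
    then show "(\<lambda>(x, u::'a). ennreal (a * exp (- a * x)) * indicator {norm u..} x) \<in> borel_measurable (lborel \<Otimes>\<^sub>M lborel)"
      unfolding case_prod_beta' by measurable
  qed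
  also have "\<dots> = (\<integral>\<^sup>+x. ennreal (unit_ball_vol (real ?d) * a * (indicator {0<..} x * (x powr (real ?d + 1 - 1) * exp (- a * x)))) \<partial>lborel)"
  proof (rule nn_integral_cong_AE)
    show "AE x in lborel. (\<integral>\<^sup>+(u::'a). ennreal (a * exp (- a * x)) * indicator {norm u..} x \<partial>lborel)
       = ennreal (unit_ball_vol (real ?d) * a * (indicator {0<..} x * (x powr (real ?d + 1 - 1) * exp (- a * x))))"
      using AE_lborel_singleton[of "0::real"]
    proof eventually_elim
      case (elim x)
      have "(\<integral>\<^sup>+(u::'a). ennreal (a * exp (- a * x)) * indicator {norm u..} x \<partial>lborel) = (\<integral>\<^sup>+(u::'a). ennreal (a * exp (- a * x)) * indicator (cball 0 x) u \<partial>lborel)"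
        by (intro nn_integral_cong) (auto simp: indicator_def)
      also have "\<dots> = ennreal (a * exp (- a * x)) * emeasure lborel (cball (0::'a) x)"
        by (rule nn_integral_cmult_indicator) simp
      also have "\<dots> = ennreal (unit_ball_vol (real ?d) * a * (indicator {0<..} x * (x powr (real ?d + 1 - 1) * exp (- a * x))))"
      proof (cases "x > 0")
        case True
        then show ?thesis using a by (simp add: emeasure_cball ennreal_mult'[symmetric] powr_realpow mult_ac)
      next
        case False
        then have "cball (0::'a) x = {}" using elim by (auto simp: cball_eq_empty)
        then show ?thesis using False by simp
      qed
      finally show ?case .
    qed
  qed
  also have "\<dots> = ennreal (unit_ball_vol (real ?d) * a * (Gamma (real ?d + 1) * a powr (- (real ?d + 1))))"
  proof -
    have "has_bochner_integral lborel (\<lambda>x. indicator {0<..} x * (x powr (real ?d + 1 - 1) * exp (- a * x))) (Gamma (real ?d + 1) * a powr (- (real ?d + 1)))"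
      by (rule scaled_Gamma_integral_real) (use a in auto)
    then have h: "has_bochner_integral lborel (\<lambda>x. unit_ball_vol (real ?d) * a * (indicator {0<..} x * (x powr (real ?d + 1 - 1) * exp (- a * x)))) (unit_ball_vol (real ?d) * a * (Gamma (real ?d + 1) * a powr (- (real ?d + 1))))"
      by (intro has_bochner_integral_mult_right)
    then show ?thesis
      unfolding has_bochner_integral_iff
      using a by (auto simp: nn_integral_eq_integral unit_ball_vol_nonneg simp del: add_diff_cancel_right')
  qed
  also have "unit_ball_vol (real ?d) * a * (Gamma (real ?d + 1) * a powr (- (real ?d + 1))) = unit_ball_vol (real ?d) * Gamma (real ?d + 1) * a powr (- real ?d)"
    using a by (simp add: powr_diff powr_minus field_simps)
  finally show ?thesis .
qed

definition exp_norm_const :: "nat \<Rightarrow> real" where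
  "exp_norm_const n = unit_ball_vol (real n) * Gamma (real n + 1)"

lemma exp_norm_const_nonneg: "exp_norm_const n \<ge> 0"
  using Gamma_real_pos[of "real n + 1"] by (simp add: exp_norm_const_def)

text \<open>
  The kernel does not decay on the ball of radius \<open>R\<close>. Lowering the rate to at most one costs only the factor \<open>e\<^sup>R\<close>.
\<close>

lemma truncated_exp_norm_integral:
  assumes a: "a > 0" and R: "R \<ge> 0"
  shows "(\<integral>\<^sup>+(u::'a::euclidean_space). ennreal (exp (- a * max 0 (norm u - R))) \<partial>lborel)
     \<le> ennreal (exp R * exp_norm_const DIM('a) * max 1 (a powr (- real DIM('a))))"
proof -
  define b where "b = min a 1"
  have b: "b > 0" "b \<le> 1" "b \<le> a" using a by (auto simp: b_def)
  have "(\<integral>\<^sup>+(u::'a). ennreal (exp (- a * max 0 (norm u - R))) \<partial>lborel) \<le> (\<integral>\<^sup>+(u::'a). ennreal (exp R) * ennreal (exp (- b * norm u)) \<partial>lborel)"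
  proof (intro nn_integral_mono)
    fix u :: 'a
    have "b * (norm u - R) \<le> b * max 0 (norm u - R)" using b by (intro mult_left_mono) auto
    also have "\<dots> \<le> a * max 0 (norm u - R)" using b by (intro mult_right_mono) auto
    finally have "- a * max 0 (norm u - R) \<le> b * R + (- b * norm u)" by (simp add: algebra_simps)
    also have "b * R \<le> R" using b R by (simp add: mult_left_le_one_le)
    finally have "exp (- a * max 0 (norm u - R)) \<le> exp (R + (- b * norm u))" by simp
    also have "\<dots> = exp R * exp (- b * norm u)" by (rule exp_add)
    finally show "ennreal (exp (- a * max 0 (norm u - R))) \<le> ennreal (exp R) * ennreal (exp (- b * norm u))"
      by (simp add: ennreal_mult'[symmetric] ennreal_leI)
  qed
  also have "\<dots> = ennreal (exp R) * ennreal (exp_norm_const DIM('a) * b powr (- real DIM('a)))"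
    by (subst nn_integral_cmult) (simp_all only: exp_norm_integral[OF b(1)] exp_norm_const_def, measurable)
  also have "\<dots> = ennreal (exp R * exp_norm_const DIM('a) * b powr (- real DIM('a)))"
    by (simp add: ennreal_mult'[symmetric] mult.assoc)
  also have "b powr (- real DIM('a)) \<le> max 1 (a powr (- real DIM('a)))" by (auto simp: b_def min_def)
  finally show ?thesis using exp_norm_const_nonneg[of "DIM('a)"] by (simp add: mult_left_mono ennreal_leI order_trans)
qed

definition ker :: "(real^'d) \<Rightarrow> real \<times> (real^'d) \<Rightarrow> real" where
  "ker y = (\<lambda>(r, u). 1 / (2 * r) * exp (- r * norm (y - u)))"

text \<open>
  Dominates the kernels of all \<open>y\<close> in the ball of radius \<open>R\<close>. The inner maximum keeps the
  radius nonnegative.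
\<close>

definition ker_envelope :: "real \<Rightarrow> real \<times> (real^'d) \<Rightarrow> real" where
  "ker_envelope R = (\<lambda>(r, u). 1 / (2 * r) * exp (- r * max 0 (norm u - max 0 R)))"

lemma ker_measurable[measurable]: "(\<lambda>(y, x). ker y x) \<in> borel_measurable (lborel \<Otimes>\<^sub>M (lborel \<Otimes>\<^sub>M lborel))"
  unfolding ker_def by measurable

lemma ker_meas_y: "(\<lambda>y. ker y x) \<in> borel_measurable borel"
  by (cases x) (simp add: ker_def)

lemma ker_envelope_measurable[measurable]: "ker_envelope R \<in> borel_measurable (lborel \<Otimes>\<^sub>M lborel)"
  unfolding ker_envelope_def by measurable

lemma ker_le_ker_envelope:
  assumes "norm y \<le> R" "fst x > 0" shows "\<bar>ker y x\<bar> \<le> ker_envelope R x"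
proof -
  obtain r u where x: "x = (r, u)" by (cases x)
  have "max 0 (norm u - max 0 R) \<le> norm (y - u)"
    using assms(1) norm_triangle_ineq2[of u y] norm_ge_zero[of "y - u"] by (auto simp: norm_minus_commute)
  then have "r * max 0 (norm u - max 0 R) \<le> r * norm (y - u)" using assms x by (intro mult_left_mono) auto
  then have "exp (- r * norm (y - u)) \<le> exp (- r * max 0 (norm u - max 0 R))" by simp
  then show ?thesis using assms x by (simp add: ker_def ker_envelope_def divide_right_mono)
qed

lemma ker_envelope_integral:
  fixes R :: real
  assumes \<beta>: "\<beta> \<ge> 1"
  shows "\<exists>K\<ge>0. \<forall>r>0. (\<integral>\<^sup>+(u::real^'d). ennreal (\<bar>ker_envelope R (r, u)\<bar> powr \<beta>) \<partial>lborel) \<le> ennreal (K * (r powr (- \<beta>) * max 1 (r powr (- real CARD('d)))))"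
proof (intro exI[of _ "exp (max 0 R) * exp_norm_const CARD('d)"] conjI allI impI)
  let ?K = "exp (max 0 R) * exp_norm_const CARD('d)"
  show "?K \<ge> 0" using exp_norm_const_nonneg by simp
  fix r :: real assume r: "r > 0"
  have p: "\<bar>ker_envelope R (r, u)\<bar> powr \<beta> = (1 / (2 * r)) powr \<beta> * exp (- (\<beta> * r) * max 0 (norm u - max 0 R))" for u :: "real^'d"
    using r by (simp add: ker_envelope_def abs_mult powr_mult powr_def[of "exp _"] powr_divide flip: exp_ln_iff) (simp add: powr_def mult_ac)
  have "(\<integral>\<^sup>+(u::real^'d). ennreal (\<bar>ker_envelope R (r, u)\<bar> powr \<beta>) \<partial>lborel) = ennreal ((1 / (2 * r)) powr \<beta>) * (\<integral>\<^sup>+(u::real^'d). ennreal (exp (- (\<beta> * r) * max 0 (norm u - max 0 R))) \<partial>lborel)"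
    unfolding p by (subst nn_integral_cmult[symmetric]) (auto simp: ennreal_mult')
  also have "\<dots> \<le> ennreal ((1 / (2 * r)) powr \<beta>) * ennreal (?K * max 1 ((\<beta> * r) powr (- real CARD('d))))"
    using truncated_exp_norm_integral[where 'a = "real^'d", of "\<beta> * r" "max 0 R"] \<beta> r by (intro mult_left_mono) auto
  also have "\<dots> = ennreal ((1 / (2 * r)) powr \<beta> * (?K * max 1 ((\<beta> * r) powr (- real CARD('d)))))"
    by (rule ennreal_mult'[symmetric]) simp
  also have "(1 / (2 * r)) powr \<beta> * (?K * max 1 ((\<beta> * r) powr (- real CARD('d)))) \<le> r powr (- \<beta>) * (?K * max 1 (r powr (- real CARD('d))))"
  proof (intro mult_mono)
    have "(1 / (2 * r)) powr \<beta> \<le> (1 / r) powr \<beta>" using r \<beta> by (intro powr_mono2) (auto simp: field_simps)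
    then show "(1 / (2 * r)) powr \<beta> \<le> r powr (- \<beta>)" using r by (simp add: powr_divide powr_minus_divide)
    have "(\<beta> * r) powr (- real CARD('d)) \<le> r powr (- real CARD('d))" using r \<beta> by (intro powr_mono2') auto
    then show "max 1 ((\<beta> * r) powr (- real CARD('d))) \<le> max 1 (r powr (- real CARD('d)))" by auto
  qed (use exp_norm_const_nonneg[of "CARD('d)"] in auto)
  finally show "(\<integral>\<^sup>+(u::real^'d). ennreal (\<bar>ker_envelope R (r, u)\<bar> powr \<beta>) \<partial>lborel) \<le> ennreal (?K * (r powr (- \<beta>) * max 1 (r powr (- real CARD('d)))))"
    by (simp add: mult_ac ennreal_leI)
qed

text \<open>
  The worst case of an averaged kernel, up to a constant: every weight considered is supported in the unit ball.
\<close>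

definition smooth_ker :: "real \<times> (real^'d) \<Rightarrow> real" where
  "smooth_ker x = (\<integral>y. indicator (cball 0 1) y * ker y x \<partial>lborel)"

lemma smooth_ker_measurable[measurable]: "(smooth_ker :: real \<times> (real^'d) \<Rightarrow> real) \<in> borel_measurable (lborel \<Otimes>\<^sub>M lborel)"
proof -
  have "(\<lambda>x::real \<times> (real^'d). \<integral>y. indicator (cball 0 1) y * ker y x \<partial>lborel) \<in> borel_measurable (lborel \<Otimes>\<^sub>M lborel)"
  proof (rule lborel.borel_measurable_lebesgue_integral)
    have 1: "(\<lambda>p::(real \<times> (real^'d)) \<times> (real^'d). indicat_real (cball 0 1) (snd p)) \<in> borel_measurable ((lborel \<Otimes>\<^sub>M lborel) \<Otimes>\<^sub>M lborel)"
      by (rule measurable_compose[OF measurable_snd]) (simp add: borel_measurable_indicator borel_closed)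
    have 2: "(\<lambda>p::(real \<times> (real^'d)) \<times> (real^'d). ker (snd p) (fst p)) \<in> borel_measurable ((lborel \<Otimes>\<^sub>M lborel) \<Otimes>\<^sub>M lborel)"
      using measurable_pair_swap[OF ker_measurable] by (simp add: case_prod_beta')
    show "(\<lambda>(x, y). indicator (cball 0 1) y * ker y x) \<in> borel_measurable ((lborel \<Otimes>\<^sub>M lborel :: (real \<times> (real^'d)) measure) \<Otimes>\<^sub>M lborel)"
      unfolding case_prod_beta' by (rule borel_measurable_times[OF 1 2])
  qed
  then show ?thesis by (simp add: smooth_ker_def[abs_def])
qed

text \<open>
  For small \<open>r\<close> the kernel is nearly constant on the unit ball, and its supremum is the right bound. For large \<open>r\<close> the kernel is
  concentrated at distance \<open>1/r\<close> from \<open>u\<close>, and its integral over the whole space gains the factor \<open>r\<^sup>-\<^sup>d\<close>. Half of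
  the exponential rate is kept for the decay in \<open>u\<close>.
\<close>

lemma smooth_ker_bound:
  "\<exists>K\<ge>0. \<forall>r>0. \<forall>u::real^'d. 0 \<le> smooth_ker (r, u) \<and>
     smooth_ker (r, u) \<le> K * (1 / r * min 1 (r powr (- real CARD('d))) * exp (- (r / 2) * max 0 (norm u - 1)))"
proof -
  let ?d = "real CARD('d)"
  let ?vol = "measure lborel (cball 0 1 :: (real^'d) set)"
  let ?c = "exp_norm_const CARD('d) * 2 powr ?d"
  define K where "K = ?vol + ?c"
  have K: "K \<ge> 0" "?vol \<le> K" "?c \<le> K" using exp_norm_const_nonneg[of "CARD('d)"] by (simp_all add: K_def)
  have "0 \<le> smooth_ker (r, u) \<and> smooth_ker (r, u) \<le> K * (1 / r * min 1 (r powr (- ?d)) * exp (- (r / 2) * max 0 (norm u - 1)))"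
    if r: "r > 0" for r and u :: "real^'d"
  proof
    let ?m = "max 0 (norm u - 1)"
    show "0 \<le> smooth_ker (r, u)" unfolding smooth_ker_def using r by (intro integral_nonneg_AE AE_I2) (auto simp: ker_def)
    have fm: "integrable lborel (indicat_real (cball (0::real^'d) 1))"
      using emeasure_compact_finite[of "cball (0::real^'d) 1"] by (intro integrable_real_indicator) auto
    have le1: "indicator (cball 0 1) y * ker y (r, u) \<le> indicator (cball 0 1) y * (1 / r * exp (- (r / 2) * ?m))" for y
    proof (cases "y \<in> cball 0 1")
      case True
      have "ker y (r, u) \<le> 1 / (2 * r) * exp (- r * ?m)"
        using ker_le_ker_envelope[of y 1 "(r, u)"] True r by (simp add: ker_envelope_def)
      also have "\<dots> \<le> 1 / r * exp (- (r / 2) * ?m)"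
      proof (rule mult_mono)
        have "r / 2 * ?m \<le> r * ?m" using r by (intro mult_right_mono) auto
        then show "exp (- r * ?m) \<le> exp (- (r / 2) * ?m)" by simp
      qed (use r in \<open>auto simp: field_simps\<close>)
      finally show ?thesis using True by simp
    qed simp
    have ki: "integrable lborel (\<lambda>y. indicator (cball 0 1) y * ker y (r, u))"
    proof (rule Bochner_Integration.integrable_bound)
      show "integrable lborel (\<lambda>y. indicator (cball (0::real^'d) 1) y * (1 / r * exp (- (r / 2) * ?m)))"
        using fm by (intro integrable_mult_left)
      show "(\<lambda>y. indicator (cball 0 1) y * ker y (r, u)) \<in> borel_measurable lborel"
        using borel_measurable_times[OF borel_measurable_indicator[OF borel_closed[OF closed_cball]] ker_meas_y] by simp
      show "AE y in lborel. norm (indicator (cball 0 1) y * ker y (r, u)) \<le> norm (indicator (cball (0::real^'d) 1) y * (1 / r * exp (- (r / 2) * ?m)))"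
      proof (rule AE_I2)
        fix y :: "real^'d"
        have "0 \<le> ker y (r, u)" using r by (simp add: ker_def)
        then show "norm (indicator (cball 0 1) y * ker y (r, u)) \<le> norm (indicator (cball (0::real^'d) 1) y * (1 / r * exp (- (r / 2) * ?m)))"
          using le1[of y] r by (simp add: abs_mult)
      qed
    qed
    have b1: "smooth_ker (r, u) \<le> K * (1 / r * exp (- (r / 2) * ?m))"
    proof -
      have "smooth_ker (r, u) \<le> (\<integral>y. indicator (cball (0::real^'d) 1) y * (1 / r * exp (- (r / 2) * ?m)) \<partial>lborel)"
        unfolding smooth_ker_def using fm by (intro integral_mono ki le1 integrable_mult_left)
      also have "\<dots> = ?vol * (1 / r * exp (- (r / 2) * ?m))" by simp
      also have "\<dots> \<le> K * (1 / r * exp (- (r / 2) * ?m))" using K r by (intro mult_right_mono) auto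
      finally show ?thesis .
    qed
    have b2: "smooth_ker (r, u) \<le> K * (1 / r * r powr (- ?d) * exp (- (r / 2) * ?m))"
    proof -
      have hb: "has_bochner_integral lborel (\<lambda>v::real^'d. exp (- (r / 2) * norm v)) (exp_norm_const CARD('d) * (r / 2) powr (- ?d))"
        using exp_norm_integral[where 'a = "real^'d", of "r / 2"] r exp_norm_const_nonneg[of "CARD('d)"]
        by (intro has_bochner_integral_nn_integral) (auto simp: exp_norm_const_def)
      have hb': "has_bochner_integral lborel (\<lambda>y::real^'d. exp (- (r / 2) * norm (y - u))) (exp_norm_const CARD('d) * (r / 2) powr (- ?d))"
      proof -
        have d: "distr lborel borel (\<lambda>y. - u + y) = (lborel :: (real^'d) measure)" by (rule lborel_distr_plus)
        show ?thesis
          using has_bochner_integral_distr[of "\<lambda>v::real^'d. exp (- (r / 2) * norm v)" borel "\<lambda>y. - u + y" lborel] hb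
            integral_distr[of "\<lambda>y. - u + y" lborel borel "\<lambda>v::real^'d. exp (- (r / 2) * norm v)"]
            integrable_distr_eq[of "\<lambda>y. - u + y" lborel borel "\<lambda>v::real^'d. exp (- (r / 2) * norm v)"]
          unfolding d has_bochner_integral_iff by simp
      qed
      have "smooth_ker (r, u) \<le> (\<integral>y. 1 / r * exp (- (r / 2) * ?m) * exp (- (r / 2) * norm (y - u)) \<partial>lborel)"
        unfolding smooth_ker_def
      proof (rule integral_mono[OF ki])
        show "integrable lborel (\<lambda>y. 1 / r * exp (- (r / 2) * ?m) * exp (- (r / 2) * norm (y - u)))"
          using hb' by (intro integrable_mult_right) (simp add: has_bochner_integral_iff)
        fix y :: "real^'d"
        show "indicator (cball 0 1) y * ker y (r, u) \<le> 1 / r * exp (- (r / 2) * ?m) * exp (- (r / 2) * norm (y - u))"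
        proof (cases "y \<in> cball 0 1")
          case True
          then have "?m \<le> norm (y - u)" using norm_triangle_ineq2[of u y] by (auto simp: norm_minus_commute)
          then have "r / 2 * ?m \<le> r / 2 * norm (y - u)" using r by (intro mult_left_mono) auto
          then have "exp (- r * norm (y - u)) \<le> exp (- (r / 2) * ?m + (- (r / 2) * norm (y - u)))" by simp
          also have "\<dots> = exp (- (r / 2) * ?m) * exp (- (r / 2) * norm (y - u))" by (rule exp_add)
          finally have "1 / (2 * r) * exp (- r * norm (y - u)) \<le> 1 / r * (exp (- (r / 2) * ?m) * exp (- (r / 2) * norm (y - u)))"
            using r by (intro mult_mono) (auto simp: field_simps)
          then show ?thesis using True by (simp add: ker_def mult.assoc)
        qed (use r in simp)
      qed
      also have "\<dots> = 1 / r * exp (- (r / 2) * ?m) * (exp_norm_const CARD('d) * (r / 2) powr (- ?d))"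
        using has_bochner_integral_integral_eq[OF hb'] by simp
      also have "(r / 2) powr (- ?d) = 2 powr ?d * r powr (- ?d)" using r by (simp add: powr_divide powr_minus field_simps)
      also have "1 / r * exp (- (r / 2) * ?m) * (exp_norm_const CARD('d) * (2 powr ?d * r powr (- ?d))) = ?c * (1 / r * r powr (- ?d) * exp (- (r / 2) * ?m))"
        by simp
      also have "\<dots> \<le> K * (1 / r * r powr (- ?d) * exp (- (r / 2) * ?m))" using K r by (intro mult_right_mono) auto
      finally show ?thesis .
    qed
    show "smooth_ker (r, u) \<le> K * (1 / r * min 1 (r powr (- ?d)) * exp (- (r / 2) * ?m))"
      using b1 b2 by (simp add: min_def)
  qed
  then show ?thesis using K by blast
qed

text \<open>
  An upper bound, up to a constant and as a function of \<open>r\<close>, for the \<open>\<beta>\<close>-th power integral over \<open>u\<close> of the averaged kernel.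
\<close>

definition profile :: "nat \<Rightarrow> real \<Rightarrow> real \<Rightarrow> real" where
  "profile d \<beta> r = r powr (- \<beta>) * min 1 (r powr (- real d * \<beta>)) * max 1 (r powr (- real d))"

lemma smooth_ker_integral:
  assumes \<beta>: "\<beta> \<ge> 1"
  shows "\<exists>K\<ge>0. \<forall>r>0. (\<integral>\<^sup>+(u::real^'d). ennreal (\<bar>smooth_ker (r, u)\<bar> powr \<beta>) \<partial>lborel) \<le> ennreal (K * profile CARD('d) \<beta> r)"
proof -
  let ?d = "real CARD('d)"
  obtain K where K: "K \<ge> 0" "\<And>r u::real^'d. r > 0 \<Longrightarrow> 0 \<le> smooth_ker (r, u) \<and>
     smooth_ker (r, u) \<le> K * (1 / r * min 1 (r powr (- ?d)) * exp (- (r / 2) * max 0 (norm u - 1)))"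
    using smooth_ker_bound[where 'd = 'd] by blast
  let ?E = "exp 1 * exp_norm_const CARD('d)"
  have E: "?E \<ge> 0" using exp_norm_const_nonneg by simp
  have "(\<integral>\<^sup>+(u::real^'d). ennreal (\<bar>smooth_ker (r, u)\<bar> powr \<beta>) \<partial>lborel) \<le> ennreal (K powr \<beta> * ?E * 2 powr ?d * profile CARD('d) \<beta> r)" if r: "r > 0" for r
  proof -
    let ?g = "1 / r * min 1 (r powr (- ?d))"
    have g: "?g \<ge> 0" using r by simp
    have p: "\<bar>smooth_ker (r, u)\<bar> powr \<beta> \<le> (K * ?g) powr \<beta> * exp (- (\<beta> * r / 2) * max 0 (norm u - 1))" for u :: "real^'d"
    proof -
      have "\<bar>smooth_ker (r, u)\<bar> powr \<beta> \<le> (K * ?g * exp (- (r / 2) * max 0 (norm u - 1))) powr \<beta>"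
        using K(2)[OF r, of u] \<beta> by (intro powr_mono2) (auto simp: mult.assoc)
      also have "\<dots> = (K * ?g) powr \<beta> * (exp (- (r / 2) * max 0 (norm u - 1))) powr \<beta>" by (rule powr_mult)
      also have "(exp (- (r / 2) * max 0 (norm u - 1))) powr \<beta> = exp (- (\<beta> * r / 2) * max 0 (norm u - 1))" by (simp add: powr_def)
      finally show ?thesis .
    qed
    have "(\<integral>\<^sup>+(u::real^'d). ennreal (\<bar>smooth_ker (r, u)\<bar> powr \<beta>) \<partial>lborel) \<le> (\<integral>\<^sup>+(u::real^'d). ennreal ((K * ?g) powr \<beta>) * ennreal (exp (- (\<beta> * r / 2) * max 0 (norm u - 1))) \<partial>lborel)"
      using p by (intro nn_integral_mono) (simp add: ennreal_mult'[symmetric] ennreal_leI)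
    also have "\<dots> = ennreal ((K * ?g) powr \<beta>) * (\<integral>\<^sup>+(u::real^'d). ennreal (exp (- (\<beta> * r / 2) * max 0 (norm u - 1))) \<partial>lborel)"
      by (rule nn_integral_cmult) measurable
    also have "\<dots> \<le> ennreal ((K * ?g) powr \<beta>) * ennreal (?E * max 1 ((\<beta> * r / 2) powr (- ?d)))"
      using truncated_exp_norm_integral[where 'a = "real^'d", of "\<beta> * r / 2" 1] \<beta> r by (intro mult_left_mono) auto
    also have "\<dots> = ennreal ((K * ?g) powr \<beta> * (?E * max 1 ((\<beta> * r / 2) powr (- ?d))))"
      by (rule ennreal_mult'[symmetric]) simp
    also have "(K * ?g) powr \<beta> * (?E * max 1 ((\<beta> * r / 2) powr (- ?d))) \<le> (K powr \<beta> * (r powr (- \<beta>) * min 1 (r powr (- ?d * \<beta>)))) * (?E * (2 powr ?d * max 1 (r powr (- ?d))))"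
    proof (intro mult_mono)
      have "(min 1 (r powr (- ?d))) powr \<beta> = min 1 (r powr (- ?d * \<beta>))"
      proof (cases "r powr (- ?d) \<le> 1")
        case True
        then have "(r powr (- ?d)) powr \<beta> \<le> 1" using \<beta> by (intro powr_le1) auto
        then show ?thesis using True by (simp add: powr_powr min_def)
      next
        case False
        then have "1 \<le> r powr (- ?d)" by simp
        then have "(r powr (- ?d)) powr \<beta> \<ge> 1" by (rule ge_one_powr_ge_zero) (use \<beta> in simp)
        then show ?thesis using False by (auto simp: powr_powr min_def)
      qed
      then show "(K * ?g) powr \<beta> \<le> K powr \<beta> * (r powr (- \<beta>) * min 1 (r powr (- ?d * \<beta>)))"
        using r K(1) by (simp add: powr_mult powr_divide powr_minus_divide)
      have "(\<beta> * r / 2) powr (- ?d) \<le> (r / 2) powr (- ?d)" using r \<beta> by (intro powr_mono2') auto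
      also have "\<dots> = 2 powr ?d * r powr (- ?d)" using r by (simp add: powr_divide powr_minus field_simps)
      also have "\<dots> \<le> 2 powr ?d * max 1 (r powr (- ?d))" by (intro mult_left_mono) auto
      finally have 1: "(\<beta> * r / 2) powr (- ?d) \<le> 2 powr ?d * max 1 (r powr (- ?d))" .
      have "1 * 1 \<le> 2 powr ?d * max 1 (r powr (- ?d))" by (intro mult_mono) (auto intro: ge_one_powr_ge_zero)
      with 1 show "max 1 ((\<beta> * r / 2) powr (- ?d)) \<le> 2 powr ?d * max 1 (r powr (- ?d))" by simp
    qed (use exp_norm_const_nonneg[of "CARD('d)"] K(1) in auto)
    finally show ?thesis by (simp add: profile_def mult_ac ennreal_leI)
  qed
  then show ?thesis using E by (intro exI[of _ "K powr \<beta> * ?E * 2 powr ?d"]) auto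
qed

lemma profile_small: "0 < r \<Longrightarrow> r \<le> 1 \<Longrightarrow> \<beta> > 0 \<Longrightarrow> profile d \<beta> r = r powr (- \<beta> - real d)"
proof -
  assume r: "0 < r" "r \<le> 1" "\<beta> > 0"
  have "r powr (- real d * \<beta>) \<ge> 1" "r powr (- real d) \<ge> 1"
    using r powr_mono2'[of "- (real d * \<beta>)" r 1] powr_mono2'[of "- real d" r 1] by simp_all
  then show ?thesis by (simp add: profile_def powr_add[symmetric] min_def max_def)
qed

lemma profile_large: "r \<ge> 1 \<Longrightarrow> \<beta> > 0 \<Longrightarrow> profile d \<beta> r = r powr (- \<beta> - real d * \<beta>)"
proof -
  assume r: "r \<ge> 1" "\<beta> > 0"
  have "r powr (- real d * \<beta>) \<le> 1" "r powr (- real d) \<le> 1"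
    using r powr_mono2'[of "- (real d * \<beta>)" 1 r] powr_mono2'[of "- real d" 1 r] by simp_all
  then show ?thesis by (simp add: profile_def powr_add[symmetric] min_def max_def)
qed

text \<open>
  Two power integrals. The inequalities for \<open>\<alpha>\<close> are those of the limit theorem, with room for Potter's \<open>\<delta>\<close>.
\<close>

lemma profile_weight_finite:
  assumes \<beta>: "\<beta> > 0" and lo: "\<beta> + real d + \<delta> < \<alpha>" and hi: "\<alpha> + \<delta> < (real d + 1) * \<beta>" and \<delta>: "\<delta> \<ge> 0"
  shows "(\<integral>\<^sup>+r. ennreal (indicator {0<..} r * (profile d \<beta> r * r powr (\<alpha> - 1) * max (r powr \<delta>) (r powr (- \<delta>)))) \<partial>lborel) < \<infinity>"
proof -
  have "(\<integral>\<^sup>+r. ennreal (indicator {0<..} r * (profile d \<beta> r * r powr (\<alpha> - 1) * max (r powr \<delta>) (r powr (- \<delta>)))) \<partial>lborel)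
     \<le> (\<integral>\<^sup>+r. ennreal (indicator {0..1} r * r powr (\<alpha> - 1 - \<beta> - real d - \<delta>)) + ennreal (indicator {1..} r * r powr (\<alpha> - 1 + \<delta> - \<beta> - real d * \<beta>)) \<partial>lborel)"
  proof (intro nn_integral_mono)
    fix r :: real
    show "ennreal (indicator {0<..} r * (profile d \<beta> r * r powr (\<alpha> - 1) * max (r powr \<delta>) (r powr (- \<delta>))))
      \<le> ennreal (indicator {0..1} r * r powr (\<alpha> - 1 - \<beta> - real d - \<delta>)) + ennreal (indicator {1..} r * r powr (\<alpha> - 1 + \<delta> - \<beta> - real d * \<beta>))"
    proof (cases "r > 0")
      case True
      show ?thesis
      proof (cases "r \<le> 1")
        case r1: True
        have "r powr \<delta> \<le> r powr (- \<delta>)" using True r1 \<delta> by (intro powr_mono') auto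
        then have "profile d \<beta> r * r powr (\<alpha> - 1) * max (r powr \<delta>) (r powr (- \<delta>)) = r powr (\<alpha> - 1 - \<beta> - real d - \<delta>)"
          using profile_small[OF True r1 \<beta>] by (simp add: max_def powr_add[symmetric] algebra_simps)
        then show ?thesis using True r1 by (simp add: add_increasing2)
      next
        case r1: False
        have "r powr (- \<delta>) \<le> r powr \<delta>" using r1 \<delta> by (intro powr_mono) auto
        then have "profile d \<beta> r * r powr (\<alpha> - 1) * max (r powr \<delta>) (r powr (- \<delta>)) = r powr (\<alpha> - 1 + \<delta> - \<beta> - real d * \<beta>)"
          using profile_large[of r \<beta> d] r1 \<beta> by (auto simp: max_def powr_add[symmetric] algebra_simps)
        then show ?thesis using True r1 by (simp add: add_increasing)
      qed
    qed simp
  qed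
  also have "\<dots> < \<infinity>"
    using assms by (subst nn_integral_add) (auto simp: nn_integral_powr_from_0 nn_integral_powr_to_inf algebra_simps)
  finally show ?thesis .
qed

section \<open>Scaling limit of the cumulant\<close>

lemma density_times_lborel:
  fixes w :: "real \<Rightarrow> real"
  assumes [measurable]: "w \<in> borel_measurable borel"
  shows "density lborel (\<lambda>r. ennreal (w r)) \<Otimes>\<^sub>M (lborel :: 'a::euclidean_space measure) = density (lborel \<Otimes>\<^sub>M lborel) (\<lambda>x. ennreal (w (fst x)))"
proof -
  have "density lborel (\<lambda>r. ennreal (w r)) \<Otimes>\<^sub>M density (lborel :: 'a measure) (\<lambda>_. 1) = density (lborel \<Otimes>\<^sub>M lborel) (\<lambda>(x,y). ennreal (w x) * 1)"
    by (rule pair_measure_density) (auto simp: density_1 intro: lborel.sigma_finite_measure_axioms)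
  then show ?thesis by (simp add: density_1 case_prod_beta')
qed

lemma lborel_pair_scaling:
  fixes f :: "real \<times> (real^'d) \<Rightarrow> complex"
  assumes T: "T > 0" and f: "f \<in> borel_measurable borel"
  shows "(\<integral>x. f x \<partial>(lborel \<Otimes>\<^sub>M lborel)) = (\<integral>x. of_real (T powr (real CARD('d) - 1)) * f (fst x / T, T *\<^sub>R snd x) \<partial>(lborel \<Otimes>\<^sub>M lborel))"
proof -
  let ?c = "\<lambda>b::real \<times> (real^'d). if snd b = 0 then 1 / T else T"
  let ?S = "\<lambda>x::real \<times> (real^'d). (fst x / T, T *\<^sub>R snd x)"
  have S: "0 + (\<Sum>j\<in>Basis. (?c j * (x \<bullet> j)) *\<^sub>R j) = ?S x" for x
  proof (rule euclidean_eqI)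
    fix b :: "real \<times> (real^'d)" assume b: "b \<in> Basis"
    have "(0 + (\<Sum>j\<in>Basis. (?c j * (x \<bullet> j)) *\<^sub>R j)) \<bullet> b = ?c b * (x \<bullet> b)"
      using b by simp
    also have "\<dots> = ?S x \<bullet> b"
      using b by (auto simp: Basis_prod_def inner_prod_def)
    finally show "(0 + (\<Sum>j\<in>Basis. (?c j * (x \<bullet> j)) *\<^sub>R j)) \<bullet> b = ?S x \<bullet> b" .
  qed
  have det: "(\<Prod>j\<in>Basis. \<bar>?c j\<bar>) = T powr (real CARD('d) - 1)"
  proof -
    have "(\<Prod>j\<in>Basis. \<bar>?c j\<bar>) = (\<Prod>j\<in>(\<lambda>u::real. (u, 0::real^'d)) ` Basis. \<bar>?c j\<bar>) * (\<Prod>j\<in>(\<lambda>v::real^'d. (0::real, v)) ` Basis. \<bar>?c j\<bar>)"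
      unfolding Basis_prod_def by (rule prod.union_disjoint) auto
    also have "(\<Prod>j\<in>(\<lambda>u::real. (u, 0::real^'d)) ` Basis. \<bar>?c j\<bar>) = 1 / T"
      using T by (subst prod.reindex) (auto simp: inj_on_def)
    also have "(\<Prod>j\<in>(\<lambda>v::real^'d. (0::real, v)) ` Basis. \<bar>?c j\<bar>) = (\<Prod>v\<in>(Basis :: (real^'d) set). \<bar>?c (0, v)\<bar>)"
      by (subst prod.reindex) (auto simp: inj_on_def)
    also have "\<dots> = (\<Prod>v\<in>(Basis :: (real^'d) set). T)"
      by (rule prod.cong[OF refl]) (use T nonzero_Basis in auto)
    also have "\<dots> = T powr real CARD('d)" using T by (simp add: powr_realpow)
    finally show ?thesis using T by (simp add: powr_diff)
  qed
  have "lborel = density (distr lborel borel (\<lambda>x. 0 + (\<Sum>j\<in>Basis. (?c j * (x \<bullet> j)) *\<^sub>R j))) (\<lambda>_. ennreal (\<Prod>j\<in>Basis. \<bar>?c j\<bar>))"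
    using T by (intro lborel_affine_euclidean) auto
  then have L: "lborel = density (distr lborel borel ?S) (\<lambda>_. ennreal (T powr (real CARD('d) - 1)))"
    unfolding S det .
  have Sm[measurable]: "?S \<in> borel_measurable borel"
    using T by (intro borel_measurable_continuous_onI continuous_intros) auto
  have "(\<integral>x. f x \<partial>lborel) = (\<integral>x. T powr (real CARD('d) - 1) *\<^sub>R f x \<partial>distr lborel borel ?S)"
    by (subst L) (use f in \<open>simp add: integral_density\<close>)
  also have "\<dots> = (\<integral>x. T powr (real CARD('d) - 1) *\<^sub>R f (?S x) \<partial>lborel)"
    using f Sm by (subst integral_distr) auto
  finally show ?thesis by (simp add: lborel_prod scaleR_conv_of_real)
qed

lemma integral_vec_scaling:
  fixes f :: "real^'d \<Rightarrow> real"
  assumes T: "T > 0" and f: "f \<in> borel_measurable borel"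
  shows "(\<integral>y. f y \<partial>lborel) = T powr real CARD('d) * (\<integral>y. f (T *\<^sub>R y) \<partial>lborel)"
proof -
  have L: "(lborel :: (real^'d) measure) = density (distr lborel borel (\<lambda>x. 0 + T *\<^sub>R x)) (\<lambda>_. ennreal (\<bar>T\<bar> ^ DIM(real^'d)))"
    using T by (intro lborel_affine) simp
  have "(\<integral>y. f y \<partial>lborel) = (\<integral>y. (\<bar>T\<bar> ^ DIM(real^'d)) *\<^sub>R f y \<partial>distr lborel borel (\<lambda>x. 0 + T *\<^sub>R x))"
    by (subst L) (use f in \<open>simp add: integral_density\<close>)
  also have "\<dots> = (\<integral>y. (\<bar>T\<bar> ^ DIM(real^'d)) *\<^sub>R f (0 + T *\<^sub>R y) \<partial>lborel)"
    using f by (subst integral_distr) auto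
  finally show ?thesis using T by (simp add: powr_realpow)
qed

text \<open>
  \<open>\<theta>\<close> is the shape against which the field is averaged, \<open>\<kappa>\<close> the cumulant before and \<open>\<kappa>'\<close> the one after
  rescaling. The real number \<open>d\<close> is the dimension.
\<close>

locale limit_setting =
  fixes l :: "real \<Rightarrow> real" and \<alpha> \<beta> :: real and \<kappa> \<kappa>' :: "real \<Rightarrow> complex" and C :: real
    and \<theta> :: "real^'d \<Rightarrow> real" and c d :: real
  assumes d: "d = real CARD('d)" and l: "slowly_varying_at_top l" "\<And>x. x > 0 \<Longrightarrow> l x > 0"
    and \<beta>: "1 < \<beta>" and lo: "\<alpha> < (d + 1) * \<beta>" and hi: "\<beta> + d < \<alpha>"
    and p_prob: "(\<integral>\<^sup>+r. ennreal (indicator {0<..} r * (l (1 / r) * r powr (\<alpha> - 1))) \<partial>lborel) = 1"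
    and \<kappa>_cont: "continuous_on UNIV \<kappa>" and C: "C > 0" "\<And>s. norm (\<kappa> s) \<le> C * \<bar>s\<bar> powr \<beta>"
    and \<kappa>_lim: "\<And>x. ((\<lambda>L. \<kappa> (L * x) / of_real (L powr \<beta>)) \<longlongrightarrow> \<kappa>' x) at_top"
    and \<kappa>'_cont: "continuous_on UNIV \<kappa>'"
    and \<theta>_meas[measurable]: "\<theta> \<in> borel_measurable borel" and c: "c \<ge> 0" "\<And>y. \<bar>\<theta> y\<bar> \<le> c * indicator (cball 0 1) y"
begin

text \<open>
  Measurability of \<open>l\<close> is given on the positive half-line; the extension by zero is a Borel function.
\<close>

definition "l0 x = (if x > 0 then l x else 0)"

lemma l0_meas[measurable]: "l0 \<in> borel_measurable borel"
proof -
  have "l \<in> borel_measurable (restrict_space borel {0<..})" using l(1) by (simp add: slowly_varying_at_top_def)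
  then have "(\<lambda>x. indicator {0<..} x *\<^sub>R l x) \<in> borel_measurable borel"
    by (subst (asm) borel_measurable_restrict_space_iff) auto
  moreover have "(\<lambda>x. indicator {0<..} x *\<^sub>R l x) = l0" by (auto simp: l0_def fun_eq_iff)
  ultimately show ?thesis by simp
qed

lemma l0_nonneg: "l0 x \<ge> 0" using l(2)[of x] by (simp add: l0_def less_imp_le)

text \<open>
  The density of the rate distribution.
\<close>

definition "p r = indicator {0<..} r * (l (1 / r) * r powr (\<alpha> - 1))"

lemma p_alt: "p r = indicator {0<..} r * (l0 (1 / r) * r powr (\<alpha> - 1))"
  by (simp add: p_def l0_def indicator_def)

lemma p_meas[measurable]: "p \<in> borel_measurable borel"
  unfolding p_alt[abs_def] by measurable

lemma p_nonneg: "p r \<ge> 0" unfolding p_alt using l0_nonneg by simp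

text \<open>
  The kernel of the field averaged against the shape \<open>\<theta>\<close> at scale \<open>T\<close>.
\<close>

definition "H T x = - (\<integral>y. \<theta> (y /\<^sub>R T) * ker y x \<partial>lborel)"

lemma H_meas[measurable]: "H T \<in> borel_measurable borel"
proof -
  have "(\<lambda>x::real \<times> (real^'d). \<integral>y. \<theta> (y /\<^sub>R T) * ker y x \<partial>lborel) \<in> borel_measurable (lborel \<Otimes>\<^sub>M lborel)"
  proof (rule lborel.borel_measurable_lebesgue_integral)
    have 1: "(\<lambda>q::(real \<times> (real^'d)) \<times> (real^'d). \<theta> (snd q /\<^sub>R T)) \<in> borel_measurable ((lborel \<Otimes>\<^sub>M lborel) \<Otimes>\<^sub>M lborel)"
      by measurable
    have 2: "(\<lambda>q::(real \<times> (real^'d)) \<times> (real^'d). ker (snd q) (fst q)) \<in> borel_measurable ((lborel \<Otimes>\<^sub>M lborel) \<Otimes>\<^sub>M lborel)"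
      using measurable_pair_swap[OF ker_measurable] by (simp add: case_prod_beta')
    show "(\<lambda>(x, y). \<theta> (y /\<^sub>R T) * ker y x) \<in> borel_measurable ((lborel \<Otimes>\<^sub>M lborel :: (real \<times> (real^'d)) measure) \<Otimes>\<^sub>M lborel)"
      unfolding case_prod_beta' by (rule borel_measurable_times[OF 1 2])
  qed
  then have "(\<lambda>x. - (\<integral>y. \<theta> (y /\<^sub>R T) * ker y x \<partial>lborel)) \<in> borel_measurable (lborel \<Otimes>\<^sub>M lborel)" by simp
  then show ?thesis by (simp add: H_def[abs_def] lborel_prod)
qed

lemma H_scaling:
  assumes T: "T > 0" and r: "r > 0"
  shows "H T (r / T, T *\<^sub>R u) = T powr (d + 1) * H 1 (r, u)"
proof -
  have k: "ker (T *\<^sub>R y) (r / T, T *\<^sub>R u) = T * ker y (r, u)" for y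
  proof -
    have "norm (T *\<^sub>R y - T *\<^sub>R u) = T * norm (y - u)" using T by (simp flip: scaleR_diff_right)
    then show ?thesis using T r by (simp add: ker_def field_simps)
  qed
  have "(\<integral>y. \<theta> (y /\<^sub>R T) * ker y (r / T, T *\<^sub>R u) \<partial>lborel) = T powr d * (\<integral>y. \<theta> ((T *\<^sub>R y) /\<^sub>R T) * ker (T *\<^sub>R y) (r / T, T *\<^sub>R u) \<partial>lborel)"
    unfolding d by (rule integral_vec_scaling[OF T]) (use ker_meas_y in measurable)
  also have "(\<integral>y. \<theta> ((T *\<^sub>R y) /\<^sub>R T) * ker (T *\<^sub>R y) (r / T, T *\<^sub>R u) \<partial>lborel) = (\<integral>y. T * (\<theta> y * ker y (r, u)) \<partial>lborel)"
    using T by (intro Bochner_Integration.integral_cong) (auto simp: k)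
  also have "\<dots> = T * (\<integral>y. \<theta> y * ker y (r, u) \<partial>lborel)" by (rule integral_mult_right_zero)
  finally show ?thesis using T by (simp add: H_def powr_add)
qed

lemma H_le_smooth:
  assumes r: "r > 0" shows "\<bar>H 1 (r, u)\<bar> \<le> c * smooth_ker (r, u)"
proof -
  have k0: "0 \<le> ker y (r, u)" for y using r by (simp add: ker_def)
  have I: "integrable lborel (\<lambda>y. indicator (cball 0 1) y * ker y (r, u))"
  proof (rule Bochner_Integration.integrable_bound)
    show "integrable lborel (\<lambda>y. (1 / (2 * r)) * indicat_real (cball (0::real^'d) 1) y)"
      using emeasure_compact_finite[of "cball (0::real^'d) 1"] by (intro integrable_mult_right integrable_real_indicator) auto
    show "(\<lambda>y. indicator (cball 0 1) y * ker y (r, u)) \<in> borel_measurable lborel"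
      using borel_measurable_times[OF borel_measurable_indicator[OF borel_closed[OF closed_cball]] ker_meas_y] by simp
    show "AE y in lborel. norm (indicator (cball 0 1) y * ker y (r, u)) \<le> norm ((1 / (2 * r)) * indicat_real (cball (0::real^'d) 1) y)"
      using r by (intro AE_I2) (auto simp: ker_def indicator_def divide_right_mono)
  qed
  have le: "\<bar>\<theta> y * ker y (r, u)\<bar> \<le> c * (indicator (cball 0 1) y * ker y (r, u))" for y
    unfolding abs_mult using mult_right_mono[OF c(2)[of y] abs_ge_zero[of "ker y (r, u)"]] k0[of y] by (simp add: mult.assoc)
  have "\<bar>H 1 (r, u)\<bar> \<le> (\<integral>y. \<bar>\<theta> y * ker y (r, u)\<bar> \<partial>lborel)"
    unfolding H_def using integral_abs_bound[of lborel "\<lambda>y. \<theta> y * ker y (r, u)"] by simp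
  also have "\<dots> \<le> (\<integral>y. c * (indicator (cball 0 1) y * ker y (r, u)) \<partial>lborel)"
  proof (rule integral_mono)
    show "integrable lborel (\<lambda>y. \<bar>\<theta> y * ker y (r, u)\<bar>)"
    proof (rule Bochner_Integration.integrable_bound[OF integrable_mult_right[OF I, of c]])
      show "(\<lambda>y. \<bar>\<theta> y * ker y (r, u)\<bar>) \<in> borel_measurable lborel" using ker_meas_y[of "(r, u)"] by measurable
      show "AE y in lborel. norm \<bar>\<theta> y * ker y (r, u)\<bar> \<le> norm (c * (indicator (cball 0 1) y * ker y (r, u)))"
        unfolding real_norm_def abs_idempotent by (intro AE_I2 order_trans[OF le abs_ge_self])
    qed
  qed (use le I in auto)
  also have "\<dots> = c * smooth_ker (r, u)" unfolding smooth_ker_def by (rule integral_mult_right_zero)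
  finally show ?thesis .
qed

text \<open>
  Reduces the domination of integrals over the parameter space to integrals over the rate.
\<close>

lemma weighted_integral_le:
  obtains K where "K \<ge> 0" "\<And>w. w \<in> borel_measurable borel \<Longrightarrow> (\<And>r::real. w r \<ge> 0) \<Longrightarrow>
     (\<integral>\<^sup>+x. ennreal (indicator {0<..} (fst x) * (w (fst x) * \<bar>H 1 x\<bar> powr \<beta>)) \<partial>(lborel \<Otimes>\<^sub>M lborel))
     \<le> (\<integral>\<^sup>+r. ennreal (K * (indicator {0<..} r * (w r * profile CARD('d) \<beta> r))) \<partial>lborel)"
proof -
  obtain K where K: "K \<ge> 0" "\<And>r. r > 0 \<Longrightarrow> (\<integral>\<^sup>+(u::real^'d). ennreal (\<bar>smooth_ker (r, u)\<bar> powr \<beta>) \<partial>lborel) \<le> ennreal (K * profile CARD('d) \<beta> r)"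
    using smooth_ker_integral[of \<beta>, where 'd = 'd] \<beta> by auto
  show ?thesis
  proof (rule that[of "c powr \<beta> * K"])
    show "c powr \<beta> * K \<ge> 0" using K by simp
    fix w :: "real \<Rightarrow> real" assume w[measurable]: "w \<in> borel_measurable borel" and w0: "\<And>r. w r \<ge> 0"
    have Hm[measurable]: "H 1 \<in> borel_measurable (lborel \<Otimes>\<^sub>M lborel)" using H_meas by (simp add: lborel_prod)
    have "(\<integral>\<^sup>+x. ennreal (indicator {0<..} (fst x) * (w (fst x) * \<bar>H 1 x\<bar> powr \<beta>)) \<partial>(lborel \<Otimes>\<^sub>M lborel))
      = (\<integral>\<^sup>+r. \<integral>\<^sup>+u. ennreal (indicator {0<..} r * (w r * \<bar>H 1 (r, u)\<bar> powr \<beta>)) \<partial>lborel \<partial>lborel)"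
    proof -
      have "(\<lambda>x. ennreal (indicator {0<..} (fst x) * (w (fst x) * \<bar>H 1 x\<bar> powr \<beta>))) \<in> borel_measurable (lborel \<Otimes>\<^sub>M lborel)"
        by measurable
      from lborel.nn_integral_fst[OF this] show ?thesis by simp
    qed
    also have "\<dots> \<le> (\<integral>\<^sup>+r. ennreal (c powr \<beta> * K * (indicator {0<..} r * (w r * profile CARD('d) \<beta> r))) \<partial>lborel)"
    proof (intro nn_integral_mono)
      fix r :: real
      show "(\<integral>\<^sup>+u. ennreal (indicator {0<..} r * (w r * \<bar>H 1 (r, u)\<bar> powr \<beta>)) \<partial>lborel) \<le> ennreal (c powr \<beta> * K * (indicator {0<..} r * (w r * profile CARD('d) \<beta> r)))"
      proof (cases "r > 0")
        case True
        have "(\<integral>\<^sup>+u. ennreal (indicator {0<..} r * (w r * \<bar>H 1 (r, u)\<bar> powr \<beta>)) \<partial>lborel) \<le> (\<integral>\<^sup>+(u::real^'d). ennreal (w r * c powr \<beta>) * ennreal (\<bar>smooth_ker (r, u)\<bar> powr \<beta>) \<partial>lborel)"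
        proof (intro nn_integral_mono)
          fix u :: "real^'d"
          have "\<bar>H 1 (r, u)\<bar> \<le> c * \<bar>smooth_ker (r, u)\<bar>" using H_le_smooth[OF True, of u] c(1) mult_left_mono[OF abs_ge_self[of "smooth_ker (r, u)"] c(1)] by linarith
          then have "\<bar>H 1 (r, u)\<bar> powr \<beta> \<le> (c * \<bar>smooth_ker (r, u)\<bar>) powr \<beta>" using \<beta> by (intro powr_mono2) auto
          then have "w r * \<bar>H 1 (r, u)\<bar> powr \<beta> \<le> w r * c powr \<beta> * \<bar>smooth_ker (r, u)\<bar> powr \<beta>"
            using mult_left_mono[OF _ w0[of r]] c(1) by (simp add: powr_mult mult.assoc)
          then show "ennreal (indicator {0<..} r * (w r * \<bar>H 1 (r, u)\<bar> powr \<beta>)) \<le> ennreal (w r * c powr \<beta>) * ennreal (\<bar>smooth_ker (r, u)\<bar> powr \<beta>)"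
            using True w0[of r] by (simp add: ennreal_mult'[symmetric] ennreal_leI)
        qed
        also have "\<dots> = ennreal (w r * c powr \<beta>) * (\<integral>\<^sup>+(u::real^'d). ennreal (\<bar>smooth_ker (r, u)\<bar> powr \<beta>) \<partial>lborel)"
        proof (rule nn_integral_cmult)
          have "(\<lambda>u::real^'d. smooth_ker (r, u)) \<in> borel_measurable lborel"
            using measurable_compose[OF measurable_Pair1' smooth_ker_measurable, of r] by simp
          then show "(\<lambda>u::real^'d. ennreal (\<bar>smooth_ker (r, u)\<bar> powr \<beta>)) \<in> borel_measurable lborel" by measurable
        qed
        also have "\<dots> \<le> ennreal (w r * c powr \<beta>) * ennreal (K * profile CARD('d) \<beta> r)" by (intro mult_left_mono K(2)[OF True]) simp
        also have "\<dots> = ennreal (c powr \<beta> * K * (indicator {0<..} r * (w r * profile CARD('d) \<beta> r)))"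
          using True w0[of r] by (simp add: ennreal_mult'[symmetric] mult_ac)
        finally show ?thesis .
      qed simp
    qed
    finally show "(\<integral>\<^sup>+x. ennreal (indicator {0<..} (fst x) * (w (fst x) * \<bar>H 1 x\<bar> powr \<beta>)) \<partial>(lborel \<Otimes>\<^sub>M lborel))
      \<le> (\<integral>\<^sup>+r. ennreal (c powr \<beta> * K * (indicator {0<..} r * (w r * profile CARD('d) \<beta> r))) \<partial>lborel)" .
  qed
qed

text \<open>
  The normalisation of the limit theorem and the resulting scale at which the cumulant is evaluated.
\<close>

definition "N T = T powr (d + 1 - (\<alpha> - d) / \<beta>) * l T powr (1 / \<beta>)"
definition "lam T = T powr ((\<alpha> - d) / \<beta>) * l T powr (- (1 / \<beta>))"

lemma lam_N: "T > 0 \<Longrightarrow> T powr (d + 1) / N T = lam T"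
  unfolding N_def lam_def using l(2)[of T] by (simp add: powr_diff powr_minus field_simps)

lemma lam_powr: "T > 0 \<Longrightarrow> lam T powr \<beta> = T powr (\<alpha> - d) / l T"
proof -
  assume T: "T > 0"
  have 1: "(l T powr (- (1 / \<beta>))) powr \<beta> = l T powr (- 1)" using \<beta> unfolding powr_powr by simp
  have 2: "(T powr ((\<alpha> - d) / \<beta>)) powr \<beta> = T powr (\<alpha> - d)" using \<beta> unfolding powr_powr by simp
  have 3: "l T powr (- 1) = 1 / l T" using l(2)[OF T] by (simp add: powr_minus_divide)
  have "lam T powr \<beta> = (T powr ((\<alpha> - d) / \<beta>)) powr \<beta> * (l T powr (- (1 / \<beta>))) powr \<beta>"
    unfolding lam_def by (rule powr_mult)
  then show "lam T powr \<beta> = T powr (\<alpha> - d) / l T" unfolding 1 2 3 by simp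
qed

lemma lam_pos: "T > 0 \<Longrightarrow> lam T > 0" unfolding lam_def using l(2)[of T] by simp

text \<open>
  The integrand \<open>\<kappa>(H\<^sub>T / N\<^sub>T)\<close> times the density of the rates, after the substitution \<open>(r, u) \<leftarrow> (r/T, T u)\<close>.
\<close>

definition "G T x = indicator {0<..} (fst x) *\<^sub>R (of_real (l0 (T / fst x) / l T * fst x powr (\<alpha> - 1) / lam T powr \<beta>) * \<kappa> (lam T * H 1 x))"

lemma \<kappa>_meas[measurable]: "\<kappa> \<in> borel_measurable borel" "\<kappa>' \<in> borel_measurable borel"
  using \<kappa>_cont \<kappa>'_cont by (auto intro: borel_measurable_continuous_onI)

lemma G_meas[measurable]: "G T \<in> borel_measurable borel"
proof -
  have Hm[measurable]: "H 1 \<in> borel_measurable (borel \<Otimes>\<^sub>M borel)" using H_meas by (simp add: borel_prod)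
  have "G T \<in> borel_measurable (borel \<Otimes>\<^sub>M borel)" unfolding G_def[abs_def] by measurable
  then show ?thesis by (simp add: borel_prod)
qed

abbreviation "LL \<equiv> (lborel \<Otimes>\<^sub>M lborel :: (real \<times> (real^'d)) measure)"

lemma scaled_cumulant:
  assumes T: "T > 0"
  shows "(\<integral>x. \<kappa> (H T x / N T) \<partial>(density lborel (\<lambda>r. ennreal (p r)) \<Otimes>\<^sub>M lborel)) = (\<integral>x. G T x \<partial>LL)"
proof -
  have fm: "(\<lambda>x. \<kappa> (H T x / N T)) \<in> borel_measurable borel" by measurable
  have pm: "(\<lambda>x::real \<times> (real^'d). p (fst x)) \<in> borel_measurable borel"
    by (rule measurable_compose[OF _ p_meas]) (intro borel_measurable_continuous_onI continuous_intros)
  have "(\<integral>x. \<kappa> (H T x / N T) \<partial>(density lborel (\<lambda>r. ennreal (p r)) \<Otimes>\<^sub>M lborel)) = (\<integral>x. p (fst x) *\<^sub>R \<kappa> (H T x / N T) \<partial>LL)"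
    unfolding density_times_lborel[OF p_meas] lborel_prod using fm pm p_nonneg by (subst integral_density) auto
  also have "\<dots> = (\<integral>x. of_real (T powr (d - 1)) * (p (fst x / T) *\<^sub>R \<kappa> (H T (fst x / T, T *\<^sub>R snd x) / N T)) \<partial>LL)"
    using lborel_pair_scaling[OF T, of "\<lambda>x. p (fst x) *\<^sub>R \<kappa> (H T x / N T)", folded d] fm pm by (simp add: d[symmetric])
  also have "\<dots> = (\<integral>x. G T x \<partial>LL)"
  proof (rule Bochner_Integration.integral_cong[OF refl])
    fix x :: "real \<times> (real^'d)"
    obtain r u where x: "x = (r, u)" by (cases x)
    show "of_real (T powr (d - 1)) * (p (fst x / T) *\<^sub>R \<kappa> (H T (fst x / T, T *\<^sub>R snd x) / N T)) = G T x"
    proof (cases "r > 0")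
      case True
      have "H T (r / T, T *\<^sub>R u) / N T = lam T * H 1 (r, u)"
        unfolding H_scaling[OF T True] lam_N[OF T, symmetric] by simp
      moreover have "T powr (d - 1) * p (r / T) = l0 (T / r) / l T * r powr (\<alpha> - 1) / lam T powr \<beta>"
      proof -
        have "p (r / T) = l0 (T / r) * (r / T) powr (\<alpha> - 1)" using True T by (simp add: p_alt)
        moreover have "T powr (d - 1) * (r / T) powr (\<alpha> - 1) = r powr (\<alpha> - 1) / T powr (\<alpha> - d)"
          using T True by (simp add: powr_divide powr_diff field_simps)
        moreover have "1 / l T / lam T powr \<beta> = 1 / T powr (\<alpha> - d)" unfolding lam_powr[OF T] using l(2)[OF T] by simp
        ultimately show ?thesis by (simp add: field_simps)
      qed
      ultimately show ?thesis using True unfolding x G_def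
        by (simp add: scaleR_conv_of_real mult.assoc[symmetric] flip: of_real_mult)
    next
      case False
      then have "\<not> r / T > 0" using T by (simp add: zero_less_divide_iff)
      then show ?thesis using False by (simp add: x G_def p_def)
    qed
  qed
  finally show ?thesis .
qed

lemma norm_G_le:
  assumes T: "T > 0"
  shows "norm (G T x) \<le> indicator {0<..} (fst x) * (C * (l0 (T / fst x) / l T * fst x powr (\<alpha> - 1)) * \<bar>H 1 x\<bar> powr \<beta>)"
proof -
  let ?a = "l0 (T / fst x) / l T * fst x powr (\<alpha> - 1)"
  have a: "?a \<ge> 0" using l0_nonneg l(2)[OF T] by (intro mult_nonneg_nonneg divide_nonneg_pos) auto
  have lp: "lam T powr \<beta> > 0" using lam_pos[OF T] by simp
  have "norm (\<kappa> (lam T * H 1 x)) \<le> C * (lam T powr \<beta> * \<bar>H 1 x\<bar> powr \<beta>)"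
    using C(2)[of "lam T * H 1 x"] lam_pos[OF T] by (simp add: abs_mult powr_mult)
  then have "?a / lam T powr \<beta> * norm (\<kappa> (lam T * H 1 x)) \<le> ?a / lam T powr \<beta> * (C * (lam T powr \<beta> * \<bar>H 1 x\<bar> powr \<beta>))"
    using a lp by (intro mult_left_mono divide_nonneg_pos) auto
  also have "\<dots> = C * ?a * \<bar>H 1 x\<bar> powr \<beta>" using lp by simp
  finally have "?a / lam T powr \<beta> * norm (\<kappa> (lam T * H 1 x)) \<le> C * ?a * \<bar>H 1 x\<bar> powr \<beta>" .
  moreover have "norm (G T x) = indicator {0<..} (fst x) * (?a / lam T powr \<beta> * norm (\<kappa> (lam T * H 1 x)))"
  proof -
    have "norm (complex_of_real (?a / lam T powr \<beta>)) = ?a / lam T powr \<beta>"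
      unfolding norm_of_real using a lp by (intro abs_of_nonneg divide_nonneg_pos)
    then show ?thesis unfolding G_def norm_scaleR norm_mult by simp
  qed
  ultimately show ?thesis by (auto simp: indicator_def)
qed

text \<open>
  Any \<open>\<delta>\<close> that is small compared to the gaps in \<open>\<beta> + d < \<alpha> < (d + 1) \<beta>\<close> does.
\<close>

lemma potter_delta:
  obtains \<delta> X C1 where "\<delta> > 0" "\<beta> + d + \<delta> < \<alpha>" "\<alpha> + \<delta> < (d + 1) * \<beta>" "X \<ge> 1" "C1 > 0"
    "\<And>x y. x \<ge> X \<Longrightarrow> y \<ge> X \<Longrightarrow> l y / l x \<le> C1 * max ((y / x) powr \<delta>) ((y / x) powr (- \<delta>))"
proof -
  define \<delta> where "\<delta> = min (\<alpha> - d - \<beta>) ((d + 1) * \<beta> - \<alpha>) / 2"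
  have \<delta>: "\<delta> > 0" "\<beta> + d + \<delta> < \<alpha>" "\<alpha> + \<delta> < (d + 1) * \<beta>"
  proof -
    have "2 * \<delta> \<le> \<alpha> - d - \<beta>" "2 * \<delta> \<le> (d + 1) * \<beta> - \<alpha>" and pos: "\<delta> > 0" using lo hi by (auto simp: \<delta>_def)
    then show "\<delta> > 0" "\<beta> + d + \<delta> < \<alpha>" "\<alpha> + \<delta> < (d + 1) * \<beta>" by linarith+
  qed
  obtain X C1 where X: "X > 0" "C1 > 0" "\<And>x y. x \<ge> X \<Longrightarrow> y \<ge> X \<Longrightarrow> l y / l x \<le> C1 * max ((y / x) powr \<delta>) ((y / x) powr (- \<delta>))"
    using potter_bound[OF l \<delta>(1)] by blast
  show ?thesis by (rule that[OF \<delta>, of "max X 1" C1]) (use X in auto)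
qed

lemma potter_upper:
  assumes X: "X \<ge> 1" and \<delta>: "\<delta> > 0" and P: "\<And>x y. x \<ge> X \<Longrightarrow> y \<ge> X \<Longrightarrow> l y / l x \<le> C1 * max ((y / x) powr \<delta>) ((y / x) powr (- \<delta>))"
    and T: "T \<ge> X"
  shows "l T \<le> l X * C1 * (T / X) powr \<delta>" and "1 / l T \<le> C1 / l X * (T / X) powr \<delta>"
proof -
  have q: "T / X \<ge> 1" using X T by simp
  have m: "max ((T / X) powr \<delta>) ((T / X) powr (- \<delta>)) = (T / X) powr \<delta>"
    using powr_mono[OF _ q, of "- \<delta>" \<delta>] \<delta> by simp
  have m': "max ((X / T) powr \<delta>) ((X / T) powr (- \<delta>)) = (T / X) powr \<delta>"
    using m X T by (simp add: powr_minus_divide powr_divide max.commute)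
  have pos: "l X > 0" "l T > 0" using l(2) X T by auto
  show "l T \<le> l X * C1 * (T / X) powr \<delta>" using P[of X T] T pos m by (simp add: field_simps)
  show "1 / l T \<le> C1 / l X * (T / X) powr \<delta>" using P[of T X] T pos m' by (simp add: field_simps)
qed

text \<open>
  Since \<open>\<alpha> > d\<close> and \<open>l\<close> grows slower than any power.
\<close>

lemma lam_lim: "filterlim lam at_top at_top"
proof -
  obtain \<delta> X C1 where p: "\<delta> > 0" "\<beta> + d + \<delta> < \<alpha>" "\<alpha> + \<delta> < (d + 1) * \<beta>" "X \<ge> 1" "C1 > 0"
    "\<And>x y. x \<ge> X \<Longrightarrow> y \<ge> X \<Longrightarrow> l y / l x \<le> C1 * max ((y / x) powr \<delta>) ((y / x) powr (- \<delta>))"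
    by (rule potter_delta) blast
  define A where "A = l X * C1 / X powr \<delta>"
  have A: "A > 0" using p l(2)[of X] by (simp add: A_def)
  have le: "A powr (- (1 / \<beta>)) * T powr ((\<alpha> - d - \<delta>) / \<beta>) \<le> lam T" if T: "T \<ge> X" for T
  proof -
    have T0: "T > 0" using T p by simp
    have "l T \<le> A * T powr \<delta>" using potter_upper(1)[OF p(4,1,6) T] p T0 by (simp add: A_def powr_divide)
    then have "(A * T powr \<delta>) powr (- (1 / \<beta>)) \<le> l T powr (- (1 / \<beta>))"
      using l(2)[OF T0] \<beta> by (intro powr_mono2') auto
    then have "T powr ((\<alpha> - d) / \<beta>) * (A * T powr \<delta>) powr (- (1 / \<beta>)) \<le> lam T"
      unfolding lam_def by (intro mult_left_mono) auto
    moreover have "T powr ((\<alpha> - d) / \<beta>) * (A * T powr \<delta>) powr (- (1 / \<beta>)) = A powr (- (1 / \<beta>)) * T powr ((\<alpha> - d - \<delta>) / \<beta>)"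
    proof -
      have "(A * T powr \<delta>) powr (- (1 / \<beta>)) = A powr (- (1 / \<beta>)) * T powr (- (\<delta> / \<beta>))"
        using A by (simp add: powr_mult powr_powr)
      moreover have "T powr ((\<alpha> - d) / \<beta>) * T powr (- (\<delta> / \<beta>)) = T powr ((\<alpha> - d - \<delta>) / \<beta>)"
        by (simp add: powr_add[symmetric] diff_divide_distrib)
      ultimately show ?thesis by (simp add: mult_ac)
    qed
    ultimately show ?thesis by simp
  qed
  have "filterlim (\<lambda>T::real. T powr ((\<alpha> - d - \<delta>) / \<beta>)) at_top at_top"
    using p \<beta> by real_asymp
  then have "filterlim (\<lambda>T::real. A powr (- (1 / \<beta>)) * T powr ((\<alpha> - d - \<delta>) / \<beta>)) at_top at_top"
    using A by (intro filterlim_tendsto_pos_mult_at_top[OF tendsto_const]) auto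
  then show ?thesis by (rule filterlim_at_top_mono) (use le in \<open>auto intro!: eventually_at_top_linorderI[of X]\<close>)
qed

text \<open>
  For \<open>r \<ge> T/X\<close> the argument of \<open>l(T/r)\<close> stays below \<open>X\<close>, where the behaviour of \<open>l\<close> at infinity says nothing. The
  normalisation of the density takes its place; the decay of \<open>profile\<close> yields the negative power of \<open>T\<close>.
\<close>

lemma outer_bound:
  assumes X: "X \<ge> 1"
  shows "\<exists>B\<ge>0. \<forall>T\<ge>X. (\<integral>\<^sup>+x. ennreal (norm (indicator {T / X..} (fst x) *\<^sub>R G T x)) \<partial>LL) \<le> ennreal (B * (T powr (\<alpha> - (d + 1) * \<beta>) / l T))"
proof -
  obtain K where K: "K \<ge> 0" "\<And>w. w \<in> borel_measurable borel \<Longrightarrow> (\<And>r::real. w r \<ge> 0) \<Longrightarrow>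
     (\<integral>\<^sup>+x. ennreal (indicator {0<..} (fst x) * (w (fst x) * \<bar>H 1 x\<bar> powr \<beta>)) \<partial>(lborel \<Otimes>\<^sub>M lborel))
     \<le> (\<integral>\<^sup>+r. ennreal (K * (indicator {0<..} r * (w r * profile CARD('d) \<beta> r))) \<partial>lborel)"
    by (rule weighted_integral_le) blast
  define B where "B = K * C * X powr ((d + 1) * \<beta>)"
  have B: "B \<ge> 0" using K C by (simp add: B_def)
  have "(\<integral>\<^sup>+x. ennreal (norm (indicator {T / X..} (fst x) *\<^sub>R G T x)) \<partial>LL) \<le> ennreal (B * (T powr (\<alpha> - (d + 1) * \<beta>) / l T))" if T: "T \<ge> X" for T
  proof -
    have T0: "T > 0" and lT: "l T > 0" using T X l(2)[of T] by auto
    define w where "w r = indicator {T / X..} r * (C * (l0 (T / r) / l T * r powr (\<alpha> - 1)))" for r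
    have w[measurable]: "w \<in> borel_measurable borel" unfolding w_def[abs_def] by measurable
    have w0: "w r \<ge> 0" for r unfolding w_def using C(1) l0_nonneg lT by (intro mult_nonneg_nonneg divide_nonneg_pos) auto
    define A where "A = B * T powr (\<alpha> - (d + 1) * \<beta> - 1) / l T"
    have A: "A \<ge> 0" using B lT by (simp add: A_def)
    have "(\<integral>\<^sup>+x. ennreal (norm (indicator {T / X..} (fst x) *\<^sub>R G T x)) \<partial>LL) \<le> (\<integral>\<^sup>+x. ennreal (indicator {0<..} (fst x) * (w (fst x) * \<bar>H 1 x\<bar> powr \<beta>)) \<partial>LL)"
    proof (intro nn_integral_mono ennreal_leI)
      fix x :: "real \<times> (real^'d)"
      show "norm (indicator {T / X..} (fst x) *\<^sub>R G T x) \<le> indicator {0<..} (fst x) * (w (fst x) * \<bar>H 1 x\<bar> powr \<beta>)"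
        using norm_G_le[OF T0, of x] by (auto simp: w_def indicator_def)
    qed
    also have "\<dots> \<le> (\<integral>\<^sup>+r. ennreal (K * (indicator {0<..} r * (w r * profile CARD('d) \<beta> r))) \<partial>lborel)"
      by (rule K(2)[OF w w0])
    also have "\<dots> \<le> (\<integral>\<^sup>+r. ennreal A * ennreal (p (r / T)) \<partial>lborel)"
    proof (intro nn_integral_mono)
      fix r :: real
      show "ennreal (K * (indicator {0<..} r * (w r * profile CARD('d) \<beta> r))) \<le> ennreal A * ennreal (p (r / T))"
      proof (cases "r \<ge> T / X")
        case True
        have q: "T / X \<ge> 1" using X T by simp
        have r: "r \<ge> 1" "r > 0" using True q by auto
        have "profile CARD('d) \<beta> r = r powr (- ((d + 1) * \<beta>))"
          using profile_large[OF r(1), of \<beta> "CARD('d)"] \<beta> by (simp add: d[symmetric] algebra_simps)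
        also have "\<dots> \<le> (T / X) powr (- ((d + 1) * \<beta>))"
          using True q \<beta> by (intro powr_mono2') (auto simp: d)
        finally have pr: "profile CARD('d) \<beta> r \<le> (T / X) powr (- ((d + 1) * \<beta>))" .
        have "K * (w r * profile CARD('d) \<beta> r) \<le> K * (w r * (T / X) powr (- ((d + 1) * \<beta>)))"
          using pr K(1) w0 by (intro mult_left_mono) auto
        also have "\<dots> = A * p (r / T)"
        proof -
          have "p (r / T) = l0 (T / r) * (r powr (\<alpha> - 1) / T powr (\<alpha> - 1))"
            using r T0 by (simp add: p_alt powr_divide)
          moreover have "(T / X) powr (- ((d + 1) * \<beta>)) = T powr (- ((d + 1) * \<beta>)) * X powr ((d + 1) * \<beta>)"
            using T0 X by (simp add: powr_divide powr_minus_divide)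
          moreover have "T powr (\<alpha> - (d + 1) * \<beta> - 1) = T powr (\<alpha> - 1) * T powr (- ((d + 1) * \<beta>))"
            by (simp add: powr_add[symmetric] algebra_simps)
          moreover have "T powr (\<alpha> - 1) > 0" using T0 by simp
          moreover have "w r = C * (l0 (T / r) / l T * r powr (\<alpha> - 1))" using True by (simp add: w_def)
          ultimately show ?thesis unfolding A_def B_def using lT by (simp add: field_simps)
        qed
        finally show ?thesis using r A by (simp add: ennreal_mult'[symmetric] ennreal_leI)
      qed (simp add: w_def)
    qed
    also have "\<dots> = ennreal A * (\<integral>\<^sup>+r. ennreal (p (r / T)) \<partial>lborel)" by (rule nn_integral_cmult) measurable
    also have "(\<integral>\<^sup>+r. ennreal (p (r / T)) \<partial>lborel) = ennreal T * (\<integral>\<^sup>+r. ennreal (p ((0 + T * r) / T)) \<partial>lborel)"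
      using T0 by (subst nn_integral_real_affine[where c = T and t = 0]) auto
    also have "\<dots> = ennreal T" using T0 p_prob by (simp add: p_def[abs_def])
    also have "ennreal A * ennreal T = ennreal (B * (T powr (\<alpha> - (d + 1) * \<beta>) / l T))"
    proof -
      have "T powr (\<alpha> - (d + 1) * \<beta> - 1) * T = T powr (\<alpha> - (d + 1) * \<beta>)" using T0 by (simp add: powr_diff)
      then have "A * T = B * (T powr (\<alpha> - (d + 1) * \<beta>) / l T)" by (simp add: A_def)
      then show ?thesis using A by (simp add: ennreal_mult'[symmetric])
    qed
    finally show ?thesis .
  qed
  then show ?thesis using B by blast
qed

lemma G_pointwise:
  assumes x: "fst x > 0"
  shows "((\<lambda>T. G T x) \<longlongrightarrow> fst x powr (\<alpha> - 1) *\<^sub>R \<kappa>' (H 1 x)) at_top"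
proof -
  have sv: "((\<lambda>T. l (1 / fst x * T) / l T) \<longlongrightarrow> 1) at_top" using l(1) x unfolding slowly_varying_at_top_def by (metis zero_less_divide_1_iff)
  have k: "((\<lambda>T. \<kappa> (lam T * H 1 x) / of_real (lam T powr \<beta>)) \<longlongrightarrow> \<kappa>' (H 1 x)) at_top"
    by (rule filterlim_compose[OF \<kappa>_lim lam_lim])
  have "((\<lambda>T. (l (1 / fst x * T) / l T * fst x powr (\<alpha> - 1)) *\<^sub>R (\<kappa> (lam T * H 1 x) / of_real (lam T powr \<beta>))) \<longlongrightarrow> (1 * fst x powr (\<alpha> - 1)) *\<^sub>R \<kappa>' (H 1 x)) at_top"
    by (intro tendsto_intros sv k)
  then have "((\<lambda>T. (l (1 / fst x * T) / l T * fst x powr (\<alpha> - 1)) *\<^sub>R (\<kappa> (lam T * H 1 x) / of_real (lam T powr \<beta>))) \<longlongrightarrow> fst x powr (\<alpha> - 1) *\<^sub>R \<kappa>' (H 1 x)) at_top"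
    by simp
  then show ?thesis
  proof (rule Lim_transform_eventually)
    show "\<forall>\<^sub>F T in at_top. (l (1 / fst x * T) / l T * fst x powr (\<alpha> - 1)) *\<^sub>R (\<kappa> (lam T * H 1 x) / of_real (lam T powr \<beta>)) = G T x"
      using eventually_gt_at_top[of 0]
    proof eventually_elim
      case (elim T)
      then show ?case using x by (simp add: G_def l0_def scaleR_conv_of_real)
    qed
  qed
qed

end

context limit_setting
begin

text \<open>
  Dominated convergence: for \<open>r < T/X\<close> the ratio \<open>l(T/r) / l(T)\<close> is at most a multiple of \<open>max (r\<^sup>\<delta>) (r\<^sup>-\<^sup>\<delta>)\<close>.
\<close>

lemma inner_limit:
  assumes p: "\<delta> > 0" "\<beta> + d + \<delta> < \<alpha>" "\<alpha> + \<delta> < (d + 1) * \<beta>" "X \<ge> 1" "C1 > 0"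
    "\<And>x y. x \<ge> X \<Longrightarrow> y \<ge> X \<Longrightarrow> l y / l x \<le> C1 * max ((y / x) powr \<delta>) ((y / x) powr (- \<delta>))"
  shows "((\<lambda>T. \<integral>x. indicator {..<T / X} (fst x) *\<^sub>R G T x \<partial>LL) \<longlongrightarrow> (\<integral>x. (indicator {0<..} (fst x) * fst x powr (\<alpha> - 1)) *\<^sub>R \<kappa>' (H 1 x) \<partial>LL)) at_top"
    and "T \<ge> X \<Longrightarrow> integrable LL (\<lambda>x. indicator {..<T / X} (fst x) *\<^sub>R G T x)"
proof -
  define w where "w r = C * C1 * (r powr (\<alpha> - 1) * max (r powr \<delta>) (r powr (- \<delta>)))" for r :: real
  have w[measurable]: "w \<in> borel_measurable borel" unfolding w_def[abs_def] by measurable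
  have w0: "w r \<ge> 0" for r unfolding w_def using C(1) p(5) by (simp add: le_max_iff_disj)
  obtain K where K: "K \<ge> 0" "\<And>w. w \<in> borel_measurable borel \<Longrightarrow> (\<And>r::real. w r \<ge> 0) \<Longrightarrow>
     (\<integral>\<^sup>+x. ennreal (indicator {0<..} (fst x) * (w (fst x) * \<bar>H 1 x\<bar> powr \<beta>)) \<partial>(lborel \<Otimes>\<^sub>M lborel))
     \<le> (\<integral>\<^sup>+r. ennreal (K * (indicator {0<..} r * (w r * profile CARD('d) \<beta> r))) \<partial>lborel)"
    by (rule weighted_integral_le) blast
  let ?D = "\<lambda>x. indicator {0<..} (fst x) * (w (fst x) * \<bar>H 1 x\<bar> powr \<beta>)"
  have Hm[measurable]: "H 1 \<in> borel_measurable LL" using H_meas by (simp add: lborel_prod)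
  have Gm[measurable]: "G T \<in> borel_measurable LL" for T using G_meas by (simp add: lborel_prod)
  have \<kappa>Hm[measurable]: "(\<lambda>x. \<kappa>' (H 1 x)) \<in> borel_measurable LL" by (rule measurable_compose[OF Hm \<kappa>_meas(2)])
  have D_int: "integrable LL ?D"
  proof (rule integrableI_bounded)
    show "?D \<in> borel_measurable LL" by measurable
    have "(\<integral>\<^sup>+x. ennreal (norm (?D x)) \<partial>LL) = (\<integral>\<^sup>+x. ennreal (?D x) \<partial>LL)"
      using w0 by (intro nn_integral_cong) (simp add: abs_mult)
    also have "\<dots> \<le> (\<integral>\<^sup>+r. ennreal (K * (indicator {0<..} r * (w r * profile CARD('d) \<beta> r))) \<partial>lborel)" by (rule K(2)[OF w w0])
    also have "\<dots> = (\<integral>\<^sup>+r. ennreal (K * C * C1) * ennreal (indicator {0<..} r * (profile CARD('d) \<beta> r * r powr (\<alpha> - 1) * max (r powr \<delta>) (r powr (- \<delta>)))) \<partial>lborel)"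
    proof (rule nn_integral_cong)
      fix r :: real
      have "0 \<le> K * C * C1" using K(1) C(1) p(5) by simp
      then show "ennreal (K * (indicator {0<..} r * (w r * profile CARD('d) \<beta> r))) = ennreal (K * C * C1) * ennreal (indicator {0<..} r * (profile CARD('d) \<beta> r * r powr (\<alpha> - 1) * max (r powr \<delta>) (r powr (- \<delta>))))"
        by (simp add: ennreal_mult'[symmetric] w_def mult_ac)
    qed
    also have "\<dots> = ennreal (K * C * C1) * (\<integral>\<^sup>+r. ennreal (indicator {0<..} r * (profile CARD('d) \<beta> r * r powr (\<alpha> - 1) * max (r powr \<delta>) (r powr (- \<delta>)))) \<partial>lborel)"
      unfolding profile_def by (rule nn_integral_cmult) measurable
    also have "\<dots> < \<infinity>"
      using profile_weight_finite[of \<beta> "CARD('d)" \<delta> \<alpha>] \<beta> p(1,2,3) by (simp add: d ennreal_mult_less_top)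
    finally show "(\<integral>\<^sup>+x. ennreal (norm (?D x)) \<partial>LL) < \<infinity>" .
  qed
  have le: "norm (indicator {..<T / X} (fst x) *\<^sub>R G T x) \<le> ?D x" if T: "T \<ge> X" for T x
  proof (cases "0 < fst x \<and> fst x < T / X")
    case True
    define r where "r = fst x"
    have r: "r > 0" "r < T / X" using True by (auto simp: r_def)
    have T0: "T > 0" using T p(4) by simp
    have "T / r \<ge> X" using r p(4) T0 by (simp add: field_simps)
    then have "l (T / r) / l T \<le> C1 * max (((T / r) / T) powr \<delta>) (((T / r) / T) powr (- \<delta>))" by (rule p(6)[OF T])
    also have "max (((T / r) / T) powr \<delta>) (((T / r) / T) powr (- \<delta>)) = max (r powr \<delta>) (r powr (- \<delta>))"
      using r T0 by (simp add: powr_divide powr_minus_divide max.commute)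
    finally have "l (T / r) / l T * r powr (\<alpha> - 1) \<le> C1 * max (r powr \<delta>) (r powr (- \<delta>)) * r powr (\<alpha> - 1)"
      by (rule mult_right_mono) simp
    then have "C * (l (T / r) / l T * r powr (\<alpha> - 1)) \<le> C * (C1 * max (r powr \<delta>) (r powr (- \<delta>)) * r powr (\<alpha> - 1))"
      by (rule mult_left_mono) (use C(1) in simp)
    also have "\<dots> = w r" by (simp add: w_def mult_ac)
    finally have "C * (l (T / r) / l T * r powr (\<alpha> - 1)) \<le> w r" .
    then have "C * (l (T / r) / l T * r powr (\<alpha> - 1)) * \<bar>H 1 x\<bar> powr \<beta> \<le> w r * \<bar>H 1 x\<bar> powr \<beta>" by (rule mult_right_mono) simp
    then show ?thesis using norm_G_le[OF T0, of x] True T0 by (simp add: r_def l0_def)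
  next
    case False
    then have z: "indicator {..<T / X} (fst x) *\<^sub>R G T x = 0" by (auto simp: G_def indicator_def)
    show ?thesis unfolding z using w0 by simp
  qed
  show "integrable LL (\<lambda>x. indicator {..<T / X} (fst x) *\<^sub>R G T x)" if "T \<ge> X"
  proof (rule Bochner_Integration.integrable_bound[OF D_int])
    show "(\<lambda>x. indicator {..<T / X} (fst x) *\<^sub>R G T x) \<in> borel_measurable LL" by measurable
    show "AE x in LL. norm (indicator {..<T / X} (fst x) *\<^sub>R G T x) \<le> norm (?D x)"
    proof (rule AE_I2)
      fix x :: "real \<times> (real^'d)"
      show "norm (indicator {..<T / X} (fst x) *\<^sub>R G T x) \<le> norm (?D x)"
        using le[OF that, of x] abs_ge_self[of "?D x"] unfolding real_norm_def by (rule order_trans)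
    qed
  qed
  show "((\<lambda>T. \<integral>x. indicator {..<T / X} (fst x) *\<^sub>R G T x \<partial>LL) \<longlongrightarrow> (\<integral>x. (indicator {0<..} (fst x) * fst x powr (\<alpha> - 1)) *\<^sub>R \<kappa>' (H 1 x) \<partial>LL)) at_top"
  proof (rule integral_dominated_convergence_at_top[OF _ _ D_int])
    show "(\<lambda>x. (indicator {0<..} (fst x) * fst x powr (\<alpha> - 1)) *\<^sub>R \<kappa>' (H 1 x)) \<in> borel_measurable LL" by measurable
    show "(\<lambda>x. indicator {..<T / X} (fst x) *\<^sub>R G T x) \<in> borel_measurable LL" for T by measurable
    show "AE x in LL. ((\<lambda>T. indicator {..<T / X} (fst x) *\<^sub>R G T x) \<longlongrightarrow> (indicator {0<..} (fst x) * fst x powr (\<alpha> - 1)) *\<^sub>R \<kappa>' (H 1 x)) at_top"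
    proof (rule AE_I2)
      fix x :: "real \<times> (real^'d)"
      show "((\<lambda>T. indicator {..<T / X} (fst x) *\<^sub>R G T x) \<longlongrightarrow> (indicator {0<..} (fst x) * fst x powr (\<alpha> - 1)) *\<^sub>R \<kappa>' (H 1 x)) at_top"
      proof (cases "fst x > 0")
        case True
        have "\<forall>\<^sub>F T in at_top. indicator {..<T / X} (fst x) *\<^sub>R G T x = G T x"
          using eventually_gt_at_top[of "fst x * X"]
        proof eventually_elim
          case (elim T)
          then show ?case using p(4) by (simp add: indicator_def field_simps)
        qed
        with G_pointwise[OF True] True show ?thesis by (simp add: tendsto_cong)
      qed (simp add: G_def)
    qed
    show "\<forall>\<^sub>F T in at_top. AE x in LL. norm (indicator {..<T / X} (fst x) *\<^sub>R G T x) \<le> ?D x"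
      using eventually_ge_at_top[of X] by eventually_elim (use le in auto)
  qed
qed

lemma cumulant_limit:
  "((\<lambda>T. \<integral>x. \<kappa> (H T x / N T) \<partial>(density lborel (\<lambda>r. ennreal (p r)) \<Otimes>\<^sub>M lborel)) \<longlongrightarrow> (\<integral>x. \<kappa>' (H 1 x) \<partial>limit_control \<alpha>)) at_top"
proof -
  obtain \<delta> X C1 where p: "\<delta> > 0" "\<beta> + d + \<delta> < \<alpha>" "\<alpha> + \<delta> < (d + 1) * \<beta>" "X \<ge> 1" "C1 > 0"
    "\<And>x y. x \<ge> X \<Longrightarrow> y \<ge> X \<Longrightarrow> l y / l x \<le> C1 * max ((y / x) powr \<delta>) ((y / x) powr (- \<delta>))"
    by (rule potter_delta) blast
  obtain B where B: "B \<ge> 0" "\<And>T. T \<ge> X \<Longrightarrow> (\<integral>\<^sup>+x. ennreal (norm (indicator {T / X..} (fst x) *\<^sub>R G T x)) \<partial>LL) \<le> ennreal (B * (T powr (\<alpha> - (d + 1) * \<beta>) / l T))"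
    using outer_bound[OF p(4)] by blast
  have Gm[measurable]: "G T \<in> borel_measurable LL" for T using G_meas by (simp add: lborel_prod)
  let ?O = "\<lambda>T. \<integral>x. indicator {T / X..} (fst x) *\<^sub>R G T x \<partial>LL"
  let ?I = "\<lambda>T. \<integral>x. indicator {..<T / X} (fst x) *\<^sub>R G T x \<partial>LL"
  have O_int: "integrable LL (\<lambda>x. indicator {T / X..} (fst x) *\<^sub>R G T x)" if "T \<ge> X" for T
  proof (rule integrableI_bounded)
    show "(\<lambda>x. indicator {T / X..} (fst x) *\<^sub>R G T x) \<in> borel_measurable LL" by measurable
    show "(\<integral>\<^sup>+x. ennreal (norm (indicator {T / X..} (fst x) *\<^sub>R G T x)) \<partial>LL) < \<infinity>"
      using le_less_trans[OF B(2)[OF that] ennreal_less_top] by simp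
  qed
  define e where "e = \<alpha> - (d + 1) * \<beta> + \<delta>"
  have e: "e < 0" using p(3) by (simp add: e_def)
  define B' where "B' = B * (C1 / l X / X powr \<delta>)"
  have O_le: "norm (?O T) \<le> B' * T powr e" if T: "T \<ge> X" for T
  proof -
    have T0: "T > 0" "l T > 0" using T p(4) l(2)[of T] by auto
    have "ennreal (norm (?O T)) \<le> (\<integral>\<^sup>+x. ennreal (norm (indicator {T / X..} (fst x) *\<^sub>R G T x)) \<partial>LL)"
      by (rule integral_norm_bound_ennreal[OF O_int[OF T]])
    also note B(2)[OF T]
    finally have "norm (?O T) \<le> B * (T powr (\<alpha> - (d + 1) * \<beta>) / l T)"
      using B(1) T0 by (subst (asm) ennreal_le_iff) auto
    also have "\<dots> = B * (T powr (\<alpha> - (d + 1) * \<beta>) * (1 / l T))" by simp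
    also have "\<dots> \<le> B * (T powr (\<alpha> - (d + 1) * \<beta>) * (C1 / l X * (T / X) powr \<delta>))"
      using potter_upper(2)[OF p(4,1,6) T] B(1) by (intro mult_left_mono) auto
    also have "\<dots> = B' * T powr e"
      using T0 p(4) by (simp add: B'_def e_def powr_add powr_divide)
    finally show ?thesis .
  qed
  have "((\<lambda>T. B' * T powr e) \<longlongrightarrow> B' * 0) at_top"
    by (intro tendsto_mult tendsto_const tendsto_neg_powr[OF e filterlim_ident])
  then have O_lim: "(?O \<longlongrightarrow> 0) at_top"
    by (intro Lim_null_comparison[of ?O "\<lambda>T. B' * T powr e"]) (use O_le in \<open>auto intro!: eventually_at_top_linorderI[of X]\<close>)
  have "((\<lambda>T. ?I T + ?O T) \<longlongrightarrow> (\<integral>x. (indicator {0<..} (fst x) * fst x powr (\<alpha> - 1)) *\<^sub>R \<kappa>' (H 1 x) \<partial>LL) + 0) at_top"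
    by (intro tendsto_add O_lim inner_limit(1)[OF p])
  moreover have "(\<integral>x. (indicator {0<..} (fst x) * fst x powr (\<alpha> - 1)) *\<^sub>R \<kappa>' (H 1 x) \<partial>LL) = (\<integral>x. \<kappa>' (H 1 x) \<partial>limit_control \<alpha>)"
  proof -
    have Hm[measurable]: "H 1 \<in> borel_measurable LL" using H_meas by (simp add: lborel_prod)
    have \<kappa>Hm[measurable]: "(\<lambda>x. \<kappa>' (H 1 x)) \<in> borel_measurable LL" by (rule measurable_compose[OF Hm \<kappa>_meas(2)])
    have wm: "(\<lambda>r::real. indicator {0<..} r * r powr (\<alpha> - 1)) \<in> borel_measurable borel" by measurable
    show ?thesis unfolding limit_control_def density_times_lborel[OF wm]
      by (subst integral_density) (auto simp: \<kappa>Hm)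
  qed
  moreover have "\<forall>\<^sub>F T in at_top. ?I T + ?O T = (\<integral>x. \<kappa> (H T x / N T) \<partial>(density lborel (\<lambda>r. ennreal (p r)) \<Otimes>\<^sub>M lborel))"
    using eventually_ge_at_top[of X]
  proof eventually_elim
    case (elim T)
    have "?I T + ?O T = (\<integral>x. indicator {..<T / X} (fst x) *\<^sub>R G T x + indicator {T / X..} (fst x) *\<^sub>R G T x \<partial>LL)"
      by (rule Bochner_Integration.integral_add[symmetric, OF inner_limit(2)[OF p elim] O_int[OF elim]])
    also have "\<dots> = (\<integral>x. G T x \<partial>LL)" by (intro Bochner_Integration.integral_cong) (auto simp: indicator_def)
    also have "\<dots> = (\<integral>x. \<kappa> (H T x / N T) \<partial>(density lborel (\<lambda>r. ennreal (p r)) \<Otimes>\<^sub>M lborel))"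
      using elim p(4) by (intro scaled_cumulant[symmetric]) simp
    finally show ?case .
  qed
  ultimately show ?thesis by (simp add: tendsto_cong)
qed

lemma H1_finite: "(\<integral>\<^sup>+x. ennreal (\<bar>H 1 x\<bar> powr \<beta>) \<partial>limit_control \<alpha>) < \<infinity>"
proof -
  obtain K where K: "K \<ge> 0" "\<And>w. w \<in> borel_measurable borel \<Longrightarrow> (\<And>r::real. w r \<ge> 0) \<Longrightarrow>
     (\<integral>\<^sup>+x. ennreal (indicator {0<..} (fst x) * (w (fst x) * \<bar>H 1 x\<bar> powr \<beta>)) \<partial>(lborel \<Otimes>\<^sub>M lborel))
     \<le> (\<integral>\<^sup>+r. ennreal (K * (indicator {0<..} r * (w r * profile CARD('d) \<beta> r))) \<partial>lborel)"
    by (rule weighted_integral_le) blast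
  have Hm[measurable]: "H 1 \<in> borel_measurable LL" using H_meas by (simp add: lborel_prod)
  have wm: "(\<lambda>r::real. indicator {0<..} r * r powr (\<alpha> - 1)) \<in> borel_measurable borel" by measurable
  have "(\<integral>\<^sup>+x. ennreal (\<bar>H 1 x\<bar> powr \<beta>) \<partial>limit_control \<alpha>) = (\<integral>\<^sup>+x. ennreal (indicator {0<..} (fst x) * fst x powr (\<alpha> - 1)) * ennreal (\<bar>H 1 x\<bar> powr \<beta>) \<partial>LL)"
    unfolding limit_control_def density_times_lborel[OF wm] by (rule nn_integral_density) measurable
  also have "\<dots> = (\<integral>\<^sup>+x. ennreal (indicator {0<..} (fst x) * (fst x powr (\<alpha> - 1) * \<bar>H 1 x\<bar> powr \<beta>)) \<partial>LL)"
    by (intro nn_integral_cong) (simp add: ennreal_mult'[symmetric] mult.assoc)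
  also have "\<dots> \<le> (\<integral>\<^sup>+r. ennreal (K * (indicator {0<..} r * (r powr (\<alpha> - 1) * profile CARD('d) \<beta> r))) \<partial>lborel)"
    by (rule K(2)) auto
  also have "\<dots> = (\<integral>\<^sup>+r. ennreal K * ennreal (indicator {0<..} r * (profile CARD('d) \<beta> r * r powr (\<alpha> - 1) * max (r powr 0) (r powr (- 0)))) \<partial>lborel)"
    using K(1) by (intro nn_integral_cong) (auto simp: ennreal_mult'[symmetric] mult_ac indicator_def)
  also have "\<dots> = ennreal K * (\<integral>\<^sup>+r. ennreal (indicator {0<..} r * (profile CARD('d) \<beta> r * r powr (\<alpha> - 1) * max (r powr 0) (r powr (- 0)))) \<partial>lborel)"
    unfolding profile_def by (rule nn_integral_cmult) measurable
  also have "\<dots> < \<infinity>"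
    using profile_weight_finite[of \<beta> "CARD('d)" 0 \<alpha>] \<beta> lo hi by (simp add: d ennreal_mult_less_top)
  finally show ?thesis .
qed

text \<open>
  For rates below \<open>1/X\<close> the density is bounded by a power of \<open>r\<close> by Potter's bound; for the others the
  integral of the envelope over \<open>u\<close> is bounded and the density has mass one.
\<close>

lemma ker_envelope_finite: "(\<integral>\<^sup>+x. ennreal (\<bar>ker_envelope R x\<bar> powr \<beta>) \<partial>(density lborel (\<lambda>r. ennreal (p r)) \<Otimes>\<^sub>M (lborel :: (real^'d) measure))) < \<infinity>"
proof -
  obtain K where K: "K \<ge> 0" "\<And>r. r > 0 \<Longrightarrow> (\<integral>\<^sup>+(u::real^'d). ennreal (\<bar>ker_envelope R (r, u)\<bar> powr \<beta>) \<partial>lborel) \<le> ennreal (K * (r powr (- \<beta>) * max 1 (r powr (- real CARD('d)))))"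
    using ker_envelope_integral[of \<beta> R, where 'd = 'd] \<beta> by auto
  obtain \<delta> X C1 where q: "\<delta> > 0" "\<beta> + d + \<delta> < \<alpha>" "\<alpha> + \<delta> < (d + 1) * \<beta>" "X \<ge> 1" "C1 > 0"
    "\<And>x y. x \<ge> X \<Longrightarrow> y \<ge> X \<Longrightarrow> l y / l x \<le> C1 * max ((y / x) powr \<delta>) ((y / x) powr (- \<delta>))"
    by (rule potter_delta) blast
  define A where "A = l X * C1 / X powr \<delta>"
  have A: "A > 0" using q l(2)[of X] by (simp add: A_def)
  have fin: "(\<integral>\<^sup>+r. ennreal (indicator {0..1} r * r powr (\<alpha> - 1 - \<delta> - \<beta> - d)) \<partial>lborel) < \<infinity>"
    using nn_integral_powr_from_0[of "\<alpha> - 1 - \<delta> - \<beta> - d" 1] q by simp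
  have "(\<integral>\<^sup>+x. ennreal (\<bar>ker_envelope R x\<bar> powr \<beta>) \<partial>(density lborel (\<lambda>r. ennreal (p r)) \<Otimes>\<^sub>M (lborel :: (real^'d) measure)))
     = (\<integral>\<^sup>+x. ennreal (p (fst x)) * ennreal (\<bar>ker_envelope R x\<bar> powr \<beta>) \<partial>LL)"
    unfolding density_times_lborel[OF p_meas] by (rule nn_integral_density) measurable
  also have "\<dots> = (\<integral>\<^sup>+r. \<integral>\<^sup>+(u::real^'d). ennreal (p r) * ennreal (\<bar>ker_envelope R (r, u)\<bar> powr \<beta>) \<partial>lborel \<partial>lborel)"
  proof -
    have "(\<lambda>x::real \<times> (real^'d). ennreal (p (fst x)) * ennreal (\<bar>ker_envelope R x\<bar> powr \<beta>)) \<in> borel_measurable (lborel \<Otimes>\<^sub>M lborel)"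
      by measurable
    from lborel.nn_integral_fst[OF this] show ?thesis by simp
  qed
  also have "\<dots> \<le> (\<integral>\<^sup>+r. ennreal (K * A) * ennreal (indicator {0..1} r * r powr (\<alpha> - 1 - \<delta> - \<beta> - d)) + ennreal (K * (X powr \<beta> * X powr d)) * ennreal (p r) \<partial>lborel)"
  proof (rule nn_integral_mono)
    fix r :: real
    show "(\<integral>\<^sup>+(u::real^'d). ennreal (p r) * ennreal (\<bar>ker_envelope R (r, u)\<bar> powr \<beta>) \<partial>lborel) \<le> ennreal (K * A) * ennreal (indicator {0..1} r * r powr (\<alpha> - 1 - \<delta> - \<beta> - d)) + ennreal (K * (X powr \<beta> * X powr d)) * ennreal (p r)"
    proof (cases "r > 0")
      case r: True
      have km: "(\<lambda>u::real^'d. ker_envelope R (r, u)) \<in> borel_measurable lborel"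
        using measurable_compose[OF measurable_Pair1' ker_envelope_measurable, of r] by simp
      have "(\<integral>\<^sup>+(u::real^'d). ennreal (p r) * ennreal (\<bar>ker_envelope R (r, u)\<bar> powr \<beta>) \<partial>lborel) = ennreal (p r) * (\<integral>\<^sup>+(u::real^'d). ennreal (\<bar>ker_envelope R (r, u)\<bar> powr \<beta>) \<partial>lborel)"
        using km by (intro nn_integral_cmult) measurable
      also have "\<dots> \<le> ennreal (p r) * ennreal (K * (r powr (- \<beta>) * max 1 (r powr (- d))))"
        using K(2)[OF r] by (intro mult_left_mono) (auto simp: d)
      also have "\<dots> = ennreal (p r * (K * (r powr (- \<beta>) * max 1 (r powr (- d)))))" using p_nonneg by (simp add: ennreal_mult')
      finally have 1: "(\<integral>\<^sup>+(u::real^'d). ennreal (p r) * ennreal (\<bar>ker_envelope R (r, u)\<bar> powr \<beta>) \<partial>lborel) \<le> ennreal (p r * (K * (r powr (- \<beta>) * max 1 (r powr (- d)))))" .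
      show ?thesis
      proof (cases "r < 1 / X")
        case True
        have r1: "r \<le> 1" using True q(4) order_trans[of r "1 / X" 1] by simp
        have rX: "1 / r \<ge> X" using True r q(4) by (simp add: field_simps)
        have "l (1 / r) \<le> l X * C1 * ((1 / r) / X) powr \<delta>" using potter_upper(1)[OF q(4,1,6) rX] .
        also have "\<dots> = A * r powr (- \<delta>)" using r q(4) by (simp add: A_def powr_divide powr_minus_divide powr_mult mult_ac)
        finally have "l (1 / r) * r powr (\<alpha> - 1) \<le> A * r powr (- \<delta>) * r powr (\<alpha> - 1)" by (rule mult_right_mono) simp
        then have "p r \<le> A * r powr (- \<delta>) * r powr (\<alpha> - 1)" using r by (simp add: p_def)
        moreover have "max 1 (r powr (- d)) = r powr (- d)" using powr_mono2'[of "- d" r 1] r r1 by (simp add: d)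
        ultimately have "p r * (K * (r powr (- \<beta>) * max 1 (r powr (- d)))) \<le> A * r powr (- \<delta>) * r powr (\<alpha> - 1) * (K * (r powr (- \<beta>) * r powr (- d)))"
          using K(1) by (simp add: mult_right_mono)
        also have "\<dots> = K * A * (r powr (- \<delta>) * r powr (\<alpha> - 1) * r powr (- \<beta>) * r powr (- d))" by (simp add: mult_ac)
        also have "r powr (- \<delta>) * r powr (\<alpha> - 1) * r powr (- \<beta>) * r powr (- d) = r powr (\<alpha> - 1 - \<delta> - \<beta> - d)"
          unfolding powr_add[symmetric] by (simp add: algebra_simps)
        finally have "ennreal (p r * (K * (r powr (- \<beta>) * max 1 (r powr (- d))))) \<le> ennreal (K * A) * ennreal (indicator {0..1} r * r powr (\<alpha> - 1 - \<delta> - \<beta> - d))"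
          using r r1 K(1) A by (simp add: ennreal_mult'[symmetric] ennreal_leI)
        with 1 show ?thesis by (meson order_trans add_increasing2 zero_le)
      next
        case False
        then have rX: "1 / X \<le> r" by simp
        have X0: "X > 0" using q(4) by simp
        have "r powr (- \<beta>) \<le> (1 / X) powr (- \<beta>)" using rX X0 \<beta> by (intro powr_mono2') auto
        then have 2: "r powr (- \<beta>) \<le> X powr \<beta>" using X0 by (simp add: powr_divide powr_minus_divide)
        have "r powr (- d) \<le> (1 / X) powr (- d)" using rX X0 by (intro powr_mono2') (auto simp: d)
        then have "r powr (- d) \<le> X powr d" using X0 by (simp add: powr_divide powr_minus_divide)
        moreover have "1 \<le> X powr d" using q(4) by (simp add: d ge_one_powr_ge_zero)
        ultimately have "max 1 (r powr (- d)) \<le> X powr d" by simp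
        with 2 have "r powr (- \<beta>) * max 1 (r powr (- d)) \<le> X powr \<beta> * X powr d" by (intro mult_mono) auto
        then have "p r * (K * (r powr (- \<beta>) * max 1 (r powr (- d)))) \<le> K * (X powr \<beta> * X powr d) * p r"
          using K(1) p_nonneg[of r] by (simp add: mult_left_mono mult.commute)
        then have "ennreal (p r * (K * (r powr (- \<beta>) * max 1 (r powr (- d))))) \<le> ennreal (K * (X powr \<beta> * X powr d)) * ennreal (p r)"
          using K(1) by (simp add: ennreal_mult'[symmetric] ennreal_leI)
        with 1 show ?thesis by (meson order_trans add_increasing zero_le)
      qed
    qed (simp add: p_def)
  qed
  also have "\<dots> = ennreal (K * A) * (\<integral>\<^sup>+r. ennreal (indicator {0..1} r * r powr (\<alpha> - 1 - \<delta> - \<beta> - d)) \<partial>lborel) + ennreal (K * (X powr \<beta> * X powr d)) * (\<integral>\<^sup>+r. ennreal (p r) \<partial>lborel)"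
    by (simp add: nn_integral_add nn_integral_cmult)
  also have "\<dots> < \<infinity>" using fin p_prob by (simp add: p_def[abs_def] ennreal_mult_less_top)
  finally show ?thesis .
qed

end

section \<open>Integrals over homothetic bodies\<close>

text \<open>
  Interiors are Borel sets, and for Jordan-measurable sets they differ from the sets themselves by null sets. Scaling by
  \<open>\<tau> = 0\<close> leaves at most one point.
\<close>

definition body :: "(real^'d) set \<Rightarrow> real \<Rightarrow> (real^'d) set" where
  "body \<Delta> \<tau> = homothetic (interior \<Delta>) \<tau>"

lemma body_borel[measurable]: "body \<Delta> \<tau> \<in> sets borel"
proof (cases "\<tau> = 0")
  case True
  then have "body \<Delta> \<tau> \<subseteq> {0}" by (simp add: body_def homothetic_def image_subset_iff)
  then have "body \<Delta> \<tau> = {} \<or> body \<Delta> \<tau> = {0}" by (rule subset_singletonD)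
  then show ?thesis by (metis sets.empty_sets borel_closed closed_singleton)
next
  case False
  then have "open (body \<Delta> \<tau>)" unfolding body_def homothetic_def by (intro open_scaling) auto
  then show ?thesis by (rule borel_open)
qed

lemma body_subset: "\<Delta> \<subseteq> cball 0 1 \<Longrightarrow> 0 \<le> \<tau> \<Longrightarrow> \<tau> \<le> 1 \<Longrightarrow> body \<Delta> \<tau> \<subseteq> cball 0 1"
proof
  fix y assume a: "\<Delta> \<subseteq> cball 0 1" "0 \<le> \<tau>" "\<tau> \<le> 1" "y \<in> body \<Delta> \<tau>"
  then obtain x where x: "y = \<tau> *\<^sub>R x" "x \<in> interior \<Delta>" by (auto simp: body_def homothetic_def)
  then have "norm x \<le> 1" using a(1) interior_subset[of \<Delta>] by auto
  then show "y \<in> cball 0 1" using a x by (simp add: mult_le_one)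
qed

lemma indicator_body_scale: "T > 0 \<Longrightarrow> indicator (body \<Delta> (\<tau> * T)) y = indicator (body \<Delta> \<tau>) (y /\<^sub>R T)"
proof -
  assume T: "T > 0"
  have "y \<in> body \<Delta> (\<tau> * T) \<longleftrightarrow> y /\<^sub>R T \<in> body \<Delta> \<tau>"
  proof
    assume "y \<in> body \<Delta> (\<tau> * T)"
    then obtain x where "y = (\<tau> * T) *\<^sub>R x" "x \<in> interior \<Delta>" by (auto simp: body_def homothetic_def)
    then show "y /\<^sub>R T \<in> body \<Delta> \<tau>" using T by (auto simp: body_def homothetic_def image_iff intro!: bexI[of _ x])
  next
    assume "y /\<^sub>R T \<in> body \<Delta> \<tau>"
    then obtain x where x: "y /\<^sub>R T = \<tau> *\<^sub>R x" "x \<in> interior \<Delta>" by (auto simp: body_def homothetic_def)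
    have "y = T *\<^sub>R (y /\<^sub>R T)" using T by simp
    also have "\<dots> = (\<tau> * T) *\<^sub>R x" unfolding x by (simp add: mult.commute)
    finally show "y \<in> body \<Delta> (\<tau> * T)" using x(2) by (auto simp: body_def homothetic_def)
  qed
  then show ?thesis by (simp add: indicator_def)
qed

lemma homothetic_minus_body:
  assumes "jordan_measurable \<Delta>" shows "homothetic \<Delta> \<tau> - body \<Delta> \<tau> \<in> null_sets lebesgue"
proof -
  have "negligible ((\<lambda>x. \<tau> *\<^sub>R x) ` frontier \<Delta>)"
    using assms by (intro negligible_differentiable_image_negligible) (auto simp: jordan_measurable_def intro!: differentiable_on_scaleR)
  moreover have "homothetic \<Delta> \<tau> - body \<Delta> \<tau> \<subseteq> (\<lambda>x. \<tau> *\<^sub>R x) ` frontier \<Delta>"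
    using closure_subset[of \<Delta>] by (fastforce simp: body_def homothetic_def frontier_def)
  ultimately show ?thesis using negligible_subset negligible_iff_null_sets by blast
qed

lemma set_integral_homothetic:
  fixes f :: "real^'d \<Rightarrow> real"
  assumes \<Delta>: "jordan_measurable \<Delta>" and f[measurable]: "f \<in> borel_measurable borel"
  shows "(LINT y:homothetic \<Delta> \<tau>|lebesgue. f y) = (\<integral>y. indicator (body \<Delta> \<tau>) y * f y \<partial>lborel)"
proof -
  let ?N = "homothetic \<Delta> \<tau> - body \<Delta> \<tau>"
  have sub: "body \<Delta> \<tau> \<subseteq> homothetic \<Delta> \<tau>" using interior_subset[of \<Delta>] by (auto simp: body_def homothetic_def)
  have N: "?N \<in> null_sets lebesgue" by (rule homothetic_minus_body[OF \<Delta>])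
  have "body \<Delta> \<tau> \<union> ?N \<in> sets lebesgue" using N body_borel[of \<Delta> \<tau>] by (intro sets.Un) auto
  moreover have "body \<Delta> \<tau> \<union> ?N = homothetic \<Delta> \<tau>" using sub by auto
  ultimately have h: "homothetic \<Delta> \<tau> \<in> sets lebesgue" by simp
  have fl: "f \<in> borel_measurable lebesgue" by (rule measurable_completion) simp
  have "(LINT y:homothetic \<Delta> \<tau>|lebesgue. f y) = (\<integral>y. indicator (body \<Delta> \<tau>) y * f y \<partial>lebesgue)"
    unfolding set_lebesgue_integral_def
  proof (rule integral_cong_AE)
    show "(\<lambda>y. indicator (homothetic \<Delta> \<tau>) y *\<^sub>R f y) \<in> borel_measurable lebesgue" using h fl by measurable
    have "body \<Delta> \<tau> \<in> sets lebesgue" using body_borel[of \<Delta> \<tau>] by simp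
    then show "(\<lambda>y. indicator (body \<Delta> \<tau>) y * f y) \<in> borel_measurable lebesgue" using fl by measurable
    show "AE y in lebesgue. indicator (homothetic \<Delta> \<tau>) y *\<^sub>R f y = indicator (body \<Delta> \<tau>) y * f y"
      using AE_not_in[OF N] by eventually_elim (use sub in \<open>auto simp: indicator_def\<close>)
  qed
  also have "\<dots> = (\<integral>y. indicator (body \<Delta> \<tau>) y * f y \<partial>lborel)"
    by (rule integral_completion) (use body_borel in measurable)
  finally show ?thesis .
qed

text \<open>
  All measures of this form have the same null sets. This transfers measurability up to null sets from the control
  measure of the field to that of the limit.
\<close>

lemma AE_weighted_product:
  fixes w :: "real \<Rightarrow> real"
  assumes w: "w \<in> borel_measurable borel" and pos: "\<And>r. w r > 0 \<longleftrightarrow> r > 0"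
  shows "(AE x in density lborel (\<lambda>r. ennreal (w r)) \<Otimes>\<^sub>M (lborel :: 'a::euclidean_space measure). P x) \<longleftrightarrow>
    (AE x in lborel \<Otimes>\<^sub>M (lborel :: 'a measure). fst x > 0 \<longrightarrow> P x)"
proof -
  have "(\<lambda>x::real \<times> 'a. ennreal (w (fst x))) \<in> borel_measurable (lborel \<Otimes>\<^sub>M lborel)" using w by measurable
  then show ?thesis unfolding density_times_lborel[OF w] by (subst AE_density) (auto simp: pos)
qed

context random_measure
begin

lemma RR_cong_AE:
  assumes "RR f Y" "Z \<in> borel_measurable M" "AE \<omega> in M. Y \<omega> = Z \<omega>" shows "RR f Z"
proof -
  obtain \<phi> where \<phi>: "\<And>n. snd ` set (\<phi> n) \<subseteq> S" "AE x in m. (\<lambda>n. simple_val (\<phi> n) x) \<longlonglongrightarrow> f x"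
    "\<And>A. A \<in> sigma_sets \<Omega> S \<Longrightarrow> \<exists>J. tendsto_in_prob M (\<lambda>n. simple_integral_on \<Lambda> A (\<phi> n)) J"
    "tendsto_in_prob M (\<lambda>n. simple_integral_on \<Lambda> \<Omega> (\<phi> n)) Y"
    using assms(1) unfolding has_RR_integral_def by blast
  have Y: "Y \<in> borel_measurable M" using \<phi>(4) by (simp add: tendsto_in_prob_def)
  have "tendsto_in_prob M (\<lambda>n \<omega>. 0) (\<lambda>\<omega>. Z \<omega> - Y \<omega>)"
    by (rule AE_imp_tendsto_in_prob) (use assms(2,3) Y in \<open>auto elim!: eventually_mono\<close>)
  from tendsto_in_prob_lincomb[OF \<phi>(4) this, of 1]
  have "tendsto_in_prob M (\<lambda>n. simple_integral_on \<Lambda> \<Omega> (\<phi> n)) Z" by simp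
  with \<phi>(1-3) show ?thesis unfolding has_RR_integral_def by blast
qed

end

lemma kernel_average_integrable:
  assumes \<theta>: "\<theta> \<in> borel_measurable borel" "\<And>y::real^'d. \<bar>\<theta> y\<bar> \<le> indicator (cball 0 1) y"
  shows "integrable lborel (\<lambda>y. \<theta> y * ker y x)"
proof (rule Bochner_Integration.integrable_bound)
  define b where "b = \<bar>1 / (2 * fst x)\<bar> * exp (\<bar>fst x\<bar> * (1 + norm (snd x)))"
  have b: "b \<ge> 0" by (simp add: b_def)
  show "integrable lborel (\<lambda>y. b * indicat_real (cball (0::real^'d) 1) y)"
    using emeasure_compact_finite[of "cball (0::real^'d) 1"] by (intro integrable_mult_right integrable_real_indicator) auto
  show "(\<lambda>y. \<theta> y * ker y x) \<in> borel_measurable lborel" using \<theta>(1) ker_meas_y[of x] by measurable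
  show "AE y in lborel. norm (\<theta> y * ker y x) \<le> norm (b * indicat_real (cball (0::real^'d) 1) y)"
  proof (rule AE_I2)
    fix y :: "real^'d"
    show "norm (\<theta> y * ker y x) \<le> norm (b * indicat_real (cball (0::real^'d) 1) y)"
    proof (cases "y \<in> cball 0 1")
      case True
      have "- fst x * norm (y - snd x) \<le> \<bar>fst x\<bar> * norm (y - snd x)" by (intro mult_right_mono) auto
      also have "\<dots> \<le> \<bar>fst x\<bar> * (1 + norm (snd x))"
        using norm_triangle_ineq4[of y "snd x"] True by (intro mult_left_mono) auto
      finally have "\<bar>ker y x\<bar> \<le> b"
        unfolding b_def by (cases x) (simp add: ker_def abs_mult divide_right_mono)
      moreover have "\<bar>\<theta> y\<bar> \<le> 1" using \<theta>(2)[of y] True by simp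
      ultimately have "\<bar>\<theta> y\<bar> * \<bar>ker y x\<bar> \<le> 1 * b" by (intro mult_mono) auto
      then show ?thesis using True b by (simp add: abs_mult)
    next
      case False
      then show ?thesis using \<theta>(2)[of y] by simp
    qed
  qed
qed

text \<open>
  The kernel is positive and the interior of the body is open and nonempty.
\<close>

lemma kernel_average_nonzero:
  fixes \<Delta> :: "(real^'d) set"
  assumes r: "fst x > 0" and \<Delta>: "\<Delta> \<subseteq> cball 0 1" "interior \<Delta> \<noteq> {}"
  shows "(\<integral>y. indicator (body \<Delta> 1) y * ker y x \<partial>lborel) \<noteq> 0"
proof
  assume 0: "(\<integral>y. indicator (body \<Delta> 1) y * ker y x \<partial>lborel) = 0"
  have k: "ker y x > 0" for y using r by (cases x) (simp add: ker_def)
  have sub: "body \<Delta> 1 \<subseteq> cball 0 1" using body_subset[OF \<Delta>(1), of 1] by simp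
  have "integrable lborel (\<lambda>y. indicator (body \<Delta> 1) y * ker y x)"
    by (rule kernel_average_integrable) (use sub in \<open>auto simp: indicator_def borel_measurable_indicator\<close>)
  then have "AE y in lborel. indicator (body \<Delta> 1) y * ker y x = 0"
    using 0 k by (subst (asm) integral_nonneg_eq_0_iff_AE) (auto simp: less_imp_le)
  then have "AE y in lborel. y \<notin> body \<Delta> 1"
    by eventually_elim (use k in \<open>auto simp: indicator_def less_le split: if_splits\<close>)
  then have "body \<Delta> 1 \<in> null_sets lborel" using AE_iff_null_sets[of "body \<Delta> 1" lborel] by simp
  then have "negligible (body \<Delta> 1)" unfolding negligible_iff_null_sets by (rule null_sets_completionI)
  moreover have "body \<Delta> 1 = interior \<Delta>" by (simp add: body_def homothetic_def)
  ultimately show False using open_not_negligible[of "interior \<Delta>"] \<Delta>(2) by simp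
qed

section \<open>Aggregated supCAR fields\<close>

text \<open>
  The hypotheses on the field, with the two inequalities that the integrability of the kernels rests on.
\<close>

locale supCAR_setting = stable_like_levy W \<beta> cp cm
  for W :: "real measure" and \<beta> cp cm :: real +
  fixes M :: "'w measure" and S :: "(real \<times> (real^'d)) set set"
    and \<Lambda> :: "(real \<times> (real^'d)) set \<Rightarrow> 'w \<Rightarrow> real" and X :: "real^'d \<Rightarrow> 'w \<Rightarrow> real"
    and \<pi> :: "real measure" and l :: "real \<Rightarrow> real" and \<alpha> d :: real
  assumes d: "d = real CARD('d)"
    and supCAR: "supCAR_field M S \<Lambda> 0 W \<pi> X"
    and l: "slowly_varying_at_top l" "\<And>x. x > 0 \<Longrightarrow> l x > 0"
    and \<pi>: "\<pi> = density lborel (\<lambda>r. ennreal (indicator {0<..} r * (l (1 / r) * r powr (\<alpha> - 1))))"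
    and lo: "\<alpha> < (d + 1) * \<beta>" and hi: "\<beta> + d < \<alpha>"
begin

lemma prob_M: "prob_space M" and ring: "exhausting_delta_ring (param_space :: (real \<times> (real^'d)) set) S"
  and S_borel: "S \<subseteq> sets borel" and scattered: "independently_scattered M S \<Lambda>"
  and cumulant: "has_cumulant_measure M S \<Lambda> (\<pi> \<Otimes>\<^sub>M lborel) \<kappa>"
  and X_joint: "(\<lambda>(y, \<omega>). X y \<omega>) \<in> borel_measurable (lborel \<Otimes>\<^sub>M M)"
  and X_RR_integrable: "RR_integrable M param_space S (\<pi> \<Otimes>\<^sub>M lborel) \<Lambda> (ker y)"
  and X_RR_integral: "AE \<omega> in M. X y \<omega> = - RR_integral M param_space S (\<pi> \<Otimes>\<^sub>M lborel) \<Lambda> (ker y) \<omega>"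
  and prob_\<pi>: "prob_space \<pi>"
  using supCAR unfolding supCAR_field_def ker_def by blast+

lemma limit_settingI:
  fixes \<theta> :: "real^'d \<Rightarrow> real"
  assumes "C > 0" "\<And>s. norm (\<kappa> s) \<le> C * \<bar>s\<bar> powr \<beta>"
    and "\<theta> \<in> borel_measurable borel" "c \<ge> 0" "\<And>y. \<bar>\<theta> y\<bar> \<le> c * indicator (cball 0 1) y"
  shows "limit_setting l \<alpha> \<beta> \<kappa> \<kappa>\<^sub>s C \<theta> c d"
proof
  have \<pi>m: "(\<lambda>r. ennreal (indicator {0<..} r * (l (1 / r) * r powr (\<alpha> - 1)))) \<in> borel_measurable lborel"
  proof -
    have "(\<lambda>x. indicator {0<..} x *\<^sub>R l x) \<in> borel_measurable borel"
      using l(1) unfolding slowly_varying_at_top_def by (subst (asm) borel_measurable_restrict_space_iff) auto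
    then have [measurable]: "(\<lambda>x. indicator {0<..} x * l x) \<in> borel_measurable borel" by simp
    have "(\<lambda>r. ennreal (indicator {0<..} r * ((indicator {0<..} (1 / r) * l (1 / r)) * r powr (\<alpha> - 1)))) \<in> borel_measurable lborel"
      by measurable
    moreover have "(\<lambda>r. ennreal (indicator {0<..} r * ((indicator {0<..} (1 / r) * l (1 / r)) * r powr (\<alpha> - 1))))
       = (\<lambda>r. ennreal (indicator {0<..} r * (l (1 / r) * r powr (\<alpha> - 1))))"
      by (auto simp: fun_eq_iff indicator_def)
    ultimately show ?thesis by simp
  qed
  have "emeasure \<pi> UNIV = 1" using prob_space.emeasure_space_1[OF prob_\<pi>] by (simp add: \<pi>)
  then show "(\<integral>\<^sup>+r. ennreal (indicator {0<..} r * (l (1 / r) * r powr (\<alpha> - 1))) \<partial>lborel) = 1"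
    using \<pi>m unfolding \<pi> by (subst (asm) emeasure_density) auto
qed (use assms d l lo hi beta kappa_continuous kappa_scaling_limit stable_cumulant_continuous[of \<beta> cp cm] in auto)

definition "control = \<pi> \<Otimes>\<^sub>M (lborel :: (real^'d) measure)"

lemma control_eq: "control = density lborel (\<lambda>r. ennreal (indicator {0<..} r * (l (1 / r) * r powr (\<alpha> - 1)))) \<Otimes>\<^sub>M lborel"
  unfolding control_def by (subst \<pi>) (rule refl)

lemma sets_control: "sets control = sets (lborel \<Otimes>\<^sub>M lborel)"
  unfolding control_eq by (intro sets_pair_measure_cong) auto

lemma sets_limit_control: "sets (limit_control \<alpha> :: (real \<times> (real^'d)) measure) = sets (lborel \<Otimes>\<^sub>M lborel)"
  unfolding limit_control_def by (intro sets_pair_measure_cong) auto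

lemma AE_limit_control: "(AE x in limit_control \<alpha>. P x) \<longleftrightarrow> (AE x in lborel \<Otimes>\<^sub>M (lborel :: (real^'d) measure). fst x > 0 \<longrightarrow> P x)"
  unfolding limit_control_def by (rule AE_weighted_product) (auto simp: indicator_def)

lemma kappa_C: obtains C D where "C > 0" "\<And>s. norm (\<kappa> s) \<le> C * \<bar>s\<bar> powr \<beta>" "D > 0" "\<And>s. norm (\<kappa> s) \<le> D * (- Re (\<kappa> s))"
  by (rule kappa_bounds) blast

lemma Re_kappa_neg: "s \<noteq> 0 \<Longrightarrow> Re (\<kappa> s) < 0"
proof -
  assume s: "s \<noteq> 0"
  obtain v where v: "v > 0" "\<And>t. \<bar>t\<bar> \<le> \<bar>s\<bar> \<Longrightarrow> v * t\<^sup>2 \<le> - Re (\<kappa> t)" using Re_kappa_lower[of "\<bar>s\<bar>"] s by auto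
  have "0 < v * s\<^sup>2" using v(1) s by simp
  with v(2)[of s] show ?thesis by simp
qed

lemma Re_stable_neg: "s \<noteq> 0 \<Longrightarrow> Re (\<kappa>\<^sub>s s) < 0"
proof -
  assume s: "s \<noteq> 0"
  have "(cp + cm) * Re (stable_const \<beta>) < 0" using stable_const_neg[OF beta] c_pos by (simp add: mult_pos_neg)
  then have "\<bar>s\<bar> powr \<beta> * ((cp + cm) * Re (stable_const \<beta>)) < 0" using s by (simp add: mult_pos_neg)
  moreover have "Re (\<kappa>\<^sub>s s) = \<bar>s\<bar> powr \<beta> * ((cp + cm) * Re (stable_const \<beta>))"
    unfolding stable_cumulant_eq by (cases "s \<ge> 0") (simp_all add: algebra_simps)
  ultimately show ?thesis by simp
qed

lemma AE_control: "(AE x in control. P x) \<longleftrightarrow> (AE x in lborel \<Otimes>\<^sub>M (lborel :: (real^'d) measure). fst x > 0 \<longrightarrow> P x)"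
proof -
  obtain C D where C: "C > 0" "\<And>s. norm (\<kappa> s) \<le> C * \<bar>s\<bar> powr \<beta>" by (rule kappa_C) blast
  interpret L: limit_setting l \<alpha> \<beta> \<kappa> \<kappa>\<^sub>s C "\<lambda>_::real^'d. 0" 0 d by (rule limit_settingI[OF C]) auto
  have control: "control = density lborel (\<lambda>r. ennreal (L.p r)) \<Otimes>\<^sub>M lborel" by (simp add: control_eq L.p_def)
  have pos: "L.p r > 0 \<longleftrightarrow> r > 0" for r using l(2)[of "1 / r"] by (cases "r > 0") (simp_all add: L.p_def)
  show ?thesis unfolding control by (rule AE_weighted_product[OF L.p_meas pos])
qed

text \<open>
  The kernel of \<open>X(0)\<close> is an integrand without zeros.
\<close>

lemma finite_random_measure_\<Lambda>:
  assumes "C > 0" "\<And>s. norm (\<kappa> s) \<le> C * \<bar>s\<bar> powr \<beta>" "D > 0" "\<And>s. norm (\<kappa> s) \<le> D * (- Re (\<kappa> s))"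
  shows "finite_random_measure M param_space S control \<Lambda> \<kappa> \<beta> C D"
proof -
  have sm: "sets control = sets borel" unfolding sets_control lborel_prod by simp
  interpret L: limit_setting l \<alpha> \<beta> \<kappa> \<kappa>\<^sub>s C "\<lambda>_::real^'d. 0" 0 d by (rule limit_settingI[OF assms(1,2)]) auto
  have control: "control = density lborel (\<lambda>r. ennreal (L.p r)) \<Otimes>\<^sub>M lborel" by (simp add: control_eq L.p_def)
  interpret P: prob_space M by (rule prob_M)
  interpret R: random_measure M param_space S control \<Lambda> \<kappa> \<beta> C D
  proof
    show "AE x in control. x \<in> param_space" unfolding AE_control by (auto simp: param_space_def)
    show "has_cumulant_measure M S \<Lambda> control \<kappa>" using cumulant by (simp add: control_def)
  qed (use ring S_borel sm scattered kappa_continuous beta assms in auto)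
  show ?thesis
  proof
    fix B assume B: "B \<in> S"
    have RR: "R.RR (ker 0) (RR_integral M param_space S control \<Lambda> (ker 0))"
      using X_RR_integrable[of 0] unfolding RR_integrable_def RR_integral_def control_def by (rule someI_ex)
    obtain f where f: "f \<in> borel_measurable R.\<Sigma>" "AE x in control. ker 0 x = f x" using R.RR_version[OF RR] by blast
    have "AE x in control. f x \<noteq> 0"
      using f(2) R.null by eventually_elim (auto simp: ker_def param_space_def split: prod.splits)
    moreover have "(\<integral>\<^sup>+x\<in>param_space. ennreal (\<bar>f x\<bar> powr \<beta>) \<partial>control) < \<infinity>"
    proof -
      have "(\<integral>\<^sup>+x\<in>param_space. ennreal (\<bar>f x\<bar> powr \<beta>) \<partial>control) \<le> (\<integral>\<^sup>+x. ennreal (\<bar>ker_envelope 0 x\<bar> powr \<beta>) \<partial>control)"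
      proof (rule nn_integral_mono_AE)
        show "AE x in control. ennreal (\<bar>f x\<bar> powr \<beta>) * indicator param_space x \<le> ennreal (\<bar>ker_envelope 0 x\<bar> powr \<beta>)"
          using f(2) R.null
        proof eventually_elim
          case (elim x)
          have "\<bar>ker 0 x\<bar> \<le> ker_envelope 0 x" using elim(2) by (intro ker_le_ker_envelope) (auto simp: param_space_def)
          then have "\<bar>f x\<bar> powr \<beta> \<le> \<bar>ker_envelope 0 x\<bar> powr \<beta>" using elim(1) beta by (intro powr_mono2) auto
          then show ?case using elim(2) by (simp add: ennreal_leI)
        qed
      qed
      also have "\<dots> < \<infinity>" unfolding control by (rule L.ker_envelope_finite)
      finally show ?thesis .
    qed
    ultimately show "emeasure control B < \<infinity>" using R.finite_measure_on_S[OF Re_kappa_neg f(1)] B by blast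
  qed
qed

text \<open>
  The stochastic Fubini theorem for the supCAR field. \<open>X(y)\<close> is only almost surely equal to minus the chosen integral, and
  so it is first recognised as an integral of \<open>- ker y\<close>.
\<close>

lemma averaged_field:
  fixes \<theta> :: "real^'d \<Rightarrow> real"
  assumes \<theta>: "\<theta> \<in> borel_measurable borel" "\<And>y. \<bar>\<theta> y\<bar> \<le> c * indicator (cball 0 R) y"
  shows "AE \<omega> in M. integrable lborel (\<lambda>y. \<theta> y * X y \<omega>)"
    and "(\<lambda>\<omega>. \<integral>y. \<theta> y * X y \<omega> \<partial>lborel) \<in> borel_measurable M"
    and "(\<integral>\<omega>. iexp (\<integral>y. \<theta> y * X y \<omega> \<partial>lborel) \<partial>M) = exp (\<integral>x. \<kappa> (- (\<integral>y. \<theta> y * ker y x \<partial>lborel)) \<partial>control)"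
    and "\<exists>f'\<in>borel_measurable (sigma param_space S). AE x in control. - (\<integral>y. \<theta> y * ker y x \<partial>lborel) = f' x"
proof -
  obtain C D where C: "C > 0" "\<And>s. norm (\<kappa> s) \<le> C * \<bar>s\<bar> powr \<beta>" "D > 0" "\<And>s. norm (\<kappa> s) \<le> D * (- Re (\<kappa> s))" by (rule kappa_C) blast
  interpret L: limit_setting l \<alpha> \<beta> \<kappa> \<kappa>\<^sub>s C "\<lambda>_::real^'d. 0" 0 d by (rule limit_settingI[OF C(1,2)]) auto
  have control: "control = density lborel (\<lambda>r. ennreal (L.p r)) \<Otimes>\<^sub>M lborel" by (simp add: control_eq L.p_def)
  interpret FR: finite_random_measure M param_space S control \<Lambda> \<kappa> \<beta> C D by (rule finite_random_measure_\<Lambda>[OF C])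
  have kj: "(\<lambda>(y, x). - ker y x) \<in> borel_measurable (lborel \<Otimes>\<^sub>M control)"
  proof -
    have "(\<lambda>(y, x). - ker y x) \<in> borel_measurable ((lborel :: (real^'d) measure) \<Otimes>\<^sub>M (lborel \<Otimes>\<^sub>M lborel))"
      using borel_measurable_uminus[OF ker_measurable] by (simp add: case_prod_beta')
    moreover have "sets ((lborel :: (real^'d) measure) \<Otimes>\<^sub>M control) = sets ((lborel :: (real^'d) measure) \<Otimes>\<^sub>M (lborel \<Otimes>\<^sub>M lborel))"
      by (intro sets_pair_measure_cong sets_control refl)
    ultimately show ?thesis by (simp cong: measurable_cong_sets)
  qed
  interpret F: RR_field M param_space S control \<Lambda> \<kappa> \<beta> C D "\<lambda>y x. - ker y x" X ker_envelope \<theta> R c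
  proof
    show "(\<lambda>(y, \<omega>). X y \<omega>) \<in> borel_measurable (lborel \<Otimes>\<^sub>M M)" by (rule X_joint)
    show "FR.RR (\<lambda>x. - ker y x) (X y)" for y
    proof -
      have RR: "FR.RR (ker y) (RR_integral M param_space S control \<Lambda> (ker y))"
        using X_RR_integrable[of y] unfolding RR_integrable_def RR_integral_def control_def by (rule someI_ex)
      have "FR.RR (\<lambda>x. - 1 * ker y x) (\<lambda>\<omega>. - 1 * RR_integral M param_space S control \<Lambda> (ker y) \<omega>)" by (rule FR.RR_scale[OF RR])
      then have 1: "FR.RR (\<lambda>x. - ker y x) (\<lambda>\<omega>. - RR_integral M param_space S control \<Lambda> (ker y) \<omega>)" by simp
      have "X y \<in> borel_measurable M" using measurable_compose[OF measurable_Pair1' X_joint, of y] by simp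
      moreover have "AE \<omega> in M. - RR_integral M param_space S control \<Lambda> (ker y) \<omega> = X y \<omega>"
        using X_RR_integral[of y] unfolding control_def by eventually_elim simp
      ultimately show ?thesis by (rule FR.RR_cong_AE[OF 1])
    qed
    show "(\<lambda>(y, x). - ker y x) \<in> borel_measurable (lborel \<Otimes>\<^sub>M control)" by (rule kj)
    show "continuous_on UNIV (\<lambda>y. - ker y x)" if "x \<in> param_space" for x :: "real \<times> (real^'d)"
      by (cases x) (use that in \<open>auto simp: ker_def param_space_def intro!: continuous_intros\<close>)
    show "ker_envelope R \<in> borel_measurable control" for R using ker_envelope_measurable sets_control by (simp cong: measurable_cong_sets)
    show "(\<integral>\<^sup>+x. ennreal (\<bar>ker_envelope R x\<bar> powr \<beta>) \<partial>control) < \<infinity>" for R unfolding control by (rule L.ker_envelope_finite)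
    show "norm y \<le> R \<Longrightarrow> x \<in> param_space \<Longrightarrow> \<bar>- ker y x\<bar> \<le> ker_envelope R x" for R y and x :: "real \<times> (real^'d)"
      using ker_le_ker_envelope[of y R x] by (auto simp: param_space_def)
  qed (use \<theta> in auto)
  have H: "F.H x = - (\<integral>y. \<theta> y * ker y x \<partial>lborel)" for x by (simp add: F.H_def)
  show "AE \<omega> in M. integrable lborel (\<lambda>y. \<theta> y * X y \<omega>)" by (rule F.\<theta>X_integrable)
  show "(\<lambda>\<omega>. \<integral>y. \<theta> y * X y \<omega> \<partial>lborel) \<in> borel_measurable M" using F.V_meas by (simp add: F.V_def[abs_def])
  show "(\<integral>\<omega>. iexp (\<integral>y. \<theta> y * X y \<omega> \<partial>lborel) \<partial>M) = exp (\<integral>x. \<kappa> (- (\<integral>y. \<theta> y * ker y x \<partial>lborel)) \<partial>control)"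
    using F.stochastic_Fubini unfolding H FR.cf_def F.V_def .
  show "\<exists>f'\<in>borel_measurable (sigma param_space S). AE x in control. - (\<integral>y. \<theta> y * ker y x \<partial>lborel) = f' x"
    using F.H_version unfolding H .
qed

lemma averaged_field_limit:
  fixes \<theta> :: "real^'d \<Rightarrow> real"
  assumes \<theta>: "\<theta> \<in> borel_measurable borel" "c \<ge> 0" "\<And>y. \<bar>\<theta> y\<bar> \<le> c * indicator (cball 0 1) y"
  shows "((\<lambda>T. \<integral>\<omega>. iexp ((\<integral>y. \<theta> (y /\<^sub>R T) * X y \<omega> \<partial>lborel) / (T powr (d + 1 - (\<alpha> - d) / \<beta>) * l T powr (1 / \<beta>))) \<partial>M)
    \<longlongrightarrow> exp (\<integral>x. \<kappa>\<^sub>s (- (\<integral>y. \<theta> y * ker y x \<partial>lborel)) \<partial>limit_control \<alpha>)) at_top"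
proof -
  obtain C D where C: "C > 0" "\<And>s. norm (\<kappa> s) \<le> C * \<bar>s\<bar> powr \<beta>" by (rule kappa_C) blast
  interpret L: limit_setting l \<alpha> \<beta> \<kappa> \<kappa>\<^sub>s C \<theta> c d by (rule limit_settingI[OF C \<theta>])
  have control: "control = density lborel (\<lambda>r. ennreal (L.p r)) \<Otimes>\<^sub>M lborel" by (simp add: control_eq L.p_def)
  have "((\<lambda>T. exp (\<integral>x. \<kappa> (L.H T x / L.N T) \<partial>control)) \<longlongrightarrow> exp (\<integral>x. \<kappa>\<^sub>s (L.H 1 x) \<partial>limit_control \<alpha>)) at_top"
    unfolding control by (intro tendsto_exp L.cumulant_limit)
  moreover have "\<forall>\<^sub>F T in at_top. exp (\<integral>x. \<kappa> (L.H T x / L.N T) \<partial>control) = (\<integral>\<omega>. iexp ((\<integral>y. \<theta> (y /\<^sub>R T) * X y \<omega> \<partial>lborel) / L.N T) \<partial>M)"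
    using eventually_gt_at_top[of 0]
  proof eventually_elim
    case (elim T)
    have N: "L.N T > 0" using elim l(2)[of T] by (simp add: L.N_def)
    have 1: "(\<lambda>y. \<theta> (y /\<^sub>R T) / L.N T) \<in> borel_measurable borel" using \<theta>(1) by measurable
    have 2: "\<bar>\<theta> (y /\<^sub>R T) / L.N T\<bar> \<le> (c / L.N T) * indicator (cball 0 T) y" for y
    proof -
      have "\<bar>\<theta> (y /\<^sub>R T)\<bar> \<le> c * indicator (cball 0 T) y"
        using \<theta>(3)[of "y /\<^sub>R T"] elim by (auto simp: indicator_def field_simps split: if_splits)
      then show ?thesis using N by (simp add: abs_div divide_right_mono)
    qed
    have "(\<integral>\<omega>. iexp (\<integral>y. \<theta> (y /\<^sub>R T) / L.N T * X y \<omega> \<partial>lborel) \<partial>M) = exp (\<integral>x. \<kappa> (- (\<integral>y. \<theta> (y /\<^sub>R T) / L.N T * ker y x \<partial>lborel)) \<partial>control)"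
      by (rule averaged_field(3)[OF 1 2])
    then show ?case by (simp add: L.H_def)
  qed
  ultimately have "((\<lambda>T. \<integral>\<omega>. iexp ((\<integral>y. \<theta> (y /\<^sub>R T) * X y \<omega> \<partial>lborel) / L.N T) \<partial>M) \<longlongrightarrow> exp (\<integral>x. \<kappa>\<^sub>s (L.H 1 x) \<partial>limit_control \<alpha>)) at_top"
    by (rule Lim_transform_eventually)
  then show ?thesis by (simp add: L.H_def L.N_def)
qed

context
  fixes \<Delta> :: "(real^'d) set" and M' :: "'v measure" and K :: "(real \<times> (real^'d)) set \<Rightarrow> 'v \<Rightarrow> real"
  assumes \<Delta>: "jordan_measurable \<Delta>" "\<Delta> \<subseteq> cball 0 1" "0 \<in> interior \<Delta>"
    and K: "prob_space M'" "independently_scattered M' S K" "has_cumulant_measure M' S K (limit_control \<alpha>) \<kappa>\<^sub>s"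
begin

abbreviation "scaled_body t \<equiv> body \<Delta> (t powr (1 / real CARD('d)))"

lemma scaled_body_le: "t \<in> {0..1} \<Longrightarrow> \<bar>indicat_real (scaled_body t) y\<bar> \<le> 1 * indicator (cball 0 1) y"
proof -
  assume "t \<in> {0..1}"
  then have "scaled_body t \<subseteq> cball 0 1" by (intro body_subset[OF \<Delta>(2)]) (auto intro: powr_le1)
  then show ?thesis by (auto simp: indicator_def)
qed

lemma limit_kernel_eq: "limit_kernel \<Delta> t x = - (\<integral>y. indicator (scaled_body t) y * ker y x \<partial>lborel)"
  by (cases x) (simp add: limit_kernel_def set_integral_homothetic[OF \<Delta>(1)] ker_def)

lemma weighted_bodies_le:
  fixes a :: "'n::finite \<Rightarrow> real"
  assumes "\<And>i. t i \<in> {0..1}"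
  shows "\<bar>\<Sum>i\<in>UNIV. a i * indicat_real (scaled_body (t i)) y\<bar> \<le> (\<Sum>i\<in>UNIV. \<bar>a i\<bar>) * indicator (cball 0 1) y"
proof -
  have "\<bar>\<Sum>i\<in>UNIV. a i * indicat_real (scaled_body (t i)) y\<bar> \<le> (\<Sum>i\<in>UNIV. \<bar>a i * indicat_real (scaled_body (t i)) y\<bar>)" by (rule sum_abs)
  also have "\<dots> \<le> (\<Sum>i\<in>UNIV. \<bar>a i\<bar> * indicator (cball 0 1) y)"
    unfolding abs_mult using scaled_body_le[OF assms] by (intro sum_mono mult_left_mono) auto
  finally show ?thesis by (simp add: sum_distrib_right)
qed

lemma weighted_kernels:
  fixes a :: "'n::finite \<Rightarrow> real"
  assumes "\<And>i. t i \<in> {0..1}"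
  shows "(\<Sum>i\<in>UNIV. a i * limit_kernel \<Delta> (t i) x) = - (\<integral>y. (\<Sum>i\<in>UNIV. a i * indicat_real (scaled_body (t i)) y) * ker y x \<partial>lborel)"
proof -
  have int: "integrable lborel (\<lambda>y. indicat_real (scaled_body (t i)) y * ker y x)" for i
    using scaled_body_le[OF assms[of i]] by (intro kernel_average_integrable borel_measurable_indicator body_borel) simp
  have "(\<integral>y. (\<Sum>i\<in>UNIV. a i * indicat_real (scaled_body (t i)) y) * ker y x \<partial>lborel) = (\<integral>y. (\<Sum>i\<in>UNIV. a i * (indicat_real (scaled_body (t i)) y * ker y x)) \<partial>lborel)"
    by (intro Bochner_Integration.integral_cong refl) (simp only: sum_distrib_right mult.assoc)
  also have "\<dots> = (\<Sum>i\<in>UNIV. a i * (\<integral>y. indicat_real (scaled_body (t i)) y * ker y x \<partial>lborel))"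
    by (simp add: Bochner_Integration.integral_sum int)
  finally show ?thesis by (simp add: limit_kernel_eq sum_negf)
qed

text \<open>
  The limit kernels are averaged kernels at scale one. Their measurability with respect to the ring is inherited from the
  field, whose control measure has the same null sets.
\<close>

lemma limit_kernel_meas_fin:
  assumes t: "t \<in> {0..1}"
  shows "limit_kernel \<Delta> t \<in> borel_measurable (limit_control \<alpha>)"
    and "(\<integral>\<^sup>+x. ennreal (\<bar>limit_kernel \<Delta> t x\<bar> powr \<beta>) \<partial>limit_control \<alpha>) < \<infinity>"
    and "\<exists>f'\<in>borel_measurable (sigma param_space S). AE x in limit_control \<alpha>. limit_kernel \<Delta> t x = f' x"
proof -
  obtain C D where C: "C > 0" "\<And>s. norm (\<kappa> s) \<le> C * \<bar>s\<bar> powr \<beta>" by (rule kappa_C) blast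
  have 1: "indicat_real (scaled_body t) \<in> borel_measurable borel" by (intro borel_measurable_indicator body_borel)
  interpret L: limit_setting l \<alpha> \<beta> \<kappa> \<kappa>\<^sub>s C "indicat_real (scaled_body t)" 1 d
    by (rule limit_settingI[OF C 1 _ scaled_body_le[OF t]]) simp
  have H: "limit_kernel \<Delta> t = L.H 1" by (simp add: fun_eq_iff limit_kernel_eq L.H_def)
  show "limit_kernel \<Delta> t \<in> borel_measurable (limit_control \<alpha>)"
  proof -
    have sm: "sets (limit_control \<alpha> :: (real \<times> (real^'d)) measure) = sets borel" unfolding sets_limit_control lborel_prod by simp
    show ?thesis unfolding H measurable_cong_sets[OF sm refl] by (rule L.H_meas)
  qed
  show "(\<integral>\<^sup>+x. ennreal (\<bar>limit_kernel \<Delta> t x\<bar> powr \<beta>) \<partial>limit_control \<alpha>) < \<infinity>" unfolding H by (rule L.H1_finite)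
  show "\<exists>f'\<in>borel_measurable (sigma param_space S). AE x in limit_control \<alpha>. limit_kernel \<Delta> t x = f' x"
    using averaged_field(4)[OF 1 scaled_body_le[OF t]] unfolding AE_control AE_limit_control limit_kernel_eq .
qed

text \<open>
  The limit kernel for \<open>t = 1\<close> is an integrand without zeros.
\<close>

lemma finite_random_measure_K:
  assumes C: "C > 0" "\<And>s. norm (\<kappa>\<^sub>s s) \<le> C * \<bar>s\<bar> powr \<beta>" "D > 0" "\<And>s. norm (\<kappa>\<^sub>s s) \<le> D * (- Re (\<kappa>\<^sub>s s))"
  shows "finite_random_measure M' param_space S (limit_control \<alpha>) K \<kappa>\<^sub>s \<beta> C D"
proof -
  have sm: "sets (limit_control \<alpha> :: (real \<times> (real^'d)) measure) = sets borel" unfolding sets_limit_control lborel_prod by simp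
  interpret P: prob_space M' by (rule K(1))
  interpret R: random_measure M' param_space S "limit_control \<alpha>" K \<kappa>\<^sub>s \<beta> C D
  proof
    show "AE x in limit_control \<alpha>. x \<in> (param_space :: (real \<times> (real^'d)) set)" unfolding AE_limit_control by (auto simp: param_space_def)
  qed (use ring S_borel sm K(2,3) stable_cumulant_continuous[of \<beta> cp cm] beta assms in auto)
  show ?thesis
  proof
    fix B assume B: "B \<in> S"
    obtain f where f: "f \<in> borel_measurable R.\<Sigma>" "AE x in limit_control \<alpha>. limit_kernel \<Delta> 1 x = f x"
      using limit_kernel_meas_fin(3)[of 1] by auto
    have "AE x in limit_control \<alpha>. f x \<noteq> 0"
      using f(2) R.null
    proof eventually_elim
      case (elim x)
      have "(\<integral>y. indicator (body \<Delta> 1) y * ker y x \<partial>lborel) \<noteq> 0"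
        using elim(2) \<Delta> by (intro kernel_average_nonzero) (auto simp: param_space_def)
      then show ?case using elim(1) by (simp add: limit_kernel_eq)
    qed
    moreover have "(\<integral>\<^sup>+x\<in>param_space. ennreal (\<bar>f x\<bar> powr \<beta>) \<partial>limit_control \<alpha>) < \<infinity>"
    proof -
      have "(\<integral>\<^sup>+x\<in>param_space. ennreal (\<bar>f x\<bar> powr \<beta>) \<partial>limit_control \<alpha>) \<le> (\<integral>\<^sup>+x. ennreal (\<bar>limit_kernel \<Delta> 1 x\<bar> powr \<beta>) \<partial>limit_control \<alpha>)"
      proof (rule nn_integral_mono_AE)
        show "AE x in limit_control \<alpha>. ennreal (\<bar>f x\<bar> powr \<beta>) * indicator param_space x \<le> ennreal (\<bar>limit_kernel \<Delta> 1 x\<bar> powr \<beta>)"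
          using f(2) by eventually_elim (auto simp: indicator_def)
      qed
      also have "\<dots> < \<infinity>" by (rule limit_kernel_meas_fin(2)) simp
      finally show ?thesis .
    qed
    ultimately show "emeasure (limit_control \<alpha>) B < \<infinity>" using R.finite_measure_on_S[OF Re_stable_neg f(1)] B by blast
  qed
qed

lemma limit_RR:
  assumes t: "t \<in> {0..1}"
  shows "has_RR_integral M' param_space S (limit_control \<alpha>) K (limit_kernel \<Delta> t) (RR_integral M' param_space S (limit_control \<alpha>) K (limit_kernel \<Delta> t))"
proof -
  obtain C D where C: "C > 0" "\<And>s. norm (\<kappa>\<^sub>s s) \<le> C * \<bar>s\<bar> powr \<beta>" "D > 0" "\<And>s. norm (\<kappa>\<^sub>s s) \<le> D * (- Re (\<kappa>\<^sub>s s))"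
    by (rule stable_cumulant_bounds[OF beta c_pos]) blast
  interpret F: finite_random_measure M' param_space S "limit_control \<alpha>" K \<kappa>\<^sub>s \<beta> C D by (rule finite_random_measure_K[OF C])
  have "\<exists>Y. F.RR (limit_kernel \<Delta> t) Y" using F.RR_exists limit_kernel_meas_fin[OF t] by blast
  then show ?thesis unfolding RR_integral_def by (rule someI_ex)
qed

lemma limit_cf:
  fixes a :: "'n::finite \<Rightarrow> real"
  assumes t: "\<And>i. t i \<in> {0..1}"
  shows "(\<integral>\<omega>. iexp (\<Sum>i\<in>UNIV. a i * RR_integral M' param_space S (limit_control \<alpha>) K (limit_kernel \<Delta> (t i)) \<omega>) \<partial>M')
    = exp (\<integral>x. \<kappa>\<^sub>s (\<Sum>i\<in>UNIV. a i * limit_kernel \<Delta> (t i) x) \<partial>limit_control \<alpha>)"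
proof -
  obtain C D where C: "C > 0" "\<And>s. norm (\<kappa>\<^sub>s s) \<le> C * \<bar>s\<bar> powr \<beta>" "D > 0" "\<And>s. norm (\<kappa>\<^sub>s s) \<le> D * (- Re (\<kappa>\<^sub>s s))"
    by (rule stable_cumulant_bounds[OF beta c_pos]) blast
  interpret F: finite_random_measure M' param_space S "limit_control \<alpha>" K \<kappa>\<^sub>s \<beta> C D by (rule finite_random_measure_K[OF C])
  have m: "(\<lambda>x. \<Sum>i\<in>UNIV. a i * limit_kernel \<Delta> (t i) x) \<in> borel_measurable (limit_control \<alpha>)"
    using limit_kernel_meas_fin(1)[OF t] by measurable
  have RR: "F.RR (\<lambda>x. \<Sum>i\<in>UNIV. a i * limit_kernel \<Delta> (t i) x) (\<lambda>\<omega>. \<Sum>i\<in>UNIV. a i * RR_integral M' param_space S (limit_control \<alpha>) K (limit_kernel \<Delta> (t i)) \<omega>)"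
    by (rule F.RR_sum) (use limit_RR[OF t] in auto)
  have fin: "(\<integral>\<^sup>+x. ennreal (\<bar>\<Sum>i\<in>UNIV. a i * limit_kernel \<Delta> (t i) x\<bar> powr \<beta>) \<partial>limit_control \<alpha>) < \<infinity>"
  proof -
    obtain C D where C: "C > 0" "\<And>s. norm (\<kappa> s) \<le> C * \<bar>s\<bar> powr \<beta>" by (rule kappa_C) blast
    let ?\<theta> = "\<lambda>y. \<Sum>i\<in>UNIV. a i * indicat_real (scaled_body (t i)) y"
    interpret L: limit_setting l \<alpha> \<beta> \<kappa> \<kappa>\<^sub>s C ?\<theta> "\<Sum>i\<in>UNIV. \<bar>a i\<bar>" d
    proof (rule limit_settingI[OF C])
      show "?\<theta> \<in> borel_measurable borel" by (intro borel_measurable_sum borel_measurable_times borel_measurable_const borel_measurable_indicator body_borel)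
      show "\<bar>?\<theta> y\<bar> \<le> (\<Sum>i\<in>UNIV. \<bar>a i\<bar>) * indicator (cball 0 1) y" for y by (rule weighted_bodies_le[OF t])
    qed (auto intro: sum_nonneg)
    have "(\<integral>\<^sup>+x. ennreal (\<bar>\<Sum>i\<in>UNIV. a i * limit_kernel \<Delta> (t i) x\<bar> powr \<beta>) \<partial>limit_control \<alpha>) = (\<integral>\<^sup>+x. ennreal (\<bar>L.H 1 x\<bar> powr \<beta>) \<partial>limit_control \<alpha>)"
      by (simp only: weighted_kernels[OF t] L.H_def inverse_1 scaleR_one)
    also have "\<dots> < \<infinity>" by (rule L.H1_finite)
    finally show ?thesis .
  qed
  show ?thesis using F.RR_cf[OF RR m fin] unfolding F.cf_def .
qed

end

end

section \<open>The limit theorem\<close>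

theorem theorem4p4:
  fixes M :: "'w measure" and M' :: "'v measure"
    and S :: "(real \<times> (real^'d)) set set"
    and \<Lambda> :: "(real \<times> (real^'d)) set \<Rightarrow> 'w \<Rightarrow> real"
    and K :: "(real \<times> (real^'d)) set \<Rightarrow> 'v \<Rightarrow> real"
    and X :: "real^'d \<Rightarrow> 'w \<Rightarrow> real"
    and W \<pi> :: "real measure" and l :: "real \<Rightarrow> real"
    and \<Delta> :: "(real^'d) set"
    and b \<alpha> \<beta> c\<^sub>p c\<^sub>m d :: real
    and ts :: "'n::finite \<Rightarrow> real"
  defines "d \<equiv> real CARD('d)"
  assumes Delta: "jordan_measurable \<Delta>" "convex \<Delta>" "bounded \<Delta>" "0 \<in> interior \<Delta>"
      "measure lebesgue \<Delta> > 0" "\<Delta> \<subseteq> cball 0 1"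
    and X: "supCAR_field M S \<Lambda> b W \<pi> X" "zero_mean_field M X"
    and b: "b = 0"
    and l: "slowly_varying_at_top l" "\<And>x. x > 0 \<Longrightarrow> l x > 0"
      "\<And>C. compact C \<Longrightarrow> C \<subseteq> {0<..} \<Longrightarrow> bounded (l ` C)"
    and \<alpha>: "d + 1 < \<alpha>" "\<alpha> < 2 * d + 2"
    and \<pi>: "\<pi> = density lborel (\<lambda>r. ennreal (indicator {0<..} r * (l (1 / r) * r powr (\<alpha> - 1))))"
    and c: "c\<^sub>p > 0" "c\<^sub>m > 0"
    and \<beta>: "BG_index W = \<beta>" "\<alpha> / (d + 1) < \<beta>" "\<beta> < min 2 (\<alpha> - d)"
    and W: "(\<lambda>x. measure W {x..}) \<sim>[at_right 0] (\<lambda>x. c\<^sub>p * x powr (- \<beta>))"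
      "(\<lambda>x. measure W {..-x}) \<sim>[at_right 0] (\<lambda>x. c\<^sub>m * x powr (- \<beta>))"
    and K: "prob_space M'" "independently_scattered M' S K"
      "has_cumulant_measure M' S K (limit_control \<alpha>) (stable_cumulant \<beta> c\<^sub>p c\<^sub>m)"
    and ts: "\<And>i. ts i \<in> {0..1}"
  shows "(\<forall>t\<in>{0..1}. RR_integrable M' param_space S (limit_control \<alpha>) K (limit_kernel \<Delta> t)) \<and>
    conv_in_distr
      M (\<lambda>T \<omega>. \<chi> i. aggregated \<Delta> X (ts i powr (1 / d) * T) \<omega>
                   / (T powr (d + 1 - (\<alpha> - d) / \<beta>) * l T powr (1 / \<beta>)))
      M' (\<lambda>\<omega>. \<chi> i. RR_integral M' param_space S (limit_control \<alpha>) K (limit_kernel \<Delta> (ts i)) \<omega>)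
      at_top"
proof -
  define \<tau> where "\<tau> i = ts i powr (1 / d)" for i
  define N where "N T = T powr (d + 1 - (\<alpha> - d) / \<beta>) * l T powr (1 / \<beta>)" for T
  have d1: "d \<ge> 1" unfolding d_def by (simp add: Suc_leI)
  have "1 < \<alpha> / (d + 1)" using \<alpha> d1 by simp
  then have \<beta>1: "1 < \<beta>" using \<beta>(2) by linarith
  have \<beta>2: "\<beta> < 2" "\<beta> + d < \<alpha>" using \<beta>(3) by auto
  have lo: "\<alpha> < (d + 1) * \<beta>" using \<beta>(2) d1 by (simp add: pos_divide_less_eq mult.commute)
  interpret Z: supCAR_setting W \<beta> c\<^sub>p c\<^sub>m M S \<Lambda> X \<pi> l \<alpha> d
  proof
    show "Levy_measure W" "(\<integral>\<^sup>+x. ennreal (x\<^sup>2) \<partial>W) < \<infinity>" using X(1) by (auto simp: supCAR_field_def)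
    show "supCAR_field M S \<Lambda> 0 W \<pi> X" using X(1) b by simp
  qed (use \<beta>1 \<beta>2 lo c W l(1,2) \<pi> d_def in auto)
  note ctx = Delta(1,6,4) K
  \<comment> \<open>The linear combination with coefficients \<open>a\<close> of the aggregated fields is the average against this step function.\<close>
  let ?\<theta> = "\<lambda>a y. \<Sum>i\<in>UNIV. a $ i * indicat_real (body \<Delta> (\<tau> i)) y"
  let ?V = "\<lambda>\<theta> T \<omega>. \<integral>y. \<theta> (y /\<^sub>R T) * X y \<omega> \<partial>lborel"
  have ind: "indicat_real (body \<Delta> (\<tau> i)) \<in> borel_measurable borel" for i by (intro borel_measurable_indicator body_borel)
  have ind_le: "\<bar>indicat_real (body \<Delta> (\<tau> i)) (y /\<^sub>R T)\<bar> \<le> 1 * indicator (cball 0 T) y" if "T > 0" for T i y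
    using Z.scaled_body_le[OF ctx ts[of i], of "y /\<^sub>R T"] that
    unfolding \<tau>_def d_def by (auto simp: indicator_def field_simps split: if_splits)
  have ind_scale: "(\<lambda>y. indicat_real (body \<Delta> (\<tau> i)) (y /\<^sub>R T)) \<in> borel_measurable borel" for T i
    by (rule measurable_compose[OF _ ind]) simp
  have agg: "aggregated \<Delta> X (\<tau> i * T) \<omega> = ?V (indicat_real (body \<Delta> (\<tau> i))) T \<omega>" if T: "T > 0" and \<omega>: "\<omega> \<in> space M" for i T \<omega>
  proof -
    have "(\<lambda>y. X y \<omega>) \<in> borel_measurable borel"
      using measurable_compose[OF measurable_Pair2'[OF \<omega>, of lborel] Z.X_joint] by simp
    from set_integral_homothetic[OF Delta(1) this, of "\<tau> i * T"] show ?thesis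
      by (simp add: aggregated_def indicator_body_scale[OF T])
  qed
  have V_meas: "?V (indicat_real (body \<Delta> (\<tau> i))) T \<in> borel_measurable M" if "T > 0" for i T
    by (rule Z.averaged_field(2)[OF ind_scale ind_le[OF that]])
  have agg_meas: "aggregated \<Delta> X (\<tau> i * T) \<in> borel_measurable M" if "T > 0" for i T
    using V_meas[OF that, of i] by (subst measurable_cong[OF agg[OF that]]) auto
  have vec_meas: "(\<lambda>\<omega>. \<chi> i. f i \<omega>) \<in> borel_measurable Q" if "\<And>i. f i \<in> borel_measurable Q" for f :: "'n \<Rightarrow> 'z \<Rightarrow> real" and Q
    using that by (subst borel_measurable_euclidean_space) (auto simp: Basis_vec_def inner_axis)
  have RR: "has_RR_integral M' param_space S (limit_control \<alpha>) K (limit_kernel \<Delta> t) (RR_integral M' param_space S (limit_control \<alpha>) K (limit_kernel \<Delta> t))"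
    if "t \<in> {0..1}" for t by (rule Z.limit_RR[OF ctx that])
  have "conv_in_distr M (\<lambda>T \<omega>. \<chi> i. aggregated \<Delta> X (\<tau> i * T) \<omega> / N T)
    M' (\<lambda>\<omega>. \<chi> i. RR_integral M' param_space S (limit_control \<alpha>) K (limit_kernel \<Delta> (ts i)) \<omega>) at_top"
  proof (rule levy_continuity_vec)
    show "prob_space M" "prob_space M'" by (rule Z.prob_M, rule K)
    show "\<forall>\<^sub>F T in at_top. (\<lambda>\<omega>. \<chi> i. aggregated \<Delta> X (\<tau> i * T) \<omega> / N T) \<in> borel_measurable M"
      using eventually_gt_at_top[of 0] by eventually_elim (intro vec_meas borel_measurable_divide agg_meas borel_measurable_const)
    show "(\<lambda>\<omega>. \<chi> i. RR_integral M' param_space S (limit_control \<alpha>) K (limit_kernel \<Delta> (ts i)) \<omega>) \<in> borel_measurable M'"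
      using RR[OF ts] by (intro vec_meas) (auto simp: has_RR_integral_def tendsto_in_prob_def)
    fix a :: "real^'n"
    have \<theta>: "?\<theta> a \<in> borel_measurable borel" by (intro borel_measurable_sum borel_measurable_times borel_measurable_const ind)
    have \<theta>_le: "\<bar>?\<theta> a y\<bar> \<le> (\<Sum>i\<in>UNIV. \<bar>a $ i\<bar>) * indicator (cball 0 1) y" for y
      using Z.weighted_bodies_le[OF ctx ts, of "\<lambda>i. a $ i"] unfolding \<tau>_def d_def .
    \<comment> \<open>Characteristic functions converge at every \<open>a\<close>; they are then identified on both sides.\<close>
    have l1: "((\<lambda>T. \<integral>\<omega>. iexp (?V (?\<theta> a) T \<omega> / N T) \<partial>M) \<longlongrightarrow> exp (\<integral>x. stable_cumulant \<beta> c\<^sub>p c\<^sub>m (- (\<integral>y. ?\<theta> a y * ker y x \<partial>lborel)) \<partial>limit_control \<alpha>)) at_top"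
      unfolding N_def by (rule Z.averaged_field_limit[OF \<theta> _ \<theta>_le]) (simp add: sum_nonneg)
    have l2: "(\<integral>\<omega>. iexp (inner a (\<chi> i. RR_integral M' param_space S (limit_control \<alpha>) K (limit_kernel \<Delta> (ts i)) \<omega>)) \<partial>M')
      = exp (\<integral>x. stable_cumulant \<beta> c\<^sub>p c\<^sub>m (- (\<integral>y. ?\<theta> a y * ker y x \<partial>lborel)) \<partial>limit_control \<alpha>)"
      using Z.limit_cf[OF ctx ts, of "\<lambda>i. a $ i"] unfolding Z.weighted_kernels[OF ctx ts] by (simp add: inner_vec_def \<tau>_def d_def)
    have l3: "\<forall>\<^sub>F T in at_top. (\<integral>\<omega>. iexp (?V (?\<theta> a) T \<omega> / N T) \<partial>M) = (\<integral>\<omega>. iexp (inner a (\<chi> i. aggregated \<Delta> X (\<tau> i * T) \<omega> / N T)) \<partial>M)"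
      using eventually_gt_at_top[of 0]
    proof eventually_elim
      case (elim T)
      have int: "AE \<omega> in M. \<forall>i\<in>UNIV. integrable lborel (\<lambda>y. indicat_real (body \<Delta> (\<tau> i)) (y /\<^sub>R T) * X y \<omega>)"
        by (rule AE_finite_allI) (use Z.averaged_field(1)[OF ind_scale ind_le[OF elim]] in auto)
      have "AE \<omega> in M. ?V (?\<theta> a) T \<omega> / N T = inner a (\<chi> i. aggregated \<Delta> X (\<tau> i * T) \<omega> / N T)"
        using int AE_space
      proof eventually_elim
        case (elim \<omega>)
        have "?V (?\<theta> a) T \<omega> = (\<integral>y. (\<Sum>i\<in>UNIV. a $ i * (indicat_real (body \<Delta> (\<tau> i)) (y /\<^sub>R T) * X y \<omega>)) \<partial>lborel)"
          by (intro Bochner_Integration.integral_cong refl) (simp only: sum_distrib_right mult.assoc)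
        also have "\<dots> = (\<Sum>i\<in>UNIV. a $ i * ?V (indicat_real (body \<Delta> (\<tau> i))) T \<omega>)"
          using elim(1) by (simp add: Bochner_Integration.integral_sum)
        also have "\<dots> = (\<Sum>i\<in>UNIV. a $ i * aggregated \<Delta> X (\<tau> i * T) \<omega>)"
          using agg[OF \<open>T > 0\<close> elim(2)] by simp
        finally show ?case by (simp add: inner_vec_def sum_divide_distrib)
      qed
      moreover have "?V (?\<theta> a) T \<in> borel_measurable M"
      proof (rule Z.averaged_field(2)[where R = T])
        show "(\<lambda>y. ?\<theta> a (y /\<^sub>R T)) \<in> borel_measurable borel" by (rule measurable_compose[OF _ \<theta>]) simp
        show "\<bar>?\<theta> a (y /\<^sub>R T)\<bar> \<le> (\<Sum>i\<in>UNIV. \<bar>a $ i\<bar>) * indicator (cball 0 T) y" for y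
        proof -
          have "indicat_real (cball 0 1) (y /\<^sub>R T) = indicator (cball 0 T) y" using elim by (auto simp: indicator_def field_simps)
          with \<theta>_le[of "y /\<^sub>R T"] show ?thesis by simp
        qed
      qed
      moreover have "(\<lambda>\<omega>. inner a (\<chi> i. aggregated \<Delta> X (\<tau> i * T) \<omega> / N T)) \<in> borel_measurable M"
        unfolding inner_vec_def using agg_meas[OF elim] by simp
      ultimately show ?case
        unfolding prob_space.cf_def[OF Z.prob_M, symmetric]
        by (intro prob_space.cf_cong_AE[OF Z.prob_M] borel_measurable_divide borel_measurable_const)
    qed
    show "((\<lambda>T. \<integral>\<omega>. iexp (inner a (\<chi> i. aggregated \<Delta> X (\<tau> i * T) \<omega> / N T)) \<partial>M)
      \<longlongrightarrow> (\<integral>\<omega>. iexp (inner a (\<chi> i. RR_integral M' param_space S (limit_control \<alpha>) K (limit_kernel \<Delta> (ts i)) \<omega>)) \<partial>M')) at_top"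
      unfolding l2 by (rule Lim_transform_eventually[OF l1 l3])
  qed
  moreover have "\<forall>t\<in>{0..1}. RR_integrable M' param_space S (limit_control \<alpha>) K (limit_kernel \<Delta> t)"
    using RR unfolding RR_integrable_def by blast
  ultimately show ?thesis unfolding \<tau>_def N_def by (intro conjI)
qed

end
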